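(* Let $\Gamma$ be a non-elementary hyperbolic finitely generated group with a finite symmetric generating set $\mathcal S$, let $P\subset\{1,\dots,d-1\}$ with $\#P\ge2$, let $\rho:\Gamma\to\mathrm{SL}(d,\mathbb R)$ be a faithful $P$-Anosov representation with $\rho(\Gamma)$ Zariski dense in $\mathrm{SL}(d,\mathbb R)$, and let $\Lambda_\rho\subset\mathcal F_P$ be the limit set of $\rho(\Gamma)$. Then $$\dim_M(\Lambda_\rho)\le\dim_F^P(\rho).$$
   Context: For $g\in\mathrm{SL}(d,\mathbb R)$, $s_1(g)\ge\dots\ge s_d(g)$ are the singular values of $g$ for the usual inner product, and $\log S(g)=(\log s_1(g),\dots,\log s_d(g))$. $|\gamma|$ is the word length with respect to $\mathcal S$. $\rho$ is $P$-Anosov if there is $c>0$ with $\frac{s_p(\rho(\gamma))}{s_{p+1}(\rho(\gamma))}>c\exp(c|\gamma|)$ for all $\gamma\in\Gamma$, $p\in P$. $\mathcal F_P$ is the space of partial flags of signature $P$ in $\mathbb R^d$ (nested subspaces of dimensions $p\in P$), with an $\mathrm{SO}(d)$-invariant Riemannian metric. The limit set $\Lambda_\rho$ is the unique minimal (non-empty closed) $\rho(\Gamma)$-invariant subset of $\mathcal F_P$. The Minkowski dimension is $\dim_M(\Lambda)=\limsup_{\varepsilon\to0}\frac{\log N(\Lambda,\varepsilon)}{\log(1/\varepsilon)}$, where $N(\Lambda,\varepsilon)$ is the covering number of $\Lambda$ by balls of radius $\varepsilon$. Let $\mathfrak a^+=\{a\in\mathbb R^d:a_1\ge\dots\ge a_d,\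 \sum a_i=0\}$. $S(P)$ is the set of pairs $(i,j)$, $1\le i<j\le d$, for which there is $p\in P$ with $i\le p<j$. For $a\in\mathfrak a^+$ let $\alpha_{i,j}(a)=a_i-a_j$. For $r\ge0$, $F^P_r(a)$ is the minimum of $\sum_{(i,j)\in S(P)}r_{i,j}\alpha_{i,j}(a)$ subject to $0\le r_{i,j}\le1$ and $\sum_{(i,j)\in S(P)}r_{i,j}\ge r$ (with value $+\infty$ if the constraints are infeasible, i.e. $r>\#S(P)$). The Falconer dimension $\dim_F^P(\rho)$ is the critical parameter $r\ge0$ for convergence of the series $\sum_{\gamma\in\Gamma}\exp\left(-F^P_r(\log S(\rho(\gamma)))\right)$, i.e. the infimum of the $r\ge0$ for which it converges. *)

theory Defs
  imports
    "HOL-Analysis.Analysis"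
    "HOL-Algebra.Generated_Groups"
    "HOL-Library.Multiset"
begin

subsection \<open>Finitely generated hyperbolic groups\<close>

definition symmetric_generating_set :: "('g, 'm) monoid_scheme \<Rightarrow> 'g set \<Rightarrow> bool" where
  "symmetric_generating_set G S \<longleftrightarrow>
     finite S \<and> S \<subseteq> carrier G \<and> (\<forall>s\<in>S. inv\<^bsub>G\<^esub> s \<in> S) \<and> generate G S = carrier G"

definition word_length :: "('g, 'm) monoid_scheme \<Rightarrow> 'g set \<Rightarrow> 'g \<Rightarrow> nat" where
  "word_length G S x =
     (LEAST n. \<exists>ws. set ws \<subseteq> S \<and> length ws = n \<and> foldr (\<lambda>s y. s \<otimes>\<^bsub>G\<^esub> y) ws \<one>\<^bsub>G\<^esub> = x)"

definition word_dist :: "('g, 'm) monoid_scheme \<Rightarrow> 'g set \<Rightarrow> 'g \<Rightarrow> 'g \<Rightarrow> real" where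
  "word_dist G S x y = real (word_length G S (inv\<^bsub>G\<^esub> x \<otimes>\<^bsub>G\<^esub> y))"

definition gromov_product :: "('a \<Rightarrow> 'a \<Rightarrow> real) \<Rightarrow> 'a \<Rightarrow> 'a \<Rightarrow> 'a \<Rightarrow> real" where
  "gromov_product d w x y = (d x w + d y w - d x y) / 2"

definition gromov_hyperbolic :: "'a set \<Rightarrow> ('a \<Rightarrow> 'a \<Rightarrow> real) \<Rightarrow> bool" where
  "gromov_hyperbolic X d \<longleftrightarrow>
     (\<exists>\<delta>\<ge>0. \<forall>w\<in>X. \<forall>x\<in>X. \<forall>y\<in>X. \<forall>z\<in>X.
        min (gromov_product d w x y) (gromov_product d w y z) - \<delta> \<le> gromov_product d w x z)"

definition hyperbolic_group :: "('g, 'm) monoid_scheme \<Rightarrow> 'g set \<Rightarrow> bool" where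
  "hyperbolic_group G S \<longleftrightarrow>
     group G \<and> symmetric_generating_set G S \<and> gromov_hyperbolic (carrier G) (word_dist G S)"

text \<open>Elementary means virtually cyclic; this includes the finite groups
  (the trivial subgroup is cyclic).\<close>
definition elementary_group :: "('g, 'm) monoid_scheme \<Rightarrow> bool" where
  "elementary_group G \<longleftrightarrow> (\<exists>a\<in>carrier G. finite (rcosets\<^bsub>G\<^esub> (generate G {a})))"


subsection \<open>The special linear group and singular values\<close>

definition SL_group :: "(real^'n^'n) monoid" where
  "SL_group = \<lparr>carrier = {A. det A = 1}, mult = (**), one = mat 1\<rparr>"

text \<open>A subset of the space of matrices is Zariski closed if it is the common zero set of a family
  of polynomials in the matrix entries.\<close>
definition zariski_closure :: "(real^'n^'n) set \<Rightarrow> (real^'n^'n) set" where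
  "zariski_closure H =
     {A. \<forall>f. real_polynomial_function f \<and> (\<forall>B\<in>H. f B = 0) \<longrightarrow> f A = 0}"

definition zariski_dense_in_SL :: "(real^'n^'n) set \<Rightarrow> bool" where
  "zariski_dense_in_SL H \<longleftrightarrow>
     H \<subseteq> carrier SL_group \<and> carrier SL_group \<subseteq> zariski_closure H"

definition eigenspace :: "real^'n^'n \<Rightarrow> real \<Rightarrow> (real^'n) set" where
  "eigenspace A t = {v. A *v v = t *\<^sub>R v}"

text \<open>Square roots of the eigenvalues of the symmetric matrix \<open>transpose A ** A\<close>, each counted as
  often as the dimension of its eigenspace.\<close>
definition singular_value_mset :: "real^'n^'n \<Rightarrow> real multiset" where
  "singular_value_mset A =
     (let B = transpose A ** A in
      \<Sum>t\<in>{t. eigenspace B t \<noteq> {0}}. replicate_mset (dim (eigenspace B t)) (sqrt t))"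

text \<open>Decreasing order, indices from 1 to \<open>CARD('n)\<close>.\<close>
definition singular_value :: "real^'n^'n \<Rightarrow> nat \<Rightarrow> real" where
  "singular_value A i = rev (sorted_list_of_multiset (singular_value_mset A)) ! (i - 1)"

definition anosov ::
  "('g, 'm) monoid_scheme \<Rightarrow> 'g set \<Rightarrow> nat set \<Rightarrow> ('g \<Rightarrow> real^'n^'n) \<Rightarrow> bool" where
  "anosov G S P \<rho> \<longleftrightarrow>
     (\<exists>c>0. \<forall>\<gamma>\<in>carrier G. \<forall>p\<in>P.
        singular_value (\<rho> \<gamma>) p / singular_value (\<rho> \<gamma>) (p + 1)
          > c * exp (c * real (word_length G S \<gamma>)))"


subsection \<open>Partial flags\<close>

type_synonym 'n flag = "nat \<Rightarrow> (real^'n) set"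

definition flags :: "nat set \<Rightarrow> 'n::finite flag set" where
  "flags P = {F \<in> (\<Pi>\<^sub>E p\<in>P. {V. subspace V \<and> dim V = p}).
     \<forall>p\<in>P. \<forall>q\<in>P. p \<le> q \<longrightarrow> F p \<subseteq> F q}"

definition flag_act :: "nat set \<Rightarrow> real^'n^'n \<Rightarrow> 'n::finite flag \<Rightarrow> 'n flag" where
  "flag_act P A F = (\<lambda>p\<in>P. (\<lambda>v. A *v v) ` F p)"

text \<open>For a subspace \<open>V\<close>, \<open>closest_point V\<close> is the orthogonal projection onto \<open>V\<close>. Sending a flag to
  the sum of the projections onto its members identifies the flag manifold, equivariantly under the
  orthogonal group, with a conjugacy class of symmetric matrices, a compact submanifold of the space
  of matrices: the flag is recovered from the eigenspaces, whose eigenvalues are pairwise distinct.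
  The topology and the smooth structure are read off from this embedding.\<close>
definition flag_embed :: "nat set \<Rightarrow> 'n::finite flag \<Rightarrow> real^'n^'n" where
  "flag_embed P F = (\<Sum>p\<in>P. matrix (closest_point (F p)))"

definition flag_topology :: "nat set \<Rightarrow> 'n::finite flag topology" where
  "flag_topology P = pullback_topology (flags P) (flag_embed P) euclidean"


subsection \<open>Invariant Riemannian metrics on the flag manifold\<close>

definition C1_flag_curve ::
  "nat set \<Rightarrow> (real \<Rightarrow> 'n::finite flag) \<Rightarrow> (real \<Rightarrow> real^'n^'n) \<Rightarrow> bool" where
  "C1_flag_curve P c c' \<longleftrightarrow>
     (\<forall>t\<in>{0..1}. c t \<in> flags P \<and>
        ((\<lambda>s. flag_embed P (c s)) has_vector_derivative c' t) (at t within {0..1})) \<and>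
     continuous_on {0..1} c'"

definition flag_tangent :: "nat set \<Rightarrow> 'n::finite flag \<Rightarrow> (real^'n^'n) set" where
  "flag_tangent P F = {c' 0 | c c'. C1_flag_curve P c c' \<and> c 0 = F}"

text \<open>A family of inner products on the tangent spaces, invariant under the special orthogonal
  group. Smoothness in the base point need not be required separately: the group acts transitively
  and smoothly, so an invariant family of inner products is smooth.\<close>
definition SO_invariant_riemannian ::
  "nat set \<Rightarrow> ('n::finite flag \<Rightarrow> real^'n^'n \<Rightarrow> real^'n^'n \<Rightarrow> real) \<Rightarrow> bool" where
  "SO_invariant_riemannian P g \<longleftrightarrow>
     (\<forall>F\<in>flags P. \<forall>u\<in>flag_tangent P F. \<forall>v\<in>flag_tangent P F.
        g F u v = g F v u \<and>
        (\<forall>w\<in>flag_tangent P F. \<forall>a b. g F (a *\<^sub>R u + b *\<^sub>R v) w = a * g F u w + b * g F v w) \<and>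
        (u \<noteq> 0 \<longrightarrow> 0 < g F u u) \<and>
        (\<forall>k. orthogonal_matrix k \<and> det k = 1 \<longrightarrow>
           g (flag_act P k F) (k ** u ** transpose k) (k ** v ** transpose k) = g F u v))"

definition riemannian_dist ::
  "nat set \<Rightarrow> ('n::finite flag \<Rightarrow> real^'n^'n \<Rightarrow> real^'n^'n \<Rightarrow> real)
     \<Rightarrow> 'n flag \<Rightarrow> 'n flag \<Rightarrow> real" where
  "riemannian_dist P g E F =
     Inf {integral {0..1} (\<lambda>t. sqrt (g (c t) (c' t) (c' t))) | c c'.
            C1_flag_curve P c c' \<and> c 0 = E \<and> c 1 = F}"


subsection \<open>The limit set\<close>

definition closed_invariant ::
  "('g, 'm) monoid_scheme \<Rightarrow> nat set \<Rightarrow> ('g \<Rightarrow> real^'n^'n) \<Rightarrow> 'n::finite flag set \<Rightarrow> bool" where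
  "closed_invariant G P \<rho> K \<longleftrightarrow>
     K \<noteq> {} \<and> closedin (flag_topology P) K \<and> (\<forall>\<gamma>\<in>carrier G. flag_act P (\<rho> \<gamma>) ` K \<subseteq> K)"

definition limit_set ::
  "('g, 'm) monoid_scheme \<Rightarrow> nat set \<Rightarrow> ('g \<Rightarrow> real^'n^'n) \<Rightarrow> 'n::finite flag set" where
  "limit_set G P \<rho> =
     (THE \<Lambda>. closed_invariant G P \<rho> \<Lambda> \<and>
        (\<forall>K. closed_invariant G P \<rho> K \<and> K \<subseteq> \<Lambda> \<longrightarrow> K = \<Lambda>))"


subsection \<open>Minkowski dimension and Falconer dimension\<close>

text \<open>Meaningful for totally bounded \<open>K\<close>, where a finite cover exists.\<close>
definition covering_number :: "'a set \<Rightarrow> ('a \<Rightarrow> 'a \<Rightarrow> real) \<Rightarrow> 'a set \<Rightarrow> real \<Rightarrow> nat" where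
  "covering_number X d K \<epsilon> =
     (LEAST n. \<exists>C\<subseteq>X. finite C \<and> card C = n \<and> K \<subseteq> (\<Union>c\<in>C. {x\<in>X. d c x < \<epsilon>}))"

definition minkowski_dim :: "'a set \<Rightarrow> ('a \<Rightarrow> 'a \<Rightarrow> real) \<Rightarrow> 'a set \<Rightarrow> ereal" where
  "minkowski_dim X d K =
     Limsup (at_right 0) (\<lambda>\<epsilon>. ereal (ln (real (covering_number X d K \<epsilon>)) / ln (1 / \<epsilon>)))"

definition root_pairs :: "nat \<Rightarrow> nat set \<Rightarrow> (nat \<times> nat) set" where
  "root_pairs d P = {(i, j). 1 \<le> i \<and> i < j \<and> j \<le> d \<and> (\<exists>p\<in>P. i \<le> p \<and> p < j)}"

text \<open>The infimum over an empty set of weights is \<open>\<infinity>\<close>; otherwise the infimum is a minimum,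
  by compactness.\<close>
definition falconer_functional :: "nat \<Rightarrow> nat set \<Rightarrow> real \<Rightarrow> (nat \<Rightarrow> real) \<Rightarrow> ereal" where
  "falconer_functional d P r a =
     (INF w \<in> {w :: nat \<times> nat \<Rightarrow> real.
                 (\<forall>ij\<in>root_pairs d P. 0 \<le> w ij \<and> w ij \<le> 1) \<and> r \<le> (\<Sum>ij\<in>root_pairs d P. w ij)}.
        ereal (\<Sum>(i, j)\<in>root_pairs d P. w (i, j) * (a i - a j)))"

definition exp_neg :: "ereal \<Rightarrow> real" where
  "exp_neg x = (if x = \<infinity> then 0 else exp (- real_of_ereal x))"

definition falconer_dim ::
  "('g, 'm) monoid_scheme \<Rightarrow> nat set \<Rightarrow> ('g \<Rightarrow> real^'n^'n) \<Rightarrow> real" where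
  "falconer_dim G P \<rho> =
     Inf {r. 0 \<le> r \<and>
       (\<lambda>\<gamma>. exp_neg (falconer_functional CARD('n) P r (\<lambda>i. ln (singular_value (\<rho> \<gamma>) i))))
         summable_on carrier G}"

end

theory Submission
  imports Defs "HOL-Combinatorics.Permutations" "HOL-Real_Asymp.Real_Asymp"
begin

text \<open>Each limit flag lies in the images of one fixed coordinate chart under all sufficiently long prefixes of a suitable
  geodesic word. Such an image is, up to uniformly Lipschitz maps, a box whose side in the direction of a root \<open>\<alpha>\<close> is
  \<open>exp (-\<alpha>)\<close>, evaluated at the singular values of the prefix. Covering the boxes of a well chosen finite set of prefixes by
  balls of radius \<open>\<epsilon>\<close> is a linear programming problem, and its dual is the program that defines the Falconer functional. So
  each convergent Falconer series bounds the number of balls.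

  The geometric input is that, along geodesic words, the attracting flags of the continuations stay uniformly transverse to the
  repelling flag of the prefix (\<open>uniform_transversality\<close>). It follows from the gap condition alone. In an exterior power the
  question concerns the largest singular value, and a discrete Gronwall inequality (\<open>dominant_growth_step\<close>) shows that the
  prefix stretches the attracting direction of the continuation by a fixed proportion of its norm: the errors made at each
  letter decay exponentially with the distance along the word, hence have a bounded sum. Exterior powers are realised
  inside tensor powers of matrices (\<open>tens\<close>, \<open>alt\<close>, \<open>lead\<close>).

  Zariski density enters in the identification of the limit set with the accumulation set of the left singular flags
  (\<open>limit_set_eq\<close>): every closed invariant set contains a flag in general position with respect to a given sequence of
  repelling flags, and such a flag is attracted to the prescribed limit flag.

  The passage from the transversality estimate to coverings uses an upper bound of the Riemannian distance by the
  coordinates of the chart (\<open>riemannian_dist_unip\<close>). A path of unitriangular matrices is orthonormalised, and an invariant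
  metric measures the resulting path of orthogonal frames by its skew-symmetric velocity. Then \<open>covering_number_charts\<close> counts
  balls box by box.

  The prefixes are chosen by a stopping rule in \<open>minkowski_dim_limit_flags_le\<close>: the first prefix at which at most \<open>r\<close> roots are
  below \<open>ln (1 / \<epsilon>)\<close>. Since roots change by a bounded amount with each letter, concentrating the weights on the roots below the
  threshold is optimal up to a constant (\<open>threshold_weights\<close>), and each box needs at most a constant times
  \<open>\<epsilon>\<close> to the power \<open>-r\<close> times its term of the series.\<close>

section \<open>Ordered coordinates\<close>

text \<open>An enumeration of the index type: it turns the abstract index type into the ordered coordinates
  \<open>1, \<dots>, d\<close> that the singular values and the standard flag \<open>std\<close> refer to.\<close>

definition pos :: "'n::finite \<Rightarrow> nat" where
  "pos = (SOME f. bij_betw f UNIV {1..CARD('n)})"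

definition ix :: "nat \<Rightarrow> 'n::finite" where
  "ix = inv_into UNIV pos"

definition head :: "nat \<Rightarrow> 'n::finite set" where
  "head p = {i. pos i \<le> p}"

definition diag :: "('n::finite \<Rightarrow> real) \<Rightarrow> real^'n^'n" where
  "diag s = (\<chi> i j. if i = j then s i else 0)"

definition std :: "nat \<Rightarrow> (real^'n::finite) set" where
  "std p = {x. \<forall>i. p < pos i \<longrightarrow> x $ i = 0}"

lemma pos_bij: "bij_betw (pos :: 'n::finite \<Rightarrow> nat) UNIV {1..CARD('n)}"
proof -
  have "\<exists>f :: 'n \<Rightarrow> nat. bij_betw f UNIV {1..CARD('n)}"
    using ex_bij_betw_finite_nat[of "UNIV::'n set"]
    by (metis card_atLeastAtMost diff_Suc_1 finite finite_atLeastAtMost finite_same_card_bij)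
  then show ?thesis unfolding pos_def by (rule someI_ex)
qed

lemma pos_inj [simp]: "pos i = pos j \<longleftrightarrow> i = (j::'n::finite)"
  using pos_bij by (auto simp: bij_betw_def inj_on_def)

lemma pos_range: "1 \<le> pos (i::'n::finite)" "pos (i::'n::finite) \<le> CARD('n)"
  using pos_bij[where 'n='n] by (auto simp: bij_betw_def)

lemma pos_ge_1 [simp]: "Suc 0 \<le> pos i"
  using pos_range(1)[of i] by simp

lemma pos_le_card [simp]: "pos (i::'n::finite) \<le> CARD('n)"
  by (rule pos_range)

lemma pos_ix [simp]: "k \<in> {1..CARD('n)} \<Longrightarrow> pos (ix k :: 'n::finite) = k"
  unfolding ix_def using pos_bij[where 'n='n] by (metis bij_betw_def f_inv_into_f)

lemma ix_pos [simp]: "ix (pos i) = (i::'n::finite)"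
  using pos_ix[of "pos i"] pos_range[of i] by (metis atLeastAtMost_iff pos_inj)

lemma ix_bij: "bij_betw (ix :: nat \<Rightarrow> 'n::finite) {1..CARD('n)} UNIV"
  by (rule bij_betw_byWitness[where f'=pos]) (auto simp: pos_range)

lemma card_head: "p \<le> CARD('n) \<Longrightarrow> card (head p :: 'n::finite set) = p"
proof -
  assume p: "p \<le> CARD('n)"
  have "bij_betw pos (head p :: 'n set) {1..p}"
    by (rule bij_betw_byWitness[where f'=ix]) (use p in \<open>auto simp: head_def pos_range\<close>)
  then show ?thesis using bij_betw_same_card by fastforce
qed

lemma subspace_std: "subspace (std p)"
  by (auto simp: subspace_def std_def)

lemma std_eq: "std p = {x :: real^'n::finite. \<forall>i. i \<notin> head p \<longrightarrow> x $ i = 0}"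
  by (auto simp: std_def head_def)

lemma dim_std: "p \<le> CARD('n) \<Longrightarrow> dim (std p :: (real^'n::finite) set) = p"
  unfolding std_eq using dim_substandard_cart[of "head p :: 'n set", where 'a=real] card_head[of p, where 'n='n]
  by (simp add: dim_vec_eq)

section \<open>Matrices\<close>

lemma orthogonal_matrix_inner:
  fixes k :: "real^'n^'n"
  assumes "orthogonal_matrix k"
  shows "(k *v x) \<bullet> (k *v y) = x \<bullet> y"
  using assms unfolding orthogonal_matrix
  by (metis dot_lmul_matrix matrix_vector_mul_assoc matrix_vector_mul_lid vector_transpose_matrix)

lemma orthogonal_matrix_norm:
  fixes k :: "real^'n^'n"
  assumes "orthogonal_matrix k"
  shows "norm (k *v x) = norm x"
  using orthogonal_matrix_inner[OF assms, of x x] by (simp add: norm_eq)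

lemma orthogonal_matrix_transpose_mult:
  fixes k :: "real^'n^'n"
  assumes "orthogonal_matrix k"
  shows "transpose k ** k = mat 1" "k ** transpose k = mat 1"
  using assms unfolding orthogonal_matrix_def by auto

lemma orthogonal_transpose: "orthogonal_matrix (k::real^'n^'n) \<Longrightarrow> orthogonal_matrix (transpose k)"
  by (simp add: orthogonal_matrix_def)

lemma diag_mult_vec: "diag s *v x = (\<chi> i. s i * x $ i)"
  by (simp add: diag_def matrix_vector_mult_def vec_eq_iff if_distrib[of "\<lambda>a. a * _"] cong: if_cong)

lemma diag_mult_diag: "diag s ** diag t = diag (\<lambda>i. s i * t i)"
  by (simp add: diag_def matrix_matrix_mult_def vec_eq_iff if_distrib[of "\<lambda>a. a * _"] cong: if_cong)

lemma transpose_diag [simp]: "transpose (diag s) = diag s"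
  by (auto simp: diag_def transpose_def vec_eq_iff)

lemma diag_1: "diag (\<lambda>_. 1) = mat 1"
  by (auto simp: diag_def mat_def vec_eq_iff)

lemma det_diag: "det (diag s) = prod s UNIV"
  by (subst det_diagonal) (auto simp: diag_def)

lemma sandwich_entry: "(transpose M ** A ** N) $ i $ j = column i M \<bullet> (A *v column j N)"
  for A :: "real^'n^'n"
proof -
  have "(transpose M ** A ** N) $ i $ j = (transpose M ** (A ** N)) $ i $ j"
    by (simp add: matrix_mul_assoc)
  also have "\<dots> = column i M \<bullet> column j (A ** N)"
    by (simp add: matrix_matrix_mult_def transpose_def column_def inner_vec_def)
  also have "column j (A ** N) = A *v column j N"
    by (simp add: matrix_matrix_mult_def column_def matrix_vector_mult_def vec_eq_iff)
  finally show ?thesis .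
qed

lemma diag_mult_left: "(diag s ** M) $ i $ j = s i * M $ i $ j"
  by (simp add: diag_def matrix_matrix_mult_def if_distrib[of "\<lambda>a. a * _"] cong: if_cong)

lemma diag_mult_right: "(M ** diag s) $ i $ j = M $ i $ j * s j"
  by (simp add: diag_def matrix_matrix_mult_def if_distrib[of "\<lambda>a. _ * a"] cong: if_cong)

section \<open>Spectral theorem\<close>

lemma inner_symmetric_matrix:
  fixes B :: "real^'n^'n"
  assumes "transpose B = B"
  shows "x \<bullet> (B *v y) = y \<bullet> (B *v x)"
  using assms by (metis dot_lmul_matrix inner_commute vector_transpose_matrix)

lemma nonneg_quadratic_imp_zero:
  fixes a b :: real
  assumes "\<And>t. 2 * t * a \<le> t^2 * b"
  shows "a = 0"
proof (rule ccontr)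
  assume a: "a \<noteq> 0"
  define c where "c = \<bar>b\<bar> + 1"
  have c: "c > 0" "b < c" unfolding c_def by auto
  have "2 * (a / c) * a \<le> (a/c)^2 * b" by (rule assms)
  also have "\<dots> \<le> (a/c)^2 * c" using c by (intro mult_left_mono) auto
  also have "\<dots> = (a/c) * a" using c by (simp add: power2_eq_square)
  finally have "(a / c) * a \<le> 0" by simp
  moreover have "(a * a) / c > 0" using a c by (intro divide_pos_pos) (auto simp: zero_less_mult_iff)
  ultimately show False by (simp add: field_simps)
qed

text \<open>The Rayleigh quotient attains a maximum on the unit sphere of the orthogonal complement of the vectors
  found so far; the first-order condition at a maximum says that the maximiser is an eigenvector, and
  successive maxima decrease.\<close>

lemma ordered_eigenvectors:
  fixes B :: "real^'n^'n"
  assumes sym: "transpose B = B" and k: "k \<le> CARD('n)"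
  shows "\<exists>e l. (\<forall>i\<in>{1..k}. norm (e i) = 1 \<and> B *v e i = l i *\<^sub>R e i) \<and>
    (\<forall>i\<in>{1..k}. \<forall>j\<in>{1..k}. i \<noteq> j \<longrightarrow> e i \<bullet> e j = 0) \<and>
    (\<forall>i\<in>{1..k}. \<forall>x. (\<forall>j\<in>{1..<i}. e j \<bullet> x = 0) \<longrightarrow> x \<bullet> (B *v x) \<le> l i * (norm x)\<^sup>2)"
  using k
proof (induction k)
  case 0 then show ?case by auto
next
  case (Suc k)
  then obtain e l where e: "\<And>i. i \<in> {1..k} \<Longrightarrow> norm (e i) = 1 \<and> B *v e i = l i *\<^sub>R e i"
    "\<And>i j. i \<in> {1..k} \<Longrightarrow> j \<in> {1..k} \<Longrightarrow> i \<noteq> j \<Longrightarrow> e i \<bullet> e j = 0"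
    "\<And>i x. i \<in> {1..k} \<Longrightarrow> (\<forall>j\<in>{1..<i}. e j \<bullet> x = 0) \<Longrightarrow> x \<bullet> (B *v x) \<le> l i * (norm x)\<^sup>2"
    by (metis Suc_leD)
  define V where "V = {x. \<forall>j\<in>{1..k}. e j \<bullet> x = 0}"
  have sV: "subspace V" unfolding V_def subspace_def by (auto simp: inner_add_right)
  have "dim (span (e ` {1..k})) < DIM(real^'n)"
  proof -
    have "dim (span (e ` {1..k})) \<le> card (e ` {1..k})" by (simp add: dim_le_card')
    also have "\<dots> \<le> k" using card_image_le[of "{1..k}" e] by simp
    finally show ?thesis using Suc.prems by simp
  qed
  then obtain a where a: "a \<noteq> 0" "\<And>y. y \<in> span (e ` {1..k}) \<Longrightarrow> orthogonal a y"
    using orthogonal_to_subspace_exists[of "e ` {1..k}"] by (auto simp: dim_span)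
  have aV: "a \<in> V" unfolding V_def using a(2)[OF span_base]
    by (fastforce simp: orthogonal_def inner_commute)
  define S where "S = V \<inter> sphere 0 1"
  have "(1 / norm a) *\<^sub>R a \<in> S" using a aV sV by (simp add: S_def subspace_scale)
  then have Sne: "S \<noteq> {}" by blast
  have Sc: "compact S" unfolding S_def
    by (intro closed_Int_compact closed_subspace sV) auto
  have "continuous_on S (\<lambda>x. x \<bullet> (B *v x))"
    by (intro continuous_intros linear_continuous_on) (simp add: matrix_vector_mul_bounded_linear)
  from continuous_attains_sup[OF Sc Sne this] obtain v where v: "v \<in> S"
    "\<And>y. y \<in> S \<Longrightarrow> y \<bullet> (B *v y) \<le> v \<bullet> (B *v v)" by blast
  define m where "m = v \<bullet> (B *v v)"
  have vV: "v \<in> V" and nv: "norm v = 1" using v by (auto simp: S_def)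
  have max: "x \<bullet> (B *v x) \<le> m * (norm x)\<^sup>2" if "x \<in> V" for x
  proof (cases "x = 0")
    case False
    have "(1 / norm x) *\<^sub>R x \<in> S" using False that sV by (simp add: S_def subspace_scale)
    from v(2)[OF this] have "(x \<bullet> (B *v x)) / (norm x)^2 \<le> m"
      by (simp add: m_def matrix_vector_mult_scaleR power2_eq_square)
    then show ?thesis using False by (simp add: divide_le_eq)
  qed auto
  have BV: "B *v v \<in> V"
    unfolding V_def
  proof (clarify)
    fix j assume j: "j \<in> {1..k}"
    have "e j \<bullet> (B *v v) = v \<bullet> (B *v e j)" by (rule inner_symmetric_matrix[OF sym])
    also have "\<dots> = l j * (e j \<bullet> v)" using e(1)[OF j] by (simp add: inner_commute)
    also have "\<dots> = 0" using vV j by (simp add: V_def)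
    finally show "e j \<bullet> (B *v v) = 0" .
  qed
  define y where "y = B *v v - m *\<^sub>R v"
  have yV: "y \<in> V" unfolding y_def using BV vV sV by (simp add: subspace_diff subspace_scale)
  have vy: "v \<bullet> y = 0" unfolding y_def m_def using nv by (simp add: inner_diff_right dot_square_norm)
  have "y \<bullet> (B *v v) = 0"
  proof (rule nonneg_quadratic_imp_zero[where b = "m * (norm y)^2 - y \<bullet> (B *v y)"])
    fix t :: real
    have "v + t *\<^sub>R y \<in> V" using vV yV sV by (simp add: subspace_add subspace_scale)
    from max[OF this]
    have "(v + t *\<^sub>R y) \<bullet> (B *v (v + t *\<^sub>R y)) \<le> m * (norm (v + t *\<^sub>R y))^2" .
    moreover have "(v + t *\<^sub>R y) \<bullet> (v + t *\<^sub>R y) = 1 + t^2 * (y \<bullet> y)"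
      using vy nv by (simp add: inner_add_left inner_add_right inner_commute power2_eq_square norm_eq_1)
    then have "(norm (v + t *\<^sub>R y))^2 = 1 + t^2 * (norm y)^2"
      unfolding power2_norm_eq_inner .
    moreover have "(v + t *\<^sub>R y) \<bullet> (B *v (v + t *\<^sub>R y)) = m + 2 * t * (y \<bullet> (B *v v)) + t^2 * (y \<bullet> (B *v y))"
      using inner_symmetric_matrix[OF sym, of v y]
      by (simp add: m_def matrix_vector_right_distrib matrix_vector_mult_scaleR inner_add_left inner_add_right power2_eq_square algebra_simps)
    ultimately show "2 * t * (y \<bullet> (B *v v)) \<le> t^2 * (m * (norm y)^2 - y \<bullet> (B *v y))"
      by (simp add: algebra_simps)
  qed
  then have "y \<bullet> y = 0" using vy by (simp add: y_def inner_diff_right inner_commute inner_diff_left)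
  then have Bv: "B *v v = m *\<^sub>R v" by (simp add: y_def)
  define e' where "e' = e(Suc k := v)"
  define l' where "l' = l(Suc k := m)"
  have dom: "i \<in> {1..Suc k} \<longleftrightarrow> i \<in> {1..k} \<or> i = Suc k" for i by auto
  show ?case
  proof (intro exI[of _ e'] exI[of _ l'] conjI ballI allI impI)
    fix i assume i: "i \<in> {1..Suc k}"
    show "norm (e' i) = 1" "B *v e' i = l' i *\<^sub>R e' i"
      using i e(1) nv Bv by (auto simp: e'_def l'_def)
    fix x assume x: "\<forall>j\<in>{1..<i}. e' j \<bullet> x = 0"
    show "x \<bullet> (B *v x) \<le> l' i * (norm x)\<^sup>2"
    proof (cases "i = Suc k")
      case True
      then have "x \<in> V" using x by (auto simp: V_def e'_def atLeastLessThanSuc_atLeastAtMost)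
      then show ?thesis using max True by (simp add: l'_def)
    next
      case False
      then have ik: "i \<in> {1..k}" using i by auto
      have "\<forall>j\<in>{1..<i}. e j \<bullet> x = 0"
      proof
        fix j assume j: "j \<in> {1..<i}"
        then have "j \<noteq> Suc k" using ik by auto
        then show "e j \<bullet> x = 0" using x[rule_format, OF j] by (simp add: e'_def)
      qed
      from e(3)[OF ik this] show ?thesis using False by (simp add: l'_def)
    qed
  next
    fix i j assume "i \<in> {1..Suc k}" "j \<in> {1..Suc k}" "i \<noteq> j"
    then show "e' i \<bullet> e' j = 0" using e(2)[of i j] vV
      by (auto simp: dom e'_def V_def inner_commute)
  qed
qed

declare transpose_matrix_vector [simp del]

lemma dim_invertible_image:
  fixes A :: "real^'n^'n"
  assumes "det A \<noteq> 0"
  shows "dim ((\<lambda>x. A *v x) ` V) = dim V"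
proof (rule dim_image_eq)
  show "linear (\<lambda>x. A *v x)" by (rule matrix_vector_mul_linear)
  have "inj (\<lambda>x. A *v x)" 
    using assms by (intro inj_matrix_vector_mult) (simp add: invertible_det_nz)
  then show "inj_on (\<lambda>x. A *v x) (span V)" by (rule inj_on_subset) simp
qed

lemma subspace_matrix_image: "subspace V \<Longrightarrow> subspace ((\<lambda>x. A *v x) ` V)"
  for A :: "real^'n^'m"
  by (rule linear_subspace_image) (rule matrix_vector_mul_linear)

lemma orthogonal_det_nz: "orthogonal_matrix (A::real^'n^'n) \<Longrightarrow> det A \<noteq> 0"
  using det_orthogonal_matrix[of A] by auto

lemma orthogonal_cancel:
  fixes L :: "real^'n^'n"
  assumes "orthogonal_matrix L"
  shows "L *v (transpose L *v x) = x" "transpose L *v (L *v x) = x"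
  using orthogonal_matrix_transpose_mult[OF assms] by (simp_all add: matrix_vector_mul_assoc)

lemma spectral_theorem:
  fixes B :: "real^'n^'n"
  assumes sym: "transpose B = B"
  obtains Q l where "orthogonal_matrix Q" "transpose Q ** B ** Q = diag l"
    "\<And>i j. pos i \<le> pos j \<Longrightarrow> l j \<le> l i"
proof -
  obtain e :: "nat \<Rightarrow> real^'n" and m :: "nat \<Rightarrow> real" where e:
    "\<And>i. i\<in>{1..CARD('n)} \<Longrightarrow> norm (e i) = 1"
    "\<And>i. i\<in>{1..CARD('n)} \<Longrightarrow> B *v e i = m i *\<^sub>R e i"
    "\<And>i j. i\<in>{1..CARD('n)} \<Longrightarrow> j\<in>{1..CARD('n)} \<Longrightarrow> i \<noteq> j \<Longrightarrow> e i \<bullet> e j = 0"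
    "\<And>i x. i\<in>{1..CARD('n)} \<Longrightarrow> (\<forall>j\<in>{1..<i}. e j \<bullet> x = 0) \<Longrightarrow> x \<bullet> (B *v x) \<le> m i * (norm x)\<^sup>2"
    using ordered_eigenvectors[OF sym order_refl] by blast
  define Q :: "real^'n^'n" where "Q = (\<chi> i j. e (pos j) $ i)"
  have col: "column j Q = e (pos j)" for j by (simp add: Q_def column_def)
  have "orthogonal_matrix Q"
    unfolding orthogonal_matrix_orthonormal_columns using e by (auto simp: col orthogonal_def)
  moreover have "transpose Q ** B ** Q = diag (\<lambda>i. m (pos i))"
  proof (subst vec_eq_iff, intro allI, subst vec_eq_iff, intro allI)
    fix i j :: 'n
    have "(transpose Q ** B ** Q) $ i $ j = m (pos j) * (e (pos i) \<bullet> e (pos j))"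
      unfolding sandwich_entry col by (subst e(2)) auto
    then show "(transpose Q ** B ** Q) $ i $ j = diag (\<lambda>i. m (pos i)) $ i $ j"
      using e(1)[of "pos i"] e(3)[of "pos i" "pos j"] by (auto simp: diag_def dot_square_norm)
  qed
  moreover have "m (pos j) \<le> m (pos i)" if "pos i \<le> pos j" for i j :: 'n
  proof -
    have "e (pos j) \<bullet> (B *v e (pos j)) \<le> m (pos i) * (norm (e (pos j)))\<^sup>2"
    proof (rule e(4))
      show "\<forall>k\<in>{1..<pos i}. e k \<bullet> e (pos j) = 0"
        using that pos_le_card[of j] pos_le_card[of i] by (auto intro!: e(3) simp del: pos_le_card)
    qed auto
    then show ?thesis using e(1)[of "pos j"] by (simp add: e(2) dot_square_norm)
  qed
  ultimately show ?thesis by (rule that)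
qed

definition is_svd :: "real^'n^'n \<Rightarrow> real^'n^'n \<Rightarrow> ('n::finite \<Rightarrow> real) \<Rightarrow> real^'n^'n \<Rightarrow> bool" where
  "is_svd A K s L \<longleftrightarrow> orthogonal_matrix K \<and> orthogonal_matrix L \<and> A = K ** diag s ** L \<and>
     (\<forall>i. 0 < s i) \<and> (\<forall>i j. pos i \<le> pos j \<longrightarrow> s j \<le> s i)"

lemma svd_exists:
  fixes A :: "real^'n^'n"
  assumes "det A \<noteq> 0"
  shows "\<exists>K s L. is_svd A K s L"
proof -
  have sym: "transpose (transpose A ** A) = transpose A ** A"
    by (simp add: matrix_transpose_mul)
  obtain Q l where Q: "orthogonal_matrix Q" "transpose Q ** (transpose A ** A) ** Q = diag l"
    and l: "\<And>i j. pos i \<le> pos j \<Longrightarrow> l j \<le> l i"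
    using spectral_theorem[OF sym] by blast
  have Q2: "(transpose Q ** transpose A) ** (A ** Q) = diag l" using Q(2) by (simp add: matrix_mul_assoc)
  have lpos: "l i > 0" for i
  proof -
    have "l i = (transpose (A ** Q) ** mat 1 ** (A ** Q)) $ i $ i"
      using Q2 by (simp add: matrix_transpose_mul diag_def)
    also have "\<dots> = column i (A ** Q) \<bullet> column i (A ** Q)" by (subst sandwich_entry) simp
    finally have "l i = column i (A ** Q) \<bullet> column i (A ** Q)" .
    moreover have "column i (A ** Q) \<noteq> 0"
      using det_zero_column(2)[of i "A ** Q"] assms Q(1) det_orthogonal_matrix[OF Q(1)]
      by (auto simp: det_mul)
    ultimately show ?thesis by simp
  qed
  define s where "s i = sqrt (l i)" for i
  define K where "K = A ** Q ** diag (\<lambda>i. 1 / s i)"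
  have spos: "s i > 0" for i using lpos by (simp add: s_def)
  have "transpose K ** K = diag (\<lambda>i. 1 / s i) ** ((transpose Q ** transpose A) ** (A ** Q)) ** diag (\<lambda>i. 1 / s i)"
    by (simp add: K_def matrix_transpose_mul matrix_mul_assoc)
  also have "\<dots> = mat 1" unfolding Q2 diag_mult_diag diag_1[symmetric]
  proof (rule arg_cong[of _ _ diag], rule ext)
    fix i show "1 / s i * l i * (1 / s i) = 1"
      using lpos[of i] by (simp add: s_def real_sqrt_mult_self field_simps)
  qed
  finally have "orthogonal_matrix K" by (simp add: orthogonal_matrix)
  moreover have "K ** diag s ** transpose Q = A"
  proof -
    have "K ** diag s ** transpose Q = A ** Q ** (diag (\<lambda>i. 1 / s i) ** diag s) ** transpose Q"
      by (simp add: K_def matrix_mul_assoc)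
    also have "diag (\<lambda>i. 1 / s i) ** diag s = mat 1"
      unfolding diag_mult_diag diag_1[symmetric] using spos by (intro arg_cong[of _ _ diag] ext) (simp add: less_imp_neq[symmetric])
    finally show ?thesis using orthogonal_matrix_transpose_mult[OF Q(1)]
      by (simp add: matrix_mul_assoc[symmetric])
  qed
  ultimately have "is_svd A K s (transpose Q)"
    unfolding is_svd_def using Q(1) spos l by (auto simp: orthogonal_transpose s_def)
  then show ?thesis by blast
qed

text \<open>Identifies the singular values with the diagonal of any decomposition, so that all later estimates can be
  made on the explicit diagonal matrix.\<close>

lemma singular_value_svd:
  fixes A :: "real^'n^'n"
  assumes svd: "is_svd A K s L"
  shows "singular_value A (pos i) = s i"
proof -
  have K: "orthogonal_matrix K" and L: "orthogonal_matrix L" and A: "A = K ** diag s ** L"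
    and s: "\<And>i. 0 < s i" "\<And>i j. pos i \<le> pos j \<Longrightarrow> s j \<le> s i"
    using svd by (auto simp: is_svd_def)
  define B where "B = transpose A ** A"
  have "B = transpose L ** diag s ** (transpose K ** K) ** diag s ** L"
    by (simp add: B_def A matrix_transpose_mul matrix_mul_assoc)
  also have "\<dots> = transpose L ** (diag s ** diag s) ** L"
    using orthogonal_matrix_transpose_mult[OF K] by (simp add: matrix_mul_assoc)
  finally have B: "B = transpose L ** diag (\<lambda>i. (s i)^2) ** L" by (simp add: diag_mult_diag power2_eq_square)
  define E where "E t = {x::real^'n. \<forall>i. i \<notin> {i. (s i)^2 = t} \<longrightarrow> x $ i = 0}" for t
  have eig: "eigenspace B t = (\<lambda>x. transpose L *v x) ` E t" for t
  proof -
    have 1: "diag (\<lambda>i. (s i)^2) *v x = t *\<^sub>R x \<longleftrightarrow> x \<in> E t" for x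
      by (auto simp: diag_mult_vec vec_eq_iff E_def)
    note LL = orthogonal_cancel[OF L]
    have Bv: "B *v v = transpose L *v (diag (\<lambda>i. (s i)^2) *v (L *v v))" for v
      by (simp only: B matrix_vector_mul_assoc matrix_mul_assoc)
    have "v \<in> eigenspace B t \<longleftrightarrow> diag (\<lambda>i. (s i)^2) *v (L *v v) = t *\<^sub>R (L *v v)" for v
    proof
      assume "v \<in> eigenspace B t"
      then have "L *v (B *v v) = L *v (t *\<^sub>R v)" by (simp add: eigenspace_def)
      then show "diag (\<lambda>i. (s i)^2) *v (L *v v) = t *\<^sub>R (L *v v)"
        by (simp only: Bv LL(1) matrix_vector_mult_scaleR)
    next
      assume "diag (\<lambda>i. (s i)^2) *v (L *v v) = t *\<^sub>R (L *v v)"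
      then have "B *v v = t *\<^sub>R v" by (simp only: Bv LL(2) matrix_vector_mult_scaleR)
      then show "v \<in> eigenspace B t" by (simp add: eigenspace_def)
    qed
    then have *: "v \<in> eigenspace B t \<longleftrightarrow> L *v v \<in> E t" for v using 1 by blast
    show ?thesis
    proof (intro equalityI subsetI)
      fix v assume "v \<in> eigenspace B t"
      then show "v \<in> (\<lambda>x. transpose L *v x) ` E t"
        using * LL(2)[of v] by (intro image_eqI[of _ _ "L *v v"]) auto
    next
      fix v assume "v \<in> (\<lambda>x. transpose L *v x) ` E t"
      then obtain x where "x \<in> E t" "v = transpose L *v x" by blast
      then show "v \<in> eigenspace B t" using * LL(1)[of x] by simp
    qed
  qed
  have dimE: "dim (eigenspace B t) = card {i. (s i)^2 = t}" for t
  proof -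
    have "dim (eigenspace B t) = dim (E t)" unfolding eig
      by (rule dim_invertible_image) (simp add: det_transpose orthogonal_det_nz[OF L])
    also have "\<dots> = card {i. (s i)^2 = t}"
      unfolding E_def using dim_substandard_cart[of "{i. (s i)^2 = t}", where 'a=real] by (simp add: dim_vec_eq)
    finally show ?thesis .
  qed
  have "eigenspace B t \<noteq> {0} \<longleftrightarrow> dim (eigenspace B t) \<noteq> 0" for t
  proof -
    have "0 \<in> eigenspace B t" by (simp add: eigenspace_def)
    then have "eigenspace B t = {0} \<longleftrightarrow> eigenspace B t \<subseteq> {0}" by blast
    then show ?thesis by (simp only: dim_eq_0)
  qed
  also have "\<dots> t \<longleftrightarrow> t \<in> (\<lambda>i. (s i)^2) ` UNIV" for t
    unfolding dimE by (auto simp: card_eq_0_iff)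
  finally have ne: "{t. eigenspace B t \<noteq> {0}} = (\<lambda>i. (s i)^2) ` UNIV"
    by blast
  have sq: "sqrt ((s i)^2) = s i" for i using s(1)[of i] by simp
  have sq_inj: "(s i)^2 = (s j)^2 \<longleftrightarrow> s i = s j" for i j using sq by metis
  have ms: "singular_value_mset A = image_mset s (mset_set UNIV)"
  proof (rule multiset_eqI)
    fix x
    have "count (singular_value_mset A) x
        = (\<Sum>t\<in>(\<lambda>i. (s i)^2) ` UNIV. if sqrt t = x then card {i. (s i)^2 = t} else 0)"
      unfolding singular_value_mset_def Let_def B_def[symmetric] ne dimE count_sum
      by (intro sum.cong refl) auto
    also have "\<dots> = card {i. s i = x}"
    proof (cases "\<exists>i. s i = x")
      case True
      then obtain i where i: "s i = x" by blast
      have "(\<Sum>t\<in>(\<lambda>i. (s i)^2) ` UNIV. if sqrt t = x then card {i. (s i)^2 = t} else 0)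
        = (\<Sum>t\<in>(\<lambda>i. (s i)^2) ` UNIV. if t = x^2 then card {i. (s i)^2 = t} else 0)"
        unfolding i[symmetric] by (intro sum.cong refl) (auto simp: sq sq_inj simp del: real_sqrt_abs)
      also have "\<dots> = card {i. (s i)^2 = x^2}" unfolding i[symmetric] by (subst sum.delta) auto
      also have "{i. (s i)^2 = x^2} = {i. s i = x}"
        unfolding i[symmetric] by (simp only: sq_inj)
      finally show ?thesis .
    next
      case False
      then have "(\<Sum>t\<in>(\<lambda>i. (s i)^2) ` UNIV. if sqrt t = x then card {i. (s i)^2 = t} else 0) = 0"
        by (intro sum.neutral) (auto simp: sq simp del: real_sqrt_abs)
      then show ?thesis using False by simp
    qed
    also have "\<dots> = count (image_mset s (mset_set UNIV)) x"
      by (simp add: count_image_mset vimage_def Int_def)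
    finally show "count (singular_value_mset A) x = count (image_mset s (mset_set UNIV)) x" .
  qed
  define xs where "xs = map (\<lambda>k. s (ix k)) [1..<Suc (CARD('n))]"
  have "mset xs = image_mset s (image_mset ix (mset_set {1..CARD('n)}))"
  proof -
    have "mset [1..<Suc (CARD('n))] = mset_set {1..CARD('n)}"
      by (metis atLeastLessThanSuc_atLeastAtMost mset_upt)
    then show ?thesis unfolding xs_def mset_map by (simp only: image_mset.compositionality o_def)
  qed
  also have "image_mset ix (mset_set {1..CARD('n)}) = mset_set (UNIV::'n set)"
    using ix_bij[where 'n='n] by (metis bij_betw_def image_mset_mset_set)
  finally have "mset (rev xs) = singular_value_mset A" using ms by simp
  moreover have "sorted (rev xs)"
    unfolding sorted_rev_iff_nth_mono xs_def
  proof (intro allI impI)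
    fix i j assume ij: "i \<le> j" "j < length (map (\<lambda>k. s (ix k)) [1..<Suc (CARD('n))])"
    then show "map (\<lambda>k. s (ix k)) [1..<Suc (CARD('n))] ! j \<le> map (\<lambda>k. s (ix k)) [1..<Suc (CARD('n))] ! i"
      by (simp del: upt_Suc add: s(2))
  qed
  ultimately have "sorted_list_of_multiset (singular_value_mset A) = rev xs"
    by (metis sorted_list_of_multiset_mset sorted_sort_id)
  then have "singular_value A (pos i) = xs ! (pos i - 1)" by (simp add: singular_value_def)
  also have "\<dots> = s (ix (pos i))"
  proof -
    have "pos i - 1 < CARD('n)" "1 + (pos i - 1) = pos i"
      using pos_le_card[of i] pos_ge_1[of i] by linarith+
    then show ?thesis unfolding xs_def by (subst nth_map) (simp_all del: upt_Suc)
  qed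
  finally show ?thesis by simp
qed

definition sv :: "real^'n^'n \<Rightarrow> 'n::finite \<Rightarrow> real" where
  "sv A i = singular_value A (pos i)"

text \<open>The singular bases are not unique. An arbitrary choice is made once; every later statement about them
  concerns only flags cut out at positions with a singular value gap, where the choice is immaterial.\<close>

definition svK :: "real^'n^'n \<Rightarrow> real^'n^'n::finite" where
  "svK A = (SOME K. \<exists>L. is_svd A K (sv A) L)"

definition svL :: "real^'n^'n \<Rightarrow> real^'n^'n::finite" where
  "svL A = (SOME L. is_svd A (svK A) (sv A) L)"

lemma svd:
  fixes A :: "real^'n^'n"
  assumes "det A \<noteq> 0"
  shows "is_svd A (svK A) (sv A) (svL A)"
proof -
  obtain K s L where svd: "is_svd A K s L" using svd_exists[OF assms] by blast
  have "s = sv A" using singular_value_svd[OF svd] by (auto simp: sv_def)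
  then have "\<exists>K L. is_svd A K (sv A) L" using svd by blast
  then have "\<exists>L. is_svd A (svK A) (sv A) L" unfolding svK_def by (rule someI_ex)
  then show ?thesis unfolding svL_def by (rule someI_ex)
qed

lemma
  fixes A :: "real^'n^'n"
  assumes "det A \<noteq> 0"
  shows orthogonal_svK: "orthogonal_matrix (svK A)"
    and orthogonal_svL: "orthogonal_matrix (svL A)"
    and svd_eq: "A = svK A ** diag (sv A) ** svL A"
    and sv_pos: "sv A i > 0"
    and sv_antimono: "pos i \<le> pos j \<Longrightarrow> sv A j \<le> sv A i"
  using svd[OF assms] by (auto simp: is_svd_def)

lemma norm_bounds_of_diag:
  fixes s :: "'n::finite \<Rightarrow> real"
  assumes s: "\<And>i j. pos i \<le> pos j \<Longrightarrow> s j \<le> s i" "\<And>i. 0 < s i"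
  shows "x \<in> std (pos k) \<Longrightarrow> s k * norm x \<le> norm (diag s *v x)"
    and "(\<forall>i. pos i < pos k \<longrightarrow> x $ i = 0) \<Longrightarrow> norm (diag s *v x) \<le> s k * norm x"
proof -
  assume x: "x \<in> std (pos k)"
  have "norm (s k *\<^sub>R x) \<le> norm (diag s *v x)"
    unfolding diag_mult_vec
  proof (rule norm_le_componentwise_cart)
    fix i show "norm ((s k *\<^sub>R x) $ i) \<le> norm ((\<chi> i. s i * x $ i) $ i)"
      using x s(1)[of i k] s(2)[of i] s(2)[of k] by (cases "pos i \<le> pos k") (auto simp: abs_mult std_def intro!: mult_right_mono)
  qed
  then show "s k * norm x \<le> norm (diag s *v x)" using s(2)[of k] by simp
next
  assume x: "\<forall>i. pos i < pos k \<longrightarrow> x $ i = 0"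
  have "norm (diag s *v x) \<le> norm (s k *\<^sub>R x)"
    unfolding diag_mult_vec
  proof (rule norm_le_componentwise_cart)
    fix i show "norm ((\<chi> i. s i * x $ i) $ i) \<le> norm ((s k *\<^sub>R x) $ i)"
      using x s(1)[of k i] s(2)[of i] s(2)[of k] by (cases "pos k \<le> pos i") (auto simp: abs_mult intro!: mult_right_mono)
  qed
  then show "norm (diag s *v x) \<le> s k * norm x" using s(2)[of k] by simp
qed

section \<open>Singular values of products\<close>

definition mbound :: "real \<Rightarrow> real^'n^'m::finite \<Rightarrow> bool" where
  "mbound C A \<longleftrightarrow> (\<forall>x. norm (A *v x) \<le> C * norm x)"

lemma mboundD: "mbound C A \<Longrightarrow> norm (A *v x) \<le> C * norm x"
  by (simp add: mbound_def)

lemma mbound_exists: "\<exists>C\<ge>1. mbound C (A :: real^'n^'m::finite)"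
proof -
  obtain B where B: "\<And>x. norm (A *v x) \<le> B * norm x"
    using linear_bounded[OF matrix_vector_mul_linear[of A]] by blast
  have "norm (A *v x) \<le> max 1 B * norm x" for x
    by (rule order_trans[OF B]) (intro mult_right_mono; simp)
  then show ?thesis by (auto simp: mbound_def intro!: exI[of _ "max 1 B"])
qed

lemma mbound_mult:
  fixes A B :: "real^'n^'n"
  assumes "mbound C A" "mbound D B" "0 \<le> C"
  shows "mbound (C * D) (A ** B)"
  unfolding mbound_def
proof
  fix x
  have "norm ((A ** B) *v x) = norm (A *v (B *v x))" by (simp add: matrix_vector_mul_assoc)
  also have "\<dots> \<le> C * norm (B *v x)" by (rule mboundD[OF assms(1)])
  also have "\<dots> \<le> C * (D * norm x)" by (intro mult_left_mono mboundD assms)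
  finally show "norm ((A ** B) *v x) \<le> C * D * norm x" by (simp add: mult.assoc)
qed

lemma mbound_mono: "mbound C A \<Longrightarrow> C \<le> D \<Longrightarrow> mbound D A"
  unfolding mbound_def by (meson mult_right_mono norm_ge_zero order_trans)

lemma mbound_transpose:
  fixes A :: "real^'n^'n"
  assumes "mbound C A"
  shows "mbound C (transpose A)"
  unfolding mbound_def
proof
  fix x
  let ?y = "transpose A *v x"
  have "norm ?y * norm ?y = ?y \<bullet> ?y" by (simp add: dot_square_norm power2_eq_square)
  also have "\<dots> = x \<bullet> (A *v ?y)"
    by (simp add: transpose_matrix_vector dot_lmul_matrix)
  also have "\<dots> \<le> norm x * norm (A *v ?y)" by (rule norm_cauchy_schwarz)
  also have "\<dots> \<le> norm x * (C * norm ?y)" by (intro mult_left_mono mboundD assms) auto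
  finally have *: "norm ?y * norm ?y \<le> (C * norm x) * norm ?y" by (simp add: mult_ac)
  show "norm ?y \<le> C * norm x"
  proof (cases "norm ?y = 0")
    case True
    have "0 \<le> C * norm x" using mboundD[OF assms, of x] norm_ge_zero order_trans by blast
    then show ?thesis using True by simp
  next
    case False
    then have "norm ?y > 0" by simp
    then show ?thesis using * by (simp only: mult_le_cancel_right_pos)
  qed
qed

lemma norm_svd_apply:
  fixes A :: "real^'n^'n"
  assumes "det A \<noteq> 0"
  shows "norm (A *v x) = norm (diag (sv A) *v (svL A *v x))"
proof -
  have "norm (A *v x) = norm (svK A *v (diag (sv A) *v (svL A *v x)))"
    by (subst svd_eq[OF assms]) (simp only: matrix_vector_mul_assoc matrix_mul_assoc)
  then show ?thesis using orthogonal_matrix_norm[OF orthogonal_svK[OF assms]] by simp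
qed

lemma sv_attained:
  fixes A :: "real^'n^'n"
  assumes A: "det A \<noteq> 0"
  obtains V where "subspace V" "dim V = pos k" "\<And>x. x \<in> V \<Longrightarrow> sv A k * norm x \<le> norm (A *v x)"
proof (rule that[of "(\<lambda>x. transpose (svL A) *v x) ` std (pos k)"])
  let ?L = "svL A"
  note L = orthogonal_svL[OF A]
  show "subspace ((\<lambda>x. transpose ?L *v x) ` std (pos k))"
    by (intro subspace_matrix_image subspace_std)
  show "dim ((\<lambda>x. transpose ?L *v x) ` std (pos k)) = pos k"
    using orthogonal_det_nz[OF L] by (subst dim_invertible_image) (auto simp: dim_std det_transpose)
  fix x assume "x \<in> (\<lambda>x. transpose ?L *v x) ` std (pos k)"
  then obtain y where y: "y \<in> std (pos k)" "x = transpose ?L *v y" by blast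
  have "norm x = norm y" using y orthogonal_matrix_norm[OF orthogonal_transpose[OF L]] by simp
  moreover have "norm (A *v x) = norm (diag (sv A) *v y)"
    by (simp add: norm_svd_apply[OF A] y orthogonal_cancel[OF L])
  ultimately show "sv A k * norm x \<le> norm (A *v x)"
    using norm_bounds_of_diag(1)[OF sv_antimono[OF A] sv_pos[OF A] y(1)] by simp
qed

lemma subspaces_meet:
  fixes V W :: "'a::euclidean_space set"
  assumes "subspace V" "subspace W" "dim V + dim W > DIM('a)"
  obtains x where "x \<in> V" "x \<in> W" "x \<noteq> 0"
proof -
  have "dim {x + y |x y. x \<in> V \<and> y \<in> W} + dim (V \<inter> W) = dim V + dim W"
    by (rule dim_sums_Int[OF assms(1,2)])
  moreover have "dim {x + y |x y. x \<in> V \<and> y \<in> W} \<le> DIM('a)" by (rule dim_subset_UNIV)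
  ultimately have "dim (V \<inter> W) \<noteq> 0" using assms(3) by linarith
  then obtain x where "x \<in> V \<inter> W" "x \<noteq> 0" by (auto simp: dim_eq_0)
  then show ?thesis using that by blast
qed

text \<open>The useful half of the Courant-Fischer principle: a subspace of the dimension \<open>p\<close> meets the span of the
  singular directions from position \<open>p\<close> on, for dimension reasons.\<close>

lemma sv_ge_of_subspace:
  fixes A :: "real^'n^'n"
  assumes A: "det A \<noteq> 0" and V: "subspace V" "dim V = pos k"
    and t: "\<And>x. x \<in> V \<Longrightarrow> t * norm x \<le> norm (A *v x)"
  shows "t \<le> sv A k"
proof -
  let ?L = "svL A"
  note L = orthogonal_svL[OF A]
  define U :: "(real^'n) set" where "U = {x. \<forall>i. i \<notin> {i. pos k \<le> pos i} \<longrightarrow> x $ i = 0}"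
  define W where "W = (\<lambda>x. transpose ?L *v x) ` U"
  have "card {i::'n. pos k \<le> pos i} = Suc (CARD('n)) - pos k"
  proof -
    have "bij_betw pos {i::'n. pos k \<le> pos i} {pos k..CARD('n)}"
    proof (rule bij_betw_byWitness[where f'=ix])
      show "\<forall>a'\<in>{pos k..CARD('n)}. pos (ix a' :: 'n) = a'"
        using pos_ge_1[of k] by (auto simp del: pos_ge_1)
    qed (use pos_ge_1[of k] in \<open>auto simp del: pos_ge_1\<close>)
    then show ?thesis using bij_betw_same_card by fastforce
  qed
  then have dU: "dim U = Suc (CARD('n)) - pos k"
    unfolding U_def using dim_substandard_cart[of "{i::'n. pos k \<le> pos i}", where 'a=real]
    by (simp add: dim_vec_eq)
  have "subspace U" by (auto simp: U_def subspace_def)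
  then have sW: "subspace W" unfolding W_def by (rule subspace_matrix_image)
  have dW: "dim W = Suc (CARD('n)) - pos k"
    unfolding W_def using orthogonal_det_nz[OF L] dU by (subst dim_invertible_image) (auto simp: det_transpose)
  obtain x where x: "x \<in> V" "x \<in> W" "x \<noteq> 0"
    using subspaces_meet[OF V(1) sW] V(2) dW pos_le_card[of k] pos_ge_1[of k]
    by (auto simp del: pos_le_card pos_ge_1)
  obtain y where y: "y \<in> U" "x = transpose ?L *v y" using x(2) W_def by blast
  have nx: "norm x = norm y" using y orthogonal_matrix_norm[OF orthogonal_transpose[OF L]] by simp
  have "t * norm x \<le> norm (A *v x)" by (rule t[OF x(1)])
  also have "\<dots> = norm (diag (sv A) *v y)"
    by (simp add: norm_svd_apply[OF A] y orthogonal_cancel[OF L])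
  also have "\<dots> \<le> sv A k * norm y"
    by (rule norm_bounds_of_diag(2)[OF sv_antimono[OF A] sv_pos[OF A]]) (use y in \<open>auto simp: U_def\<close>)
  finally have "t * norm x \<le> sv A k * norm x" using nx by simp
  then show ?thesis using x(3) by (simp add: mult_le_cancel_right)
qed

text \<open>Multiplication by a fixed matrix changes all singular values by a bounded factor. This makes the logarithms
  of the singular values Lipschitz functions of the word length.\<close>

lemma sv_mult_left_le:
  fixes A M :: "real^'n^'n"
  assumes A: "det A \<noteq> 0" and M: "det M \<noteq> 0" "mbound C M" "C > 0"
  shows "sv (M ** A) k \<le> C * sv A k"
proof -
  have MA: "det (M ** A) \<noteq> 0" using A M by (simp add: det_mul)
  obtain V where V: "subspace V" "dim V = pos k"
    "\<And>x. x \<in> V \<Longrightarrow> sv (M ** A) k * norm x \<le> norm ((M ** A) *v x)" using sv_attained[OF MA, of k] by blast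
  have "sv (M ** A) k / C \<le> sv A k"
  proof (rule sv_ge_of_subspace[OF A V(1,2)])
    fix x assume x: "x \<in> V"
    have "sv (M ** A) k * norm x \<le> norm (M *v (A *v x))"
      using V(3)[OF x] by (simp add: matrix_vector_mul_assoc)
    also have "\<dots> \<le> C * norm (A *v x)" by (rule mboundD[OF M(2)])
    finally show "sv (M ** A) k / C * norm x \<le> norm (A *v x)"
      using M(3) by (simp add: field_simps)
  qed
  then show ?thesis using M(3) by (simp add: field_simps)
qed

lemma sv_mult_right_le:
  fixes A M :: "real^'n^'n"
  assumes A: "det A \<noteq> 0" and M: "det M \<noteq> 0" "mbound C M" "C > 0"
  shows "sv (A ** M) k \<le> C * sv A k"
proof -
  have AM: "det (A ** M) \<noteq> 0" using A M by (simp add: det_mul)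
  obtain V where V: "subspace V" "dim V = pos k"
    "\<And>x. x \<in> V \<Longrightarrow> sv (A ** M) k * norm x \<le> norm ((A ** M) *v x)" using sv_attained[OF AM, of k] by blast
  have "sv (A ** M) k / C \<le> sv A k"
  proof (rule sv_ge_of_subspace[OF A])
    show "subspace ((\<lambda>x. M *v x) ` V)" by (rule subspace_matrix_image[OF V(1)])
    show "dim ((\<lambda>x. M *v x) ` V) = pos k" using dim_invertible_image[OF M(1)] V(2) by simp
    fix y assume "y \<in> (\<lambda>x. M *v x) ` V"
    then obtain x where x: "x \<in> V" "y = M *v x" by blast
    have "sv (A ** M) k * norm y \<le> sv (A ** M) k * (C * norm x)"
      unfolding x(2) using sv_pos[OF AM, of k] by (intro mult_left_mono mboundD M) auto
    also have "\<dots> \<le> C * norm ((A ** M) *v x)" using V(3)[OF x(1)] M(3) by (simp add: mult.left_commute)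
    also have "(A ** M) *v x = A *v y" by (simp add: x(2) matrix_vector_mul_assoc)
    finally show "sv (A ** M) k / C * norm y \<le> norm (A *v y)"
      using M(3) by (simp add: field_simps)
  qed
  then show ?thesis using M(3) by (simp add: field_simps)
qed

lemma orthogonal_entry_le_1:
  fixes Q :: "real^'n^'n"
  assumes "orthogonal_matrix Q"
  shows "\<bar>Q $ i $ j\<bar> \<le> 1"
proof -
  have "norm (column j Q) = 1" using assms by (simp add: orthogonal_matrix_orthonormal_columns)
  then have "\<bar>column j Q $ i\<bar> \<le> 1" using component_le_norm_cart[of "column j Q" i] by simp
  then show ?thesis by (simp add: column_def)
qed

text \<open>Moving the left singular basis of \<open>B\<close> by \<open>A\<close> lands close to the left singular basis of
  \<open>A B\<close>, as far as the flags cut out by large singular value gaps are concerned.\<close>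

lemma left_singular_basis_entry_le:
  fixes A B :: "real^'n^'n"
  assumes A: "det A \<noteq> 0" and B: "det B \<noteq> 0"
  shows "\<bar>(transpose (svK (A ** B)) ** A ** svK B) $ i $ j\<bar> \<le> sv (A ** B) i / sv B j"
proof -
  let ?C = "A ** B"
  have C: "det ?C \<noteq> 0" using A B by (simp add: det_mul)
  note O = orthogonal_svK[OF B] orthogonal_svL[OF B] orthogonal_svK[OF C] orthogonal_svL[OF C]
  note T = O[THEN orthogonal_matrix_transpose_mult(1)] O[THEN orthogonal_matrix_transpose_mult(2)]
  have inv: "diag (sv B) ** diag (\<lambda>i. 1 / sv B i) = mat 1"
    unfolding diag_mult_diag diag_1[symmetric] using sv_pos[OF B]
    by (intro arg_cong[of _ _ diag] ext) (simp add: less_imp_neq[symmetric])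
  have BK: "svK B = B ** transpose (svL B) ** diag (\<lambda>i. 1 / sv B i)"
  proof -
    have "B ** transpose (svL B) ** diag (\<lambda>i. 1 / sv B i)
       = svK B ** diag (sv B) ** (svL B ** transpose (svL B)) ** diag (\<lambda>i. 1 / sv B i)"
      by (subst (1) svd_eq[OF B]) (simp add: matrix_mul_assoc)
    also have "\<dots> = svK B ** (diag (sv B) ** diag (\<lambda>i. 1 / sv B i))"
      by (simp add: T matrix_mul_assoc)
    finally show ?thesis by (simp add: inv)
  qed
  have "transpose (svK ?C) ** A ** svK B
     = transpose (svK ?C) ** (A ** B) ** transpose (svL B) ** diag (\<lambda>i. 1 / sv B i)"
    by (subst BK) (simp add: matrix_mul_assoc)
  also have "transpose (svK ?C) ** (A ** B) = diag (sv ?C) ** svL ?C"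
    by (subst (2) svd_eq[OF C]) (simp add: matrix_mul_assoc T)
  finally have "transpose (svK ?C) ** A ** svK B
     = diag (sv ?C) ** (svL ?C ** transpose (svL B)) ** diag (\<lambda>i. 1 / sv B i)"
    by (simp add: matrix_mul_assoc)
  then have "(transpose (svK ?C) ** A ** svK B) $ i $ j
     = sv ?C i * (svL ?C ** transpose (svL B)) $ i $ j * (1 / sv B j)"
    by (simp add: diag_mult_left diag_mult_right)
  moreover have "\<bar>(svL ?C ** transpose (svL B)) $ i $ j\<bar> \<le> 1"
    by (intro orthogonal_entry_le_1 orthogonal_matrix_mul orthogonal_transpose O)
  then have "sv ?C i * \<bar>(svL ?C ** transpose (svL B)) $ i $ j\<bar> * (1 / sv B j) \<le> sv ?C i * 1 * (1 / sv B j)"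
    using sv_pos[OF C, of i] sv_pos[OF B, of j] by (intro mult_right_mono mult_left_mono) auto
  ultimately show ?thesis
    using sv_pos[OF C, of i] sv_pos[OF B, of j] by (simp add: abs_mult)
qed

section \<open>Exterior powers inside tensor powers\<close>

definition slot :: "'n set \<Rightarrow> real^'n^'n \<Rightarrow> 'n::finite \<Rightarrow> real^'n^'n" where
  "slot I A i = (if i \<in> I then A else mat 1)"

text \<open>The matrix acting as \<open>A\<close> on the tensor slots in \<open>I\<close> and trivially on the others. The type of functions on
  the index type indexes the basis of the full tensor power, so that exterior powers of every degree live in
  one and the same finite-dimensional space.\<close>

definition tens :: "'n::finite set \<Rightarrow> real^'n^'n \<Rightarrow> real^('n \<Rightarrow> 'n)^('n \<Rightarrow> 'n)" where
  "tens I A = (\<chi> f h. \<Prod>i\<in>UNIV. slot I A i $ f i $ h i)"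

text \<open>A copy of the exterior power of degree \<open>card I\<close>: tensors antisymmetric in the slots \<open>I\<close> and concentrated on the
  fixed basis vector \<open>i\<close> in every slot \<open>i\<close> outside \<open>I\<close>.\<close>

definition alt :: "'n::finite set \<Rightarrow> (real^('n \<Rightarrow> 'n)) set" where
  "alt I = {z. (\<forall>\<tau> f. \<tau> permutes I \<longrightarrow> z $ (f \<circ> \<tau>) = of_int (sign \<tau>) * z $ f) \<and>
               (\<forall>f i. i \<notin> I \<longrightarrow> f i \<noteq> i \<longrightarrow> z $ f = 0)}"

text \<open>The unit vector of \<open>alt I\<close> that represents the wedge product of the coordinate vectors in \<open>I\<close>.\<close>

definition lead :: "'n::finite set \<Rightarrow> real^('n \<Rightarrow> 'n)" where
  "lead I = (\<chi> f. (if f permutes I then of_int (sign f) else 0) / sqrt (fact (card I)))"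

lemma PiE_UNIV_eq: "PiE UNIV (\<lambda>_. UNIV) = UNIV"
  by (auto simp: PiE_def extensional_def)

lemma slot_mult: "slot I A i ** slot I B i = slot I (A ** B) i"
  by (simp add: slot_def)

lemma tens_mult: "tens I (A ** B) = tens I A ** tens I B"
proof (subst vec_eq_iff, intro allI, subst vec_eq_iff, intro allI)
  fix f k
  have "(tens I A ** tens I B) $ f $ k
      = (\<Sum>h\<in>UNIV. \<Prod>i\<in>UNIV. slot I A i $ f i $ h i * slot I B i $ h i $ k i)"
    by (simp add: tens_def matrix_matrix_mult_def prod.distrib)
  also have "\<dots> = (\<Prod>i\<in>UNIV. \<Sum>j\<in>UNIV. slot I A i $ f i $ j * slot I B i $ j $ k i)"
    by (subst prod_sum_PiE) (auto simp: PiE_UNIV_eq)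
  also have "\<dots> = (\<Prod>i\<in>UNIV. (slot I A i ** slot I B i) $ f i $ k i)"
    by (simp add: matrix_matrix_mult_def)
  also have "\<dots> = tens I (A ** B) $ f $ k" by (simp add: slot_mult tens_def)
  finally show "tens I (A ** B) $ f $ k = (tens I A ** tens I B) $ f $ k" by simp
qed

lemma tens_diag: "tens I (diag s) = diag (\<lambda>f. \<Prod>i\<in>I. s (f i))"
proof (subst vec_eq_iff, intro allI, subst vec_eq_iff, intro allI)
  fix f h :: "'a \<Rightarrow> 'a"
  show "tens I (diag s) $ f $ h = diag (\<lambda>f. \<Prod>i\<in>I. s (f i)) $ f $ h"
  proof (cases "f = h")
    case True
    have "tens I (diag s) $ f $ h = (\<Prod>i\<in>UNIV. if i \<in> I then s (f i) else 1)"
      unfolding tens_def True by (auto simp: slot_def diag_def mat_def intro!: prod.cong)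
    also have "\<dots> = (\<Prod>i\<in>I. s (f i))" by (simp add: prod.If_cases)
    finally show ?thesis using True by (simp add: diag_def)
  next
    case False
    then obtain i where "f i \<noteq> h i" by auto
    then have "slot I (diag s) i $ f i $ h i = 0" by (simp add: slot_def diag_def mat_def)
    then have "tens I (diag s) $ f $ h = 0" by (auto simp: tens_def)
    then show ?thesis using False by (simp add: diag_def)
  qed
qed

lemma tens_1: "tens I (mat 1) = mat 1"
  by (simp add: diag_1[symmetric] tens_diag)

lemma tens_transpose: "tens I (transpose A) = transpose (tens I A)"
proof -
  have "slot I (transpose A) i $ a $ b = slot I A i $ b $ a" for i a b
    by (auto simp: slot_def transpose_def mat_def)
  then show ?thesis by (simp add: tens_def transpose_def)
qed

lemma tens_orthogonal: "orthogonal_matrix Q \<Longrightarrow> orthogonal_matrix (tens I Q)"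
  unfolding orthogonal_matrix_def tens_transpose[symmetric] tens_mult[symmetric]
  by (simp add: tens_1)

lemma subspace_alt: "subspace (alt I)"
  unfolding subspace_def alt_def by (auto simp: algebra_simps)

lemma tens_alt:
  assumes z: "z \<in> alt I"
  shows "tens I A *v z \<in> alt I"
  unfolding alt_def
proof (intro CollectI conjI allI impI)
  fix \<tau> f assume t: "\<tau> permutes I"
  have bt: "bij \<tau>" using t permutes_bij by blast
  have "(tens I A *v z) $ (f \<circ> \<tau>) = (\<Sum>h\<in>UNIV. (\<Prod>i\<in>UNIV. slot I A i $ f (\<tau> i) $ h i) * z $ h)"
    by (simp add: tens_def matrix_vector_mult_def)
  also have "\<dots> = (\<Sum>h\<in>UNIV. (\<Prod>i\<in>UNIV. slot I A i $ f (\<tau> i) $ (h \<circ> \<tau>) i) * z $ (h \<circ> \<tau>))"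
  proof (rule sum.reindex_bij_betw[symmetric])
    show "bij (\<lambda>h. h \<circ> \<tau>)"
      by (rule bij_betw_byWitness[where f'="\<lambda>h. h \<circ> Hilbert_Choice.inv \<tau>"])
         (use bt in \<open>auto simp: fun_eq_iff bij_is_surj bij_is_inj surj_f_inv_f inv_f_f\<close>)
  qed
  also have "\<dots> = (\<Sum>h\<in>UNIV. (\<Prod>i\<in>UNIV. slot I A i $ f i $ h i) * (of_int (sign \<tau>) * z $ h))"
  proof (rule sum.cong[OF refl])
    fix h
    have "(\<Prod>i\<in>UNIV. slot I A i $ f (\<tau> i) $ (h \<circ> \<tau>) i) = (\<Prod>i\<in>UNIV. slot I A (\<tau> i) $ f (\<tau> i) $ h (\<tau> i))"
      using t by (intro prod.cong) (auto simp: slot_def permutes_in_image)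
    also have "\<dots> = (\<Prod>i\<in>UNIV. slot I A i $ f i $ h i)"
      using bt by (rule prod.reindex_bij_betw)
    finally show "(\<Prod>i\<in>UNIV. slot I A i $ f (\<tau> i) $ (h \<circ> \<tau>) i) * z $ (h \<circ> \<tau>)
      = (\<Prod>i\<in>UNIV. slot I A i $ f i $ h i) * (of_int (sign \<tau>) * z $ h)"
      using z t by (simp add: alt_def)
  qed
  also have "\<dots> = of_int (sign \<tau>) * (tens I A *v z) $ f"
    by (simp add: tens_def matrix_vector_mult_def sum_distrib_left algebra_simps)
  finally show "(tens I A *v z) $ (f \<circ> \<tau>) = of_int (sign \<tau>) * (tens I A *v z) $ f" .
next
  fix f i assume i: "i \<notin> I" "f i \<noteq> i"
  have "(\<Prod>i\<in>UNIV. slot I A i $ f i $ h i) * z $ h = 0" for h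
  proof (cases "h i = i")
    case True
    then have "slot I A i $ f i $ h i = 0" using i by (simp add: slot_def mat_def)
    then have "(\<Prod>i\<in>UNIV. slot I A i $ f i $ h i) = 0" by auto
    then show ?thesis by simp
  next
    case False then show ?thesis using z i by (auto simp: alt_def)
  qed
  then have "(\<Sum>h\<in>UNIV. (\<Prod>i\<in>UNIV. slot I A i $ f i $ h i) * z $ h) = 0" by (intro sum.neutral ballI)
  then show "(tens I A *v z) $ f = 0" by (simp only: tens_def matrix_vector_mult_def vec_lambda_beta)
qed

lemma lead_alt: "lead I \<in> alt I"
  unfolding alt_def
proof (intro CollectI conjI allI impI)
  fix \<tau> f :: "'a \<Rightarrow> 'a" assume t: "\<tau> permutes I"
  have "f \<circ> \<tau> permutes I \<longleftrightarrow> f permutes I"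
  proof
    assume "f \<circ> \<tau> permutes I"
    from permutes_compose[OF permutes_inv[OF t] this]
    show "f permutes I" by (simp only: o_assoc[symmetric] permutes_inv_o(1)[OF t] comp_id)
  qed (use t in \<open>auto intro: permutes_compose\<close>)
  moreover have "sign (f \<circ> \<tau>) = sign f * sign \<tau>" if "f permutes I"
    using that t by (meson finite permutation_permutes sign_compose)
  ultimately show "lead I $ (f \<circ> \<tau>) = of_int (sign \<tau>) * lead I $ f"
    by (simp add: lead_def)
next
  fix f :: "'a \<Rightarrow> 'a" and i assume "i \<notin> I" "f i \<noteq> i"
  then have "\<not> f permutes I" by (auto simp: permutes_def)
  then show "lead I $ f = 0" by (simp add: lead_def)
qed

lemma alt_permutes: "z \<in> alt I \<Longrightarrow> f permutes I \<Longrightarrow> z $ f = of_int (sign f) * z $ id"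
  unfolding alt_def by (metis (mono_tags, lifting) comp_id id_comp mem_Collect_eq)

lemma sign_sq: "(of_int (sign f) :: real) * of_int (sign f) = 1"
  by (simp add: sign_def)

lemma lead_inner:
  assumes z: "z \<in> alt I"
  shows "lead I \<bullet> z = sqrt (fact (card I)) * z $ id"
proof -
  have "lead I \<bullet> z = (\<Sum>f\<in>UNIV. if f permutes I then z $ id / sqrt (fact (card I)) else 0)"
    unfolding inner_vec_def
  proof (rule sum.cong[OF refl])
    fix f :: "'a \<Rightarrow> 'a"
    show "lead I $ f \<bullet> z $ f = (if f permutes I then z $ id / sqrt (fact (card I)) else 0)"
      using alt_permutes[OF z, of f] sign_sq[of f] by (simp add: lead_def flip: mult.assoc)
  qed
  also have "\<dots> = real (card {f. f permutes I}) * (z $ id / sqrt (fact (card I)))"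
    by (simp add: sum.If_cases)
  also have "card {f. f permutes I} = fact (card I)" by (rule card_permutations) auto
  finally have "lead I \<bullet> z = fact (card I) / sqrt (fact (card I)) * z $ id" by (simp add: id_def)
  then show ?thesis by (simp only: real_div_sqrt fact_ge_zero)
qed

lemma norm_lead [simp]: "norm (lead I) = 1"
proof -
  have "lead I \<bullet> lead I = 1"
    by (simp add: lead_inner[OF lead_alt]) (simp add: lead_def permutes_id)
  then show ?thesis by (simp add: norm_eq_1)
qed

lemma lead_inner_sq:
  assumes z: "z \<in> alt I"
  shows "(lead I \<bullet> z)\<^sup>2 = (\<Sum>f | f permutes I. (z $ f)\<^sup>2)"
proof -
  have "(\<Sum>f | f permutes I. (z $ f)\<^sup>2) = (\<Sum>f | f permutes I. (z $ id)\<^sup>2)"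
  proof (rule sum.cong[OF refl])
    fix f assume "f \<in> {f. f permutes I}"
    then show "(z $ f)\<^sup>2 = (z $ id)\<^sup>2"
      using alt_permutes[OF z, of f] by (auto simp: sign_def)
  qed
  also have "\<dots> = fact (card I) * (z $ id)\<^sup>2" by (simp add: card_permutations)
  finally show ?thesis by (simp add: lead_inner[OF z] power_mult_distrib)
qed

text \<open>Antisymmetry kills the entries with a repeated index. Hence an index in the support of an alternating tensor
  is either a permutation of \<open>I\<close>, accounted for by the leading vector, or leaves \<open>I\<close>.\<close>

lemma alt_support:
  assumes z: "z \<in> alt I" and f: "z $ f \<noteq> 0"
  shows "inj_on f I" "i \<notin> I \<Longrightarrow> f i = i"
proof -
  show "inj_on f I"
  proof (rule inj_onI, rule ccontr)
    fix x y assume xy: "x \<in> I" "y \<in> I" "f x = f y" "x \<noteq> y"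
    have "f \<circ> Transposition.transpose x y = f" using xy(3) by (auto simp: Transposition.transpose_def)
    moreover have "z $ (f \<circ> Transposition.transpose x y) = of_int (sign (Transposition.transpose x y)) * z $ f"
      using z permutes_swap_id[OF xy(1,2)] by (simp add: alt_def)
    ultimately have "z $ f = - z $ f" using xy(4) by (simp add: sign_swap_id)
    then show False using f by simp
  qed
  show "i \<notin> I \<Longrightarrow> f i = i" using z f by (auto simp: alt_def)
qed

lemma prod_moved_le:
  fixes s :: "'n::finite \<Rightarrow> real"
  assumes f: "inj_on f I" "f ` I \<noteq> I" and s: "\<And>i. 0 < s i" "\<And>i. i \<in> I \<Longrightarrow> a \<le> s i" "\<And>i. i \<notin> I \<Longrightarrow> s i \<le> b"
    and ab: "0 < b" "b \<le> a"
  shows "(\<Prod>i\<in>I. s (f i)) \<le> (b / a) * prod s I"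
proof -
  define J where "J = f ` I"
  have cJ: "card J = card I" unfolding J_def by (rule card_image[OF f(1)])
  define k where "k = card (J - I)"
  have k': "card (I - J) = k"
  proof -
    have "card J = card (J \<inter> I) + card (J - I)" "card I = card (J \<inter> I) + card (I - J)"
      using card_Int_Diff[of J I] card_Int_Diff[of I J] by (simp_all add: Int_commute)
    then show ?thesis using cJ by (simp add: k_def)
  qed
  have "k \<noteq> 0"
  proof
    assume "k = 0"
    then have "J \<subseteq> I" by (simp add: k_def)
    then have "J = I" using cJ by (intro card_subset_eq) auto
    then show False using f(2) by (simp add: J_def)
  qed
  then obtain m where m: "k = Suc m" by (cases k) auto
  define P where "P = prod s (J \<inter> I)"
  have P: "P > 0" unfolding P_def by (rule prod_pos) (simp add: s)
  have J: "prod s J = P * prod s (J - I)" unfolding P_def by (rule prod.Int_Diff) simp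
  have I: "prod s I = P * prod s (I - J)" unfolding P_def Int_commute[of J] by (rule prod.Int_Diff) simp
  have "prod s (J - I) \<le> (\<Prod>i\<in>J-I. b)" using s(1) s(3) by (intro prod_mono) (auto intro: less_imp_le)
  then have 1: "prod s (J - I) \<le> b ^ k" by (simp add: k_def)
  have "(\<Prod>i\<in>I-J. a) \<le> prod s (I - J)" using s(2) ab by (intro prod_mono) auto
  then have 2: "a ^ k \<le> prod s (I - J)" by (simp add: k')
  have "b ^ k \<le> (b / a) * a ^ k"
  proof -
    have "b * b ^ m \<le> b * a ^ m" using ab by (intro mult_left_mono power_mono) auto
    then show ?thesis using ab by (simp add: m)
  qed
  also have "\<dots> \<le> (b / a) * prod s (I - J)" using 2 ab by (intro mult_left_mono) auto
  finally have "prod s (J - I) \<le> (b / a) * prod s (I - J)" using 1 by linarith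
  then have "P * prod s (J - I) \<le> P * ((b / a) * prod s (I - J))" using P by (intro mult_left_mono) auto
  then have "prod s J \<le> (b / a) * prod s I" unfolding J I by (simp add: mult_ac)
  moreover have "prod s J = (\<Prod>i\<in>I. s (f i))" unfolding J_def by (subst prod.reindex[OF f(1)]) simp
  ultimately show ?thesis by simp
qed

text \<open>The spectral gap of the exterior power: orthogonally to the leading vector at least one factor \<open>s i\<close> with
  \<open>i\<close> inside \<open>I\<close> is replaced by one from outside, which costs the ratio of the two singular values next to the cut.\<close>

lemma diag_alt_norm_le:
  fixes s :: "'n::finite \<Rightarrow> real"
  assumes z: "z \<in> alt I" and s: "\<And>i. 0 < s i" "\<And>i. i \<in> I \<Longrightarrow> a \<le> s i" "\<And>i. i \<notin> I \<Longrightarrow> s i \<le> b"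
    and ab: "0 < b" "b \<le> a"
  shows "norm (diag (\<lambda>f. \<Prod>i\<in>I. s (f i)) *v z) \<le> prod s I * (\<bar>lead I \<bullet> z\<bar> + (b / a) * norm z)"
proof -
  let ?N = "prod s I" and ?e = "b / a"
  have N: "?N > 0" by (rule prod_pos) (simp add: s)
  have e: "?e \<ge> 0" using ab by simp
  let ?w = "\<lambda>f. ((\<Prod>i\<in>I. s (f i)) * z $ f)\<^sup>2"
  have perm: "?w f = ?N\<^sup>2 * (z $ f)\<^sup>2" if "f permutes I" for f
  proof -
    have "(\<Prod>i\<in>I. s (f i)) = ?N"
      using prod.permute[OF that, of s] by (simp add: o_def)
    then show ?thesis by (simp add: power_mult_distrib)
  qed
  have nonperm: "?w f \<le> ?N\<^sup>2 * (?e\<^sup>2 * (z $ f)\<^sup>2)" if "\<not> f permutes I" for f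
  proof (cases "z $ f = 0")
    case False
    have "f ` I \<noteq> I"
    proof
      assume "f ` I = I"
      then have "bij_betw f I I" using alt_support(1)[OF z False] by (simp add: bij_betw_def)
      then show False using that bij_imp_permutes[of f I] alt_support(2)[OF z False] by blast
    qed
    then have "(\<Prod>i\<in>I. s (f i)) \<le> ?e * ?N"
      by (rule prod_moved_le[OF alt_support(1)[OF z False] _ s ab])
    moreover have "0 \<le> (\<Prod>i\<in>I. s (f i))" by (intro prod_nonneg) (simp add: s less_imp_le)
    ultimately have "(\<Prod>i\<in>I. s (f i))\<^sup>2 \<le> (?e * ?N)\<^sup>2" by (rule power_mono)
    then have "(\<Prod>i\<in>I. s (f i))\<^sup>2 * (z $ f)\<^sup>2 \<le> (?e * ?N)\<^sup>2 * (z $ f)\<^sup>2" by (rule mult_right_mono) simp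
    moreover have "(?e * ?N)\<^sup>2 * (z $ f)\<^sup>2 = ?N\<^sup>2 * (?e\<^sup>2 * (z $ f)\<^sup>2)"
      by (simp only: power_mult_distrib mult_ac)
    ultimately show ?thesis by (simp only: power_mult_distrib)
  qed auto
  have "(norm (diag (\<lambda>f. \<Prod>i\<in>I. s (f i)) *v z))\<^sup>2 = (\<Sum>f\<in>UNIV. ?w f)"
    by (simp add: diag_mult_vec norm_vec_def L2_set_def sum_nonneg)
  also have "\<dots> = (\<Sum>f | f permutes I. ?w f) + (\<Sum>f | \<not> f permutes I. ?w f)"
  proof -
    have "{f. \<not> f permutes I} = UNIV - {f. f permutes I}" by blast
    then show ?thesis using sum.Int_Diff[of UNIV ?w "{f. f permutes I}"] by (simp only: finite Int_UNIV_left)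
  qed
  also have "\<dots> \<le> (\<Sum>f | f permutes I. ?N\<^sup>2 * (z $ f)\<^sup>2) + (\<Sum>f | \<not> f permutes I. ?N\<^sup>2 * (?e\<^sup>2 * (z $ f)\<^sup>2))"
    by (intro add_mono sum_mono) (use perm nonperm in \<open>auto simp only: mem_Collect_eq\<close>)
  also have "\<dots> = ?N\<^sup>2 * ((lead I \<bullet> z)\<^sup>2 + ?e\<^sup>2 * (\<Sum>f | \<not> f permutes I. (z $ f)\<^sup>2))"
    unfolding lead_inner_sq[OF z] by (simp only: distrib_left sum_distrib_left)
  also have "\<dots> \<le> ?N\<^sup>2 * ((lead I \<bullet> z)\<^sup>2 + ?e\<^sup>2 * (norm z)\<^sup>2)"
  proof -
    have "(\<Sum>f | \<not> f permutes I. (z $ f)\<^sup>2) \<le> (\<Sum>f\<in>UNIV. (z $ f)\<^sup>2)" by (rule sum_mono2) auto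
    also have "\<dots> = (norm z)\<^sup>2" by (simp add: norm_vec_def L2_set_def sum_nonneg)
    finally show ?thesis by (intro mult_left_mono add_left_mono) auto
  qed
  also have "\<dots> \<le> ?N\<^sup>2 * (\<bar>lead I \<bullet> z\<bar> + ?e * norm z)\<^sup>2"
  proof -
    have "x\<^sup>2 + c\<^sup>2 * m\<^sup>2 \<le> (\<bar>x\<bar> + c * m)\<^sup>2" if "0 \<le> c" "0 \<le> m" for x c m :: real
      using that by (simp add: power2_sum power_mult_distrib)
    from this[OF e, of "norm z" "lead I \<bullet> z"] show ?thesis by (intro mult_left_mono) auto
  qed
  finally have "(norm (diag (\<lambda>f. \<Prod>i\<in>I. s (f i)) *v z))\<^sup>2 \<le> (?N * (\<bar>lead I \<bullet> z\<bar> + ?e * norm z))\<^sup>2"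
    by (simp add: power_mult_distrib)
  then show ?thesis
    by (rule power2_le_imp_le) (intro mult_nonneg_nonneg add_nonneg_nonneg e less_imp_le[OF N]; simp)
qed

lemma diag_lead: "diag (\<lambda>f. \<Prod>i\<in>I. s (f i)) *v lead I = prod s I *\<^sub>R lead I"
proof -
  have "(\<Prod>i\<in>I. s (f i)) = prod s I" if "f permutes I" for f
    using prod.permute[OF that, of s] by (simp add: o_def)
  then show ?thesis by (auto simp: diag_mult_vec vec_eq_iff lead_def)
qed

section \<open>Matrices with a dominant singular direction\<close>

text \<open>On the invariant subspace \<open>W\<close>, the largest singular value of \<open>X\<close> is \<open>N\<close>, with right and left singular vectors
  \<open>n\<close> and \<open>u\<close>, and the second one is at most \<open>\<eta> N\<close>. The subspace is needed because an exterior power is only an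
  invariant subspace of the tensor power.\<close>

definition dominant ::
  "(real^'m::finite) set \<Rightarrow> real^'m^'m \<Rightarrow> real \<Rightarrow> real \<Rightarrow> real^'m \<Rightarrow> real^'m \<Rightarrow> bool" where
  "dominant W X N \<eta> u n \<longleftrightarrow> subspace W \<and> (\<forall>z\<in>W. X *v z \<in> W \<and> transpose X *v z \<in> W) \<and>
     0 < N \<and> 0 \<le> \<eta> \<and> \<eta> \<le> 1 \<and> u \<in> W \<and> n \<in> W \<and> norm u = 1 \<and> norm n = 1 \<and>
     X *v n = N *\<^sub>R u \<and> transpose X *v u = N *\<^sub>R n \<and>
     (\<forall>z\<in>W. n \<bullet> z = 0 \<longrightarrow> norm (X *v z) \<le> \<eta> * N * norm z) \<and>
     (\<forall>z\<in>W. u \<bullet> z = 0 \<longrightarrow> norm (transpose X *v z) \<le> \<eta> * N * norm z)"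

lemma dominant_transpose: "dominant W X N \<eta> u n \<Longrightarrow> dominant W (transpose X) N \<eta> n u"
  by (simp add: dominant_def)

lemma inner_matrix_transpose: "x \<bullet> (A *v y) = (transpose A *v x) \<bullet> y" for A :: "real^'n^'m"
  by (simp add: transpose_matrix_vector dot_lmul_matrix)

lemma mbound_nonneg:
  fixes A :: "real^'n^'m::finite" and n :: "real^'n"
  assumes "mbound C A" "norm n = 1"
  shows "0 \<le> C"
proof -
  have "0 \<le> norm (A *v n)" by simp
  also have "\<dots> \<le> C" using mboundD[OF assms(1), of n] assms(2) by simp
  finally show ?thesis .
qed

lemma norm_split_unit:
  fixes n :: "'a::real_inner"
  assumes "norm n = 1"
  shows "(norm z)\<^sup>2 = (n \<bullet> z)\<^sup>2 + (norm (z - (n \<bullet> z) *\<^sub>R n))\<^sup>2"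
proof -
  have nn: "n \<bullet> n = 1" using assms by (simp add: norm_eq_1)
  show ?thesis unfolding power2_norm_eq_inner
    using nn by (simp add: inner_diff_left inner_diff_right inner_commute power2_eq_square)
qed

lemma norm_proj_le:
  fixes n :: "'a::real_inner"
  assumes "norm n = 1"
  shows "norm (z - (n \<bullet> z) *\<^sub>R n) \<le> norm z"
  by (rule power2_le_imp_le) (use norm_split_unit[OF assms, of z] in auto)

lemma norm_proj_minimal:
  fixes n :: "'a::real_inner"
  assumes "norm n = 1"
  shows "norm (z - (n \<bullet> z) *\<^sub>R n) \<le> norm (z - c *\<^sub>R n)"
proof -
  have "n \<bullet> n = 1" using assms by (simp add: norm_eq_1)
  then have "(z - c *\<^sub>R n) - (n \<bullet> (z - c *\<^sub>R n)) *\<^sub>R n = z - (n \<bullet> z) *\<^sub>R n"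
    by (simp add: inner_diff_right algebra_simps)
  then show ?thesis using norm_proj_le[OF assms, of "z - c *\<^sub>R n"] by (simp only:)
qed

lemma dominant_proj:
  assumes d: "dominant W X N \<eta> u n" and z: "z \<in> W"
  shows "norm (X *v z - (u \<bullet> (X *v z)) *\<^sub>R u) \<le> \<eta> * N * norm z"
    and "u \<bullet> (X *v z) = N * (n \<bullet> z)"
    and "norm (X *v z) \<le> N * norm z"
    and "N * \<bar>n \<bullet> z\<bar> \<le> norm (X *v z)"
    and "norm (X *v z) \<le> N * (\<bar>n \<bullet> z\<bar> + \<eta> * norm z)"
proof -
  note D = d[unfolded dominant_def]
  show uX: "u \<bullet> (X *v z) = N * (n \<bullet> z)" using D by (simp add: inner_matrix_transpose)
  let ?z = "z - (n \<bullet> z) *\<^sub>R n"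
  have zW: "?z \<in> W" using D z by (simp add: subspace_diff subspace_scale)
  have nz: "n \<bullet> ?z = 0" using D by (simp add: inner_diff_right norm_eq_1)
  have X: "X *v z - (u \<bullet> (X *v z)) *\<^sub>R u = X *v ?z"
    using D by (simp add: uX matrix_vector_mult_diff_distrib matrix_vector_mult_scaleR)
  have "norm (X *v ?z) \<le> \<eta> * N * norm ?z" using D zW nz by blast
  also have "\<dots> \<le> \<eta> * N * norm z" using D norm_proj_le[of n z] by (intro mult_left_mono) auto
  finally have le: "norm (X *v ?z) \<le> \<eta> * N * norm z" .
  then show "norm (X *v z - (u \<bullet> (X *v z)) *\<^sub>R u) \<le> \<eta> * N * norm z" unfolding X .
  have "(norm (X *v z))\<^sup>2 = (N * (n \<bullet> z))\<^sup>2 + (norm (X *v ?z))\<^sup>2"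
    using norm_split_unit[of u "X *v z"] D by (simp add: uX X[unfolded uX])
  also have "\<dots> \<le> (N * (n \<bullet> z))\<^sup>2 + (N * norm ?z)\<^sup>2"
  proof -
    have "norm (X *v ?z) \<le> \<eta> * N * norm ?z" using D zW nz by blast
    also have "\<dots> \<le> 1 * N * norm ?z" using D by (intro mult_right_mono) auto
    finally show ?thesis by (intro add_left_mono power_mono) auto
  qed
  also have "\<dots> = (N * norm z)\<^sup>2" using norm_split_unit[of n z] D by (simp add: power_mult_distrib distrib_left)
  finally show "norm (X *v z) \<le> N * norm z" by (rule power2_le_imp_le) (use D in auto)
  have "\<bar>u \<bullet> (X *v z)\<bar> \<le> norm u * norm (X *v z)" by (rule Cauchy_Schwarz_ineq2)
  then show "N * \<bar>n \<bullet> z\<bar> \<le> norm (X *v z)" using D by (simp add: uX abs_mult)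
  have "X *v z = (N * (n \<bullet> z)) *\<^sub>R u + X *v ?z" using X uX by (simp add: algebra_simps)
  then have "norm (X *v z) \<le> norm ((N * (n \<bullet> z)) *\<^sub>R u) + norm (X *v ?z)" by (metis norm_triangle_ineq)
  also have "\<dots> \<le> N * \<bar>n \<bullet> z\<bar> + \<eta> * N * norm z" using le D by (simp add: abs_mult)
  finally show "norm (X *v z) \<le> N * (\<bar>n \<bullet> z\<bar> + \<eta> * norm z)" by (simp add: algebra_simps)
qed

text \<open>The distance of the lines spanned by two unit vectors: dominant directions are determined up to sign only.\<close>

definition line_dist :: "'a::real_inner \<Rightarrow> 'a \<Rightarrow> real" where
  "line_dist u v = min (norm (u - v)) (norm (u + v))"

lemma line_dist_triangle: "line_dist a c \<le> line_dist a b + line_dist b c"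
proof -
  have "norm (a - c) \<le> norm (a - b) + norm (b - c)" using norm_triangle_ineq[of "a - b" "b - c"] by simp
  moreover have "norm (a + c) \<le> norm (a - b) + norm (b + c)" using norm_triangle_ineq[of "a - b" "b + c"] by simp
  moreover have "norm (a + c) \<le> norm (a + b) + norm (b - c)" using norm_triangle_ineq4[of "a + b" "b - c"] by simp
  moreover have "norm (a - c) \<le> norm (a + b) + norm (b + c)" using norm_triangle_ineq4[of "a + b" "b + c"] by simp
  ultimately show ?thesis unfolding line_dist_def by linarith
qed

lemma line_dist_le:
  assumes "norm u = 1" "norm v = 1" "norm (v - (u \<bullet> v) *\<^sub>R u) \<le> e"
  shows "line_dist u v \<le> 2 * e"
proof -
  let ?c = "u \<bullet> v"
  have "1 = norm ((v - ?c *\<^sub>R u) + ?c *\<^sub>R u)" using assms by simp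
  also have "\<dots> \<le> e + \<bar>?c\<bar>" using norm_triangle_ineq[of "v - ?c *\<^sub>R u" "?c *\<^sub>R u"] assms by simp
  finally have c: "1 - \<bar>?c\<bar> \<le> e" by simp
  have c1: "\<bar>?c\<bar> \<le> 1" using Cauchy_Schwarz_ineq2[of u v] assms by simp
  show ?thesis
  proof (cases "?c \<ge> 0")
    case True
    have "norm (u - v) = norm ((1 - ?c) *\<^sub>R u - (v - ?c *\<^sub>R u))" by (simp add: algebra_simps)
    also have "\<dots> \<le> \<bar>1 - ?c\<bar> + e" using norm_triangle_ineq4[of "(1 - ?c) *\<^sub>R u" "v - ?c *\<^sub>R u"] assms by simp
    finally show ?thesis using c c1 True by (simp add: line_dist_def)
  next
    case False
    have "norm (u + v) = norm ((1 + ?c) *\<^sub>R u + (v - ?c *\<^sub>R u))" by (simp add: algebra_simps)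
    also have "\<dots> \<le> \<bar>1 + ?c\<bar> + e" using norm_triangle_ineq[of "(1 + ?c) *\<^sub>R u" "v - ?c *\<^sub>R u"] assms by simp
    finally show ?thesis using c c1 False by (simp add: line_dist_def)
  qed
qed

lemma off_line_change:
  assumes u: "norm u = 1" "norm v = 1" and e: "norm (f - (u \<bullet> f) *\<^sub>R u) \<le> e" and d: "line_dist u v \<le> d"
  shows "norm (f - (v \<bullet> f) *\<^sub>R v) \<le> e + d * norm f"
proof -
  let ?c = "u \<bullet> f"
  have c: "\<bar>?c\<bar> \<le> norm f" using Cauchy_Schwarz_ineq2[of u f] u by simp
  have d0: "0 \<le> d" using d unfolding line_dist_def by (meson min.boundedI norm_ge_zero order_trans)
  consider "norm (u - v) \<le> d" | "norm (u + v) \<le> d" using d by (auto simp: line_dist_def min_le_iff_disj)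
  then show ?thesis
  proof cases
    case 1
    have "norm (f - (v \<bullet> f) *\<^sub>R v) \<le> norm (f - ?c *\<^sub>R v)" by (rule norm_proj_minimal[OF u(2)])
    also have "\<dots> = norm ((f - ?c *\<^sub>R u) + ?c *\<^sub>R (u - v))" by (simp add: algebra_simps)
    also have "\<dots> \<le> e + \<bar>?c\<bar> * norm (u - v)"
      using norm_triangle_ineq[of "f - ?c *\<^sub>R u" "?c *\<^sub>R (u - v)"] e by simp
    also have "\<dots> \<le> e + norm f * d" using c 1 by (intro add_left_mono mult_mono) auto
    finally show ?thesis by (simp add: mult.commute)
  next
    case 2
    have "norm (f - (v \<bullet> f) *\<^sub>R v) \<le> norm (f - (- ?c) *\<^sub>R v)" by (rule norm_proj_minimal[OF u(2)])
    also have "\<dots> = norm ((f - ?c *\<^sub>R u) + ?c *\<^sub>R (u + v))" by (simp add: algebra_simps)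
    also have "\<dots> \<le> e + \<bar>?c\<bar> * norm (u + v)"
      using norm_triangle_ineq[of "f - ?c *\<^sub>R u" "?c *\<^sub>R (u + v)"] e by simp
    also have "\<dots> \<le> e + norm f * d" using c 2 by (intro add_left_mono mult_mono) auto
    finally show ?thesis by (simp add: mult.commute)
  qed
qed

text \<open>Multiplying on the right by a matrix of bounded distortion moves the dominant left direction
  by at most the order of the gap.\<close>

lemma dominant_right_mult:
  fixes X M M' :: "real^'m::finite^'m"
  assumes X: "dominant W X N \<eta> u n" and XM: "dominant W (X ** M) N' \<eta>' u' n'"
    and M: "mbound C M" "mbound C M'" "M ** M' = mat 1"
    and W: "\<And>z. z \<in> W \<Longrightarrow> M *v z \<in> W" "\<And>z. z \<in> W \<Longrightarrow> M' *v z \<in> W"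
  shows "line_dist u u' \<le> 2 * (\<eta> * C\<^sup>2)"
proof (rule line_dist_le)
  note D = X[unfolded dominant_def] and D' = XM[unfolded dominant_def]
  show "norm u = 1" "norm u' = 1" using D D' by auto
  have C0: "0 \<le> C" using mbound_nonneg[OF M(1)] D by blast
  have "N *\<^sub>R u = (X ** M) *v (M' *v n)"
    using D M(3) by (simp add: matrix_vector_mul_assoc flip: matrix_mul_assoc)
  then have "N = norm ((X ** M) *v (M' *v n))" using D by (metis abs_of_pos norm_scaleR mult.right_neutral)
  also have "\<dots> \<le> N' * norm (M' *v n)" using dominant_proj(3)[OF XM] W(2) D by blast
  also have "\<dots> \<le> N' * C" using mboundD[OF M(2), of n] D D' by (intro mult_left_mono) auto
  finally have N: "N \<le> N' * C" .
  have "N' *\<^sub>R u' = X *v (M *v n')" using D' by (simp add: matrix_vector_mul_assoc)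
  then have "norm (N' *\<^sub>R u' - (u \<bullet> (N' *\<^sub>R u')) *\<^sub>R u) \<le> \<eta> * N * norm (M *v n')"
    using dominant_proj(1)[OF X, of "M *v n'"] W(1) D' by simp
  also have "\<dots> \<le> \<eta> * (N' * C) * C"
    using mboundD[OF M(1), of n'] D D' N C0 by (intro mult_mono mult_left_mono) auto
  finally have "norm (N' *\<^sub>R u' - (u \<bullet> (N' *\<^sub>R u')) *\<^sub>R u) \<le> N' * (\<eta> * C\<^sup>2)" by (simp add: power2_eq_square mult_ac)
  moreover have "N' *\<^sub>R u' - (u \<bullet> (N' *\<^sub>R u')) *\<^sub>R u = N' *\<^sub>R (u' - (u \<bullet> u') *\<^sub>R u)" by (simp add: algebra_simps)
  ultimately show "norm (u' - (u \<bullet> u') *\<^sub>R u) \<le> \<eta> * C\<^sup>2" using D' by simp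
qed

text \<open>Pulling the dominant left direction of \<open>Q P\<close> back by \<open>Q\<close> lands close to that of \<open>P\<close>.\<close>

lemma dominant_left_quotient:
  fixes P Q Q' :: "real^'m::finite^'m"
  assumes P: "dominant W P N \<eta> u n" and QP: "dominant W (Q ** P) N' \<eta>' u' n'"
    and Q: "mbound C Q" "mbound C Q'" "Q' ** Q = mat 1"
  shows "norm (Q' *v u' - (u \<bullet> (Q' *v u')) *\<^sub>R u) \<le> \<eta> * C\<^sup>2 * norm (Q' *v u')"
proof -
  note D = P[unfolded dominant_def] and D' = QP[unfolded dominant_def]
  define f where "f = Q' *v u'"
  have f: "N' *\<^sub>R f = P *v n'"
  proof -
    have "N' *\<^sub>R f = Q' *v ((Q ** P) *v n')" using D' by (simp add: f_def matrix_vector_mult_scaleR)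
    also have "\<dots> = (Q' ** Q) *v (P *v n')" by (simp add: matrix_vector_mul_assoc matrix_mul_assoc)
    finally show ?thesis by (simp add: Q(3))
  qed
  have QQ: "(Q ** P) *v z = Q *v (P *v z)" for z by (simp add: matrix_vector_mul_assoc)
  have C0: "0 \<le> C" using mbound_nonneg[OF Q(1)] D by blast
  have "norm (P *v n) = norm (Q' *v (Q *v (P *v n)))"
    by (simp add: matrix_vector_mul_assoc matrix_mul_assoc Q(3))
  also have "\<dots> \<le> C * norm ((Q ** P) *v n)" unfolding QQ by (rule mboundD[OF Q(2)])
  also have "\<dots> \<le> C * N'" using dominant_proj(3)[OF QP, of n] D C0 by (intro mult_left_mono) auto
  finally have N: "N \<le> C * N'" using D by simp
  have "N' = norm (Q *v (N' *\<^sub>R f))" unfolding f using D' by (simp flip: QQ)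
  also have "\<dots> \<le> C * (N' * norm f)" using mboundD[OF Q(1), of "N' *\<^sub>R f"] D' by simp
  finally have "1 \<le> C * norm f" using D' by (simp add: mult.left_commute)
  have "norm (N' *\<^sub>R f - (u \<bullet> (N' *\<^sub>R f)) *\<^sub>R u) \<le> \<eta> * N * norm n'"
    unfolding f using dominant_proj(1)[OF P] D' by blast
  also have "\<dots> \<le> \<eta> * (C * N') * 1" using N D D' by (intro mult_mono mult_left_mono) auto
  also have "\<dots> \<le> \<eta> * (C * N') * (C * norm f)"
    using \<open>1 \<le> C * norm f\<close> D D' C0 by (intro mult_left_mono) auto
  finally have "norm (N' *\<^sub>R f - (u \<bullet> (N' *\<^sub>R f)) *\<^sub>R u) \<le> N' * (\<eta> * C\<^sup>2 * norm f)"
    by (simp add: power2_eq_square mult_ac)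
  moreover have "N' *\<^sub>R f - (u \<bullet> (N' *\<^sub>R f)) *\<^sub>R u = N' *\<^sub>R (f - (u \<bullet> f) *\<^sub>R u)" by (simp add: algebra_simps)
  ultimately show ?thesis using D' by (simp add: f_def)
qed

text \<open>One step of a discrete Gronwall argument. With \<open>y\<close> the normalised pull-back of \<open>f\<close>, the vector \<open>y' - y\<close> is the
  image under the transpose of \<open>A\<close> of a vector orthogonal to \<open>f\<close>. As \<open>f\<close> is nearly parallel to the dominant left direction
  of \<open>A\<close>, this image is shorter by the factor \<open>2 e + \<eta>\<close> than the crude bound. When the errors are summable along a word,
  \<open>norm y\<close> stays bounded, and the second estimate then shows that the growth \<open>N\<close> of \<open>A\<close> is realised, up to a constant,
  by \<open>f\<close>.\<close>

lemma dominant_growth_step: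
  fixes A M :: "real^'m::finite^'m"
  assumes A: "dominant W A N \<eta> u n" and f: "f \<in> W" "f \<noteq> 0"
    and e: "norm (f - (u \<bullet> f) *\<^sub>R u) \<le> e * norm f" "e \<le> 1/2"
    and M: "mbound C M" "1 \<le> C" "norm f \<le> C * norm (M *v f)"
    and W: "\<And>z. z \<in> W \<Longrightarrow> M *v z \<in> W" "\<And>z. z \<in> W \<Longrightarrow> transpose M *v z \<in> W"
  defines "y \<equiv> (1 / (norm f)\<^sup>2) *\<^sub>R (transpose A *v f)"
  defines "y' \<equiv> (1 / (norm (M *v f))\<^sup>2) *\<^sub>R (transpose (M ** A) *v (M *v f))"
  shows "norm y' \<le> norm y * (1 + 4 * C\<^sup>2 * (2 * e + \<eta>))" "N \<le> 2 * norm f * norm y"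
proof -
  note D = A[unfolded dominant_def]
  let ?c = "u \<bullet> f" and ?g = "M *v f"
  define r where "r = f - ?c *\<^sub>R u"
  have nf: "norm f > 0" using f by simp
  have "0 \<le> e * norm f" by (rule order_trans[OF norm_ge_zero e(1)])
  then have e0: "0 \<le> e" using nf by (simp add: zero_le_mult_iff)
  have fr: "f = ?c *\<^sub>R u + r" by (simp add: r_def)
  have "norm f \<le> \<bar>?c\<bar> + norm r" using norm_triangle_ineq[of "?c *\<^sub>R u" r] D fr by simp
  moreover have "norm r \<le> norm f / 2"
    using e mult_right_mono[OF e(2), of "norm f"] by (simp add: r_def)
  ultimately have c: "norm f / 2 \<le> \<bar>?c\<bar>" by simp
  have "N * \<bar>?c\<bar> \<le> norm (transpose A *v f)"
    using dominant_proj(4)[OF dominant_transpose[OF A] f(1)] .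
  then have "N * (norm f / 2) \<le> norm (transpose A *v f)"
    using c D by (meson mult_left_mono less_imp_le order_trans)
  also have "\<dots> = (norm f)\<^sup>2 * norm y" using nf by (simp add: y_def)
  finally show Ny: "N \<le> 2 * norm f * norm y" using nf by (simp add: power2_eq_square field_simps)
  have ng: "norm ?g > 0" using M nf by (smt (verit) mult_nonneg_nonpos norm_ge_zero)
  define z where "z = (1 / (norm ?g)\<^sup>2) *\<^sub>R (transpose M *v ?g) - (1 / (norm f)\<^sup>2) *\<^sub>R f"
  have sW: "subspace W" using D by blast
  have zW: "z \<in> W" unfolding z_def by (intro subspace_diff[OF sW] subspace_scale[OF sW] W f)
  have "(transpose M *v ?g) \<bullet> f = ?g \<bullet> ?g" using inner_matrix_transpose[of ?g M f] by simp
  then have zf: "f \<bullet> z = 0"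
    using nf ng by (simp add: z_def inner_diff_right inner_commute[of f] dot_square_norm)
  have "norm z \<le> norm ((1 / (norm ?g)\<^sup>2) *\<^sub>R (transpose M *v ?g)) + norm ((1 / (norm f)\<^sup>2) *\<^sub>R f)"
    unfolding z_def by (rule norm_triangle_ineq4)
  also have "\<dots> \<le> C / norm ?g + 1 / norm f"
  proof (rule add_mono)
    have "norm (transpose M *v ?g) \<le> C * norm ?g" by (rule mboundD[OF mbound_transpose[OF M(1)]])
    then show "norm ((1 / (norm ?g)\<^sup>2) *\<^sub>R (transpose M *v ?g)) \<le> C / norm ?g"
      using ng by (simp add: power2_eq_square field_simps)
    show "norm ((1 / (norm f)\<^sup>2) *\<^sub>R f) \<le> 1 / norm f" using nf by (simp add: power2_eq_square)
  qed
  also have "\<dots> \<le> 2 * C\<^sup>2 / norm f"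
  proof -
    have "1 / norm ?g \<le> C / norm f" using M(3) nf ng by (simp add: field_simps)
    then have "C / norm ?g \<le> C\<^sup>2 / norm f" using mult_left_mono[of "1 / norm ?g" "C / norm f" C] M(2)
      by (simp add: power2_eq_square)
    moreover have "1 / norm f \<le> C\<^sup>2 / norm f" using M(2) nf by (intro divide_right_mono) auto
    ultimately show ?thesis by simp
  qed
  finally have nz: "norm z \<le> 2 * C\<^sup>2 / norm f" .
  have "?c * (u \<bullet> z) = - (r \<bullet> z)" using zf by (subst (asm) fr) (simp add: inner_add_left)
  then have "\<bar>?c\<bar> * \<bar>u \<bullet> z\<bar> = \<bar>r \<bullet> z\<bar>" by (metis abs_minus_cancel abs_mult)
  also have "\<dots> \<le> norm r * norm z" by (rule Cauchy_Schwarz_ineq2)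
  also have "\<dots> \<le> (e * norm f) * norm z" using e by (intro mult_right_mono) (auto simp: r_def)
  finally have "\<bar>?c\<bar> * \<bar>u \<bullet> z\<bar> \<le> e * norm f * norm z" .
  moreover have "norm f / 2 * \<bar>u \<bullet> z\<bar> \<le> \<bar>?c\<bar> * \<bar>u \<bullet> z\<bar>" using c by (intro mult_right_mono) auto
  ultimately have "norm f * \<bar>u \<bullet> z\<bar> \<le> norm f * (2 * e * norm z)" by (simp add: mult_ac)
  then have uz: "\<bar>u \<bullet> z\<bar> \<le> 2 * e * norm z" using nf by (simp only: mult_le_cancel_left_pos)
  have "norm (transpose A *v z) \<le> N * (\<bar>u \<bullet> z\<bar> + \<eta> * norm z)"
    using dominant_proj(5)[OF dominant_transpose[OF A] zW] .
  also have "\<dots> \<le> N * ((2 * e + \<eta>) * norm z)" using uz D by (intro mult_left_mono) (auto simp: algebra_simps)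
  also have "\<dots> \<le> N * ((2 * e + \<eta>) * (2 * C\<^sup>2 / norm f))" using nz D e0 by (intro mult_left_mono) auto
  also have "\<dots> \<le> (2 * norm f * norm y) * ((2 * e + \<eta>) * (2 * C\<^sup>2 / norm f))"
    using Ny D e0 nf by (intro mult_right_mono) auto
  also have "\<dots> = norm y * (4 * C\<^sup>2 * (2 * e + \<eta>))" using nf by (simp add: field_simps)
  finally have 1: "norm (transpose A *v z) \<le> norm y * (4 * C\<^sup>2 * (2 * e + \<eta>))" .
  have "y' = y + transpose A *v z"
    by (simp add: y'_def y_def z_def matrix_transpose_mul matrix_vector_mult_diff_distrib
        matrix_vector_mult_scaleR matrix_vector_mul_assoc matrix_mul_assoc)
  then have "norm y' \<le> norm y + norm (transpose A *v z)" by (simp add: norm_triangle_ineq)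
  then show "norm y' \<le> norm y * (1 + 4 * C\<^sup>2 * (2 * e + \<eta>))" using 1 by (simp add: algebra_simps)
qed

section \<open>Flags and orthogonal frames\<close>

lemma adapted_orthonormal_family:
  fixes F :: "nat \<Rightarrow> (real^'n::finite) set"
  assumes P: "P \<subseteq> {1..CARD('n)}" and F: "\<And>p. p \<in> P \<Longrightarrow> subspace (F p)" "\<And>p. p \<in> P \<Longrightarrow> dim (F p) = p"
    and mono: "\<And>p q. p \<in> P \<Longrightarrow> q \<in> P \<Longrightarrow> p \<le> q \<Longrightarrow> F p \<subseteq> F q"
    and k: "k \<le> CARD('n)"
  shows "\<exists>e. (\<forall>i\<in>{1..k}. norm (e i) = 1) \<and> (\<forall>i\<in>{1..k}. \<forall>j\<in>{1..k}. i \<noteq> j \<longrightarrow> e i \<bullet> e j = 0) \<and>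
    (\<forall>i\<in>{1..k}. \<forall>p\<in>P. i \<le> p \<longrightarrow> e i \<in> F p)"
  using k
proof (induction k)
  case 0 then show ?case by auto
next
  case (Suc k)
  then obtain e where e: "\<And>i. i \<in> {1..k} \<Longrightarrow> norm (e i) = 1"
    "\<And>i j. i \<in> {1..k} \<Longrightarrow> j \<in> {1..k} \<Longrightarrow> i \<noteq> j \<Longrightarrow> e i \<bullet> e j = 0"
    "\<And>i p. i \<in> {1..k} \<Longrightarrow> p \<in> P \<Longrightarrow> i \<le> p \<Longrightarrow> e i \<in> F p"
    by (metis Suc_leD)
  define Q where "Q = {p \<in> P. Suc k \<le> p}"
  define V where "V = (if Q = {} then UNIV else F (Min Q))"
  have finQ: "finite Q" using P finite_subset[of Q "{1..CARD('n)}"] by (auto simp: Q_def)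
  have minQ: "Min Q \<in> Q" if "Q \<noteq> {}" using Min_in[OF finQ that] .
  have sV: "subspace V" using F minQ by (auto simp: V_def Q_def)
  have VF: "V \<subseteq> F p" if "p \<in> P" "Suc k \<le> p" for p
  proof -
    have "p \<in> Q" using that by (simp add: Q_def)
    then have "Q \<noteq> {}" "Min Q \<le> p" using finQ by auto
    then show ?thesis using mono[of "Min Q" p] minQ that by (auto simp: V_def Q_def)
  qed
  have dV: "k < dim V"
  proof (cases "Q = {}")
    case True then show ?thesis using Suc.prems by (simp add: V_def)
  next
    case False
    then show ?thesis using minQ F(2)[of "Min Q"] by (auto simp: V_def Q_def)
  qed
  have eV: "e i \<in> V" if "i \<in> {1..k}" for i
  proof (cases "Q = {}")
    case False
    then show ?thesis using e(3)[OF that, of "Min Q"] minQ that by (auto simp: V_def Q_def)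
  qed (simp add: V_def)
  have sub: "span (e ` {1..k}) \<subseteq> V" using eV sV by (intro span_minimal) auto
  have "dim (e ` {1..k}) \<le> k"
    using dim_le_card'[of "e ` {1..k}"] card_image_le[of "{1..k}" e] by simp
  then have "span (e ` {1..k}) \<noteq> V" using dV by (metis dim_span not_le)
  then have "span (e ` {1..k}) \<subset> span V" using sub sV by (simp add: psubset_eq span_eq_iff[THEN iffD2])
  then obtain x where x: "x \<noteq> 0" "x \<in> span V" "\<And>y. y \<in> span (e ` {1..k}) \<Longrightarrow> orthogonal x y"
    using orthogonal_to_subspace_exists_gen by blast
  define v where "v = (1 / norm x) *\<^sub>R x"
  have v: "norm v = 1" "v \<in> V" using x sV by (auto simp: v_def span_eq_iff[THEN iffD2] subspace_scale)
  have ve: "e i \<bullet> v = 0" if "i \<in> {1..k}" for i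
    using x(3)[OF span_base[of "e i"]] that by (auto simp: v_def orthogonal_def inner_commute)
  define e' where "e' = e(Suc k := v)"
  have dom: "i \<in> {1..Suc k} \<longleftrightarrow> i \<in> {1..k} \<or> i = Suc k" for i by auto
  show ?case
  proof (intro exI[of _ e'] conjI ballI impI)
    fix i assume i: "i \<in> {1..Suc k}"
    show "norm (e' i) = 1" using i e(1) v by (auto simp: e'_def)
    fix p assume p: "p \<in> P" "i \<le> p"
    show "e' i \<in> F p"
    proof (cases "i = Suc k")
      case True
      then show ?thesis using VF[OF p(1)] p(2) v(2) by (auto simp: e'_def)
    next
      case False
      then show ?thesis using e(3)[of i p] i p by (auto simp: e'_def)
    qed
  next
    fix i j assume "i \<in> {1..Suc k}" "j \<in> {1..Suc k}" "i \<noteq> j"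
    then show "e' i \<bullet> e' j = 0" using e(2)[of i j] ve
      by (auto simp: dom e'_def inner_commute)
  qed
qed

lemma image_subset_std_eq:
  fixes A :: "real^'n^'n"
  assumes A: "det A \<noteq> 0" and p: "p \<le> CARD('n)" and V: "subspace V" "dim V = p"
    and sub: "\<And>x. x \<in> std p \<Longrightarrow> A *v x \<in> V"
  shows "(\<lambda>x. A *v x) ` std p = V"
  using subspace_matrix_image[OF subspace_std] V(1)
  by (rule subspace_dim_equal) (use sub V(2) dim_invertible_image[OF A] dim_std[OF p] in auto)

lemma matrix_std_sum: "x \<in> std p \<Longrightarrow> A *v x = (\<Sum>i | pos i \<le> p. x $ i *\<^sub>R column i A)"
  for A :: "real^'n^'m::finite"
proof -
  assume x: "x \<in> std p"
  have "A *v x = (\<Sum>i\<in>UNIV. x $ i *\<^sub>R column i A)"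
    by (simp add: matrix_mult_sum scalar_mult_eq_scaleR)
  also have "\<dots> = (\<Sum>i | pos i \<le> p. x $ i *\<^sub>R column i A)"
    by (rule sum.mono_neutral_right) (use x in \<open>auto simp: std_def not_le\<close>)
  finally show ?thesis .
qed

definition frame_flag :: "nat set \<Rightarrow> real^'n^'n \<Rightarrow> 'n::finite flag" where
  "frame_flag P A = (\<lambda>p\<in>P. (\<lambda>x. A *v x) ` std p)"

lemma std_mono: "p \<le> q \<Longrightarrow> std p \<subseteq> std q"
  by (auto simp: std_def)

lemma frame_flag_in_flags:
  fixes A :: "real^'n^'n"
  assumes "P \<subseteq> {1..CARD('n)}" "det A \<noteq> 0"
  shows "frame_flag P A \<in> flags P"
  unfolding flags_def
proof (intro CollectI conjI ballI impI)
  show "frame_flag P A \<in> (\<Pi>\<^sub>E p\<in>P. {V. subspace V \<and> dim V = p})"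
    using assms by (auto simp: frame_flag_def subspace_matrix_image subspace_std dim_invertible_image dim_std subset_iff)
  fix p q assume "p \<in> P" "q \<in> P" "p \<le> q"
  then show "frame_flag P A p \<subseteq> frame_flag P A q" using std_mono by (auto simp: frame_flag_def)
qed

lemma frame_flag_eqI:
  fixes A B :: "real^'n^'n"
  assumes P: "P \<subseteq> {1..CARD('n)}" and "det A \<noteq> 0" "det B \<noteq> 0"
    and "\<And>p x. p \<in> P \<Longrightarrow> x \<in> std p \<Longrightarrow> \<exists>y\<in>std p. A *v x = B *v y"
  shows "frame_flag P A = frame_flag P B"
  unfolding frame_flag_def
proof (rule restrict_ext)
  fix p assume p: "p \<in> P"
  show "(\<lambda>x. A *v x) ` std p = (\<lambda>x. B *v x) ` std p"
  proof (rule image_subset_std_eq)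
    show "A *v x \<in> (\<lambda>x. B *v x) ` std p" if "x \<in> std p" for x
      using assms(4)[OF p that] by (simp add: image_iff)
  qed (use assms p in \<open>auto simp: subspace_matrix_image subspace_std dim_invertible_image dim_std subset_iff\<close>)
qed

text \<open>Every flag is the image of the standard flag under an orthogonal matrix, obtained from an orthonormal
  basis adapted to the nested subspaces.\<close>

lemma flag_has_frame:
  fixes F :: "'n::finite flag"
  assumes P: "P \<subseteq> {1..CARD('n)}" and F: "F \<in> flags P"
  obtains Q :: "real^'n^'n" where "orthogonal_matrix Q" "F = frame_flag P Q"
proof -
  have FP: "F \<in> (\<Pi>\<^sub>E p\<in>P. {V. subspace V \<and> dim V = p})"
    and mono: "\<And>p q. p \<in> P \<Longrightarrow> q \<in> P \<Longrightarrow> p \<le> q \<Longrightarrow> F p \<subseteq> F q" using F by (auto simp: flags_def)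
  have sF: "subspace (F p)" "dim (F p) = p" if "p \<in> P" for p using FP that by (auto simp: PiE_def Pi_def)
  obtain e :: "nat \<Rightarrow> real^'n" where e: "\<And>i. i \<in> {1..CARD('n)} \<Longrightarrow> norm (e i) = 1"
    "\<And>i j. i \<in> {1..CARD('n)} \<Longrightarrow> j \<in> {1..CARD('n)} \<Longrightarrow> i \<noteq> j \<Longrightarrow> e i \<bullet> e j = 0"
    "\<And>i p. i \<in> {1..CARD('n)} \<Longrightarrow> p \<in> P \<Longrightarrow> i \<le> p \<Longrightarrow> e i \<in> F p"
    using adapted_orthonormal_family[OF P, of F, OF sF mono order_refl] by blast
  define Q :: "real^'n^'n" where "Q = (\<chi> i j. e (pos j) $ i)"
  have col: "column j Q = e (pos j)" for j by (simp add: Q_def column_def)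
  have Q: "orthogonal_matrix Q"
    unfolding orthogonal_matrix_orthonormal_columns using e by (auto simp: col orthogonal_def)
  have "F p = (\<lambda>x. Q *v x) ` std p" if p: "p \<in> P" for p
  proof (rule image_subset_std_eq[symmetric])
    fix x :: "real^'n" assume x: "x \<in> std p"
    show "Q *v x \<in> F p" unfolding matrix_std_sum[OF x] col
      by (intro subspace_sum subspace_scale sF(1)[OF p] e(3)[OF _ p]) auto
  qed (use sF p P orthogonal_det_nz[OF Q] in auto)
  then have "F = frame_flag P Q"
    using FP by (auto simp: frame_flag_def PiE_def extensional_def restrict_def fun_eq_iff)
  with Q show ?thesis by (rule that)
qed

lemma flag_act_frame: "flag_act P A (frame_flag P B) = frame_flag P (A ** B)"
  for A :: "real^'n^'n"
  by (auto simp: flag_act_def frame_flag_def restrict_def fun_eq_iff image_image matrix_vector_mul_assoc)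

section \<open>From leading minors to transversality\<close>

lemma inverse_matrix_exists:
  fixes A :: "real^'n^'n"
  assumes "det A \<noteq> 0"
  obtains A' :: "real^'n^'n" where "A ** A' = mat 1" "A' ** A = mat 1" "det A' \<noteq> 0"
proof -
  obtain A' where A': "A ** A' = mat 1" "A' ** A = mat 1"
    using assms invertible_det_nz[of A] by (auto simp: invertible_def)
  then have "det A * det A' = 1" by (metis det_I det_mul)
  then have "det A' \<noteq> 0" by auto
  with A' show ?thesis by (rule that)
qed

definition corner :: "'n set \<Rightarrow> real^'n^'n \<Rightarrow> real^'n^'n::finite" where
  "corner I A = (\<chi> i j. if i \<in> I \<and> j \<in> I then A $ i $ j else if i = j then 1 else 0)"

lemma tens_lead_id: "(tens I A *v lead I) $ id = det (corner I A) / sqrt (fact (card I))"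
proof -
  have "det (corner I A) = (\<Sum>p | p permutes UNIV. of_int (sign p) * (\<Prod>i\<in>UNIV. corner I A $ i $ p i))"
    by (simp add: det_def)
  also have "\<dots> = (\<Sum>p | p permutes I. of_int (sign p) * (\<Prod>i\<in>UNIV. corner I A $ i $ p i))"
  proof (rule sum.mono_neutral_right)
    show "{p. p permutes I} \<subseteq> {p. p permutes UNIV}" using permutes_subset[of _ I UNIV] by auto
    show "\<forall>p\<in>{p. p permutes UNIV} - {p. p permutes I}. of_int (sign p) * (\<Prod>i\<in>UNIV. corner I A $ i $ p i) = 0"
    proof
      fix p assume p: "p \<in> {p. p permutes UNIV} - {p. p permutes I}"
      then obtain i where i: "i \<notin> I" "p i \<noteq> i" by (auto simp: permutes_def)
      then have "corner I A $ i $ p i = 0" by (simp add: corner_def)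
      then have "(\<Prod>i\<in>UNIV. corner I A $ i $ p i) = 0" by (auto intro!: prod_zero)
      then show "of_int (sign p) * (\<Prod>i\<in>UNIV. corner I A $ i $ p i) = 0" by simp
    qed
  qed auto
  also have "\<dots> = (\<Sum>p | p permutes I. of_int (sign p) * (\<Prod>i\<in>UNIV. slot I A i $ i $ p i))"
  proof (rule sum.cong[OF refl])
    fix p assume p: "p \<in> {p. p permutes I}"
    then have "corner I A $ i $ p i = slot I A i $ i $ p i" for i
      using permutes_in_image[of p I i] permutes_not_in[of p I i] by (auto simp: corner_def slot_def mat_def)
    then show "of_int (sign p) * (\<Prod>i\<in>UNIV. corner I A $ i $ p i) = of_int (sign p) * (\<Prod>i\<in>UNIV. slot I A i $ i $ p i)"
      by simp
  qed
  also have "\<dots> = (\<Sum>p\<in>UNIV. if p permutes I then of_int (sign p) * (\<Prod>i\<in>UNIV. slot I A i $ i $ p i) else 0)"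
    by (simp add: sum.If_cases)
  finally have "det (corner I A) / sqrt (fact (card I)) =
    (\<Sum>p\<in>UNIV. (if p permutes I then of_int (sign p) * (\<Prod>i\<in>UNIV. slot I A i $ i $ p i) else 0) / sqrt (fact (card I)))"
    by (simp add: sum_divide_distrib)
  also have "\<dots> = (tens I A *v lead I) $ id"
    unfolding tens_def lead_def matrix_vector_mult_def vec_lambda_beta
    by (intro sum.cong refl) auto
  finally show ?thesis by simp
qed

text \<open>The matrix coefficient of the exterior power at the leading vector is the leading minor; this translates
  bounds in exterior powers into transversality of flags.\<close>

lemma lead_tens_lead: "lead I \<bullet> (tens I A *v lead I) = det (corner I A)"
  by (simp add: lead_inner[OF tens_alt[OF lead_alt]] tens_lead_id)

text \<open>A matrix preserving the coordinate subspace of \<open>I\<close> fixes the line of the leading vector.\<close>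

lemma tens_lead_eigen:
  fixes R :: "real^'n^'n::finite"
  assumes R: "\<And>i j. j \<in> I \<Longrightarrow> i \<notin> I \<Longrightarrow> R $ i $ j = 0"
  obtains c where "tens I R *v lead I = c *\<^sub>R lead I"
proof -
  let ?w = "tens I R *v lead I"
  have w: "?w \<in> alt I" by (rule tens_alt[OF lead_alt])
  have supp: "?w $ f = 0" if nf: "\<not> f permutes I" for f
  proof (rule ccontr)
    assume f: "?w $ f \<noteq> 0"
    have "f i \<in> I" if i: "i \<in> I" for i
    proof (rule ccontr)
      assume fi: "f i \<notin> I"
      have "(\<Prod>k\<in>UNIV. slot I R k $ f k $ h k) * lead I $ h = 0" for h
      proof (cases "h permutes I")
        case True
        then have "slot I R i $ f i $ h i = 0" using i fi R[of "h i" "f i"]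
          by (simp add: slot_def permutes_in_image)
        then have "(\<Prod>k\<in>UNIV. slot I R k $ f k $ h k) = 0" by (auto intro!: prod_zero)
        then show ?thesis by simp
      qed (simp add: lead_def)
      then have "?w $ f = 0" unfolding tens_def matrix_vector_mult_def vec_lambda_beta
        by (intro sum.neutral ballI)
      then show False using f by simp
    qed
    then have "f ` I \<subseteq> I" by blast
    then have "bij_betw f I I" using alt_support(1)[OF w f] by (simp add: bij_betw_def endo_inj_surj)
    then show False using nf bij_imp_permutes[of f I] alt_support(2)[OF w f] by blast
  qed
  show ?thesis
  proof (rule that[of "?w $ id * sqrt (fact (card I))"])
    show "?w = (?w $ id * sqrt (fact (card I))) *\<^sub>R lead I"
    proof (subst vec_eq_iff, intro allI)
      fix f show "?w $ f = ((?w $ id * sqrt (fact (card I))) *\<^sub>R lead I) $ f"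
        using supp[of f] alt_permutes[OF w, of f] by (cases "f permutes I") (auto simp: lead_def)
    qed
  qed
qed

lemma abs_det_le:
  fixes A :: "real^'n^'n"
  assumes "\<And>i j. \<bar>A $ i $ j\<bar> \<le> 1"
  shows "\<bar>det A\<bar> \<le> fact CARD('n)"
proof -
  have "\<bar>det A\<bar> \<le> (\<Sum>p | p permutes (UNIV::'n set). \<bar>of_int (sign p) * (\<Prod>i\<in>UNIV. A $ i $ p i)\<bar>)"
    unfolding det_def by (rule sum_abs)
  also have "\<dots> \<le> (\<Sum>p | p permutes (UNIV::'n set). 1)"
  proof (rule sum_mono)
    fix p :: "'n \<Rightarrow> 'n"
    have "\<bar>\<Prod>i\<in>UNIV. A $ i $ p i\<bar> \<le> 1" unfolding abs_prod using assms by (intro prod_le_1) auto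
    then show "\<bar>of_int (sign p) * (\<Prod>i\<in>UNIV. A $ i $ p i)\<bar> \<le> 1" by (simp add: abs_mult sign_def)
  qed
  also have "\<dots> = fact CARD('n)" by (simp add: card_permutations)
  finally show ?thesis .
qed

definition proj :: "'n set \<Rightarrow> real^'n \<Rightarrow> real^'n::finite" where
  "proj I x = (\<chi> i. if i \<in> I then x $ i else 0)"

lemma abs_det_corner_le:
  fixes Q :: "real^'n^'n"
  assumes Q: "orthogonal_matrix Q" and x: "\<And>i. i \<notin> I \<Longrightarrow> x $ i = 0"
  shows "\<bar>det (corner I Q)\<bar> * \<bar>x $ k\<bar> \<le> fact CARD('n) * norm (proj I (Q *v x))"
proof (cases "det (corner I Q) = 0")
  case False
  let ?B = "corner I Q"
  define w where "w = proj I (Q *v x)"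
  have Bx: "?B *v x = w"
  proof (subst vec_eq_iff, intro allI)
    fix i
    show "(?B *v x) $ i = w $ i"
    proof (cases "i \<in> I")
      case True
      then have "(?B *v x) $ i = (\<Sum>j\<in>UNIV. Q $ i $ j * x $ j)"
        unfolding matrix_vector_mult_def vec_lambda_beta
        by (intro sum.cong refl) (use x in \<open>auto simp: corner_def\<close>)
      then show ?thesis using True by (simp add: w_def proj_def matrix_vector_mult_def)
    next
      case False
      then have "(?B *v x) $ i = (\<Sum>j\<in>UNIV. (if i = j then 1 else 0) * x $ j)"
        by (simp add: matrix_vector_mult_def corner_def)
      also have "\<dots> = x $ i" by (simp add: if_distrib[of "\<lambda>a. a * _"] cong: if_cong)
      finally show ?thesis using False x by (simp add: w_def proj_def)
    qed
  qed
  show ?thesis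
  proof (cases "w = 0")
    case True
    then have "x = 0" using Bx False matrix_left_invertible_ker[of ?B] inverse_matrix_exists[OF False] by metis
    then show ?thesis by simp
  next
    case w0: False
    define x' where "x' = (1 / norm w) *\<^sub>R x"
    define w' where "w' = (1 / norm w) *\<^sub>R w"
    have "?B *v x' = w'" by (simp add: x'_def w'_def Bx matrix_vector_mult_scaleR)
    then have "x' = (\<chi> k. det (\<chi> i j. if j = k then w' $ i else ?B $ i $ j) / det ?B)"
      using cramer[OF False] by blast
    then have "x' $ k = det (\<chi> i j. if j = k then w' $ i else ?B $ i $ j) / det ?B"
      by (metis (no_types, lifting) vec_lambda_beta)
    then have "\<bar>det ?B\<bar> * \<bar>x' $ k\<bar> = \<bar>det (\<chi> i j. if j = k then w' $ i else ?B $ i $ j)\<bar>"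
      using False by (simp add: abs_divide)
    also have "\<dots> \<le> fact CARD('n)"
    proof (rule abs_det_le)
      fix i j
      have "\<bar>w' $ i\<bar> \<le> norm w'" by (rule component_le_norm_cart)
      also have "\<dots> = 1" using w0 by (simp add: w'_def)
      finally have "\<bar>w' $ i\<bar> \<le> 1" .
      moreover have "\<bar>?B $ i $ j\<bar> \<le> 1" using orthogonal_entry_le_1[OF Q] by (simp add: corner_def)
      ultimately show "\<bar>(\<chi> i j. if j = k then w' $ i else ?B $ i $ j) $ i $ j\<bar> \<le> 1" by simp
    qed
    finally have "\<bar>det ?B\<bar> * (\<bar>x $ k\<bar> / norm w) \<le> fact CARD('n)" by (simp add: x'_def abs_mult)
    then show ?thesis using w0 by (simp add: w_def field_simps)
  qed
qed simp

text \<open>If the leading component of the transformed wedge product is not small, then the corresponding leading minor is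
  comparable with all other minors of the first columns. By Cramer's rule the transformed subspace is then the graph of
  a linear map of controlled norm over the standard subspace.\<close>

lemma transverse_of_leading_component:
  fixes H :: "real^'n^'n"
  assumes H: "det H \<noteq> 0" and p: "p \<in> {1..CARD('n)}" and \<kappa>: "0 < \<kappa>"
    and le: "\<kappa> * norm (tens (head p) H *v lead (head p)) \<le> \<bar>lead (head p) \<bullet> (tens (head p) H *v lead (head p))\<bar>"
    and x: "x \<in> std p"
  shows "norm (H *v x) \<le> (real CARD('n) * fact CARD('n) / \<kappa>) * norm (proj (head p) (H *v x))"
proof -
  let ?I = "head p :: 'n set"
  have P: "{p} \<subseteq> {1..CARD('n)}" using p by simp
  obtain Q where Q: "orthogonal_matrix Q" "frame_flag {p} H = frame_flag {p} Q"
    using flag_has_frame[OF P frame_flag_in_flags[OF P H]] by metis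
  have HQ: "(\<lambda>x. H *v x) ` std p = (\<lambda>x. Q *v x) ` std p"
    using fun_cong[OF Q(2), of p] by (simp add: frame_flag_def)
  define R where "R = transpose Q ** H"
  have QR: "Q ** R = H" using orthogonal_matrix_transpose_mult[OF Q(1)] by (simp add: R_def matrix_mul_assoc)
  have Rz: "R $ i $ j = 0" if "j \<in> ?I" "i \<notin> ?I" for i j
  proof -
    have "axis j 1 \<in> std p" using that by (auto simp: std_eq axis_def)
    then obtain y where y: "y \<in> std p" "H *v axis j 1 = Q *v y" using HQ by blast
    then have "R *v axis j 1 = y"
      by (simp add: R_def orthogonal_cancel[OF Q(1)] flip: matrix_vector_mul_assoc)
    then have "R $ i $ j = y $ i" by (simp add: matrix_vector_mul_component matrix_vector_mult_basis column_def vec_eq_iff)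
    then show ?thesis using y(1) that by (simp add: std_eq)
  qed
  obtain c where c: "tens ?I R *v lead ?I = c *\<^sub>R lead ?I" using tens_lead_eigen[of ?I R] Rz by blast
  have T: "tens ?I H *v lead ?I = c *\<^sub>R (tens ?I Q *v lead ?I)"
    unfolding QR[symmetric] tens_mult by (simp add: c matrix_vector_mult_scaleR flip: matrix_vector_mul_assoc)
  have "c \<noteq> 0"
  proof
    assume "c = 0"
    obtain H' where H': "H' ** H = mat 1" using inverse_matrix_exists[OF H] by blast
    have "lead ?I = tens ?I H' *v (tens ?I H *v lead ?I)"
      by (simp add: matrix_vector_mul_assoc H' tens_1 flip: tens_mult)
    also have "\<dots> = 0" unfolding T \<open>c = 0\<close> by simp
    finally show False using norm_lead[of ?I] by simp
  qed
  then have \<kappa>': "\<kappa> \<le> \<bar>det (corner ?I Q)\<bar>"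
    using le unfolding T
    by (simp add: orthogonal_matrix_norm[OF tens_orthogonal[OF Q(1)]] lead_tens_lead abs_mult mult.commute[of \<kappa>])
  obtain y where y: "y \<in> std p" "H *v x = Q *v y" using HQ x by blast
  have "\<kappa> * \<bar>y $ k\<bar> \<le> fact CARD('n) * norm (proj ?I (Q *v y))" for k
  proof -
    have "\<kappa> * \<bar>y $ k\<bar> \<le> \<bar>det (corner ?I Q)\<bar> * \<bar>y $ k\<bar>" by (intro mult_right_mono \<kappa>') simp
    also have "\<dots> \<le> fact CARD('n) * norm (proj ?I (Q *v y))"
      using y(1) by (intro abs_det_corner_le[OF Q(1)]) (auto simp: std_eq)
    finally show ?thesis .
  qed
  then have yk: "\<bar>y $ k\<bar> \<le> fact CARD('n) * norm (proj ?I (Q *v y)) / \<kappa>" for k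
    using \<kappa> by (simp add: field_simps)
  have "norm (H *v x) = norm y" using y(2) orthogonal_matrix_norm[OF Q(1)] by simp
  also have "\<dots> \<le> (\<Sum>k\<in>UNIV. \<bar>y $ k\<bar>)" by (rule norm_le_l1_cart)
  also have "\<dots> \<le> (\<Sum>k\<in>(UNIV::'n set). fact CARD('n) * norm (proj ?I (Q *v y)) / \<kappa>)"
    by (intro sum_mono yk)
  finally show ?thesis using y(2) by (simp add: mult_ac)
qed

section \<open>Dominance in exterior powers\<close>

text \<open>A singular value gap of \<open>A\<close> at \<open>p\<close> becomes a gap after the first singular value in the exterior power of degree \<open>p\<close>,
  which reduces all questions about the position \<open>p\<close> to dominant directions.\<close>

lemma dominant_tens:
  fixes A :: "real^'n^'n"
  assumes A: "det A \<noteq> 0" and p: "1 \<le> p" "p < CARD('n)"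
  defines "I \<equiv> head p :: 'n set"
  shows "dominant (alt I) (tens I A) (prod (sv A) I) (sv A (ix (Suc p)) / sv A (ix p))
     (tens I (svK A) *v lead I) (tens I (transpose (svL A)) *v lead I)"
proof -
  let ?K = "svK A" and ?L = "svL A" and ?s = "sv A"
  define D where "D = diag (\<lambda>f. \<Prod>i\<in>I. ?s (f i))"
  define a b where "a = ?s (ix p)" and "b = ?s (ix (Suc p))"
  note K = orthogonal_svK[OF A] and L = orthogonal_svL[OF A]
  have pp: "pos (ix p :: 'n) = p" "pos (ix (Suc p) :: 'n) = Suc p" using p by auto
  have ab: "0 < b" "b \<le> a" unfolding a_def b_def using sv_pos[OF A] sv_antimono[OF A, of "ix p" "ix (Suc p)"] by (auto simp: pp)
  have sI: "a \<le> ?s i" if "i \<in> I" for i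
    unfolding a_def by (rule sv_antimono[OF A]) (use that in \<open>simp add: pp I_def head_def\<close>)
  have snI: "?s i \<le> b" if "i \<notin> I" for i
    unfolding b_def by (rule sv_antimono[OF A]) (use that in \<open>simp add: pp I_def head_def\<close>)
  have N: "0 < prod ?s I" by (rule prod_pos) (simp add: sv_pos[OF A])
  have T: "tens I A = tens I ?K ** D ** tens I ?L"
    by (subst svd_eq[OF A]) (simp add: tens_mult tens_diag D_def)
  have Tt: "transpose (tens I A) = tens I (transpose ?L) ** D ** tens I (transpose ?K)"
    unfolding T by (simp add: matrix_transpose_mul tens_transpose D_def matrix_mul_assoc)
  have cancel: "tens I Q *v (tens I (transpose Q) *v z) = z" "tens I (transpose Q) *v (tens I Q *v z) = z"
    if "orthogonal_matrix Q" for Q z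
    using orthogonal_matrix_transpose_mult[OF that] by (simp_all add: matrix_vector_mul_assoc tens_1 flip: tens_mult)
  have DL: "D *v lead I = prod ?s I *\<^sub>R lead I" unfolding D_def by (rule diag_lead)
  have bound: "norm (tens I Q *v (D *v (tens I R *v z))) \<le> b / a * prod ?s I * norm z"
    if Q: "orthogonal_matrix Q" and R: "orthogonal_matrix R" and z: "z \<in> alt I"
      and o: "(tens I (transpose R) *v lead I) \<bullet> z = 0" for Q R z
  proof -
    let ?z = "tens I R *v z"
    have lz: "lead I \<bullet> ?z = 0" using o by (simp add: inner_matrix_transpose tens_transpose)
    have "norm (tens I Q *v (D *v ?z)) = norm (D *v ?z)" by (rule orthogonal_matrix_norm[OF tens_orthogonal[OF Q]])
    also have "\<dots> \<le> prod ?s I * (\<bar>lead I \<bullet> ?z\<bar> + (b / a) * norm ?z)"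
      unfolding D_def by (rule diag_alt_norm_le[OF tens_alt[OF z] sv_pos[OF A] sI snI ab])
    also have "norm ?z = norm z" by (rule orthogonal_matrix_norm[OF tens_orthogonal[OF R]])
    finally show ?thesis using lz by (simp add: mult_ac)
  qed
  show ?thesis
    unfolding dominant_def a_def[symmetric] b_def[symmetric]
  proof (intro conjI ballI impI)
    show "tens I A *v (tens I (transpose ?L) *v lead I) = prod ?s I *\<^sub>R (tens I ?K *v lead I)"
      by (simp add: T cancel[OF L] DL matrix_vector_mult_scaleR flip: matrix_vector_mul_assoc)
    show "transpose (tens I A) *v (tens I ?K *v lead I) = prod ?s I *\<^sub>R (tens I (transpose ?L) *v lead I)"
      by (simp add: Tt cancel[OF K] DL matrix_vector_mult_scaleR flip: matrix_vector_mul_assoc)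
    fix z assume z: "z \<in> alt I"
    show "tens I A *v z \<in> alt I" "transpose (tens I A) *v z \<in> alt I"
      using z by (auto simp: tens_alt simp flip: tens_transpose)
    show "norm (tens I A *v z) \<le> b / a * prod ?s I * norm z" if "(tens I (transpose ?L) *v lead I) \<bullet> z = 0"
      using bound[OF K L z that] by (simp add: T matrix_vector_mul_assoc matrix_mul_assoc)
    show "norm (transpose (tens I A) *v z) \<le> b / a * prod ?s I * norm z" if "(tens I ?K *v lead I) \<bullet> z = 0"
      using bound[OF orthogonal_transpose[OF L] orthogonal_transpose[OF K] z] that
      by (simp add: Tt matrix_vector_mul_assoc matrix_mul_assoc)
  qed (use ab N in \<open>auto simp: subspace_alt tens_alt lead_alt orthogonal_matrix_norm[OF tens_orthogonal[OF K]]
      orthogonal_matrix_norm[OF tens_orthogonal[OF orthogonal_transpose[OF L]]]\<close>)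
qed

section \<open>Words and word length\<close>

text \<open>Hyperbolicity is not part of these assumptions: the gap condition in terms of the word length already carries
  the geometry.\<close>

locale anosov_rep =
  fixes G :: "('g, 'm) monoid_scheme" and S :: "'g set" and P :: "nat set"
    and \<rho> :: "'g \<Rightarrow> real^'n^'n::finite"
  assumes group: "group G"
    and gens: "symmetric_generating_set G S"
    and infinite_carrier: "infinite (carrier G)"
    and P_range: "P \<subseteq> {1..CARD('n) - 1}" and P_nonempty: "P \<noteq> {}"
    and hom: "\<rho> \<in> hom G SL_group"
    and anosov: "anosov G S P \<rho>"
begin

sublocale group G by (rule group)

definition gprod :: "'g list \<Rightarrow> 'g" where
  "gprod ws = foldr (\<lambda>s y. s \<otimes>\<^bsub>G\<^esub> y) ws \<one>\<^bsub>G\<^esub>"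

abbreviation wl :: "'g \<Rightarrow> nat" where "wl \<equiv> word_length G S"

definition geodesic :: "'g list \<Rightarrow> bool" where
  "geodesic ws \<longleftrightarrow> set ws \<subseteq> S \<and> wl (gprod ws) = length ws"

lemma S_facts: "finite S" "S \<subseteq> carrier G" "s \<in> S \<Longrightarrow> inv\<^bsub>G\<^esub> s \<in> S" "generate G S = carrier G"
  using gens by (auto simp: symmetric_generating_set_def)

lemma gprod_simps [simp]: "gprod [] = \<one>\<^bsub>G\<^esub>" "gprod (s # ws) = s \<otimes>\<^bsub>G\<^esub> gprod ws"
  by (simp_all add: gprod_def)

lemma gprod_closed: "set ws \<subseteq> S \<Longrightarrow> gprod ws \<in> carrier G"
  using S_facts(2) by (induction ws) auto

lemma gprod_append: "set xs \<subseteq> S \<Longrightarrow> set ys \<subseteq> S \<Longrightarrow> gprod (xs @ ys) = gprod xs \<otimes>\<^bsub>G\<^esub> gprod ys"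
  using S_facts(2) by (induction xs) (auto simp: gprod_closed m_assoc subset_iff)

lemma word_exists: "x \<in> carrier G \<Longrightarrow> \<exists>ws. set ws \<subseteq> S \<and> gprod ws = x"
proof -
  assume "x \<in> carrier G"
  then have "x \<in> generate G S" using S_facts by simp
  then show ?thesis
  proof induction
    case one then show ?case by (auto intro!: exI[of _ "[]"])
  next
    case (incl h) then show ?case using S_facts(2) by (auto intro!: exI[of _ "[h]"])
  next
    case (inv h) then show ?case using S_facts by (auto intro!: exI[of _ "[inv\<^bsub>G\<^esub> h]"])
  next
    case (eng h1 h2)
    then obtain a b where "set a \<subseteq> S" "gprod a = h1" "set b \<subseteq> S" "gprod b = h2" by blast
    then show ?case by (intro exI[of _ "a @ b"]) (auto simp: gprod_append)
  qed
qed

lemma wl_le: "set ws \<subseteq> S \<Longrightarrow> wl (gprod ws) \<le> length ws"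
  unfolding word_length_def gprod_def by (rule Least_le) blast

lemma geodesic_exists: "x \<in> carrier G \<Longrightarrow> \<exists>ws. geodesic ws \<and> gprod ws = x"
proof -
  assume "x \<in> carrier G"
  then have "\<exists>n ws. set ws \<subseteq> S \<and> length ws = n \<and> foldr (\<lambda>s y. s \<otimes>\<^bsub>G\<^esub> y) ws \<one>\<^bsub>G\<^esub> = x"
    using word_exists by (auto simp: gprod_def)
  from LeastI_ex[OF this] show ?thesis
    unfolding geodesic_def gprod_def[symmetric] word_length_def by auto
qed

lemma wl_mult_le:
  assumes "x \<in> carrier G" "y \<in> carrier G"
  shows "wl (x \<otimes>\<^bsub>G\<^esub> y) \<le> wl x + wl y"
proof -
  obtain a b where "geodesic a" "gprod a = x" "geodesic b" "gprod b = y" using assms geodesic_exists by metis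
  then show ?thesis using wl_le[of "a @ b"] by (auto simp: geodesic_def gprod_append)
qed

lemma geodesic_append:
  assumes "geodesic (xs @ ys)"
  shows "geodesic xs" "geodesic ys"
proof -
  have s: "set xs \<subseteq> S" "set ys \<subseteq> S" using assms by (auto simp: geodesic_def)
  have "length xs + length ys \<le> wl (gprod xs) + wl (gprod ys)"
    using assms s wl_mult_le[OF gprod_closed gprod_closed, of xs ys] by (simp add: geodesic_def gprod_append)
  then show "geodesic xs" "geodesic ys" using s wl_le[OF s(1)] wl_le[OF s(2)] by (auto simp: geodesic_def)
qed

lemma rho_det: "x \<in> carrier G \<Longrightarrow> det (\<rho> x) = 1"
  using hom by (auto simp: hom_def SL_group_def)

lemma rho_det_nz: "x \<in> carrier G \<Longrightarrow> det (\<rho> x) \<noteq> 0"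
  by (simp add: rho_det)

lemma rho_mult: "x \<in> carrier G \<Longrightarrow> y \<in> carrier G \<Longrightarrow> \<rho> (x \<otimes>\<^bsub>G\<^esub> y) = \<rho> x ** \<rho> y"
  using hom by (auto simp: hom_def SL_group_def)

lemma rho_one: "\<rho> \<one>\<^bsub>G\<^esub> = mat 1"
proof -
  have e: "\<rho> \<one>\<^bsub>G\<^esub> = \<rho> \<one>\<^bsub>G\<^esub> ** \<rho> \<one>\<^bsub>G\<^esub>" using rho_mult[of "\<one>\<^bsub>G\<^esub>" "\<one>\<^bsub>G\<^esub>"] by simp
  obtain B where B: "B ** \<rho> \<one>\<^bsub>G\<^esub> = mat 1" using inverse_matrix_exists[OF rho_det_nz[OF one_closed]] by blast
  have "B ** \<rho> \<one>\<^bsub>G\<^esub> = (B ** \<rho> \<one>\<^bsub>G\<^esub>) ** \<rho> \<one>\<^bsub>G\<^esub>" by (subst e) (simp add: matrix_mul_assoc)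
  then show ?thesis using B by simp
qed

lemma rho_inv: "x \<in> carrier G \<Longrightarrow> \<rho> (inv\<^bsub>G\<^esub> x) ** \<rho> x = mat 1" "x \<in> carrier G \<Longrightarrow> \<rho> x ** \<rho> (inv\<^bsub>G\<^esub> x) = mat 1"
  by (simp_all add: rho_one flip: rho_mult)

lemma wl_inv_le: "x \<in> carrier G \<Longrightarrow> wl (inv\<^bsub>G\<^esub> x) \<le> wl x"
proof -
  assume x: "x \<in> carrier G"
  have *: "set ws \<subseteq> S \<Longrightarrow> gprod (rev (map (\<lambda>s. inv\<^bsub>G\<^esub> s) ws)) = inv\<^bsub>G\<^esub> (gprod ws)" for ws
  proof (induction ws)
    case (Cons s ws)
    then have s: "s \<in> S" "set ws \<subseteq> S" by auto
    then have "set (rev (map (\<lambda>s. inv\<^bsub>G\<^esub> s) ws)) \<subseteq> S" "set [inv\<^bsub>G\<^esub> s] \<subseteq> S" using S_facts(3) by auto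
    then show ?case using Cons s S_facts(2) gprod_closed[of ws]
      by (auto simp: gprod_append inv_mult_group)
  qed simp
  obtain ws where ws: "geodesic ws" "gprod ws = x" using geodesic_exists[OF x] by blast
  then have "set (rev (map (\<lambda>s. inv\<^bsub>G\<^esub> s) ws)) \<subseteq> S" using S_facts(3) by (auto simp: geodesic_def)
  from wl_le[OF this] show ?thesis using * ws by (simp add: geodesic_def)
qed

lemma finite_P: "finite P" using P_range finite_subset by blast

lemma P_bounds: "p \<in> P \<Longrightarrow> 1 \<le> p \<and> p < CARD('n)"
  using P_range zero_less_card_finite[where 'a='n] by fastforce

text \<open>Finitely many generators distort by a bounded factor, hence a word distorts at most exponentially in its length.\<close>

lemma uniform_bound:
  "\<exists>C\<ge>1. \<forall>x\<in>carrier G. mbound (C ^ wl x) (\<rho> x) \<and> (\<forall>p\<in>P. mbound (C ^ wl x) (tens (head p) (\<rho> x)))"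
proof -
  have "\<forall>s. \<exists>c\<ge>1. mbound c (\<rho> s)" using mbound_exists by blast
  then obtain c where c: "\<And>s. c s \<ge> 1" "\<And>s. mbound (c s) (\<rho> s)" by metis
  have "\<forall>s p. \<exists>e\<ge>1. mbound e (tens (head p) (\<rho> s))" using mbound_exists by blast
  then obtain e where e: "\<And>s p. e s p \<ge> 1" "\<And>s p. mbound (e s p) (tens (head p) (\<rho> s))" by metis
  define C where "C = 1 + (\<Sum>s\<in>S. c s + (\<Sum>p\<in>P. e s p))"
  have e0: "0 \<le> c s" "0 \<le> e s p" for s p using c(1)[of s] e(1)[of s p] by auto
  have nn: "0 \<le> c s + (\<Sum>p\<in>P. e s p)" for s
    using e0 by (intro add_nonneg_nonneg sum_nonneg)
  have C1: "C \<ge> 1" unfolding C_def using nn by (simp add: sum_nonneg)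
  have *: "c s + (\<Sum>p\<in>P. e s p) \<le> C" if "s \<in> S" for s
    unfolding C_def using member_le_sum[OF that, of "\<lambda>s. c s + (\<Sum>p\<in>P. e s p)"] nn S_facts(1) by auto
  have bs: "mbound C (\<rho> s)" if "s \<in> S" for s
  proof (rule mbound_mono[OF c(2)])
    show "c s \<le> C" using *[OF that] sum_nonneg[of P "e s"] e0 by force
  qed
  have bt: "mbound C (tens (head p) (\<rho> s))" if "s \<in> S" "p \<in> P" for s p
  proof (rule mbound_mono[OF e(2)])
    have "e s p \<le> (\<Sum>p\<in>P. e s p)" using member_le_sum[OF that(2), of "e s"] e0 finite_P by auto
    then show "e s p \<le> C" using *[OF that(1)] e0(1)[of s] by linarith
  qed
  have "mbound (C ^ length ws) (\<rho> (gprod ws)) \<and> (\<forall>p\<in>P. mbound (C ^ length ws) (tens (head p) (\<rho> (gprod ws))))"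
    if "set ws \<subseteq> S" for ws
    using that
  proof (induction ws)
    case Nil
    then show ?case by (simp add: rho_one tens_1 mbound_def)
  next
    case (Cons s ws)
    then have s: "s \<in> S" "s \<in> carrier G" "gprod ws \<in> carrier G" using S_facts(2) gprod_closed by auto
    have "mbound (C * C ^ length ws) (\<rho> s ** \<rho> (gprod ws))"
      using Cons C1 by (intro mbound_mult bs s) auto
    moreover have "mbound (C * C ^ length ws) (tens (head p) (\<rho> s) ** tens (head p) (\<rho> (gprod ws)))" if "p \<in> P" for p
      using Cons C1 that by (intro mbound_mult bt s) auto
    ultimately show ?case by (simp add: rho_mult s tens_mult)
  qed
  then have "\<forall>x\<in>carrier G. mbound (C ^ wl x) (\<rho> x) \<and> (\<forall>p\<in>P. mbound (C ^ wl x) (tens (head p) (\<rho> x)))"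
    using geodesic_exists by (metis geodesic_def)
  with C1 show ?thesis by blast
qed

definition gap :: "nat \<Rightarrow> 'g \<Rightarrow> real" where
  "gap p x = sv (\<rho> x) (ix (Suc p)) / sv (\<rho> x) (ix p)"

lemma gap_decay: "\<exists>c>(0::real). \<forall>x\<in>carrier G. \<forall>p\<in>P. gap p x \<le> exp (- c * real (wl x)) / c"
proof -
  obtain c where c: "c > 0" "\<And>x p. x \<in> carrier G \<Longrightarrow> p \<in> P \<Longrightarrow>
    c * exp (c * real (wl x)) < singular_value (\<rho> x) p / singular_value (\<rho> x) (p + 1)"
    using anosov unfolding anosov_def by blast
  have *: "gap p x \<le> exp (- c * real (wl x)) / c" if xp: "x \<in> carrier G" "p \<in> P" for x p
  proof -
    have g: "gap p x = singular_value (\<rho> x) (p + 1) / singular_value (\<rho> x) p"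
      using P_bounds[OF xp(2)] by (simp add: gap_def sv_def)
    have "gap p x > 0" unfolding gap_def using sv_pos[OF rho_det_nz[OF xp(1)]] by simp
    then have "c * exp (c * real (wl x)) < 1 / gap p x" using c(2)[OF xp] by (simp add: g)
    then have "gap p x * (c * exp (c * real (wl x))) \<le> 1" using \<open>gap p x > 0\<close> by (simp add: field_simps)
    then show ?thesis using c(1) by (simp add: exp_minus field_simps)
  qed
  show ?thesis by (intro exI[of _ c] conjI ballI c(1) *)
qed

lemma gap_nonneg: "x \<in> carrier G \<Longrightarrow> 0 \<le> gap p x"
  unfolding gap_def using sv_pos[OF rho_det_nz] by (simp add: less_imp_le)

end

section \<open>Uniform transversality along geodesics\<close>

lemma exp_eventually_small:
  fixes A b c :: real
  assumes "c > 0" "b > 0"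
  obtains J :: nat where "\<And>l. J \<le> l \<Longrightarrow> A * exp (- c * real l) \<le> b"
proof -
  have "(\<lambda>n. A * (exp (- c)) ^ n) \<longlonglongrightarrow> 0"
    by (intro tendsto_mult_right_zero LIMSEQ_realpow_zero) (use assms in auto)
  then have "eventually (\<lambda>n. A * (exp (- c)) ^ n < b) sequentially"
    using assms by (simp add: order_tendstoD(2))
  then obtain J where J: "\<And>n. J \<le> n \<Longrightarrow> A * (exp (- c)) ^ n < b" by (auto simp: eventually_sequentially)
  show ?thesis
  proof (rule that)
    fix l assume "J \<le> l"
    then show "A * exp (- c * real l) \<le> b"
      using J[of l] by (simp add: exp_of_nat_mult[symmetric] mult.commute)
  qed
qed

lemma geometric_sum_le:
  fixes r :: real
  assumes "0 \<le> r" "r < 1"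
  shows "(\<Sum>i<n. r ^ i) \<le> 1 / (1 - r)"
proof -
  have "(\<Sum>i<n. r ^ i) = (1 - r ^ n) / (1 - r)" using assms by (simp add: sum_gp_strict)
  also have "\<dots> \<le> 1 / (1 - r)" using assms by (intro divide_right_mono) auto
  finally show ?thesis .
qed

lemma line_dist_commute: "line_dist u v = line_dist v u"
  by (simp add: line_dist_def norm_minus_commute add.commute)

context anosov_rep
begin

text \<open>The heart of the proof. Let \<open>xs @ ys\<close> be a geodesic word with \<open>ys\<close> very long, and let \<open>e\<close> be the dominant direction that
  the singular basis of the whole word determines after translating back by \<open>xs\<close>, in the exterior power of degree \<open>p\<close>.
  The letters of \<open>xs\<close> are applied to \<open>e\<close> one after the other, starting with the last one. After \<open>j\<close> letters the
  image of \<open>e\<close> is close to the dominant left direction of the last \<open>j\<close> letters, with an error that decays exponentially in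
  \<open>j\<close>, because subwords of geodesic words are geodesic and the gap is exponential in the word length. The errors are
  therefore summable with a bound independent of the word, and \<open>dominant_growth_step\<close> shows that \<open>xs\<close> stretches \<open>e\<close> by at
  least a fixed proportion of its norm. A vector that is stretched so much has a component of definite size along the
  dominant right direction.\<close>

lemma leading_component_bound:
  assumes p: "p \<in> P"
  shows "\<exists>\<kappa>>0. \<exists>J. \<forall>l\<ge>J. \<exists>m0. \<forall>xs ys. geodesic (xs @ ys) \<and> length xs = l \<and> m0 \<le> length ys \<longrightarrow>
    (let H = svL (\<rho> (gprod xs)) ** \<rho> (inv\<^bsub>G\<^esub> (gprod xs)) ** svK (\<rho> (gprod (xs @ ys)));
         w = tens (head p) H *v lead (head p)
     in \<kappa> * norm w \<le> \<bar>lead (head p) \<bullet> w\<bar>)"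
proof -
  let ?I = "head p :: 'n set"
  define X where "X w = tens ?I (\<rho> (gprod w))" for w
  define u where "u w = tens ?I (svK (\<rho> (gprod w))) *v lead ?I" for w
  define n where "n w = tens ?I (transpose (svL (\<rho> (gprod w)))) *v lead ?I" for w
  define N where "N w = prod (sv (\<rho> (gprod w))) ?I" for w
  define \<eta> where "\<eta> w = gap p (gprod w)" for w
  obtain C where C: "C \<ge> 1" "\<And>x. x \<in> carrier G \<Longrightarrow> mbound (C ^ wl x) (tens ?I (\<rho> x))"
    using uniform_bound p by blast
  obtain c where c: "c > 0" "\<And>x. x \<in> carrier G \<Longrightarrow> gap p x \<le> exp (- c * real (wl x)) / c"
    using gap_decay p by blast
  define r where "r = exp (- c)"
  have r: "0 < r" "r < 1" using c by (auto simp: r_def)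
  have rpow: "exp (- c * real k) = r ^ k" for k
    by (simp add: r_def exp_of_nat_mult[symmetric] mult.commute)
  have geoS: "set w \<subseteq> S" "gprod w \<in> carrier G" "wl (gprod w) = length w" if "geodesic w" for w
    using that gprod_closed by (auto simp: geodesic_def)
  have dom: "dominant (alt ?I) (X w) (N w) (\<eta> w) (u w) (n w)" if "geodesic w" for w
    unfolding X_def N_def \<eta>_def u_def n_def gap_def
    using P_bounds[OF p] geoS(2)[OF that] by (intro dominant_tens rho_det_nz) auto
  have \<eta>le: "\<eta> w \<le> r ^ length w / c" if "geodesic w" for w
    using c(2)[OF geoS(2)[OF that]] geoS(3)[OF that] rpow by (simp add: \<eta>_def)
  have Xapp: "X (a @ b) = X a ** X b" if "set a \<subseteq> S" "set b \<subseteq> S" for a b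
    using that by (simp add: X_def gprod_append rho_mult gprod_closed tens_mult)
  have XC: "mbound (C ^ length w) (X w)" if "set w \<subseteq> S" for w
    unfolding X_def using C wl_le[OF that] gprod_closed[OF that] by (meson mbound_mono power_increasing)
  define X' where "X' w = tens ?I (\<rho> (inv\<^bsub>G\<^esub> (gprod w)))" for w
  have X'C: "mbound (C ^ length w) (X' w)" if "set w \<subseteq> S" for w
  proof -
    have "wl (inv\<^bsub>G\<^esub> (gprod w)) \<le> length w"
      using wl_inv_le[OF gprod_closed[OF that]] wl_le[OF that] by linarith
    then show ?thesis unfolding X'_def using C gprod_closed[OF that] by (meson inv_closed mbound_mono power_increasing)
  qed
  have X'X: "X w ** X' w = mat 1" "X' w ** X w = mat 1" if "set w \<subseteq> S" for w
    using rho_inv[OF gprod_closed[OF that]] by (simp_all add: X_def X'_def tens_1 flip: tens_mult)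
  have Xalt: "z \<in> alt ?I \<Longrightarrow> X w *v z \<in> alt ?I" "z \<in> alt ?I \<Longrightarrow> X' w *v z \<in> alt ?I"
    "z \<in> alt ?I \<Longrightarrow> transpose (X w) *v z \<in> alt ?I" for z w
    by (auto simp: X_def X'_def tens_alt simp flip: tens_transpose)
  define D where "D = 2 * C\<^sup>2 / (c * (1 - r))"
  have D0: "D \<ge> 0" unfolding D_def using C c r by simp
  have prefix: "line_dist (u a) (u (a @ b)) \<le> D * r ^ length a" if "geodesic (a @ b)" for a b
  proof -
    have "geodesic (a @ b) \<Longrightarrow> line_dist (u a) (u (a @ b)) \<le> 2 * C\<^sup>2 / c * r ^ length a * (\<Sum>i<length b. r ^ i)"
    proof (induction b rule: rev_induct)
      case Nil
      then show ?case by (simp add: line_dist_def)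
    next
      case (snoc s b)
      have g: "geodesic (a @ b)" "geodesic ((a @ b) @ [s])" using snoc.prems geodesic_append[of "a @ b" "[s]"] by auto
      have s: "set [s] \<subseteq> S" "set (a @ b) \<subseteq> S" using geoS(1)[OF g(2)] by auto
      have "line_dist (u (a @ b)) (u ((a @ b) @ [s])) \<le> 2 * (\<eta> (a @ b) * C\<^sup>2)"
      proof (rule dominant_right_mult[OF dom[OF g(1)]])
        show "dominant (alt ?I) (X (a @ b) ** X [s]) (N ((a @ b) @ [s])) (\<eta> ((a @ b) @ [s])) (u ((a @ b) @ [s])) (n ((a @ b) @ [s]))"
          using dom[OF g(2)] Xapp[OF s(2,1)] by simp
        show "mbound C (X [s])" "mbound C (X' [s])" using XC[OF s(1)] X'C[OF s(1)] by simp_all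
        show "X [s] ** X' [s] = mat 1" by (rule X'X(1)[OF s(1)])
      qed (rule Xalt, assumption)+
      also have "\<dots> \<le> 2 * (r ^ length (a @ b) / c * C\<^sup>2)" by (intro mult_left_mono mult_right_mono \<eta>le g) auto
      finally have "line_dist (u a) (u ((a @ b) @ [s])) \<le>
          2 * C\<^sup>2 / c * r ^ length a * (\<Sum>i<length b. r ^ i) + 2 * (r ^ length (a @ b) / c * C\<^sup>2)"
        using snoc.IH[OF g(1)] line_dist_triangle[of "u a" "u ((a @ b) @ [s])" "u (a @ b)"] by linarith
      then show ?case by (simp add: power_add algebra_simps add_divide_distrib)
    qed
    from this[OF that] have "line_dist (u a) (u (a @ b)) \<le> 2 * C\<^sup>2 / c * r ^ length a * (\<Sum>i<length b. r ^ i)" .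
    also have "\<dots> \<le> 2 * C\<^sup>2 / c * r ^ length a * (1 / (1 - r))"
      using C c r by (intro mult_left_mono geometric_sum_le) auto
    finally show ?thesis by (simp add: D_def)
  qed
  obtain j0 where j0: "\<And>j. j0 \<le> j \<Longrightarrow> (D + 1) * exp (- c * real j) \<le> 1/2"
    using exp_eventually_small[OF c(1), of "1/2" "D + 1"] by auto
  define B where "B = 4 * C\<^sup>2 * (2 * (D + 1) + 1 / c)"
  have B0: "B \<ge> 0" unfolding B_def using D0 c C by simp
  define E where "E = B * (1 / (1 - r))"
  define \<theta> where "\<theta> = 1 / (2 * C ^ (2 * j0) * exp E)"
  have \<theta>: "\<theta> > 0" unfolding \<theta>_def using C by simp
  obtain J1 where J1: "\<And>l. J1 \<le> l \<Longrightarrow> (1 / c) * exp (- c * real l) \<le> \<theta> / 2"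
    using exp_eventually_small[OF c(1), of "\<theta>/2" "1/c"] \<theta> by auto
  have \<theta>2: "\<theta> / 2 > 0" using \<theta> by simp
  show ?thesis
  proof (rule exI[of _ "\<theta> / 2"], rule conjI[OF \<theta>2], rule exI[of _ "max j0 J1"], intro allI impI)
    fix l assume l: "max j0 J1 \<le> l"
    obtain m0 where m0: "\<And>m. m0 \<le> m \<Longrightarrow> (C ^ l)\<^sup>2 / c * exp (- c * real m) \<le> 1"
      using exp_eventually_small[OF c(1), of 1 "(C ^ l)\<^sup>2 / c"] by auto
    show "\<exists>m0. \<forall>xs ys. geodesic (xs @ ys) \<and> length xs = l \<and> m0 \<le> length ys \<longrightarrow>
      (let H = svL (\<rho> (gprod xs)) ** \<rho> (inv\<^bsub>G\<^esub> (gprod xs)) ** svK (\<rho> (gprod (xs @ ys)));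
           w = tens ?I H *v lead ?I in \<theta> / 2 * norm w \<le> \<bar>lead ?I \<bullet> w\<bar>)"
    proof (rule exI[of _ m0], intro allI impI, elim conjE)
      fix xs ys assume geo: "geodesic (xs @ ys)" and lx: "length xs = l" and ly: "m0 \<le> length ys"
      have sxy: "set xs \<subseteq> S" "set ys \<subseteq> S" using geoS(1)[OF geo] by auto
      define e0 where "e0 = X' xs *v u (xs @ ys)"
      define d where "d j = drop (l - j) xs" for j
      define t where "t j = take (l - j) xs" for j
      define f where "f j = X (d j) *v e0" for j
      have td: "t j @ d j = xs" for j by (simp add: t_def d_def)
      have sd: "set (d j) \<subseteq> S" "set (t j) \<subseteq> S" for j using sxy(1) td[of j] by (metis set_append le_sup_iff)+
      have gtd: "geodesic (t j)" "geodesic (d j)" "geodesic (d j @ ys)" for j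
        using geo geodesic_append[of "t j" "d j @ ys"] geodesic_append[of "d j" ys] td[of j]
        by (metis append.assoc)+
      have ld: "length (d j) = j" if "j \<le> l" for j using that lx by (simp add: d_def)
      have lt: "length (t j) \<le> l" for j using lx by (simp add: t_def)
      have u1: "norm (u (xs @ ys)) = 1" "u (xs @ ys) \<in> alt ?I" using dom[OF geo] by (auto simp: dominant_def)
      have e0W: "e0 \<in> alt ?I" unfolding e0_def by (rule Xalt(2)[OF u1(2)])
      have fW: "f j \<in> alt ?I" for j unfolding f_def by (rule Xalt(1)[OF e0W])
      have X'fe0: "X' (d j) *v f j = e0" for j
        unfolding f_def by (simp add: matrix_vector_mul_assoc X'X(2)[OF sd(1)])
      have e0nz: "e0 \<noteq> 0"
      proof
        assume "e0 = 0"
        then have "X xs *v e0 = 0" by simp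
        then have "u (xs @ ys) = 0" unfolding e0_def by (simp add: matrix_vector_mul_assoc X'X(1)[OF sxy(1)])
        then show False using u1 by simp
      qed
      have fnz: "f j \<noteq> 0" for j using X'fe0[of j] e0nz by auto
      have fQ: "f j = X' (t j) *v u (xs @ ys)" for j
      proof -
        have "X (d j) = X' (t j) ** X xs"
          using Xapp[OF sd(2,1), of j j] td[of j] by (simp add: matrix_mul_assoc X'X(2)[OF sd(2)])
        then show ?thesis unfolding f_def e0_def
          by (simp add: matrix_vector_mul_assoc X'X(1)[OF sxy(1)] flip: matrix_mul_assoc)
      qed
      have close: "norm (f j - (u (d j) \<bullet> f j) *\<^sub>R u (d j)) \<le> (D + 1) * r ^ j * norm (f j)" if j: "j \<le> l" for j
      proof -
        have "norm (f j - (u (d j @ ys) \<bullet> f j) *\<^sub>R u (d j @ ys)) \<le> \<eta> (d j @ ys) * (C ^ l)\<^sup>2 * norm (f j)"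
          unfolding fQ
        proof (rule dominant_left_quotient[OF dom[OF gtd(3)]])
          show "dominant (alt ?I) (X (t j) ** X (d j @ ys)) (N (xs @ ys)) (\<eta> (xs @ ys)) (u (xs @ ys)) (n (xs @ ys))"
            using dom[OF geo] Xapp[of "t j" "d j @ ys"] sd[of j] sxy td[of j] by (simp flip: append.assoc)
          have le: "C ^ length (t j) \<le> C ^ l" using C lt by (intro power_increasing)
          show "mbound (C ^ l) (X (t j))" by (rule mbound_mono[OF XC[OF sd(2)] le])
          show "mbound (C ^ l) (X' (t j))" by (rule mbound_mono[OF X'C[OF sd(2)] le])
          show "X' (t j) ** X (t j) = mat 1" by (rule X'X(2)[OF sd(2)])
        qed
        also have "\<dots> \<le> r ^ j * norm (f j)"
        proof (rule mult_right_mono)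
          have "\<eta> (d j @ ys) * (C ^ l)\<^sup>2 \<le> r ^ length (d j @ ys) / c * (C ^ l)\<^sup>2"
            by (intro mult_right_mono \<eta>le gtd) auto
          also have "\<dots> = r ^ j * ((C ^ l)\<^sup>2 / c * r ^ length ys)" using ld[OF j] by (simp add: power_add)
          also have "\<dots> \<le> r ^ j * 1" using m0[OF ly, unfolded rpow] r by (intro mult_left_mono) auto
          finally show "\<eta> (d j @ ys) * (C ^ l)\<^sup>2 \<le> r ^ j" by simp
        qed simp
        finally have "norm (f j - (u (d j @ ys) \<bullet> f j) *\<^sub>R u (d j @ ys)) \<le> r ^ j * norm (f j)" .
        moreover have "line_dist (u (d j @ ys)) (u (d j)) \<le> D * r ^ j"
          using prefix[OF gtd(3), of j] ld[OF j] by (simp add: line_dist_commute)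
        ultimately have "norm (f j - (u (d j) \<bullet> f j) *\<^sub>R u (d j)) \<le> r ^ j * norm (f j) + D * r ^ j * norm (f j)"
          using dom[OF gtd(3), of j] dom[OF gtd(2), of j] by (intro off_line_change) (auto simp: dominant_def)
        then show ?thesis by (simp add: algebra_simps)
      qed
      define y where "y j = (1 / (norm (f j))\<^sup>2) *\<^sub>R (transpose (X (d j)) *v f j)" for j
      have eps: "(D + 1) * r ^ j \<le> 1/2" if "j0 \<le> j" for j using j0[OF that, unfolded rpow] .
      have step: "norm (y (Suc j)) \<le> norm (y j) * exp (B * r ^ j)" if j: "j0 \<le> j" "j < l" for j
      proof -
        define s where "s = xs ! (l - Suc j)"
        have ds: "d (Suc j) = s # d j"
        proof -
          have "Suc (l - Suc j) = l - j" using j by simp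
          moreover have "l - Suc j < length xs" using j lx by simp
          ultimately show ?thesis unfolding d_def s_def by (metis Cons_nth_drop_Suc)
        qed
        have sS: "set [s] \<subseteq> S" using sd(1)[of "Suc j"] ds by auto
        have Xs: "X (d (Suc j)) = X [s] ** X (d j)" using Xapp[OF sS sd(1)[of j]] ds by simp
        have fs: "f (Suc j) = X [s] *v f j" unfolding f_def Xs by (simp add: matrix_vector_mul_assoc)
        have "norm (y (Suc j)) \<le> norm (y j) * (1 + 4 * C\<^sup>2 * (2 * ((D + 1) * r ^ j) + \<eta> (d j)))"
          unfolding y_def Xs fs
        proof (rule dominant_growth_step(1)[OF dom[OF gtd(2)] fW fnz close])
          show "j \<le> l" using j by simp
          show "(D + 1) * r ^ j \<le> 1 / 2" by (rule eps[OF j(1)])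
          show "mbound C (X [s])" "1 \<le> C" using XC[OF sS] C by auto
          have "norm (f j) = norm (X' [s] *v (X [s] *v f j))"
            by (simp add: matrix_vector_mul_assoc X'X(2)[OF sS])
          also have "\<dots> \<le> C * norm (X [s] *v f j)" using mboundD[OF X'C[OF sS]] by simp
          finally show "norm (f j) \<le> C * norm (X [s] *v f j)" .
        qed (rule Xalt, assumption)+
        also have "\<dots> \<le> norm (y j) * (1 + B * r ^ j)"
        proof (rule mult_left_mono)
          have "\<eta> (d j) \<le> r ^ j / c" using \<eta>le[OF gtd(2), of j] ld[of j] j by simp
          then have "4 * C\<^sup>2 * (2 * ((D + 1) * r ^ j) + \<eta> (d j)) \<le> 4 * C\<^sup>2 * (2 * ((D + 1) * r ^ j) + r ^ j / c)"
            by (intro mult_left_mono add_left_mono) auto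
          also have "\<dots> = B * r ^ j" by (simp add: B_def algebra_simps)
          finally show "1 + 4 * C\<^sup>2 * (2 * ((D + 1) * r ^ j) + \<eta> (d j)) \<le> 1 + B * r ^ j" by simp
        qed simp
        also have "\<dots> \<le> norm (y j) * exp (B * r ^ j)" by (intro mult_left_mono exp_ge_add_one_self) simp
        finally show ?thesis .
      qed
      have grow: "j0 \<le> j \<Longrightarrow> j \<le> l \<Longrightarrow> norm (y j) \<le> norm (y j0) * exp (B * (\<Sum>i<j. r ^ i))" for j
      proof (induction j rule: dec_induct)
        case base
        have "0 \<le> B * (\<Sum>i<j0. r ^ i)" using B0 r by (intro mult_nonneg_nonneg sum_nonneg) auto
        then show ?case using mult_left_mono[of 1 "exp (B * (\<Sum>i<j0. r ^ i))" "norm (y j0)"] by simp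
      next
        case (step j)
        have "norm (y (Suc j)) \<le> norm (y j) * exp (B * r ^ j)" using step by (intro \<open>\<And>j. j0 \<le> j \<Longrightarrow> j < l \<Longrightarrow> norm (y (Suc j)) \<le> norm (y j) * exp (B * r ^ j)\<close>) auto
        also have "\<dots> \<le> (norm (y j0) * exp (B * (\<Sum>i<j. r ^ i))) * exp (B * r ^ j)"
          using step by (intro mult_right_mono) auto
        finally show ?case by (simp add: exp_add[symmetric] algebra_simps)
      qed
      have jl: "j0 \<le> l" "J1 \<le> l" using l by auto
      have y0: "norm (y j0) \<le> C ^ (2 * j0) / norm e0"
      proof -
        have nf: "norm (f j0) > 0" using fnz by simp
        have "norm (transpose (X (d j0)) *v f j0) \<le> C ^ j0 * norm (f j0)"
          using mboundD[OF mbound_transpose[OF XC[OF sd(1)[of j0]]]] ld[OF jl(1)] by simp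
        then have 1: "norm (y j0) \<le> C ^ j0 / norm (f j0)"
          using nf by (simp add: y_def power2_eq_square field_simps)
        have "norm e0 \<le> C ^ j0 * norm (f j0)"
          using mboundD[OF X'C[OF sd(1)[of j0]], of "f j0"] ld[OF jl(1)] by (simp add: X'fe0)
        then have "C ^ j0 * norm e0 \<le> C ^ j0 * (C ^ j0 * norm (f j0))" using C by (intro mult_left_mono) auto
        then have "C ^ j0 * norm e0 \<le> C ^ (2 * j0) * norm (f j0)" by (simp add: mult_2 power_add)
        then have "C ^ j0 / norm (f j0) \<le> C ^ (2 * j0) / norm e0" using nf e0nz by (simp add: field_simps)
        with 1 show ?thesis by linarith
      qed
      have dl: "d l = xs" using lx by (simp add: d_def)
      have "N (d l) \<le> 2 * norm (f l) * norm (y l)"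
        unfolding y_def
      proof (rule dominant_growth_step(2)[OF dom[OF gtd(2)] fW fnz close, where M="mat 1" and C=1])
        show "(D + 1) * r ^ l \<le> 1/2" by (rule eps[OF jl(1)])
      qed (auto simp: mbound_def transpose_mat)
      also have "\<dots> \<le> 2 * norm (f l) * (C ^ (2 * j0) / norm e0 * exp E)"
      proof (intro mult_left_mono)
        have "norm (y l) \<le> norm (y j0) * exp (B * (\<Sum>i<l. r ^ i))" by (rule grow[OF jl(1) order_refl])
        also have "\<dots> \<le> (C ^ (2 * j0) / norm e0) * exp E"
        proof (rule mult_mono[OF y0])
          show "exp (B * (\<Sum>i<l. r ^ i)) \<le> exp E" unfolding E_def exp_le_cancel_iff
            using r B0 by (intro mult_left_mono geometric_sum_le) auto
        qed (use C in auto)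
        finally show "norm (y l) \<le> C ^ (2 * j0) / norm e0 * exp E" .
      qed auto
      also have "\<dots> = norm (f l) / norm e0 / \<theta>" by (simp add: \<theta>_def)
      finally have "\<theta> * norm e0 * N xs \<le> norm (f l)"
        using \<theta> e0nz by (simp add: dl field_simps)
      also have "norm (f l) \<le> N xs * (\<bar>n xs \<bullet> e0\<bar> + \<eta> xs * norm e0)"
        using dominant_proj(5)[OF dom[OF gtd(2)[of l]] e0W] by (simp add: f_def dl)
      finally have "N xs * (\<theta> * norm e0) \<le> N xs * (\<bar>n xs \<bullet> e0\<bar> + \<eta> xs * norm e0)" by (simp add: mult_ac)
      moreover have "N xs > 0" using dom[OF gtd(2)[of l]] by (simp add: dl dominant_def)
      ultimately have 1: "\<theta> * norm e0 \<le> \<bar>n xs \<bullet> e0\<bar> + \<eta> xs * norm e0" by (simp only: mult_le_cancel_left_pos)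
      have "\<eta> xs \<le> (1 / c) * r ^ l" using \<eta>le[OF gtd(2)[of l]] by (simp add: dl lx)
      also have "\<dots> \<le> \<theta> / 2" using J1[OF jl(2)] unfolding rpow .
      finally have "\<eta> xs \<le> \<theta> / 2" .
      then have "\<eta> xs * norm e0 \<le> \<theta> / 2 * norm e0" by (rule mult_right_mono) simp
      with 1 have fin: "\<theta> / 2 * norm e0 \<le> \<bar>n xs \<bullet> e0\<bar>" by (simp add: algebra_simps)
      define H where "H = svL (\<rho> (gprod xs)) ** \<rho> (inv\<^bsub>G\<^esub> (gprod xs)) ** svK (\<rho> (gprod (xs @ ys)))"
      define w where "w = tens ?I H *v lead ?I"
      have L: "orthogonal_matrix (svL (\<rho> (gprod xs)))"
        by (rule orthogonal_svL[OF rho_det_nz[OF gprod_closed[OF sxy(1)]]])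
      have w: "w = tens ?I (svL (\<rho> (gprod xs))) *v e0"
        by (simp add: w_def H_def e0_def X'_def u_def tens_mult matrix_vector_mul_assoc matrix_mul_assoc)
      have "norm w = norm e0" unfolding w by (rule orthogonal_matrix_norm[OF tens_orthogonal[OF L]])
      moreover have "lead ?I \<bullet> w = n xs \<bullet> e0"
        unfolding w n_def by (simp add: inner_matrix_transpose tens_transpose)
      ultimately show "let H = svL (\<rho> (gprod xs)) ** \<rho> (inv\<^bsub>G\<^esub> (gprod xs)) ** svK (\<rho> (gprod (xs @ ys)));
           w = tens ?I H *v lead ?I in \<theta> / 2 * norm w \<le> \<bar>lead ?I \<bullet> w\<bar>"
        using fin by (simp add: Let_def w_def H_def)
    qed
  qed
qed

definition transverse :: "real \<Rightarrow> real^'n^'n \<Rightarrow> bool" where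
  "transverse T H \<longleftrightarrow> (\<forall>p\<in>P. \<forall>x\<in>std p. norm (H *v x) \<le> T * norm (proj (head p) (H *v x)))"

text \<open>Seen from the right singular basis of a prefix, the singular flags of all much longer geodesic continuations are
  uniformly transverse to the repelling flag. All values \<open>p \<in> P\<close> are treated at once by taking the worst constants.\<close>

theorem uniform_transversality:
  "\<exists>T>0. \<exists>J. \<forall>l\<ge>J. \<exists>m0. \<forall>xs ys. geodesic (xs @ ys) \<and> length xs = l \<and> m0 \<le> length ys \<longrightarrow>
    transverse T (svL (\<rho> (gprod xs)) ** \<rho> (inv\<^bsub>G\<^esub> (gprod xs)) ** svK (\<rho> (gprod (xs @ ys))))"
proof -
  let ?H = "\<lambda>xs ys. svL (\<rho> (gprod xs)) ** \<rho> (inv\<^bsub>G\<^esub> (gprod xs)) ** svK (\<rho> (gprod (xs @ ys)))"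
  obtain \<kappa> J where \<kappa>: "\<And>p. p \<in> P \<Longrightarrow> \<kappa> p > 0" and J: "\<And>p l. p \<in> P \<Longrightarrow> J p \<le> l \<Longrightarrow>
     \<exists>m0. \<forall>xs ys. geodesic (xs @ ys) \<and> length xs = l \<and> m0 \<le> length ys \<longrightarrow>
      \<kappa> p * norm (tens (head p) (?H xs ys) *v lead (head p)) \<le> \<bar>lead (head p) \<bullet> (tens (head p) (?H xs ys) *v lead (head p))\<bar>"
    using leading_component_bound unfolding Let_def by metis
  obtain m0 where m0: "\<And>p l xs ys. p \<in> P \<Longrightarrow> J p \<le> l \<Longrightarrow> geodesic (xs @ ys) \<Longrightarrow> length xs = l \<Longrightarrow> m0 p l \<le> length ys \<Longrightarrow>
      \<kappa> p * norm (tens (head p) (?H xs ys) *v lead (head p)) \<le> \<bar>lead (head p) \<bullet> (tens (head p) (?H xs ys) *v lead (head p))\<bar>"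
    using J by metis
  define Tp where "Tp p = real CARD('n) * fact CARD('n) / \<kappa> p" for p
  define T where "T = 1 + (\<Sum>p\<in>P. Tp p)"
  have Tp0: "0 \<le> Tp p" if "p \<in> P" for p using \<kappa>[OF that] by (simp add: Tp_def)
  have TpT: "Tp p \<le> T" if "p \<in> P" for p
    unfolding T_def using member_le_sum[OF that, of Tp] Tp0 finite_P by auto
  have T0: "T > 0" unfolding T_def using sum_nonneg[of P Tp] Tp0 by auto
  show ?thesis
  proof (rule exI[of _ T], rule conjI[OF T0], rule exI[of _ "\<Sum>p\<in>P. J p"], intro allI impI)
    fix l assume l: "(\<Sum>p\<in>P. J p) \<le> l"
    show "\<exists>m0. \<forall>xs ys. geodesic (xs @ ys) \<and> length xs = l \<and> m0 \<le> length ys \<longrightarrow> transverse T (?H xs ys)"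
    proof (rule exI[of _ "\<Sum>p\<in>P. m0 p l"], intro allI impI, elim conjE)
      fix xs ys assume a: "geodesic (xs @ ys)" "length xs = l" "(\<Sum>p\<in>P. m0 p l) \<le> length ys"
      have c: "gprod xs \<in> carrier G" "gprod (xs @ ys) \<in> carrier G" using a(1) gprod_closed by (auto simp: geodesic_def)
      have detH: "det (?H xs ys) \<noteq> 0"
        using orthogonal_det_nz[OF orthogonal_svL[OF rho_det_nz[OF c(1)]]]
          orthogonal_det_nz[OF orthogonal_svK[OF rho_det_nz[OF c(2)]]] rho_det_nz[OF inv_closed[OF c(1)]]
        by (simp add: det_mul)
      show "transverse T (?H xs ys)"
        unfolding transverse_def
      proof (intro ballI)
        fix p and x :: "real^'n" assume p: "p \<in> P" and x: "x \<in> std p"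
        have "J p \<le> l" using l member_le_sum[OF p, of J] finite_P by auto
        moreover have "m0 p l \<le> length ys" using a(3) member_le_sum[OF p, of "\<lambda>p. m0 p l"] finite_P by auto
        ultimately have "norm (?H xs ys *v x) \<le> Tp p * norm (proj (head p) (?H xs ys *v x))"
          unfolding Tp_def using P_bounds[OF p]
          by (intro transverse_of_leading_component[OF detH _ \<kappa>[OF p] m0[OF p _ a(1,2)] x]) auto
        also have "\<dots> \<le> T * norm (proj (head p) (?H xs ys *v x))" by (intro mult_right_mono TpT p) simp
        finally show "norm (?H xs ys *v x) \<le> T * norm (proj (head p) (?H xs ys *v x))" .
      qed
    qed
  qed
qed

end

section \<open>Limits of matrices\<close>

lemma tendsto_matrix_mult [tendsto_intros]:
  fixes A :: "'a \<Rightarrow> real^'n^'m::finite" and B :: "'a \<Rightarrow> real^'k^'n"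
  assumes "(A \<longlongrightarrow> a) F" "(B \<longlongrightarrow> b) F"
  shows "((\<lambda>x. A x ** B x) \<longlongrightarrow> a ** b) F"
proof (intro vec_tendstoI)
  fix i j
  show "((\<lambda>x. (A x ** B x) $ i $ j) \<longlongrightarrow> (a ** b) $ i $ j) F"
    unfolding matrix_matrix_mult_def vec_lambda_beta
    by (intro tendsto_sum tendsto_mult tendsto_vec_nth assms)
qed

lemma tendsto_matrix_transpose [tendsto_intros]:
  fixes A :: "'a \<Rightarrow> real^'n^'m::finite"
  assumes "(A \<longlongrightarrow> a) F"
  shows "((\<lambda>x. transpose (A x)) \<longlongrightarrow> transpose a) F"
  by (intro vec_tendstoI) (simp add: transpose_def, intro tendsto_vec_nth assms)

lemma tendsto_matrix_vector_mult [tendsto_intros]: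
  fixes A :: "'a \<Rightarrow> real^'n^'m::finite"
  assumes "(A \<longlongrightarrow> a) F" "(v \<longlongrightarrow> w) F"
  shows "((\<lambda>x. A x *v v x) \<longlongrightarrow> a *v w) F"
  unfolding matrix_vector_mult_def
  by (intro vec_tendstoI) (simp, intro tendsto_sum tendsto_mult tendsto_vec_nth assms)

lemma compact_orthogonal: "compact {Q :: real^'n^'n. orthogonal_matrix Q}"
  unfolding compact_eq_bounded_closed
proof
  have "norm Q \<le> (\<Sum>i\<in>(UNIV::'n set). \<Sum>j\<in>(UNIV::'n set). 1)" if "orthogonal_matrix Q" for Q :: "real^'n^'n"
  proof -
    have "norm Q \<le> (\<Sum>i\<in>UNIV. norm (Q $ i))" by (simp add: norm_vec_def L2_set_le_sum)
    also have "\<dots> \<le> (\<Sum>i\<in>UNIV. \<Sum>j\<in>UNIV. \<bar>Q $ i $ j\<bar>)" by (intro sum_mono norm_le_l1_cart)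
    also have "\<dots> \<le> (\<Sum>i\<in>(UNIV::'n set). \<Sum>j\<in>(UNIV::'n set). 1)"
      by (intro sum_mono orthogonal_entry_le_1 that)
    finally show ?thesis .
  qed
  then show "bounded {Q :: real^'n^'n. orthogonal_matrix Q}" by (auto simp: bounded_iff)
  show "closed {Q :: real^'n^'n. orthogonal_matrix Q}"
    unfolding closed_sequential_limits
  proof (intro allI impI, elim conjE)
    fix A :: "nat \<Rightarrow> real^'n^'n" and Q assume A: "\<forall>n. A n \<in> {Q. orthogonal_matrix Q}" "A \<longlonglongrightarrow> Q"
    have "(\<lambda>n. transpose (A n) ** A n) \<longlonglongrightarrow> transpose Q ** Q" by (intro tendsto_intros A)
    moreover have "(\<lambda>n. transpose (A n) ** A n) = (\<lambda>n. mat 1)" using A(1) by (auto simp: orthogonal_matrix)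
    ultimately have "transpose Q ** Q = mat 1" using LIMSEQ_unique[OF _ tendsto_const] by metis
    then show "Q \<in> {Q. orthogonal_matrix Q}" by (simp add: orthogonal_matrix)
  qed
qed

lemma orthogonal_subsequence:
  fixes A :: "nat \<Rightarrow> real^'n^'n"
  assumes "\<And>n. orthogonal_matrix (A n)"
  obtains Q r where "orthogonal_matrix Q" "strict_mono (r :: nat \<Rightarrow> nat)" "(A \<circ> r) \<longlonglongrightarrow> Q"
proof -
  have "\<forall>n. A n \<in> {Q. orthogonal_matrix Q}" using assms by simp
  with compact_orthogonal show ?thesis unfolding compact_def using that by blast
qed

lemma mbound_norm: "mbound (norm A) A" for A :: "real^'n^'m::finite"
  unfolding mbound_def
proof
  fix x
  have "norm (A *v x) = L2_set (\<lambda>i. norm ((A *v x) $ i)) UNIV" by (simp add: norm_vec_def)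
  also have "\<dots> \<le> L2_set (\<lambda>i. norm (A $ i) * norm x) UNIV"
  proof (rule L2_set_mono)
    fix i show "norm ((A *v x) $ i) \<le> norm (A $ i) * norm x"
      using Cauchy_Schwarz_ineq2[of "A $ i" x] by (simp add: matrix_vector_mul_component)
  qed simp
  also have "\<dots> = L2_set (\<lambda>i. norm (A $ i)) UNIV * norm x" by (rule L2_set_left_distrib[symmetric]) simp
  also have "\<dots> = norm A * norm x" by (simp only: norm_vec_def[of A])
  finally show "norm (A *v x) \<le> norm A * norm x" .
qed

section \<open>The embedding of the flag manifold\<close>

text \<open>The stabiliser of the standard flag.\<close>

definition blocktri :: "nat set \<Rightarrow> real^'n^'n::finite \<Rightarrow> bool" where
  "blocktri P q \<longleftrightarrow> (\<forall>p\<in>P. \<forall>i j. pos j \<le> p \<longrightarrow> p < pos i \<longrightarrow> q $ i $ j = 0)"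

lemma blocktri_std: "blocktri P q \<Longrightarrow> p \<in> P \<Longrightarrow> x \<in> std p \<Longrightarrow> q *v x \<in> std p"
proof -
  assume q: "blocktri P q" "p \<in> P" "x \<in> std p"
  have "q $ i $ j * x $ j = 0" if "p < pos i" for i j
    using q that by (cases "pos j \<le> p") (auto simp: blocktri_def std_def)
  then have "(\<Sum>j\<in>UNIV. q $ i $ j * x $ j) = 0" if "p < pos i" for i
    using that by (intro sum.neutral ballI)
  then show ?thesis by (simp add: std_def matrix_vector_mult_def)
qed

lemma frame_flag_blocktri:
  fixes A q :: "real^'n^'n"
  assumes "P \<subseteq> {1..CARD('n)}" "det A \<noteq> 0" "det q \<noteq> 0" "blocktri P q"
  shows "frame_flag P (A ** q) = frame_flag P A"
proof (rule frame_flag_eqI)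
  fix p and x :: "real^'n" assume "p \<in> P" "x \<in> std p"
  then show "\<exists>y\<in>std p. (A ** q) *v x = A *v y"
    using blocktri_std[OF assms(4)] by (auto simp: matrix_vector_mul_assoc[symmetric])
qed (use assms in \<open>auto simp: det_mul\<close>)

text \<open>The eigenvalues of the embedded flag: the sum of the projections onto the subspaces of the standard flag is the
  diagonal matrix of these numbers, which drop exactly at the positions in \<open>P\<close>.\<close>

definition level :: "nat set \<Rightarrow> 'n::finite \<Rightarrow> real" where
  "level P i = real (card {p \<in> P. pos i \<le> p})"

lemma closest_point_frame:
  fixes k :: "real^'n^'n"
  assumes k: "orthogonal_matrix k"
  shows "matrix (closest_point ((\<lambda>x. k *v x) ` std p)) = k ** diag (\<lambda>i. if pos i \<le> p then 1 else 0) ** transpose k"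
proof -
  let ?V = "(\<lambda>x. k *v x) ` std p" and ?D = "diag (\<lambda>i. if pos i \<le> p then 1 else 0) :: real^'n^'n"
  have "closest_point ?V a = (k ** ?D ** transpose k) *v a" for a
  proof (rule closest_point_unique[symmetric])
    have sV: "subspace ?V" by (intro subspace_matrix_image subspace_std)
    then show "convex ?V" "closed ?V" by (auto simp: subspace_imp_convex closed_subspace)
    let ?b = "transpose k *v a"
    have e: "(k ** ?D ** transpose k) *v a = k *v (?D *v ?b)" by (simp add: matrix_vector_mul_assoc matrix_mul_assoc)
    have Db: "?D *v ?b \<in> std p" by (simp add: std_def diag_mult_vec)
    then show "(k ** ?D ** transpose k) *v a \<in> ?V" unfolding e by blast
    show "\<forall>z\<in>?V. dist a ((k ** ?D ** transpose k) *v a) \<le> dist a z"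
    proof
      fix z assume "z \<in> ?V"
      then obtain y where y: "y \<in> std p" "z = k *v y" by blast
      have n: "dist a (k *v w) = norm (?b - w)" for w
      proof -
        have "norm (?b - w) = norm (k *v (?b - w))" by (rule orthogonal_matrix_norm[OF k, symmetric])
        also have "k *v (?b - w) = a - k *v w"
          by (simp add: matrix_vector_mult_diff_distrib orthogonal_cancel[OF k])
        finally show ?thesis by (simp add: dist_norm)
      qed
      have "norm (?b - ?D *v ?b) \<le> norm (?b - y)"
        by (rule norm_le_componentwise_cart) (use y in \<open>auto simp: diag_mult_vec std_def\<close>)
      then show "dist a ((k ** ?D ** transpose k) *v a) \<le> dist a z" unfolding e y n .
    qed
  qed
  then have "closest_point ?V = (\<lambda>a. (k ** ?D ** transpose k) *v a)" by auto
  then show ?thesis by simp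
qed

lemma diag_sum: "(\<Sum>p\<in>P. diag (s p)) = diag (\<lambda>i. \<Sum>p\<in>P. s p i)"
  by (induction P rule: infinite_finite_induct) (auto simp: diag_def vec_eq_iff)

lemma matrix_mult_sum_distrib: "finite P \<Longrightarrow> (\<Sum>p\<in>P. A ** B p ** C) = A ** (\<Sum>p\<in>P. B p) ** C"
  for A :: "real^'n^'n" and C :: "real^'n^'n"
  by (induction P rule: finite_induct)
    (simp_all add: matrix_matrix_mult_def vec_eq_iff algebra_simps sum.distrib)

lemma flag_embed_frame:
  fixes k :: "real^'n^'n"
  assumes k: "orthogonal_matrix k" and P: "P \<subseteq> {1..CARD('n)}"
  shows "flag_embed P (frame_flag P k) = k ** diag (level P) ** transpose k"
proof -
  have fP: "finite P" using P finite_subset by blast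
  have "flag_embed P (frame_flag P k) = (\<Sum>p\<in>P. k ** diag (\<lambda>i. if pos i \<le> p then 1 else 0) ** transpose k)"
    unfolding flag_embed_def
    by (intro sum.cong refl) (simp add: frame_flag_def closest_point_frame[OF k])
  also have "\<dots> = k ** (\<Sum>p\<in>P. diag (\<lambda>i. if pos i \<le> p then 1 else 0)) ** transpose k"
    by (rule matrix_mult_sum_distrib[OF fP])
  also have "(\<Sum>p\<in>P. diag (\<lambda>i::'n. if pos i \<le> p then 1 else 0)) = diag (level P)"
    unfolding diag_sum using fP by (intro arg_cong[of _ _ diag] ext) (simp add: level_def sum.If_cases Int_def)
  finally show ?thesis .
qed

lemma level_less:
  assumes "finite P" "p \<in> P" "pos j \<le> p" "p < pos i"
  shows "level P i < level P j"
proof -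
  have "p \<in> {q \<in> P. pos j \<le> q}" "p \<notin> {q \<in> P. pos i \<le> q}" using assms by auto
  moreover have "{q \<in> P. pos i \<le> q} \<subseteq> {q \<in> P. pos j \<le> q}" using assms by auto
  ultimately have "{q \<in> P. pos i \<le> q} \<subset> {q \<in> P. pos j \<le> q}" by blast
  then show ?thesis unfolding level_def using assms(1) by (simp add: psubset_card_mono)
qed

text \<open>An orthogonal matrix that carries one embedded matrix to the other preserves the eigenspaces. As the eigenvalues
  \<open>level\<close> differ on the two sides of each \<open>p \<in> P\<close>, it stabilises the standard flag.\<close>

lemma flag_embed_inj:
  fixes k k' :: "real^'n^'n"
  assumes P: "P \<subseteq> {1..CARD('n)}" and k: "orthogonal_matrix k" "orthogonal_matrix k'"
    and eq: "flag_embed P (frame_flag P k) = flag_embed P (frame_flag P k')"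
  shows "frame_flag P k = frame_flag P k'"
proof -
  have fP: "finite P" using P finite_subset by blast
  define q where "q = transpose k' ** k"
  note O = orthogonal_matrix_transpose_mult[OF k(1)] orthogonal_matrix_transpose_mult[OF k(2)]
  let ?D = "diag (level P) :: real^'n^'n"
  have "q ** ?D = transpose k' ** (k ** ?D ** transpose k) ** k"
    by (simp add: q_def O(1) flip: matrix_mul_assoc)
  also have "k ** ?D ** transpose k = k' ** ?D ** transpose k'"
    using eq unfolding flag_embed_frame[OF k(1) P] flag_embed_frame[OF k(2) P] .
  also have "transpose k' ** (k' ** ?D ** transpose k') ** k = ?D ** q"
    by (simp add: q_def O(3) matrix_mul_assoc)
  finally have comm: "q ** ?D = ?D ** q" .
  have "blocktri P q"
    unfolding blocktri_def
  proof (intro ballI allI impI)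
    fix p and i j :: 'n assume p: "p \<in> P" "pos j \<le> p" "p < pos i"
    have "q $ i $ j * level P j = level P i * q $ i $ j"
      using arg_cong[OF comm, of "\<lambda>A. A $ i $ j"] by (simp add: diag_mult_left diag_mult_right)
    then show "q $ i $ j = 0" using level_less[OF fP p] by (auto simp: mult.commute)
  qed
  moreover have "k = k' ** q" by (simp add: q_def O matrix_mul_assoc)
  moreover have "det q \<noteq> 0" unfolding q_def using orthogonal_det_nz[OF k(1)] orthogonal_det_nz[OF k(2)] by (simp add: det_mul det_transpose)
  ultimately show ?thesis using frame_flag_blocktri[OF P orthogonal_det_nz[OF k(2)]] by metis
qed

lemma closedin_flag_topology:
  "closedin (flag_topology P) K \<longleftrightarrow> (\<exists>C. closed C \<and> K = flag_embed P -` C \<inter> flags P)"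
proof -
  have top: "topspace (flag_topology P) = flags P"
    by (simp add: flag_topology_def topspace_pullback_topology)
  show ?thesis
  proof
    assume K: "closedin (flag_topology P) K"
    then have sub: "K \<subseteq> flags P" and "openin (flag_topology P) (flags P - K)"
      by (auto simp: closedin_def top)
    then obtain U where U: "open U" "flags P - K = flag_embed P -` U \<inter> flags P"
      by (auto simp: flag_topology_def openin_pullback_topology)
    then have "K = flag_embed P -` (- U) \<inter> flags P" using sub by blast
    then show "\<exists>C. closed C \<and> K = flag_embed P -` C \<inter> flags P" using U(1) by (intro exI[of _ "- U"]) auto
  next
    assume "\<exists>C. closed C \<and> K = flag_embed P -` C \<inter> flags P"
    then obtain C where C: "closed C" "K = flag_embed P -` C \<inter> flags P" by blast
    then have "flags P - K = flag_embed P -` (- C) \<inter> flags P" by blast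
    then have "openin (flag_topology P) (flags P - K)" unfolding flag_topology_def openin_pullback_topology
      using C(1) by (intro exI[of _ "- C"]) (auto simp: open_Compl)
    then show "closedin (flag_topology P) K" using C(2) by (auto simp: closedin_def top)
  qed
qed

text \<open>Frames of flags may be chosen orthogonal, hence in a compact set, so convergence of arbitrary
  invertible frames implies convergence of flags.\<close>

lemma closed_flags_frame_limit:
  fixes A :: "nat \<Rightarrow> real^'n^'n"
  assumes P: "P \<subseteq> {1..CARD('n)}" and K: "closedin (flag_topology P) K"
    and A: "\<And>n. det (A n) \<noteq> 0" "\<And>n. frame_flag P (A n) \<in> K" "A \<longlonglongrightarrow> B" "det B \<noteq> 0"
  shows "frame_flag P B \<in> K"
proof -
  obtain C where C: "closed C" "K = flag_embed P -` C \<inter> flags P" using K by (auto simp: closedin_flag_topology)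
  have "\<exists>h. orthogonal_matrix h \<and> frame_flag P (A n) = frame_flag P h" for n
    using flag_has_frame[OF P frame_flag_in_flags[OF P A(1)]] by metis
  then obtain h where h: "\<And>n. orthogonal_matrix (h n)" "\<And>n. frame_flag P (A n) = frame_flag P (h n)" by metis
  obtain Q r where Q: "orthogonal_matrix Q" "strict_mono r" "(h \<circ> r) \<longlonglongrightarrow> Q"
    using orthogonal_subsequence[of h, OF h(1)] by blast
  have Ar: "(A \<circ> r) \<longlonglongrightarrow> B" using A(3) Q(2) by (rule LIMSEQ_subseq_LIMSEQ)
  have "k ** diag (level P) ** transpose k \<in> C" if "frame_flag P k \<in> K" "orthogonal_matrix k" for k :: "real^'n^'n"
    using that C(2) flag_embed_frame[OF that(2) P] by auto
  then have "(h \<circ> r) n ** diag (level P) ** transpose ((h \<circ> r) n) \<in> C" for n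
    using h A(2) by (metis comp_apply)
  moreover have "(\<lambda>n. (h \<circ> r) n ** diag (level P) ** transpose ((h \<circ> r) n)) \<longlonglongrightarrow> Q ** diag (level P) ** transpose Q"
    by (intro tendsto_intros Q)
  ultimately have "Q ** diag (level P) ** transpose Q \<in> C" by (rule closed_sequentially[OF C(1)])
  then have QK: "frame_flag P Q \<in> K"
    using C(2) flag_embed_frame[OF Q(1) P] frame_flag_in_flags[OF P orthogonal_det_nz[OF Q(1)]] by auto
  define q where "q = transpose Q ** B"
  have lim: "(\<lambda>n. transpose ((h \<circ> r) n) ** (A \<circ> r) n) \<longlonglongrightarrow> q" unfolding q_def by (intro tendsto_intros Q Ar)
  have "blocktri P q"
    unfolding blocktri_def
  proof (intro ballI allI impI)
    fix p and i j :: 'n assume p: "p \<in> P" "pos j \<le> p" "p < pos i"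
    have "(transpose (h n) ** A n) $ i $ j = 0" for n
    proof -
      have "axis j 1 \<in> std p" using p by (auto simp: std_def axis_def)
      moreover have "(\<lambda>x. A n *v x) ` std p = (\<lambda>x. h n *v x) ` std p"
        using fun_cong[OF h(2)[of n], of p] p(1) by (simp add: frame_flag_def)
      ultimately obtain y where y: "y \<in> std p" "A n *v axis j 1 = h n *v y" by blast
      then have "(transpose (h n) ** A n) *v axis j 1 = y"
        by (simp add: orthogonal_cancel[OF h(1)] flip: matrix_vector_mul_assoc)
      then have "(transpose (h n) ** A n) $ i $ j = y $ i"
        by (simp add: matrix_vector_mult_basis column_def vec_eq_iff)
      then show ?thesis using y(1) p(3) by (simp add: std_def)
    qed
    then have "(\<lambda>n. (transpose ((h \<circ> r) n) ** (A \<circ> r) n) $ i $ j) = (\<lambda>n. 0)" by simp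
    moreover have "(\<lambda>n. (transpose ((h \<circ> r) n) ** (A \<circ> r) n) $ i $ j) \<longlonglongrightarrow> q $ i $ j"
      by (intro tendsto_vec_nth lim)
    ultimately show "q $ i $ j = 0" using LIMSEQ_unique[OF _ tendsto_const] by metis
  qed
  moreover have "det q \<noteq> 0" unfolding q_def using A(4) orthogonal_det_nz[OF Q(1)] by (simp add: det_mul det_transpose)
  ultimately have "frame_flag P (Q ** q) = frame_flag P Q" by (intro frame_flag_blocktri[OF P orthogonal_det_nz[OF Q(1)]])
  moreover have "Q ** q = B" by (simp add: q_def orthogonal_matrix_transpose_mult[OF Q(1)] matrix_mul_assoc)
  ultimately show ?thesis using QK by simp
qed

section \<open>Unipotent frames of transverse flags\<close>

text \<open>The matrix positions strictly below the diagonal blocks defined by \<open>P\<close>. They correspond to the roots in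
  \<open>root_pairs\<close>, with row and column exchanged.\<close>

definition below :: "nat set \<Rightarrow> 'n::finite \<Rightarrow> 'n \<Rightarrow> bool" where
  "below P i j \<longleftrightarrow> (\<exists>p\<in>P. pos j \<le> p \<and> p < pos i)"

text \<open>The affine chart of flags transverse to the opposite standard flag, restricted to coordinates of size \<open>T\<close>.\<close>

definition unip :: "nat set \<Rightarrow> real \<Rightarrow> real^'n^'n::finite \<Rightarrow> bool" where
  "unip P T m \<longleftrightarrow> (\<forall>i j. m $ i $ j = (if i = j then 1 else 0) \<or> (below P i j \<and> \<bar>m $ i $ j\<bar> \<le> T))"

lemma below_less: "below P i j \<Longrightarrow> pos j < pos i"
  by (auto simp: below_def)

lemma lower_unitriangular_det_nz:
  fixes m :: "real^'n^'n"
  assumes "\<And>i. m $ i $ i = 1" "\<And>i j. pos i < pos j \<Longrightarrow> m $ i $ j = 0"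
  shows "det m \<noteq> 0"
proof -
  have "x = 0" if mx: "m *v x = 0" for x
  proof -
    have "x $ j = 0" for j
    proof (induction "pos j" arbitrary: j rule: less_induct)
      case less
      have "0 = (m *v x) $ j" using mx by simp
      also have "\<dots> = (\<Sum>k\<in>UNIV. if k = j then x $ j else 0)"
        unfolding matrix_vector_mult_def vec_lambda_beta
      proof (rule sum.cong[OF refl])
        fix k show "m $ j $ k * x $ k = (if k = j then x $ j else 0)"
          using assms less[of k] by (cases "pos k" "pos j" rule: linorder_cases) auto
      qed
      finally show "x $ j = 0" by simp
    qed
    then show ?thesis by (simp add: vec_eq_iff)
  qed
  then have "\<exists>B. B ** m = mat 1" by (simp add: matrix_left_invertible_ker)
  then show ?thesis using invertible_det_nz invertible_left_inverse by blast
qed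

lemma unip_det_nz: "unip P T m \<Longrightarrow> det m \<noteq> 0"
proof (rule lower_unitriangular_det_nz)
  assume m: "unip P T m"
  show "m $ i $ i = 1" for i using m unfolding unip_def by (metis below_less less_irrefl)
  show "m $ i $ j = 0" if "pos i < pos j" for i j
    using m that unfolding unip_def by (metis below_less less_asym less_irrefl)
qed

text \<open>Uniform transversality writes each subspace as a graph over the standard subspace. The column of index \<open>j\<close> of the
  unipotent frame is the vector of the graph at the first position of \<open>P\<close> that covers \<open>j\<close>, lying over the
  coordinate vector \<open>j\<close>.\<close>

lemma unip_frame_exists:
  fixes H :: "real^'n^'n"
  assumes P: "P \<subseteq> {1..CARD('n)}" and H: "det H \<noteq> 0" and T: "0 \<le> T"
    and tr: "\<And>p x. p \<in> P \<Longrightarrow> x \<in> std p \<Longrightarrow> norm (H *v x) \<le> T * norm (proj (head p) (H *v x))"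
  obtains m where "unip P T m" "frame_flag P m = frame_flag P H"
proof -
  have fP: "finite P" using P finite_subset by blast
  have Hinj: "H *v x = 0 \<Longrightarrow> x = 0" for x
    using inverse_matrix_exists[OF H] matrix_left_invertible_ker[of H] by metis
  have surj: "\<exists>x\<in>std p. proj (head p) (H *v x) = y" if p: "p \<in> P" and y: "y \<in> std p" for p y
  proof -
    define g where "g = (\<lambda>x. proj (head p) (H *v x))"
    have lin: "linear g" unfolding g_def
      by (rule linearI) (auto simp: proj_def vec_eq_iff matrix_vector_right_distrib matrix_vector_mult_scaleR)
    have inj: "inj_on g (span (std p))"
    proof -
      have "g x = 0 \<Longrightarrow> x = 0" if "x \<in> std p" for x
        using tr[OF p that] Hinj[of x] by (simp add: g_def)
      then show ?thesis
        unfolding span_eq_iff[THEN iffD2, OF subspace_std]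
        using linear_injective_on_subspace_0[OF lin subspace_std[of p]] by blast
    qed
    have "g ` std p = std p"
    proof (rule subspace_dim_equal)
      show "subspace (g ` std p)" by (rule linear_subspace_image[OF lin subspace_std])
      show "subspace (std p)" by (rule subspace_std)
      show "g ` std p \<subseteq> std p" by (auto simp: g_def proj_def std_def head_def)
      show "dim (g ` std p) \<ge> dim (std p :: (real^'n) set)" using dim_image_eq[OF lin inj] by simp
    qed
    then show ?thesis using y unfolding g_def by (metis (no_types, lifting) image_iff)
  qed
  define Q where "Q j = {p \<in> P. pos j \<le> p}" for j :: 'n
  define v where "v j = (if Q j = {} then axis j 1 else
     (SOME w. \<exists>x\<in>std (Min (Q j)). w = H *v x \<and> proj (head (Min (Q j))) w = axis j 1))" for j
  have fQ: "finite (Q j)" for j using fP by (simp add: Q_def)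
  have Qm: "Min (Q j) \<in> P" "pos j \<le> Min (Q j)" if "Q j \<noteq> {}" for j
    using Min_in[OF fQ that] by (auto simp: Q_def)
  have v: "\<exists>x\<in>std (Min (Q j)). v j = H *v x \<and> proj (head (Min (Q j))) (v j) = axis j 1" if ne: "Q j \<noteq> {}" for j
  proof -
    have "axis j 1 \<in> std (Min (Q j))" using Qm[OF ne] by (auto simp: std_def axis_def)
    then have "\<exists>w. \<exists>x\<in>std (Min (Q j)). w = H *v x \<and> proj (head (Min (Q j))) w = axis j 1"
      using surj[OF Qm(1)[OF ne]] by blast
    from someI_ex[OF this] show ?thesis using ne by (simp add: v_def)
  qed
  define m where "m = (\<chi> i j. v j $ i)"
  have col: "column j m = v j" for j by (simp add: m_def column_def)
  have un: "unip P T m"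
    unfolding unip_def
  proof (intro allI)
    fix i j
    show "m $ i $ j = (if i = j then 1 else 0) \<or> (below P i j \<and> \<bar>m $ i $ j\<bar> \<le> T)"
    proof (cases "Q j = {}")
      case True
      then show ?thesis by (auto simp: m_def v_def axis_def)
    next
      case False
      let ?q = "Min (Q j)"
      obtain x where x: "x \<in> std ?q" "v j = H *v x" "proj (head ?q) (v j) = axis j 1" using v[OF False] by blast
      show ?thesis
      proof (cases "pos i \<le> ?q")
        case True
        moreover have "proj (head ?q) (v j) $ i = axis j 1 $ i" using x(3) by simp
        ultimately have "v j $ i = axis j 1 $ i" by (simp add: proj_def head_def)
        then show ?thesis by (auto simp: m_def axis_def)
      next
        case out: False
        have "\<bar>v j $ i\<bar> \<le> norm (v j)" by (rule component_le_norm_cart)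
        also have "\<dots> \<le> T * norm (proj (head ?q) (v j))" using tr[OF Qm(1)[OF False] x(1)] x(2) by simp
        also have "\<dots> = T" using x(3) by simp
        finally have "\<bar>m $ i $ j\<bar> \<le> T" by (simp add: m_def)
        moreover have "below P i j" using Qm[OF False] out by (auto simp: below_def)
        ultimately show ?thesis by blast
      qed
    qed
  qed
  have "frame_flag P m = frame_flag P H"
  proof (rule frame_flag_eqI[OF P unip_det_nz[OF un] H])
    fix p and x :: "real^'n" assume p: "p \<in> P" and x: "x \<in> std p"
    have "v j \<in> (\<lambda>x. H *v x) ` std p" if "pos j \<le> p" for j
    proof -
      have "p \<in> Q j" using that p by (simp add: Q_def)
      then have "Q j \<noteq> {}" "Min (Q j) \<le> p" using fQ by auto
      then show ?thesis using v[of j] std_mono[of "Min (Q j)" p] by blast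
    qed
    then have "m *v x \<in> (\<lambda>x. H *v x) ` std p"
      unfolding matrix_std_sum[OF x] col
      by (intro subspace_sum subspace_scale subspace_matrix_image subspace_std) auto
    then show "\<exists>y\<in>std p. m *v x = H *v y" by blast
  qed
  with un show ?thesis by (rule that)
qed

section \<open>Polynomials and Zariski density\<close>

lemma poly_entry:
  fixes l h :: "real^'n^'n"
  shows "real_polynomial_function (\<lambda>A :: real^'n^'n. (l ** A ** h) $ i $ j)"
proof -
  have "linear (\<lambda>A :: real^'n^'n. (l ** A ** h) $ i $ j)"
    by (rule linearI)
      (simp_all add: matrix_matrix_mult_def sum.distrib sum_distrib_left sum_distrib_right algebra_simps)
  then show ?thesis by (intro real_polynomial_function.intros(1)) (simp add: linear_conv_bounded_linear)
qed

lemma poly_det_corner: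
  fixes l h :: "real^'n^'n"
  shows "real_polynomial_function (\<lambda>A :: real^'n^'n. det (corner I (l ** A ** h)))"
proof -
  have "real_polynomial_function (\<lambda>A. corner I (l ** A ** h) $ i $ j)" for i j
    by (cases "i \<in> I \<and> j \<in> I") (auto simp: corner_def poly_entry)
  then show ?thesis unfolding det_def
    by (intro real_polynomial_function_sum real_polynomial_function.intros(4) real_polynomial_function_prod
        real_polynomial_function.intros(2)) auto
qed

lemma det_corner_diag: "det (corner I (diag s)) = prod s I"
proof -
  have "corner I (diag s) = diag (\<lambda>i. if i \<in> I then s i else 1)"
    by (auto simp: corner_def diag_def vec_eq_iff)
  then show ?thesis by (simp add: det_diag prod.If_cases)
qed

text \<open>Leading minors are polynomials in the matrix entries, and on the special linear group the ones in question do not vanish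
  identically. Hence neither does their product, and a Zariski dense set contains a matrix in general position.\<close>

lemma zariski_dense_general_position:
  fixes l h :: "real^'n^'n" and H :: "(real^'n^'n) set"
  assumes dense: "zariski_dense_in_SL H" and l: "orthogonal_matrix l" and h: "orthogonal_matrix h"
    and P: "finite P"
  obtains A where "A \<in> H" "\<And>p. p \<in> P \<Longrightarrow> det (corner (head p) (l ** A ** h)) \<noteq> 0"
proof -
  let ?f = "\<lambda>A. \<Prod>p\<in>P. det (corner (head p) (l ** A ** h))"
  have poly: "real_polynomial_function ?f"
    by (intro real_polynomial_function_prod P poly_det_corner)
  have "\<exists>A\<in>H. ?f A \<noteq> 0"
  proof (rule ccontr)
    assume "\<not> (\<exists>A\<in>H. ?f A \<noteq> 0)"
    then have zero: "?f A = 0" if "det A = 1" for A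
      using dense poly that unfolding zariski_dense_in_SL_def zariski_closure_def SL_group_def by auto
    define i0 :: 'n where "i0 = undefined"
    define s where "s i = (if i = i0 then det l * det h else 1)" for i
    have dlh: "det l = 1 \<or> det l = -1" "det h = 1 \<or> det h = -1" using l h det_orthogonal_matrix by auto
    have snz: "s i \<noteq> 0" for i using dlh by (auto simp: s_def)
    have ps: "prod s UNIV = det l * det h" by (simp add: s_def)
    define A where "A = transpose l ** diag s ** transpose h"
    have "det A = 1" using dlh by (auto simp: A_def det_mul det_diag ps det_transpose)
    moreover have "l ** A ** h = diag s"
    proof -
      have "l ** A ** h = (l ** transpose l) ** diag s ** (transpose h ** h)"
        by (simp add: A_def matrix_mul_assoc)
      then show ?thesis by (simp add: orthogonal_matrix_transpose_mult l h)
    qed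
    ultimately have "(\<Prod>p\<in>P. prod s (head p)) = 0" using zero[of A] by (simp add: det_corner_diag)
    then show False using snz P by (simp add: prod_zero_iff)
  qed
  then obtain A where "A \<in> H" "?f A \<noteq> 0" by blast
  then show ?thesis using that P by (simp add: prod_zero_iff)
qed

section \<open>The limit set\<close>

context anosov_rep
begin

lemma P_range': "P \<subseteq> {1..CARD('n)}" using P_range by (meson atLeastatMost_subset_iff diff_le_self order_refl subset_trans)

lemma long_elements: "\<exists>x\<in>carrier G. N \<le> wl x"
proof (rule ccontr)
  assume "\<not> (\<exists>x\<in>carrier G. N \<le> wl x)"
  then have short: "wl x < N" if "x \<in> carrier G" for x using that by (auto simp: not_le)
  have "carrier G \<subseteq> gprod ` {ws. set ws \<subseteq> S \<and> length ws \<le> N}"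
  proof
    fix x assume x: "x \<in> carrier G"
    obtain ws where "geodesic ws" "gprod ws = x" using geodesic_exists[OF x] by blast
    then show "x \<in> gprod ` {ws. set ws \<subseteq> S \<and> length ws \<le> N}"
      using short[OF x] by (auto simp: geodesic_def image_iff intro!: exI[of _ ws])
  qed
  moreover have "finite {ws. set ws \<subseteq> S \<and> length ws \<le> N}" by (rule finite_lists_length_le) (rule S_facts)
  ultimately show False using infinite_carrier finite_subset by blast
qed

text \<open>Working with frames instead of flags makes compactness of the orthogonal group available: long elements have
  convergent subsequences of singular bases.\<close>

definition limit_frames :: "(real^'n^'n) set" where
  "limit_frames = (\<Inter>N::nat. closure {svK (\<rho> x) | x. x \<in> carrier G \<and> N \<le> wl x})"

lemma limit_frames_sequence:
  assumes "k \<in> limit_frames"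
  obtains \<gamma> :: "nat \<Rightarrow> 'g" where "\<And>n. \<gamma> n \<in> carrier G" "\<And>n. n \<le> wl (\<gamma> n)" "(\<lambda>n. svK (\<rho> (\<gamma> n))) \<longlonglongrightarrow> k"
proof -
  have "\<exists>x. x \<in> carrier G \<and> n \<le> wl x \<and> dist (svK (\<rho> x)) k < inverse (real (Suc n))" for n
  proof -
    have "k \<in> closure {svK (\<rho> x) | x. x \<in> carrier G \<and> n \<le> wl x}" using assms by (auto simp: limit_frames_def)
    then have "\<forall>e>0. \<exists>y\<in>{svK (\<rho> x) | x. x \<in> carrier G \<and> n \<le> wl x}. dist y k < e"
      unfolding closure_approachable .
    moreover have "0 < inverse (real (Suc n))" by simp
    ultimately have "\<exists>y\<in>{svK (\<rho> x) | x. x \<in> carrier G \<and> n \<le> wl x}. dist y k < inverse (real (Suc n))"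
      by (simp only:)
    then show ?thesis by auto
  qed
  then obtain \<gamma> where \<gamma>: "\<And>n. \<gamma> n \<in> carrier G" "\<And>n. n \<le> wl (\<gamma> n)" "\<And>n. dist (svK (\<rho> (\<gamma> n))) k < inverse (real (Suc n))"
    by metis
  have "(\<lambda>n. svK (\<rho> (\<gamma> n))) \<longlonglongrightarrow> k"
  proof -
    have "(\<lambda>n. dist (svK (\<rho> (\<gamma> n))) k) \<longlonglongrightarrow> 0"
      by (rule tendsto_sandwich[OF _ _ tendsto_const LIMSEQ_inverse_real_of_nat])
         (use \<gamma>(3) in \<open>auto intro!: always_eventually less_imp_le\<close>)
    then show ?thesis by (rule tendsto_dist_iff[THEN iffD2])
  qed
  with \<gamma>(1,2) show ?thesis by (rule that)
qed

lemma limit_frames_limit: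
  assumes "\<And>n. \<gamma> n \<in> carrier G" "filterlim (\<lambda>n. wl (\<gamma> n)) at_top sequentially" "(\<lambda>n. svK (\<rho> (\<gamma> n))) \<longlonglongrightarrow> k"
  shows "k \<in> limit_frames"
  unfolding limit_frames_def
proof
  fix N :: nat
  have "eventually (\<lambda>n. N \<le> wl (\<gamma> n)) sequentially" using assms(2) by (simp add: filterlim_at_top)
  then obtain M where M: "\<And>n. M \<le> n \<Longrightarrow> N \<le> wl (\<gamma> n)" by (auto simp: eventually_sequentially)
  show "k \<in> closure {svK (\<rho> x) | x. x \<in> carrier G \<and> N \<le> wl x}"
    unfolding closure_sequential
  proof (intro exI[of _ "\<lambda>n. svK (\<rho> (\<gamma> (n + M)))"] conjI allI)
    show "svK (\<rho> (\<gamma> (n + M))) \<in> {svK (\<rho> x) | x. x \<in> carrier G \<and> N \<le> wl x}" for n using assms(1) M by auto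
    show "(\<lambda>n. svK (\<rho> (\<gamma> (n + M)))) \<longlonglongrightarrow> k" using LIMSEQ_ignore_initial_segment[OF assms(3), of M] .
  qed
qed

lemma limit_frames_orthogonal: "k \<in> limit_frames \<Longrightarrow> orthogonal_matrix k"
proof -
  assume k: "k \<in> limit_frames"
  obtain \<gamma> :: "nat \<Rightarrow> 'g" where \<gamma>: "\<And>n. \<gamma> n \<in> carrier G" "\<And>n. n \<le> wl (\<gamma> n)" "(\<lambda>n. svK (\<rho> (\<gamma> n))) \<longlonglongrightarrow> k"
    using limit_frames_sequence[OF k] by blast
  have "svK (\<rho> (\<gamma> n)) \<in> {Q. orthogonal_matrix Q}" for n using orthogonal_svK[OF rho_det_nz[OF \<gamma>(1)]] by simp
  from closed_sequentially[OF compact_imp_closed[OF compact_orthogonal] this \<gamma>(3)] show ?thesis by simp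
qed

lemma compact_limit_frames: "compact limit_frames"
proof -
  have "limit_frames \<subseteq> {Q. orthogonal_matrix Q}" using limit_frames_orthogonal by blast
  moreover have "closed limit_frames" unfolding limit_frames_def by (intro closed_INT) auto
  ultimately show ?thesis using compact_Int_closed[OF compact_orthogonal, of limit_frames] by (simp add: Int_absorb1)
qed

lemma long_sequence_limit_frame:
  assumes "\<And>n. \<gamma> n \<in> carrier G" "filterlim (\<lambda>n. wl (\<gamma> n)) at_top sequentially"
  obtains k r where "k \<in> limit_frames" "strict_mono (r :: nat \<Rightarrow> nat)" "(\<lambda>n. svK (\<rho> (\<gamma> (r n)))) \<longlonglongrightarrow> k"
proof -
  obtain k r where k: "strict_mono (r :: nat \<Rightarrow> nat)" "((\<lambda>n. svK (\<rho> (\<gamma> n))) \<circ> r) \<longlonglongrightarrow> k"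
    using orthogonal_subsequence[of "\<lambda>n. svK (\<rho> (\<gamma> n))"] orthogonal_svK[OF rho_det_nz[OF assms(1)]] by metis
  have "k \<in> limit_frames"
  proof (rule limit_frames_limit)
    show "(\<gamma> \<circ> r) n \<in> carrier G" for n using assms by simp
    show "filterlim (\<lambda>n. wl ((\<gamma> \<circ> r) n)) at_top sequentially"
      using filterlim_compose[OF assms(2) filterlim_subseq[OF k(1)]] by simp
    show "(\<lambda>n. svK (\<rho> ((\<gamma> \<circ> r) n))) \<longlonglongrightarrow> k" using k(2) by (simp add: o_def)
  qed
  then show ?thesis using k by (intro that[of k r]) (simp_all add: o_def)
qed

lemma limit_frames_nonempty: "limit_frames \<noteq> {}"
proof -
  obtain \<gamma> where \<gamma>: "\<And>n::nat. \<gamma> n \<in> carrier G" "\<And>n. n \<le> wl (\<gamma> n)" using long_elements by metis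
  have "filterlim (\<lambda>n. wl (\<gamma> n)) at_top sequentially"
    unfolding filterlim_at_top using \<gamma>(2) by (metis eventually_sequentiallyI le_trans)
  from long_sequence_limit_frame[OF \<gamma>(1) this] show ?thesis by blast
qed

lemma gap_tendsto_0:
  assumes "\<And>n. \<gamma> n \<in> carrier G" "filterlim (\<lambda>n. wl (\<gamma> n)) at_top sequentially" "p \<in> P"
  shows "(\<lambda>n. gap p (\<gamma> n)) \<longlonglongrightarrow> 0"
proof -
  obtain c where c: "c > 0" "\<And>x. x \<in> carrier G \<Longrightarrow> gap p x \<le> exp (- c * real (wl x)) / c"
    using gap_decay assms(3) by blast
  have 1: "(\<lambda>n. exp (- c * real n) / c) \<longlonglongrightarrow> 0"
  proof -
    have "(\<lambda>n. (exp (- c)) ^ n / c) \<longlonglongrightarrow> 0 / c"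
      by (intro tendsto_divide tendsto_const LIMSEQ_realpow_zero) (use c in auto)
    then show ?thesis by (simp add: exp_of_nat_mult[symmetric] mult.commute)
  qed
  have 2: "(\<lambda>n. exp (- c * real (wl (\<gamma> n))) / c) \<longlonglongrightarrow> 0" by (rule filterlim_compose[OF 1 assms(2)])
  show ?thesis
  proof (rule tendsto_sandwich[OF _ _ tendsto_const 2])
    show "\<forall>\<^sub>F n in sequentially. 0 \<le> gap p (\<gamma> n)" using gap_nonneg[OF assms(1)] by simp
    show "\<forall>\<^sub>F n in sequentially. gap p (\<gamma> n) \<le> exp (- c * real (wl (\<gamma> n))) / c"
      by (intro always_eventually allI c(2) assms(1))
  qed
qed

lemma sv_ratio_le_gap:
  assumes "x \<in> carrier G" "p \<in> P" "pos j \<le> p" "p < pos i"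
  shows "sv (\<rho> x) i / sv (\<rho> x) j \<le> gap p x"
proof -
  note d = rho_det_nz[OF assms(1)]
  have pp: "pos (ix p :: 'n) = p" "pos (ix (Suc p) :: 'n) = Suc p" using P_bounds[OF assms(2)] by auto
  show ?thesis unfolding gap_def
    by (intro frac_le sv_antimono[OF d]) (use assms pp sv_pos[OF d] in \<open>auto intro: less_imp_le\<close>)
qed

definition limit_flags :: "'n flag set" where
  "limit_flags = frame_flag P ` limit_frames"

lemma closedin_limit_flags: "closedin (flag_topology P) limit_flags"
  unfolding closedin_flag_topology
proof (intro exI conjI)
  let ?g = "\<lambda>k :: real^'n^'n. k ** diag (level P) ** transpose k"
  have "continuous_on limit_frames ?g"
    unfolding continuous_on_def by (intro ballI tendsto_intros)
  then show "closed (?g ` limit_frames)"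
    by (intro compact_imp_closed compact_continuous_image compact_limit_frames)
  show "limit_flags = flag_embed P -` (?g ` limit_frames) \<inter> flags P"
  proof (intro equalityI subsetI)
    fix F assume "F \<in> limit_flags"
    then obtain k where k: "k \<in> limit_frames" "F = frame_flag P k" by (auto simp: limit_flags_def)
    note o = limit_frames_orthogonal[OF k(1)]
    show "F \<in> flag_embed P -` (?g ` limit_frames) \<inter> flags P"
      using k flag_embed_frame[OF o P_range'] frame_flag_in_flags[OF P_range' orthogonal_det_nz[OF o]] by auto
  next
    fix F assume F: "F \<in> flag_embed P -` (?g ` limit_frames) \<inter> flags P"
    then obtain k where k: "k \<in> limit_frames" "flag_embed P F = ?g k" by auto
    obtain h where h: "orthogonal_matrix h" "F = frame_flag P h" using flag_has_frame[OF P_range'] F by blast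
    note o = limit_frames_orthogonal[OF k(1)]
    have "F = frame_flag P k" using flag_embed_inj[OF P_range' h(1) o] k(2) h(2) flag_embed_frame[OF o P_range'] by simp
    then show "F \<in> limit_flags" using k(1) by (auto simp: limit_flags_def)
  qed
qed

text \<open>Multiplying a long element by a fixed one changes its left singular flag by as much as that element moves the flag, up
  to an error of the order of the gap, which vanishes in the limit.\<close>

lemma limit_flags_invariant:
  assumes g: "g \<in> carrier G" and F: "F \<in> limit_flags"
  shows "flag_act P (\<rho> g) F \<in> limit_flags"
proof -
  obtain k where k: "k \<in> limit_frames" "F = frame_flag P k" using F by (auto simp: limit_flags_def)
  obtain \<gamma> :: "nat \<Rightarrow> 'g" where \<gamma>: "\<And>n. \<gamma> n \<in> carrier G" "\<And>n. n \<le> wl (\<gamma> n)" "(\<lambda>n. svK (\<rho> (\<gamma> n))) \<longlonglongrightarrow> k"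
    using limit_frames_sequence[OF k(1)] by blast
  define \<delta> where "\<delta> n = g \<otimes>\<^bsub>G\<^esub> \<gamma> n" for n
  have \<delta>: "\<delta> n \<in> carrier G" for n using g \<gamma>(1) by (simp add: \<delta>_def)
  have \<gamma>top: "filterlim (\<lambda>n. wl (\<gamma> n)) at_top sequentially"
    unfolding filterlim_at_top using \<gamma>(2) by (metis eventually_sequentiallyI le_trans)
  have low0: "wl (\<gamma> n) \<le> wl g + wl (\<delta> n)" for n
  proof -
    have "\<gamma> n = inv\<^bsub>G\<^esub> g \<otimes>\<^bsub>G\<^esub> \<delta> n" using g \<gamma>(1)[of n] by (simp add: \<delta>_def m_assoc[symmetric])
    then show ?thesis using wl_mult_le[of "inv\<^bsub>G\<^esub> g" "\<delta> n"] wl_inv_le[OF g] g \<delta>[of n] by simp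
  qed
  have low: "n - wl g \<le> wl (\<delta> n)" for n using low0[of n] \<gamma>(2)[of n] by linarith
  have "filterlim (\<lambda>n. wl (\<delta> n)) at_top sequentially"
    unfolding filterlim_at_top
  proof
    fix Z show "eventually (\<lambda>n. Z \<le> wl (\<delta> n)) sequentially"
    proof (rule eventually_sequentiallyI)
      fix n assume "Z + wl g \<le> n"
      then show "Z \<le> wl (\<delta> n)" using low[of n] by linarith
    qed
  qed
  from long_sequence_limit_frame[OF \<delta> this]
  obtain k' r where k': "k' \<in> limit_frames" "strict_mono (r :: nat \<Rightarrow> nat)" "(\<lambda>n. svK (\<rho> (\<delta> (r n)))) \<longlonglongrightarrow> k'"
    by blast
  note ok = limit_frames_orthogonal[OF k(1)] and ok' = limit_frames_orthogonal[OF k'(1)]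
  define q where "q = transpose k' ** \<rho> g ** k"
  have klim: "(\<lambda>n. svK (\<rho> (\<gamma> (r n)))) \<longlonglongrightarrow> k" using LIMSEQ_subseq_LIMSEQ[OF \<gamma>(3) k'(2)] by (simp add: o_def)
  have qlim: "(\<lambda>n. transpose (svK (\<rho> (\<delta> (r n)))) ** \<rho> g ** svK (\<rho> (\<gamma> (r n)))) \<longlonglongrightarrow> q"
    unfolding q_def by (intro tendsto_intros k' klim)
  obtain C where C: "C \<ge> 1" "mbound C (\<rho> g)" using mbound_exists by blast
  have "blocktri P q"
    unfolding blocktri_def
  proof (intro ballI allI impI)
    fix p and i j :: 'n assume p: "p \<in> P" "pos j \<le> p" "p < pos i"
    have "\<bar>(transpose (svK (\<rho> (\<delta> n))) ** \<rho> g ** svK (\<rho> (\<gamma> n))) $ i $ j\<bar> \<le> C * gap p (\<gamma> n)" for n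
    proof -
      note d = rho_det_nz[OF g] rho_det_nz[OF \<gamma>(1)[of n]]
      have e: "\<rho> (\<delta> n) = \<rho> g ** \<rho> (\<gamma> n)" unfolding \<delta>_def by (rule rho_mult[OF g \<gamma>(1)])
      have "\<bar>(transpose (svK (\<rho> (\<delta> n))) ** \<rho> g ** svK (\<rho> (\<gamma> n))) $ i $ j\<bar> \<le> sv (\<rho> (\<delta> n)) i / sv (\<rho> (\<gamma> n)) j"
        unfolding e by (rule left_singular_basis_entry_le[OF d])
      also have "\<dots> \<le> (C * sv (\<rho> (\<gamma> n)) i) / sv (\<rho> (\<gamma> n)) j"
        unfolding e using sv_mult_left_le[OF d(2,1) C(2)] C(1) sv_pos[OF d(2), of j] by (intro divide_right_mono) auto
      also have "\<dots> \<le> C * gap p (\<gamma> n)"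
        using mult_left_mono[OF sv_ratio_le_gap[OF \<gamma>(1) p, of n], of C] C(1) by simp
      finally show ?thesis .
    qed
    then have bd: "\<bar>(transpose (svK (\<rho> (\<delta> (r n)))) ** \<rho> g ** svK (\<rho> (\<gamma> (r n)))) $ i $ j\<bar> \<le> C * gap p (\<gamma> (r n))" for n .
    have "(\<lambda>n. gap p (\<gamma> n)) \<longlonglongrightarrow> 0" by (rule gap_tendsto_0[OF \<gamma>(1) \<gamma>top p(1)])
    from LIMSEQ_subseq_LIMSEQ[OF this k'(2)] have "(\<lambda>n. C * gap p (\<gamma> (r n))) \<longlonglongrightarrow> 0"
      by (intro tendsto_mult_right_zero) (simp add: o_def)
    then have "(\<lambda>n. (transpose (svK (\<rho> (\<delta> (r n)))) ** \<rho> g ** svK (\<rho> (\<gamma> (r n)))) $ i $ j) \<longlonglongrightarrow> 0"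
      by (rule Lim_null_comparison[rotated]) (use bd in \<open>auto intro!: always_eventually\<close>)
    moreover have "(\<lambda>n. (transpose (svK (\<rho> (\<delta> (r n)))) ** \<rho> g ** svK (\<rho> (\<gamma> (r n)))) $ i $ j) \<longlonglongrightarrow> q $ i $ j"
      by (intro tendsto_vec_nth qlim)
    ultimately show "q $ i $ j = 0" using LIMSEQ_unique by blast
  qed
  moreover have "det q \<noteq> 0" unfolding q_def using orthogonal_det_nz[OF ok] orthogonal_det_nz[OF ok'] rho_det_nz[OF g]
    by (simp add: det_mul det_transpose)
  ultimately have "frame_flag P (k' ** q) = frame_flag P k'"
    by (intro frame_flag_blocktri[OF P_range' orthogonal_det_nz[OF ok']])
  moreover have "k' ** q = \<rho> g ** k" by (simp add: q_def orthogonal_matrix_transpose_mult[OF ok'] matrix_mul_assoc)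
  ultimately have "flag_act P (\<rho> g) F = frame_flag P k'" by (simp add: k(2) flag_act_frame)
  then show ?thesis using k'(1) by (simp add: limit_flags_def)
qed

lemma diag_conj_entry: "(diag s ** m ** diag t) $ i $ j = s i * m $ i $ j * t j"
  by (simp add: diag_mult_left diag_mult_right)

lemma unip_conj_tendsto_1:
  assumes "\<And>n. \<gamma> n \<in> carrier G" "filterlim (\<lambda>n. wl (\<gamma> n)) at_top sequentially" "\<And>n. unip P T (m n)"
  shows "(\<lambda>n. diag (sv (\<rho> (\<gamma> n))) ** m n ** diag (\<lambda>i. 1 / sv (\<rho> (\<gamma> n)) i)) \<longlonglongrightarrow> mat 1"
proof (intro vec_tendstoI)
  fix i j
  let ?s = "\<lambda>n. sv (\<rho> (\<gamma> n))"
  have pos: "?s n k > 0" for n k by (rule sv_pos[OF rho_det_nz[OF assms(1)]])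
  show "(\<lambda>n. (diag (?s n) ** m n ** diag (\<lambda>i. 1 / ?s n i)) $ i $ j) \<longlonglongrightarrow> mat 1 $ i $ j"
  proof (cases "below P i j")
    case False
    then have "m n $ i $ j = (if i = j then 1 else 0)" for n using assms(3)[of n] unfolding unip_def by blast
    then have "(diag (?s n) ** m n ** diag (\<lambda>i. 1 / ?s n i)) $ i $ j = mat 1 $ i $ j" for n
      using pos[of n i] by (auto simp: diag_conj_entry mat_def)
    then show ?thesis by simp
  next
    case True
    then obtain p where p: "p \<in> P" "pos j \<le> p" "p < pos i" by (auto simp: below_def)
    have ij: "i \<noteq> j" using p by auto
    have mT: "\<bar>m n $ i $ j\<bar> \<le> \<bar>T\<bar>" for n using assms(3)[of n] ij unfolding unip_def by (smt (verit))
    have bd: "\<bar>(diag (?s n) ** m n ** diag (\<lambda>i. 1 / ?s n i)) $ i $ j\<bar> \<le> \<bar>T\<bar> * gap p (\<gamma> n)" for n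
    proof -
      have "\<bar>(diag (?s n) ** m n ** diag (\<lambda>i. 1 / ?s n i)) $ i $ j\<bar> = \<bar>m n $ i $ j\<bar> * (?s n i / ?s n j)"
        using pos[of n i] pos[of n j] by (simp add: diag_conj_entry abs_mult)
      also have "\<dots> \<le> \<bar>T\<bar> * gap p (\<gamma> n)"
        using pos[of n i] pos[of n j] by (intro mult_mono mT sv_ratio_le_gap[OF assms(1) p]) auto
      finally show ?thesis .
    qed
    have lim: "(\<lambda>n. \<bar>T\<bar> * gap p (\<gamma> n)) \<longlonglongrightarrow> 0"
      by (intro tendsto_mult_right_zero gap_tendsto_0[OF assms(1,2) p(1)])
    have "(\<lambda>n. (diag (?s n) ** m n ** diag (\<lambda>i. 1 / ?s n i)) $ i $ j) \<longlonglongrightarrow> 0"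
      by (rule Lim_null_comparison[OF _ lim]) (intro always_eventually allI, simp only: real_norm_def bd)
    then show ?thesis using ij by (simp add: mat_def)
  qed
qed

text \<open>Conjugating by the singular values turns a unipotent chart at the right singular basis into
  one at the left singular basis.\<close>

lemma frame_flag_svd_unip:
  fixes A H m :: "real^'n^'n"
  assumes A: "det A \<noteq> 0" and H: "det H \<noteq> 0" and m: "unip P T m" "frame_flag P m = frame_flag P (svL A ** H)"
  shows "frame_flag P (A ** H) = frame_flag P (svK A ** (diag (sv A) ** m ** diag (\<lambda>i. 1 / sv A i)))"
proof -
  let ?D = "diag (sv A)" and ?D' = "diag (\<lambda>i. 1 / sv A i)"
  have dD: "det ?D \<noteq> 0" "det ?D' \<noteq> 0" using sv_pos[OF A] by (auto simp: det_diag prod_zero_iff less_imp_neq[symmetric])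
  have "frame_flag P (A ** H) = flag_act P (svK A ** ?D) (frame_flag P (svL A ** H))"
    unfolding flag_act_frame by (subst (1) svd_eq[OF A]) (simp add: matrix_mul_assoc)
  also have "\<dots> = frame_flag P (svK A ** ?D ** m)" by (simp add: m(2)[symmetric] flag_act_frame)
  also have "\<dots> = frame_flag P (svK A ** ?D ** m ** ?D')"
    by (rule frame_flag_blocktri[symmetric, OF P_range'])
       (use dD unip_det_nz[OF m(1)] orthogonal_det_nz[OF orthogonal_svK[OF A]] in \<open>auto simp: det_mul blocktri_def diag_def\<close>)
  finally show ?thesis by (simp add: matrix_mul_assoc)
qed

text \<open>A flag in general position with respect to the right singular bases is attracted to the limit
  of the left singular bases.\<close>

lemma limit_flags_minimal:
  assumes dense: "zariski_dense_in_SL (\<rho> ` carrier G)" and K: "closed_invariant G P \<rho> K"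
  shows "limit_flags \<subseteq> K"
proof
  fix \<xi> assume "\<xi> \<in> limit_flags"
  then obtain k where k: "k \<in> limit_frames" "\<xi> = frame_flag P k" by (auto simp: limit_flags_def)
  obtain \<gamma>0 :: "nat \<Rightarrow> 'g" where \<gamma>0: "\<And>n. \<gamma>0 n \<in> carrier G" "\<And>n. n \<le> wl (\<gamma>0 n)" "(\<lambda>n. svK (\<rho> (\<gamma>0 n))) \<longlonglongrightarrow> k"
    using limit_frames_sequence[OF k(1)] by blast
  obtain l r where l: "orthogonal_matrix l" "strict_mono (r :: nat \<Rightarrow> nat)" "((\<lambda>n. svL (\<rho> (\<gamma>0 n))) \<circ> r) \<longlonglongrightarrow> l"
    using orthogonal_subsequence[of "\<lambda>n. svL (\<rho> (\<gamma>0 n))"] orthogonal_svL[OF rho_det_nz[OF \<gamma>0(1)]] by metis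
  define \<gamma> where "\<gamma> = \<gamma>0 \<circ> r"
  have \<gamma>: "\<gamma> n \<in> carrier G" for n by (simp add: \<gamma>_def \<gamma>0)
  have "n \<le> wl (\<gamma> n)" for n using \<gamma>0(2)[of "r n"] seq_suble[OF l(2), of n] by (simp add: \<gamma>_def)
  then have \<gamma>top: "filterlim (\<lambda>n. wl (\<gamma> n)) at_top sequentially"
    unfolding filterlim_at_top by (metis eventually_sequentiallyI le_trans)
  have klim: "(\<lambda>n. svK (\<rho> (\<gamma> n))) \<longlonglongrightarrow> k" using LIMSEQ_subseq_LIMSEQ[OF \<gamma>0(3) l(2)] by (simp add: o_def \<gamma>_def)
  have llim: "(\<lambda>n. svL (\<rho> (\<gamma> n))) \<longlonglongrightarrow> l" using l(3) by (simp add: o_def \<gamma>_def)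
  have Kne: "K \<noteq> {}" and Kcl: "closedin (flag_topology P) K" and Kinv: "\<And>g F. g \<in> carrier G \<Longrightarrow> F \<in> K \<Longrightarrow> flag_act P (\<rho> g) F \<in> K"
    using K by (auto simp: closed_invariant_def)
  obtain F where F: "F \<in> K" using Kne by blast
  have "F \<in> flags P" using F Kcl by (auto simp: closedin_flag_topology)
  then obtain h where h: "orthogonal_matrix h" "F = frame_flag P h" using flag_has_frame[OF P_range'] by blast
  obtain A where "A \<in> \<rho> ` carrier G" and Ac: "\<And>p. p \<in> P \<Longrightarrow> det (corner (head p) (l ** A ** h)) \<noteq> 0"
    using zariski_dense_general_position[OF dense l(1) h(1) finite_P] by blast
  then obtain g where g: "g \<in> carrier G" "A = \<rho> g" by blast
  define W where "W n = svL (\<rho> (\<gamma> n)) ** A ** h" for n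
  define Q where "Q = l ** A ** h"
  have Olim: "W \<longlonglongrightarrow> Q" unfolding W_def Q_def by (intro tendsto_intros llim)
  have dO: "det (W n) \<noteq> 0" for n unfolding W_def
    using orthogonal_det_nz[OF orthogonal_svL[OF rho_det_nz[OF \<gamma>[of n]]]] orthogonal_det_nz[OF h(1)] rho_det_nz[OF g(1)]
    by (simp add: det_mul g(2))
  obtain C where C: "C \<ge> 1" "mbound C A" using mbound_exists by blast
  have OC: "norm (W n *v x) \<le> C * norm x" for n x
  proof -
    have "norm (W n *v x) = norm (A *v (h *v x))"
      using orthogonal_matrix_norm[OF orthogonal_svL[OF rho_det_nz[OF \<gamma>[of n]]]]
      by (simp add: W_def matrix_vector_mul_assoc[symmetric])
    then show ?thesis using mboundD[OF C(2), of "h *v x"] orthogonal_matrix_norm[OF h(1)] by simp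
  qed
  have low: "\<exists>b>0. \<forall>x\<in>std p. norm x \<le> b * norm (proj (head p) (Q *v x))" if p: "p \<in> P" for p
  proof -
    obtain B where B: "B ** corner (head p) Q = mat 1" using inverse_matrix_exists[OF Ac[OF p]] Q_def by metis
    obtain b where b: "b \<ge> 1" "mbound b B" using mbound_exists by blast
    have "norm x \<le> b * norm (proj (head p) (Q *v x))" if x: "x \<in> std p" for x
    proof -
      have "corner (head p) Q *v x = proj (head p) (Q *v x)"
      proof (subst vec_eq_iff, intro allI)
        fix i
        have x0: "x $ j = 0" if "j \<notin> head p" for j using x that by (simp add: std_eq)
        show "(corner (head p) Q *v x) $ i = proj (head p) (Q *v x) $ i"
        proof (cases "i \<in> head p")
          case True
          then have "(corner (head p) Q *v x) $ i = (\<Sum>j\<in>UNIV. Q $ i $ j * x $ j)"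
            unfolding matrix_vector_mult_def vec_lambda_beta
            by (intro sum.cong refl) (use x0 in \<open>auto simp: corner_def\<close>)
          then show ?thesis using True by (simp add: proj_def matrix_vector_mult_def)
        next
          case False
          then have "(corner (head p) Q *v x) $ i = (\<Sum>j\<in>UNIV. if i = j then x $ j else 0)"
            unfolding matrix_vector_mult_def vec_lambda_beta
            by (intro sum.cong refl) (auto simp: corner_def)
          then show ?thesis using False x0 by (simp add: proj_def)
        qed
      qed
      then have "x = B *v proj (head p) (Q *v x)"
        by (metis B matrix_vector_mul_assoc matrix_vector_mul_lid)
      then show ?thesis using mboundD[OF b(2)] by metis
    qed
    then show ?thesis using b(1) by (intro exI[of _ b]) auto
  qed
  then obtain b where b: "\<And>p. p \<in> P \<Longrightarrow> b p > 0" "\<And>p x. p \<in> P \<Longrightarrow> x \<in> std p \<Longrightarrow> norm x \<le> b p * norm (proj (head p) (Q *v x))"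
    by metis
  define T where "T = 2 * C * (\<Sum>p\<in>P. b p)"
  have T0: "0 \<le> T" unfolding T_def using C b(1) by (intro mult_nonneg_nonneg sum_nonneg) (auto intro: less_imp_le)
  have proj_le: "norm (proj I z) \<le> norm z" for I and z :: "real^'n"
    by (rule norm_le_componentwise_cart) (simp add: proj_def)
  have "\<exists>M. \<forall>n\<ge>M. norm (W n - Q) * b p \<le> 1/2" if "p \<in> P" for p
  proof -
    have "(\<lambda>n. norm (W n - Q) * b p) \<longlonglongrightarrow> 0"
      using Olim by (intro tendsto_mult_left_zero tendsto_norm_zero) (simp add: LIM_zero)
    then have "eventually (\<lambda>n. norm (W n - Q) * b p < 1/2) sequentially" by (rule order_tendstoD(2)) simp
    then show ?thesis by (auto simp: eventually_sequentially intro: less_imp_le)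
  qed
  then obtain M where M: "\<And>p n. p \<in> P \<Longrightarrow> M p \<le> n \<Longrightarrow> norm (W n - Q) * b p \<le> 1/2" by metis
  define M0 where "M0 = (\<Sum>p\<in>P. M p)"
  have tr: "norm (W n *v x) \<le> T * norm (proj (head p) (W n *v x))" if n: "M0 \<le> n" and p: "p \<in> P" and x: "x \<in> std p" for n p x
  proof -
    have "M p \<le> n" using n member_le_sum[OF p, of M] finite_P by (auto simp: M0_def)
    then have Mp: "norm (W n - Q) * b p \<le> 1/2" by (rule M[OF p])
    have "proj (head p) (Q *v x) = proj (head p) (W n *v x) - proj (head p) ((W n - Q) *v x)"
      by (auto simp: proj_def vec_eq_iff matrix_vector_mult_diff_rdistrib)
    then have "norm (proj (head p) (Q *v x)) \<le> norm (proj (head p) (W n *v x)) + norm ((W n - Q) *v x)"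
      using norm_triangle_ineq4[of "proj (head p) (W n *v x)" "proj (head p) ((W n - Q) *v x)"] proj_le[of "head p" "(W n - Q) *v x"]
      by simp
    also have "norm ((W n - Q) *v x) \<le> norm (W n - Q) * norm x" by (rule mboundD[OF mbound_norm])
    finally have "norm (proj (head p) (Q *v x)) \<le> norm (proj (head p) (W n *v x)) + norm (W n - Q) * norm x" by simp
    from mult_left_mono[OF this less_imp_le[OF b(1)[OF p]]]
    have "norm x \<le> b p * (norm (proj (head p) (W n *v x)) + norm (W n - Q) * norm x)"
      using b(2)[OF p x] by linarith
    also have "\<dots> = b p * norm (proj (head p) (W n *v x)) + (norm (W n - Q) * b p) * norm x" by (simp add: algebra_simps)
    also have "\<dots> \<le> b p * norm (proj (head p) (W n *v x)) + 1/2 * norm x"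
      using Mp by (intro add_left_mono mult_right_mono) auto
    finally have nx: "norm x \<le> 2 * b p * norm (proj (head p) (W n *v x))" by simp
    have "norm (W n *v x) \<le> C * (2 * b p * norm (proj (head p) (W n *v x)))"
      by (rule order_trans[OF OC mult_left_mono[OF nx]]) (use C(1) in simp)
    also have "\<dots> = (2 * C * b p) * norm (proj (head p) (W n *v x))" by simp
    also have "\<dots> \<le> T * norm (proj (head p) (W n *v x))"
    proof (rule mult_right_mono)
      have "b p \<le> (\<Sum>p\<in>P. b p)" by (rule member_le_sum[OF p _ finite_P]) (use b(1) in \<open>auto intro: less_imp_le\<close>)
      then show "2 * C * b p \<le> T" unfolding T_def using C(1) by (intro mult_left_mono) auto
    qed simp
    finally show ?thesis .
  qed
  have "\<exists>m. unip P T m \<and> frame_flag P m = frame_flag P (W (n + M0))" for n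
    using unip_frame_exists[OF P_range' dO[of "n + M0"] T0] tr[of "n + M0"] by (metis le_add2)
  then obtain m where m: "\<And>n. unip P T (m n)" "\<And>n. frame_flag P (m n) = frame_flag P (W (n + M0))" by metis
  define \<delta> where "\<delta> n = \<gamma> (n + M0)" for n
  have \<delta>: "\<delta> n \<in> carrier G" for n by (simp add: \<delta>_def \<gamma>)
  have \<delta>top: "filterlim (\<lambda>n. wl (\<delta> n)) at_top sequentially"
    unfolding \<delta>_def using \<gamma>top by (rule filterlim_compose) (rule filterlim_add_const_nat_at_top)
  define B where "B n = svK (\<rho> (\<delta> n)) ** (diag (sv (\<rho> (\<delta> n))) ** m n ** diag (\<lambda>i. 1 / sv (\<rho> (\<delta> n)) i))" for n
  have "B \<longlonglongrightarrow> k ** mat 1" unfolding B_def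
  proof (intro tendsto_intros unip_conj_tendsto_1[OF \<delta> \<delta>top m(1)])
    show "(\<lambda>n. svK (\<rho> (\<delta> n))) \<longlonglongrightarrow> k" unfolding \<delta>_def by (rule LIMSEQ_ignore_initial_segment[OF klim])
  qed
  then have Blim: "B \<longlonglongrightarrow> k" by simp
  have FB: "frame_flag P (B n) = flag_act P (\<rho> (\<delta> n)) (flag_act P (\<rho> g) F)" for n
  proof -
    have d: "det (A ** h) \<noteq> 0" using orthogonal_det_nz[OF h(1)] rho_det_nz[OF g(1)] by (simp add: det_mul g(2))
    have e: "frame_flag P (m n) = frame_flag P (svL (\<rho> (\<delta> n)) ** (A ** h))"
      using m(2)[of n] by (simp add: W_def \<delta>_def matrix_mul_assoc)
    show ?thesis unfolding B_def h(2) flag_act_frame g(2)[symmetric]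
      by (rule frame_flag_svd_unip[OF rho_det_nz[OF \<delta>] d m(1) e, symmetric])
  qed
  have "frame_flag P k \<in> K"
  proof (rule closed_flags_frame_limit[OF P_range' Kcl _ _ Blim])
    show "frame_flag P (B n) \<in> K" for n unfolding FB using Kinv \<delta> g F by blast
    show "det (B n) \<noteq> 0" for n
      unfolding B_def using orthogonal_det_nz[OF orthogonal_svK[OF rho_det_nz[OF \<delta>[of n]]]] unip_det_nz[OF m(1)[of n]] sv_pos[OF rho_det_nz[OF \<delta>[of n]]]
      by (auto simp: det_mul det_diag prod_zero_iff less_imp_neq[symmetric])
    show "det k \<noteq> 0" by (rule orthogonal_det_nz[OF limit_frames_orthogonal[OF k(1)]])
  qed
  then show "\<xi> \<in> K" by (simp add: k(2))
qed

text \<open>The limit flags are closed, invariant and contained in every closed invariant set; hence they are the unique minimal one.\<close>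

theorem limit_set_eq:
  assumes "zariski_dense_in_SL (\<rho> ` carrier G)"
  shows "limit_set G P \<rho> = limit_flags"
proof -
  have ci: "closed_invariant G P \<rho> limit_flags"
    unfolding closed_invariant_def
    using closedin_limit_flags limit_flags_invariant limit_frames_nonempty by (auto simp: limit_flags_def)
  show ?thesis unfolding limit_set_def
  proof (rule the_equality)
    show "closed_invariant G P \<rho> limit_flags \<and> (\<forall>K. closed_invariant G P \<rho> K \<and> K \<subseteq> limit_flags \<longrightarrow> K = limit_flags)"
      using ci limit_flags_minimal[OF assms] by blast
    fix L assume "closed_invariant G P \<rho> L \<and> (\<forall>K. closed_invariant G P \<rho> K \<and> K \<subseteq> L \<longrightarrow> K = L)"
    then show "L = limit_flags" using ci limit_flags_minimal[OF assms] by metis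
  qed
qed

end

section \<open>Curves with bounded continuous derivative\<close>

text \<open>Only the upper bound on the derivative matters: curves are used solely to bound distances from above.\<close>

definition C1b :: "real \<Rightarrow> (real \<Rightarrow> 'a::real_normed_vector) \<Rightarrow> bool" where
  "C1b B f \<longleftrightarrow> (\<exists>f'. (\<forall>t\<in>{0..1}. (f has_vector_derivative f' t) (at t within {0..1})) \<and>
     continuous_on {0..1} f' \<and> (\<forall>t\<in>{0..1}. norm (f' t) \<le> B))"

lemma C1bE:
  assumes "C1b B f"
  obtains f' where "\<And>t. t \<in> {0..1} \<Longrightarrow> (f has_vector_derivative f' t) (at t within {0..1})"
    "continuous_on {0..1} f'" "\<And>t. t \<in> {0..1} \<Longrightarrow> norm (f' t) \<le> B"
  using assms unfolding C1b_def by blast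

lemma C1bI:
  assumes "\<And>t. t \<in> {0..1} \<Longrightarrow> (f has_vector_derivative f' t) (at t within {0..1})"
    "continuous_on {0..1} f'" "\<And>t. t \<in> {0..1} \<Longrightarrow> norm (f' t) \<le> B"
  shows "C1b B f"
  unfolding C1b_def by (intro exI[of _ f'] conjI ballI assms)

lemma C1b_cont: "C1b B f \<Longrightarrow> continuous_on {0..1} f"
  unfolding C1b_def continuous_on_eq_continuous_within
  using has_vector_derivative_continuous by blast

lemma C1b_mono: "C1b B f \<Longrightarrow> B \<le> B' \<Longrightarrow> C1b B' f"
  unfolding C1b_def by (meson order_trans)

lemma C1b_diff: "C1b A f \<Longrightarrow> C1b B g \<Longrightarrow> C1b (A + B) (\<lambda>t. f t - g t)"
proof -
  assume "C1b A f" "C1b B g"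
  then obtain f' g' where f': "\<And>t. t \<in> {0..1} \<Longrightarrow> (f has_vector_derivative f' t) (at t within {0..1})"
    "continuous_on {0..1} f'" "\<And>t. t \<in> {0..1} \<Longrightarrow> norm (f' t) \<le> A" and
    g': "\<And>t. t \<in> {0..1} \<Longrightarrow> (g has_vector_derivative g' t) (at t within {0..1})"
    "continuous_on {0..1} g'" "\<And>t. t \<in> {0..1} \<Longrightarrow> norm (g' t) \<le> B"
    by (metis C1bE)
  show ?thesis
  proof (rule C1bI)
    fix t :: real assume t: "t \<in> {0..1}"
    show "((\<lambda>t. f t - g t) has_vector_derivative (f' t - g' t)) (at t within {0..1})"
      by (intro has_vector_derivative_diff f' g' t)
    show "norm (f' t - g' t) \<le> A + B" using norm_triangle_ineq4[of "f' t" "g' t"] f'(3)[OF t] g'(3)[OF t] by linarith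
  qed (intro continuous_intros f' g')
qed

lemma C1b_sum:
  assumes "finite I" "\<And>i. i \<in> I \<Longrightarrow> C1b (B i) (f i)"
  shows "C1b (\<Sum>i\<in>I. B i) (\<lambda>t. \<Sum>i\<in>I. f i t)"
proof -
  have "\<forall>i\<in>I. \<exists>f'. (\<forall>t\<in>{0..1}. (f i has_vector_derivative f' t) (at t within {0..1})) \<and>
     continuous_on {0..1} f' \<and> (\<forall>t\<in>{0..1}. norm (f' t) \<le> B i)" using assms(2) by (simp add: C1b_def)
  then obtain f' where f': "\<And>i. i \<in> I \<Longrightarrow> (\<forall>t\<in>{0..1}. (f i has_vector_derivative f' i t) (at t within {0..1})) \<and>
     continuous_on {0..1} (f' i) \<and> (\<forall>t\<in>{0..1}. norm (f' i t) \<le> B i)" by metis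
  show ?thesis
  proof (rule C1bI[where f'="\<lambda>t. \<Sum>i\<in>I. f' i t"])
    fix t :: real assume t: "t \<in> {0..1}"
    show "((\<lambda>t. \<Sum>i\<in>I. f i t) has_vector_derivative (\<Sum>i\<in>I. f' i t)) (at t within {0..1})"
      by (rule has_vector_derivative_sum) (use f' t in blast)
    show "norm (\<Sum>i\<in>I. f' i t) \<le> (\<Sum>i\<in>I. B i)"
      by (rule sum_norm_le) (use f' t in blast)
  next
    show "continuous_on {0..1} (\<lambda>t. \<Sum>i\<in>I. f' i t)"
      by (rule continuous_on_sum) (use f' in blast)
  qed
qed

lemma C1b_bilinear:
  assumes h: "bounded_bilinear h" "\<And>x y. norm (h x y) \<le> norm x * norm y"
    and f: "C1b A f" "\<And>t. t \<in> {0..1} \<Longrightarrow> norm (f t) \<le> M" and g: "C1b B g" "\<And>t. t \<in> {0..1} \<Longrightarrow> norm (g t) \<le> N"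
  shows "C1b (A * N + M * B) (\<lambda>t. h (f t) (g t))"
proof -
  interpret bounded_bilinear h by (rule h)
  obtain f' where f': "\<And>t. t \<in> {0..1} \<Longrightarrow> (f has_vector_derivative f' t) (at t within {0..1})"
    "continuous_on {0..1} f'" "\<And>t. t \<in> {0..1} \<Longrightarrow> norm (f' t) \<le> A" using f(1) unfolding C1b_def by blast
  obtain g' where g': "\<And>t. t \<in> {0..1} \<Longrightarrow> (g has_vector_derivative g' t) (at t within {0..1})"
    "continuous_on {0..1} g'" "\<And>t. t \<in> {0..1} \<Longrightarrow> norm (g' t) \<le> B" using g(1) unfolding C1b_def by blast
  show ?thesis
  proof (rule C1bI)
    fix t :: real assume t: "t \<in> {0..1}"
    show "((\<lambda>t. h (f t) (g t)) has_vector_derivative (h (f t) (g' t) + h (f' t) (g t))) (at t within {0..1})"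
      by (intro has_vector_derivative f' g' t)
    have A: "0 \<le> A" "0 \<le> M" using f'(3)[OF t] f(2)[OF t] norm_ge_zero order_trans by blast+
    have "norm (h (f t) (g' t)) \<le> M * B"
      by (rule order_trans[OF h(2)]) (intro mult_mono f g' t A norm_ge_zero)
    moreover have "norm (h (f' t) (g t)) \<le> A * N"
      by (rule order_trans[OF h(2)]) (intro mult_mono g f' t A norm_ge_zero)
    ultimately show "norm (h (f t) (g' t) + h (f' t) (g t)) \<le> A * N + M * B"
      using norm_triangle_ineq[of "h (f t) (g' t)" "h (f' t) (g t)"] by linarith
  next
    show "continuous_on {0..1} (\<lambda>t. h (f t) (g' t) + h (f' t) (g t))"
      by (intro continuous_on_add continuous_on f' g' C1b_cont[OF f(1)] C1b_cont[OF g(1)])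
  qed
qed

lemma C1b_normalize:
  fixes w :: "real \<Rightarrow> 'a::real_inner"
  assumes w: "C1b B w" and lo: "\<And>t. t \<in> {0..1} \<Longrightarrow> c \<le> norm (w t)" and hi: "\<And>t. t \<in> {0..1} \<Longrightarrow> norm (w t) \<le> M" and c: "c > 0"
  shows "C1b (B * (M\<^sup>2 / c^3 + 1 / c)) (\<lambda>t. (1 / norm (w t)) *\<^sub>R w t)"
proof -
  obtain w' where w': "\<And>t. t \<in> {0..1} \<Longrightarrow> (w has_vector_derivative w' t) (at t within {0..1})"
    "continuous_on {0..1} w'" "\<And>t. t \<in> {0..1} \<Longrightarrow> norm (w' t) \<le> B" using w unfolding C1b_def by blast
  have nz: "w t \<bullet> w t > 0" if "t \<in> {0..1}" for t using lo[OF that] c by auto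
  define s where "s t = 1 / sqrt (w t \<bullet> w t)" for t
  define s' where "s' t = - (w t \<bullet> w' t) / (norm (w t))^3" for t
  have ds: "(s has_vector_derivative s' t) (at t within {0..1})" if t: "t \<in> {0..1}" for t
  proof -
    have 1: "((\<lambda>t. w t \<bullet> w t) has_real_derivative (w t \<bullet> w' t + w' t \<bullet> w t)) (at t within {0..1})"
      unfolding has_real_derivative_iff_has_vector_derivative
      by (rule bounded_bilinear.has_vector_derivative[OF bounded_bilinear_inner w'(1)[OF t] w'(1)[OF t]])
    have 2: "(s has_real_derivative
        - ((w t \<bullet> w' t + w' t \<bullet> w t) * (inverse (sqrt (w t \<bullet> w t)) / 2)) / (sqrt (w t \<bullet> w t) * sqrt (w t \<bullet> w t))) (at t within {0..1})"
      unfolding s_def using nz[OF t] by (auto intro!: derivative_eq_intros 1 simp: field_simps simp del: inner_gt_zero_iff)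
    moreover have "- ((w t \<bullet> w' t + w' t \<bullet> w t) * (inverse (sqrt (w t \<bullet> w t)) / 2)) / (sqrt (w t \<bullet> w t) * sqrt (w t \<bullet> w t)) = s' t"
      using nz[OF t] by (simp add: s'_def norm_eq_sqrt_inner[symmetric] inner_commute power3_eq_cube field_simps)
    ultimately show ?thesis by (simp add: has_real_derivative_iff_has_vector_derivative)
  qed
  have cw: "continuous_on {0..1} w" by (rule C1b_cont[OF w])
  have wn: "norm (w t) \<noteq> 0" if "t \<in> {0..1}" for t using lo[OF that] c by auto
  have s: "C1b (M * B / c^3) s"
  proof (rule C1bI[OF ds])
    show "continuous_on {0..1} s'" unfolding s'_def
      by (intro continuous_intros cw w') (use wn in auto)
    fix t :: real assume t: "t \<in> {0..1}"
    have "norm (s' t) = \<bar>w t \<bullet> w' t\<bar> / (norm (w t))^3" by (simp add: s'_def)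
    also have "\<dots> \<le> (M * B) / c^3"
    proof (rule frac_le)
      have "\<bar>w t \<bullet> w' t\<bar> \<le> norm (w t) * norm (w' t)" by (rule Cauchy_Schwarz_ineq2)
      also have "\<dots> \<le> M * B" using order_trans[OF norm_ge_zero hi[OF t]] by (intro mult_mono hi w' t) auto
      finally show "\<bar>w t \<bullet> w' t\<bar> \<le> M * B" .
      then show "0 \<le> M * B" by linarith
      show "c^3 \<le> (norm (w t))^3" using lo[OF t] c by (intro power_mono) auto
    qed (use c in auto)
    finally show "norm (s' t) \<le> M * B / c^3" .
  qed
  have "C1b (M * B / c^3 * M + 1 / c * B) (\<lambda>t. s t *\<^sub>R w t)"
  proof (rule C1b_bilinear[OF bounded_bilinear_scaleR _ s _ w hi])
    show "norm (s t) \<le> 1 / c" if "t \<in> {0..1}" for t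
      using lo[OF that] c by (simp add: s_def norm_eq_sqrt_inner[symmetric] frac_le)
  qed auto
  then show ?thesis by (simp add: s_def norm_eq_sqrt_inner[symmetric] power2_eq_square algebra_simps)
qed

section \<open>Gram-Schmidt orthonormalisation\<close>

text \<open>Indexed from 1, to match the enumeration \<open>pos\<close> of the coordinates.\<close>

function gram_schmidt :: "(nat \<Rightarrow> 'a::real_inner) \<Rightarrow> nat \<Rightarrow> 'a" where
  "gram_schmidt x k = (let w = x k - (\<Sum>j\<in>{1..<k}. (gram_schmidt x j \<bullet> x k) *\<^sub>R gram_schmidt x j)
     in (1 / norm w) *\<^sub>R w)"
  by auto
termination by (relation "Wellfounded.measure snd") auto

declare gram_schmidt.simps [simp del]

definition gs_residual :: "(nat \<Rightarrow> 'a::real_inner) \<Rightarrow> nat \<Rightarrow> 'a" where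
  "gs_residual x k = x k - (\<Sum>j\<in>{1..<k}. (gram_schmidt x j \<bullet> x k) *\<^sub>R gram_schmidt x j)"

lemma gram_schmidt_eq: "gram_schmidt x k = (1 / norm (gs_residual x k)) *\<^sub>R gs_residual x k"
  by (subst gram_schmidt.simps) (simp add: gs_residual_def Let_def)

lemma gram_schmidt_orthonormal:
  assumes "\<And>k. k \<in> {1..d} \<Longrightarrow> gs_residual x k \<noteq> 0" and "k \<in> {1..d}"
  shows "norm (gram_schmidt x k) = 1" "\<And>i. i \<in> {1..<k} \<Longrightarrow> gram_schmidt x i \<bullet> gram_schmidt x k = 0"
proof -
  have n1: "norm (gram_schmidt x k) = 1" if "k \<in> {1..d}" for k using assms(1)[OF that] by (simp add: gram_schmidt_eq)
  show "norm (gram_schmidt x k) = 1" by (rule n1[OF assms(2)])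
  show "gram_schmidt x i \<bullet> gram_schmidt x k = 0" if "i \<in> {1..<k}" for i
    using assms(2) that
  proof (induction k arbitrary: i rule: less_induct)
    case (less k)
    have o: "gram_schmidt x i \<bullet> gram_schmidt x j = (if j = i then 1 else 0)" if j: "j \<in> {1..<k}" for j
    proof -
      consider "j = i" | "i < j" | "j < i" by linarith
      then show ?thesis
      proof cases
        case 1 then show ?thesis using n1[of i] j less.prems by (simp add: norm_eq_1)
      next
        case 2 then show ?thesis using less.IH[of j i] j less.prems by auto
      next
        case 3 then show ?thesis using less.IH[of i j] j less.prems by (auto simp: inner_commute)
      qed
    qed
    have "gram_schmidt x i \<bullet> gs_residual x k
       = gram_schmidt x i \<bullet> x k - (\<Sum>j\<in>{1..<k}. (gram_schmidt x j \<bullet> x k) * (gram_schmidt x i \<bullet> gram_schmidt x j))"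
      by (simp add: gs_residual_def inner_diff_right inner_sum_right)
    also have "(\<Sum>j\<in>{1..<k}. (gram_schmidt x j \<bullet> x k) * (gram_schmidt x i \<bullet> gram_schmidt x j))
       = (\<Sum>j\<in>{1..<k}. if j = i then gram_schmidt x i \<bullet> x k else 0)"
      by (intro sum.cong refl) (simp add: o)
    also have "\<dots> = gram_schmidt x i \<bullet> x k" using less.prems by simp
    finally show ?case by (simp add: gram_schmidt_eq[of x k])
  qed
qed

lemma gram_schmidt_combination:
  "\<exists>c. gs_residual x k = x k - (\<Sum>j\<in>{1..<k}. c j *\<^sub>R x j)"
proof -
  have sp: "gram_schmidt x k \<in> span (x ` {1..k})" if "1 \<le> k" for k
    using that
  proof (induction k rule: less_induct)
    case (less k)
    have "gram_schmidt x j \<in> span (x ` {1..k})" if "j \<in> {1..<k}" for j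
    proof -
      have "gram_schmidt x j \<in> span (x ` {1..j})" using less.IH[of j] that by simp
      moreover have "span (x ` {1..j}) \<subseteq> span (x ` {1..k})" by (intro span_mono image_mono) (use that in auto)
      ultimately show ?thesis by (rule subsetD[rotated])
    qed
    then have "gs_residual x k \<in> span (x ` {1..k})"
      unfolding gs_residual_def
      by (intro span_diff span_sum span_scale) (use less.prems in \<open>auto intro: span_base\<close>)
    then show ?case unfolding gram_schmidt_eq by (rule span_scale)
  qed
  have "(\<Sum>j\<in>{1..<k}. (gram_schmidt x j \<bullet> x k) *\<^sub>R gram_schmidt x j) \<in> span (x ` {1..<k})"
  proof (intro span_sum span_scale)
    fix j assume j: "j \<in> {1..<k}"
    show "gram_schmidt x j \<in> span (x ` {1..<k})"
    proof -
      have "gram_schmidt x j \<in> span (x ` {1..j})" using sp[of j] j by simp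
      moreover have "span (x ` {1..j}) \<subseteq> span (x ` {1..<k})" by (intro span_mono image_mono) (use j in auto)
      ultimately show ?thesis by (rule subsetD[rotated])
    qed
  qed
  moreover have "\<exists>c. y = (\<Sum>j\<in>{1..<k}. c j *\<^sub>R x j)" if "y \<in> span (x ` {1..<k})" for y
    using that
  proof (induction rule: span_induct_alt)
    case base then show ?case by (intro exI[of _ "\<lambda>_. 0"]) simp
  next
    case (step a b y)
    obtain j where j: "j \<in> {1..<k}" "b = x j" using step(1) by blast
    obtain c where c0: "y = (\<Sum>j\<in>{1..<k}. c j *\<^sub>R x j)" using step by blast
    note c = c0 j
    have "a *\<^sub>R b + y = (\<Sum>i\<in>{1..<k}. (if i = j then a else 0) *\<^sub>R x i) + (\<Sum>i\<in>{1..<k}. c i *\<^sub>R x i)"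
    proof -
      have "(\<Sum>i\<in>{1..<k}. (if i = j then a else 0) *\<^sub>R x i) = (\<Sum>i\<in>{1..<k}. if i = j then a *\<^sub>R x j else 0)"
        by (intro sum.cong) auto
      also have "\<dots> = a *\<^sub>R x j" using c(2) by simp
      finally show ?thesis using c by simp
    qed
    also have "\<dots> = (\<Sum>i\<in>{1..<k}. ((if i = j then a else 0) + c i) *\<^sub>R x i)"
      by (simp add: scaleR_add_left sum.distrib)
    finally show ?case by (intro exI[of _ "\<lambda>i. (if i = j then a else 0) + c i"])
  qed
  ultimately show ?thesis unfolding gs_residual_def by metis
qed

lemma gram_schmidt_orth_earlier:
  assumes "\<And>k. k \<in> {1..d} \<Longrightarrow> gs_residual x k \<noteq> 0" and "1 \<le> k" "k < i" "i \<le> d"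
  shows "gram_schmidt x i \<bullet> x k = 0"
proof -
  define y where "y = norm (gs_residual x k) *\<^sub>R gram_schmidt x k + (\<Sum>j\<in>{1..<k}. (gram_schmidt x j \<bullet> x k) *\<^sub>R gram_schmidt x j)"
  have "norm (gs_residual x k) *\<^sub>R gram_schmidt x k = gs_residual x k"
    using assms(1)[of k] assms(2-4) by (simp add: gram_schmidt_eq)
  then have "x k = y" by (simp add: y_def gs_residual_def)
  then have "gram_schmidt x i \<bullet> x k = gram_schmidt x i \<bullet> y" by simp
  also have "\<dots> = norm (gs_residual x k) * (gram_schmidt x i \<bullet> gram_schmidt x k)
     + (\<Sum>j\<in>{1..<k}. (gram_schmidt x j \<bullet> x k) * (gram_schmidt x i \<bullet> gram_schmidt x j))"
    by (simp add: y_def inner_add_right inner_sum_right)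
  finally have "gram_schmidt x i \<bullet> x k = norm (gs_residual x k) * (gram_schmidt x i \<bullet> gram_schmidt x k)
     + (\<Sum>j\<in>{1..<k}. (gram_schmidt x j \<bullet> x k) * (gram_schmidt x i \<bullet> gram_schmidt x j))" .
  moreover have "gram_schmidt x i \<bullet> gram_schmidt x j = 0" if "j \<in> {1..k}" for j
    using gram_schmidt_orthonormal(2)[where d=d and x=x and k=i and i=j, OF assms(1)] that assms by (auto simp: inner_commute)
  ultimately show ?thesis using assms by simp
qed

text \<open>Constants uniform in the family: orthonormalising keeps derivatives proportional to the
  derivatives of the given vectors.\<close>

lemma gram_schmidt_C1b:
  assumes c: "c > 0" and M: "M \<ge> 0"
  shows "\<exists>C\<ge>0. \<forall>(x :: real \<Rightarrow> nat \<Rightarrow> 'a::real_inner) \<delta>.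
    (\<forall>k\<in>{1..d}. C1b \<delta> (\<lambda>t. x t k) \<and> (\<forall>t\<in>{0..1}. norm (x t k) \<le> M \<and> c \<le> norm (gs_residual (x t) k))) \<longrightarrow>
    (\<forall>k\<in>{1..d}. C1b (C * \<delta>) (\<lambda>t. gram_schmidt (x t) k))"
proof -
  have step: "\<exists>C\<ge>0. \<forall>(x :: real \<Rightarrow> nat \<Rightarrow> 'a) \<delta>.
    (\<forall>k\<in>{1..d}. C1b \<delta> (\<lambda>t. x t k) \<and> (\<forall>t\<in>{0..1}. norm (x t k) \<le> M \<and> c \<le> norm (gs_residual (x t) k))) \<longrightarrow>
    (\<forall>k\<in>{1..n}. C1b (C * \<delta>) (\<lambda>t. gram_schmidt (x t) k))" if "n \<le> d" for n
    using that
  proof (induction n)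
    case 0 then show ?case by auto
  next
    case (Suc n)
    then obtain C where C: "C \<ge> 0" "\<And>(x :: real \<Rightarrow> nat \<Rightarrow> 'a) \<delta> k.
      (\<forall>k\<in>{1..d}. C1b \<delta> (\<lambda>t. x t k) \<and> (\<forall>t\<in>{0..1}. norm (x t k) \<le> M \<and> c \<le> norm (gs_residual (x t) k))) \<Longrightarrow>
      k\<in>{1..n} \<Longrightarrow> C1b (C * \<delta>) (\<lambda>t. gram_schmidt (x t) k)" by (meson Suc_leD)
    define R where "R = M + real n * M"
    define C' where "C' = (1 + real n * (2 * C * M + 1)) * (R\<^sup>2 / c^3 + 1 / c)"
    have R0: "R \<ge> 0" using M by (simp add: R_def)
    have C'0: "C' \<ge> 0" unfolding C'_def using C(1) M c by simp
    show ?case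
    proof (intro exI[of _ "C + C'"] conjI allI impI ballI)
      show "0 \<le> C + C'" using C(1) C'0 by simp
      fix x :: "real \<Rightarrow> nat \<Rightarrow> 'a" and \<delta> k
      assume x: "\<forall>k\<in>{1..d}. C1b \<delta> (\<lambda>t. x t k) \<and> (\<forall>t\<in>{0..1}. norm (x t k) \<le> M \<and> c \<le> norm (gs_residual (x t) k))"
        and k: "k \<in> {1..Suc n}"
      have IH: "C1b (C * \<delta>) (\<lambda>t. gram_schmidt (x t) j)" if "j \<in> {1..n}" for j by (rule C(2)[OF x that])
      have n1: "norm (gram_schmidt (x t) j) = 1" if "j \<in> {1..d}" "t \<in> {0..1}" for j t
      proof -
        have "gs_residual (x t) j \<noteq> 0" using x that c by force
        then show ?thesis by (simp add: gram_schmidt_eq)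
      qed
      have nd: "Suc n \<in> {1..d}" using Suc.prems by simp
      have xn: "C1b \<delta> (\<lambda>t. x t (Suc n))" "\<And>t. t \<in> {0..1} \<Longrightarrow> norm (x t (Suc n)) \<le> M" using x nd by auto
      obtain f' :: "real \<Rightarrow> 'a" where "norm (f' 0) \<le> \<delta>" using C1bE[OF xn(1)] by (metis atLeastAtMost_iff order_refl zero_le_one)
      then have \<delta>: "0 \<le> \<delta>" using norm_ge_zero order_trans by blast
      show "C1b ((C + C') * \<delta>) (\<lambda>t. gram_schmidt (x t) k)"
      proof (cases "k = Suc n")
        case False
        then have "C1b (C * \<delta>) (\<lambda>t. gram_schmidt (x t) k)" using IH k by auto
        then show ?thesis by (rule C1b_mono) (use C'0 \<delta> in \<open>auto intro: mult_right_mono\<close>)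
      next
        case True
        have summand: "C1b ((2 * C * M + 1) * \<delta>) (\<lambda>t. (gram_schmidt (x t) j \<bullet> x t (Suc n)) *\<^sub>R gram_schmidt (x t) j)"
          if j: "j \<in> {1..n}" for j
        proof -
          have jd: "j \<in> {1..d}" using j Suc.prems by auto
          have "C1b (C * \<delta> * M + 1 * \<delta>) (\<lambda>t. gram_schmidt (x t) j \<bullet> x t (Suc n))"
            by (rule C1b_bilinear[OF bounded_bilinear_inner _ IH[OF j] _ xn])
               (use n1[OF jd] in \<open>auto simp: Cauchy_Schwarz_ineq2\<close>)
          note inner_bd = this
          have "C1b ((C * \<delta> * M + 1 * \<delta>) * 1 + M * (C * \<delta>)) (\<lambda>t. (gram_schmidt (x t) j \<bullet> x t (Suc n)) *\<^sub>R gram_schmidt (x t) j)"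
          proof (rule C1b_bilinear[OF bounded_bilinear_scaleR _ inner_bd _ IH[OF j]])
            fix t :: real assume t: "t \<in> {0..1}"
            show "norm (gram_schmidt (x t) j \<bullet> x t (Suc n)) \<le> M"
              using Cauchy_Schwarz_ineq2[of "gram_schmidt (x t) j" "x t (Suc n)"] n1[OF jd t] xn(2)[OF t] by simp
          qed (use n1[OF jd] in auto)
          then show ?thesis by (simp add: algebra_simps)
        qed
        have "C1b (\<delta> + (\<Sum>j\<in>{1..<Suc n}. (2 * C * M + 1) * \<delta>)) (\<lambda>t. gs_residual (x t) (Suc n))"
          unfolding gs_residual_def by (intro C1b_diff xn C1b_sum summand) auto
        then have res: "C1b (\<delta> * (1 + real n * (2 * C * M + 1))) (\<lambda>t. gs_residual (x t) (Suc n))" by (simp add: algebra_simps)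
        have "norm (gs_residual (x t) (Suc n)) \<le> R" if t: "t \<in> {0..1}" for t
        proof -
          have "norm (gs_residual (x t) (Suc n)) \<le> norm (x t (Suc n)) + norm (\<Sum>j\<in>{1..<Suc n}. (gram_schmidt (x t) j \<bullet> x t (Suc n)) *\<^sub>R gram_schmidt (x t) j)"
            unfolding gs_residual_def by (rule norm_triangle_ineq4)
          also have "\<dots> \<le> M + (\<Sum>j\<in>{1..<Suc n}. M)"
          proof (intro add_mono xn(2)[OF t] sum_norm_le)
            fix j assume "j \<in> {1..<Suc n}"
            then have jd: "j \<in> {1..d}" using Suc.prems by auto
            show "norm ((gram_schmidt (x t) j \<bullet> x t (Suc n)) *\<^sub>R gram_schmidt (x t) j) \<le> M"
              using Cauchy_Schwarz_ineq2[of "gram_schmidt (x t) j" "x t (Suc n)"] n1[OF jd t] xn(2)[OF t] by simp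
          qed
          finally show ?thesis by (simp add: R_def)
        qed
        from C1b_normalize[OF res _ this c]
        have "C1b (\<delta> * (1 + real n * (2 * C * M + 1)) * (R\<^sup>2 / c^3 + 1 / c)) (\<lambda>t. gram_schmidt (x t) (Suc n))"
          unfolding gram_schmidt_eq using x nd by blast
        then have "C1b (C' * \<delta>) (\<lambda>t. gram_schmidt (x t) (Suc n))" by (simp add: C'_def mult_ac)
        then show ?thesis unfolding True by (rule C1b_mono) (use C(1) \<delta> in \<open>auto intro: mult_right_mono\<close>)
      qed
    qed
  qed
  show ?thesis by (rule step[OF order_refl])
qed

section \<open>Gram-Schmidt frames of unitriangular matrices\<close>

definition unitri :: "real \<Rightarrow> real^'n^'n::finite \<Rightarrow> bool" where
  "unitri T m \<longleftrightarrow> (\<forall>i. m $ i $ i = 1) \<and> (\<forall>i j. pos i < pos j \<longrightarrow> m $ i $ j = 0) \<and> (\<forall>i j. \<bar>m $ i $ j\<bar> \<le> T)"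

lemma unip_unitri: "unip P T m \<Longrightarrow> 1 \<le> T \<Longrightarrow> unitri T m"
proof -
  assume m: "unip P T m" and T: "1 \<le> T"
  have "m $ i $ j = (if i = j then 1 else 0) \<or> (below P i j \<and> \<bar>m $ i $ j\<bar> \<le> T)" for i j
    using m by (simp add: unip_def)
  then show ?thesis using T below_less unfolding unitri_def
    by (smt (verit) less_asym less_irrefl)
qed

lemma unitri_bounds_vector:
  fixes m :: "real^'n^'n"
  assumes m: "unitri T m" and T: "0 \<le> T"
  shows "\<bar>y $ j\<bar> \<le> (1 + real CARD('n) * T) ^ pos j * norm (m *v y)"
proof (induction "pos j" arbitrary: j rule: less_induct)
  case less
  let ?R = "1 + real CARD('n) * T" and ?N = "norm (m *v y)"
  have R1: "1 \<le> ?R" using T by simp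
  have "(m *v y) $ j = (\<Sum>k\<in>UNIV. m $ j $ k * y $ k)" by (simp add: matrix_vector_mult_def)
  also have "\<dots> = y $ j + (\<Sum>k\<in>UNIV - {j}. m $ j $ k * y $ k)"
    using m by (subst sum.remove[of _ j]) (auto simp: unitri_def)
  finally have "\<bar>y $ j\<bar> \<le> \<bar>(m *v y) $ j\<bar> + \<bar>\<Sum>k\<in>UNIV - {j}. m $ j $ k * y $ k\<bar>" by linarith
  also have "\<dots> \<le> ?N + (\<Sum>k\<in>UNIV - {j}. T * (?R ^ (pos j - 1) * ?N))"
  proof (intro add_mono component_le_norm_cart order_trans[OF sum_abs] sum_mono)
    fix k assume k: "k \<in> UNIV - {j}"
    show "\<bar>m $ j $ k * y $ k\<bar> \<le> T * (?R ^ (pos j - 1) * ?N)"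
    proof (cases "pos k < pos j")
      case True
      have "\<bar>y $ k\<bar> \<le> ?R ^ pos k * ?N" by (rule less[OF True])
      also have "\<dots> \<le> ?R ^ (pos j - 1) * ?N" using True R1 by (intro mult_right_mono power_increasing) auto
      finally show ?thesis using m T by (auto simp: abs_mult unitri_def intro!: mult_mono)
    next
      case False
      then have "pos j < pos k" using k by (auto simp: not_less le_less)
      then show ?thesis using m T by (auto simp: unitri_def)
    qed
  qed
  also have "\<dots> \<le> ?N + real CARD('n) * (T * (?R ^ (pos j - 1) * ?N))"
    using T R1 by (simp add: card_Diff_singleton mult_right_mono)
  also have "\<dots> \<le> ?R ^ (pos j - 1) * ?N + real CARD('n) * (T * (?R ^ (pos j - 1) * ?N))"
    using mult_right_mono[OF one_le_power[OF R1, of "pos j - 1"], of ?N] by simp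
  also have "\<dots> = ?R ^ Suc (pos j - 1) * ?N" by (simp add: algebra_simps)
  also have "Suc (pos j - 1) = pos j" using pos_ge_1[of j] by (simp del: pos_ge_1)
  finally show ?case .
qed

definition cols :: "real^'n^'n \<Rightarrow> nat \<Rightarrow> real^'n::finite" where
  "cols m k = column (ix k) m"

definition gs_frame :: "real^'n^'n \<Rightarrow> real^'n^'n::finite" where
  "gs_frame m = (\<chi> i j. gram_schmidt (cols m) (pos j) $ i)"

lemma column_gs_frame: "column j (gs_frame m) = gram_schmidt (cols m) (pos j)"
  by (simp add: gs_frame_def column_def)

text \<open>A lower bound uniform over all unitriangular matrices with bounded entries: it keeps the normalisation step away from
  its singularity, so that orthonormalisation is uniformly smooth.\<close>

lemma unitri_residual:
  fixes m :: "real^'n^'n"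
  assumes m: "unitri T m" and T: "0 \<le> T" and k: "k \<in> {1..CARD('n)}"
  shows "1 / (1 + real CARD('n) * T) ^ CARD('n) \<le> norm (gs_residual (cols m) k)"
proof -
  let ?R = "1 + real CARD('n) * T"
  have R1: "1 \<le> ?R" using T by simp
  obtain c where c: "gs_residual (cols m) k = cols m k - (\<Sum>j\<in>{1..<k}. c j *\<^sub>R cols m j)"
    using gram_schmidt_combination by blast
  define y :: "real^'n" where "y = (\<chi> i. if pos i = k then 1 else if pos i < k then - c (pos i) else 0)"
  have "m *v y = (\<Sum>i\<in>UNIV. y $ i *\<^sub>R column i m)" by (simp add: matrix_mult_sum scalar_mult_eq_scaleR)
  also have "\<dots> = (\<Sum>j\<in>{1..CARD('n)}. y $ ix j *\<^sub>R column (ix j) m)"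
    by (rule sum.reindex_bij_betw[OF ix_bij, symmetric])
  also have "\<dots> = (\<Sum>j\<in>{1..k}. y $ ix j *\<^sub>R cols m j)"
    unfolding cols_def by (rule sum.mono_neutral_right) (use k in \<open>auto simp: y_def\<close>)
  also have "\<dots> = y $ ix k *\<^sub>R cols m k + (\<Sum>j\<in>{1..<k}. y $ ix j *\<^sub>R cols m j)"
    using k by (subst sum.remove[of _ k]) (auto intro: sum.cong)
  also have "(\<Sum>j\<in>{1..<k}. y $ ix j *\<^sub>R cols m j) = (\<Sum>j\<in>{1..<k}. - (c j *\<^sub>R cols m j))"
    using k by (intro sum.cong refl) (auto simp: y_def)
  also have "y $ ix k *\<^sub>R cols m k + \<dots> = gs_residual (cols m) k"
    using k by (simp add: c y_def sum_negf)
  finally have my: "m *v y = gs_residual (cols m) k" .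
  have "1 = \<bar>y $ ix k\<bar>" using k by (simp add: y_def)
  also have "\<dots> \<le> ?R ^ pos (ix k :: 'n) * norm (m *v y)" by (rule unitri_bounds_vector[OF m T])
  also have "\<dots> \<le> ?R ^ CARD('n) * norm (m *v y)" using R1 by (intro mult_right_mono power_increasing) auto
  finally show ?thesis using R1 by (simp add: my field_simps)
qed

lemma
  fixes m :: "real^'n^'n"
  assumes m: "unitri T m"
  shows orthogonal_gs_frame: "orthogonal_matrix (gs_frame m)"
    and gs_frame_triangular: "pos j < pos i \<Longrightarrow> (transpose (gs_frame m) ** m) $ i $ j = 0"
proof -
  have T: "0 \<le> T" using m by (meson abs_ge_zero order_trans unitri_def)
  have nz: "gs_residual (cols m) k \<noteq> 0" if "k \<in> {1..CARD('n)}" for k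
  proof -
    have "0 < 1 / (1 + real CARD('n) * T) ^ CARD('n)" using T by (simp add: add_pos_nonneg)
    then have "0 < norm (gs_residual (cols m) k)" using unitri_residual[OF m T that] by linarith
    then show ?thesis by simp
  qed
  note on = gram_schmidt_orthonormal[where d="CARD('n)" and x="cols m", OF nz]
  have "gram_schmidt (cols m) (pos i) \<bullet> gram_schmidt (cols m) (pos j) = 0" if "i \<noteq> j" for i j :: 'n
  proof (cases "pos i < pos j")
    case True then show ?thesis using on(2)[of "pos j" "pos i"] by simp
  next
    case False
    then have "pos j < pos i" using that by (auto simp: not_less le_less)
    then show ?thesis using on(2)[of "pos i" "pos j"] by (simp add: inner_commute)
  qed
  then show "orthogonal_matrix (gs_frame m)"
    unfolding orthogonal_matrix_orthonormal_columns column_gs_frame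
    using on(1) by (auto simp: orthogonal_def)
  assume ij: "pos j < pos i"
  have "(transpose (gs_frame m) ** m) $ i $ j = gram_schmidt (cols m) (pos i) \<bullet> column j m"
    using sandwich_entry[of "gs_frame m" "mat 1" m i j] by (simp add: column_gs_frame)
  also have "column j m = cols m (pos j)" by (simp add: cols_def)
  also have "gram_schmidt (cols m) (pos i) \<bullet> cols m (pos j) = 0"
    by (rule gram_schmidt_orth_earlier[OF nz]) (use ij in auto)
  finally show "(transpose (gs_frame m) ** m) $ i $ j = 0" .
qed

lemma unitri_det_nz: "unitri T m \<Longrightarrow> det m \<noteq> 0"
  by (rule lower_unitriangular_det_nz) (auto simp: unitri_def)

text \<open>Orthonormalising the columns in order is a triangular change of basis, which stabilises the standard flag.\<close>

lemma frame_flag_gs_frame: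
  fixes m Q :: "real^'n^'n"
  assumes P: "P \<subseteq> {1..CARD('n)}" and m: "unitri T m" and Q: "orthogonal_matrix Q"
  shows "frame_flag P (Q ** gs_frame m) = frame_flag P (Q ** m)"
proof -
  note K = orthogonal_gs_frame[OF m]
  let ?q = "transpose (gs_frame m) ** m"
  have "frame_flag P ((Q ** gs_frame m) ** ?q) = frame_flag P (Q ** gs_frame m)"
    by (rule frame_flag_blocktri[OF P])
       (use orthogonal_det_nz[OF Q] orthogonal_det_nz[OF K] unitri_det_nz[OF m] gs_frame_triangular[OF m]
         in \<open>auto simp: det_mul det_transpose blocktri_def\<close>)
  moreover have "(Q ** gs_frame m) ** ?q = Q ** (gs_frame m ** transpose (gs_frame m)) ** m" by (simp add: matrix_mul_assoc)
  ultimately show ?thesis by (simp add: orthogonal_matrix_transpose_mult[OF K])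
qed

lemma bounded_bilinear_matrix_mult: "bounded_bilinear (\<lambda>(A :: real^'n^'n) (B :: real^'n^'n). A ** B)"
  unfolding bilinear_conv_bounded_bilinear[symmetric] bilinear_def
  by (auto intro!: linearI simp: matrix_matrix_mult_def vec_eq_iff sum.distrib sum_distrib_left algebra_simps)

lemma matrix_mult_diff_right: "A ** (B - C) = A ** B - A ** C" for A B C :: "real^'n^'n"
  by (simp add: matrix_matrix_mult_def vec_eq_iff sum_subtractf algebra_simps)

lemma matrix_mult_diff_left: "(A - B) ** C = A ** C - B ** C" for A B C :: "real^'n^'n"
  by (simp add: matrix_matrix_mult_def vec_eq_iff sum_subtractf algebra_simps)

lemma matrix_mult_minus_left: "(- A) ** B = - (A ** B)" for A B :: "real^'n^'n"
  by (simp add: matrix_matrix_mult_def vec_eq_iff sum_negf)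

lemma has_vector_derivative_matrix_mult:
  fixes A B :: "real \<Rightarrow> real^'n^'n"
  assumes "(A has_vector_derivative A') (at t within X)" "(B has_vector_derivative B') (at t within X)"
  shows "((\<lambda>s. A s ** B s) has_vector_derivative (A t ** B' + A' ** B t)) (at t within X)"
  by (rule bounded_bilinear.has_vector_derivative[OF bounded_bilinear_matrix_mult assms])

lemma has_vector_derivative_transpose:
  fixes A :: "real \<Rightarrow> real^'n^'n"
  assumes "(A has_vector_derivative A') F"
  shows "((\<lambda>s. transpose (A s)) has_vector_derivative transpose A') F"
proof -
  have "bounded_linear (transpose :: real^'n^'n \<Rightarrow> real^'n^'n)"
    unfolding linear_conv_bounded_linear[symmetric]
    by (auto intro!: linearI simp: transpose_def vec_eq_iff)
  then show ?thesis using assms by (rule bounded_linear.has_vector_derivative)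
qed

lemma norm_matrix_le:
  fixes A :: "real^'n^'n"
  assumes "\<And>i j. \<bar>A $ i $ j\<bar> \<le> b"
  shows "norm A \<le> (real CARD('n))\<^sup>2 * b"
proof -
  have "norm A \<le> (\<Sum>i\<in>UNIV. norm (A $ i))" by (simp add: norm_vec_def L2_set_le_sum)
  also have "\<dots> \<le> (\<Sum>i\<in>(UNIV::'n set). \<Sum>j\<in>(UNIV::'n set). \<bar>A $ i $ j\<bar>)" by (intro sum_mono norm_le_l1_cart)
  also have "\<dots> \<le> (\<Sum>i\<in>(UNIV::'n set). \<Sum>j\<in>(UNIV::'n set). b)" by (intro sum_mono assms)
  finally show ?thesis by (simp add: power2_eq_square mult.assoc)
qed

lemma entry_le_norm: "\<bar>A $ i $ j\<bar> \<le> norm (A :: real^'n^'m::finite)"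
  by (rule order_trans[OF component_le_norm_cart Finite_Cartesian_Product.norm_nth_le])

lemma unique_derivative_of_constant:
  fixes f :: "real \<Rightarrow> 'a::real_normed_vector"
  assumes "t \<in> {0..1}" "\<And>s. s \<in> {0..1} \<Longrightarrow> f s = c" "(f has_vector_derivative f') (at t within {0..1})"
  shows "f' = 0"
proof -
  have "((\<lambda>_. c) has_vector_derivative f') (at t within {0..1})"
    by (rule has_vector_derivative_transform[OF assms(1) _ assms(3)]) (simp add: assms(2))
  moreover have "((\<lambda>_. c) has_vector_derivative 0) (at t within {0..1})" by simp
  ultimately show ?thesis
    using vector_derivative_unique_within_closed_interval[of 0 1 t "\<lambda>_. c" f' 0] assms(1)
    by (auto simp: cbox_interval)
qed

text \<open>Orthonormalising the affine path between two unitriangular matrices gives a path of orthogonal frames. Its derivative is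
  written as \<open>K Y\<close> with \<open>Y\<close> skew-symmetric, because an invariant metric measures it by \<open>Y\<close> alone, independently of \<open>K\<close>.\<close>

lemma gs_frame_path:
  assumes T: "1 \<le> T"
  shows "\<exists>C\<ge>0. \<forall>(A :: real^'n^'n::finite) B \<delta>.
    (\<forall>t\<in>{0..1}. unitri T (A + t *\<^sub>R B)) \<longrightarrow> (\<forall>i j. \<bar>B $ i $ j\<bar> \<le> \<delta>) \<longrightarrow>
    (\<exists>Y. (\<forall>t\<in>{0..1}. ((\<lambda>t. gs_frame (A + t *\<^sub>R B)) has_vector_derivative (gs_frame (A + t *\<^sub>R B) ** Y t)) (at t within {0..1}) \<and>
        transpose (Y t) = - Y t \<and> norm (Y t) \<le> C * \<delta>) \<and> continuous_on {0..1} Y)"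
proof -
  let ?d = "CARD('n)"
  define c where "c = 1 / (1 + real ?d * T) ^ ?d"
  define M where "M = real ?d * T"
  have c: "c > 0" unfolding c_def using T by (simp add: add_pos_nonneg)
  have M: "M \<ge> 0" unfolding M_def using T by simp
  obtain C where C: "C \<ge> 0" "\<And>(x :: real \<Rightarrow> nat \<Rightarrow> real^'n) \<delta> k.
    (\<forall>k\<in>{1..?d}. C1b \<delta> (\<lambda>t. x t k) \<and> (\<forall>t\<in>{0..1}. norm (x t k) \<le> M \<and> c \<le> norm (gs_residual (x t) k))) \<Longrightarrow>
    k\<in>{1..?d} \<Longrightarrow> C1b (C * \<delta>) (\<lambda>t. gram_schmidt (x t) k)"
    using gram_schmidt_C1b[OF c M, where 'a="real^'n" and d="?d"] by blast
  define C' where "C' = (real ?d)\<^sup>2 * (C * real ?d)"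
  have C'0: "0 \<le> C'" using C(1) by (simp add: C'_def)
  show ?thesis
  proof (rule exI[of _ C'], rule conjI[OF C'0], intro allI impI)
    fix A B :: "real^'n^'n" and \<delta>
    define m where "m t = A + t *\<^sub>R B" for t
    assume "\<forall>t\<in>{0..1}. unitri T (A + t *\<^sub>R B)"
    then have m: "unitri T (m t)" if "t \<in> {0..1}" for t using that by (simp add: m_def)
    assume \<delta>: "\<forall>i j. \<bar>B $ i $ j\<bar> \<le> \<delta>"
    have nc: "norm (column k X) \<le> real ?d * b" if "\<And>i j. \<bar>X $ i $ j\<bar> \<le> b" for X :: "real^'n^'n" and b k
    proof -
      have "norm (column k X) \<le> (\<Sum>i\<in>UNIV. \<bar>column k X $ i\<bar>)" by (rule norm_le_l1_cart)
      also have "\<dots> \<le> (\<Sum>i\<in>(UNIV::'n set). b)" using that by (intro sum_mono) (simp add: column_def)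
      finally show ?thesis by simp
    qed
    have col: "C1b (real ?d * \<delta>) (\<lambda>t. cols (m t) k)" for k
    proof (rule C1bI[where f'="\<lambda>t. column (ix k) B"])
      have cc: "cols (m t) k = column (ix k) A + t *\<^sub>R column (ix k) B" for t
        by (simp add: cols_def column_def m_def vec_eq_iff)
      show "((\<lambda>t. cols (m t) k) has_vector_derivative column (ix k) B) (at t within {0..1})" for t
        unfolding cc by (auto intro!: derivative_eq_intros)
      show "norm (column (ix k) B) \<le> real ?d * \<delta>" for t :: real by (rule nc) (use \<delta> in blast)
    qed auto
    have "C1b (C * (real ?d * \<delta>)) (\<lambda>t. gram_schmidt (cols (m t)) k)" if "k \<in> {1..?d}" for k
    proof (rule C(2)[OF _ that], intro ballI conjI)
      fix k t assume k: "k \<in> {1..?d}" and t: "t \<in> {0..1::real}"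
      show "norm (cols (m t) k) \<le> M" unfolding M_def cols_def
        by (rule nc) (use m[OF t] in \<open>simp add: unitri_def\<close>)
      show "c \<le> norm (gs_residual (cols (m t)) k)" unfolding c_def
        by (rule unitri_residual[OF m[OF t] _ k]) (use T in simp)
    qed (rule col)
    then have "\<forall>j::'n. \<exists>f'. (\<forall>t\<in>{0..1}. ((\<lambda>t. gram_schmidt (cols (m t)) (pos j)) has_vector_derivative f' t) (at t within {0..1})) \<and>
       continuous_on {0..1} f' \<and> (\<forall>t\<in>{0..1}. norm (f' t) \<le> C * (real ?d * \<delta>))" unfolding C1b_def by simp
    then obtain k' where k': "\<And>(j::'n) t. t \<in> {0..1} \<Longrightarrow> ((\<lambda>t. gram_schmidt (cols (m t)) (pos j)) has_vector_derivative k' j t) (at t within {0..1})"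
       "\<And>j. continuous_on {0..1} (k' j)" "\<And>j t. t \<in> {0..1} \<Longrightarrow> norm (k' j t) \<le> C * (real ?d * \<delta>)" by metis
    define L where "L j v = (\<chi> i l. if l = j then v $ i else 0)" for j :: 'n and v :: "real^'n"
    have L: "bounded_linear (L j)" for j
      unfolding linear_conv_bounded_linear[symmetric] by (auto intro!: linearI simp: L_def vec_eq_iff)
    let ?K = "\<lambda>t. gs_frame (m t)"
    define K' where "K' t = (\<Sum>j\<in>UNIV. L j (k' j t))" for t
    have K'c: "column j (K' t) = k' j t" for j t
    proof -
      have "column j (K' t) $ i = k' j t $ i" for i
      proof -
        have "column j (K' t) $ i = (\<Sum>l\<in>UNIV. if l = j then k' j t $ i else 0)"
          unfolding K'_def column_def by (simp add: L_def) 
        then show ?thesis by simp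
      qed
      then show ?thesis by (simp add: vec_eq_iff)
    qed
    have Keq: "?K t = (\<Sum>j\<in>UNIV. L j (gram_schmidt (cols (m t)) (pos j)))" for t
      by (simp add: vec_eq_iff gs_frame_def L_def)
    have dK: "(?K has_vector_derivative K' t) (at t within {0..1})" if "t \<in> {0..1}" for t
      unfolding Keq K'_def
      by (intro has_vector_derivative_sum bounded_linear.has_vector_derivative[OF L] k' that)
    have cK': "continuous_on {0..1} K'" unfolding K'_def
      by (intro continuous_on_sum bounded_linear.continuous_on[OF L] k')
    have cK: "continuous_on {0..1} ?K"
      unfolding continuous_on_eq_continuous_within using dK has_vector_derivative_continuous by blast
    define Y where "Y t = transpose (?K t) ** K' t" for t
    have oK: "orthogonal_matrix (?K t)" if "t \<in> {0..1}" for t by (rule orthogonal_gs_frame[OF m[OF that]])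
    have KY: "?K t ** Y t = K' t" if "t \<in> {0..1}" for t
      by (simp add: Y_def matrix_mul_assoc orthogonal_matrix_transpose_mult[OF oK[OF that]])
    have skew: "transpose (Y t) = - Y t" if t: "t \<in> {0..1}" for t
    proof -
      have "((\<lambda>s. transpose (?K s) ** ?K s) has_vector_derivative (transpose (?K t) ** K' t + transpose (K' t) ** ?K t)) (at t within {0..1})"
        by (intro has_vector_derivative_matrix_mult has_vector_derivative_transpose dK t)
      from unique_derivative_of_constant[OF t _ this, of "mat 1"]
      have "transpose (?K t) ** K' t + transpose (K' t) ** ?K t = 0"
        using orthogonal_matrix_transpose_mult[OF oK] by blast
      then show ?thesis unfolding Y_def matrix_transpose_mul transpose_transpose
        by (simp add: add_eq_0_iff add.commute)
    qed
    have bd: "norm (Y t) \<le> C' * \<delta>" if t: "t \<in> {0..1}" for t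
    proof -
      have "norm (Y t) \<le> (real ?d)\<^sup>2 * (C * (real ?d * \<delta>))"
      proof (rule norm_matrix_le)
        fix i j
        have "Y t $ i $ j = column i (?K t) \<bullet> k' j t"
          using sandwich_entry[of "?K t" "mat 1" "K' t" i j] by (simp add: Y_def K'c)
        also have "\<bar>\<dots>\<bar> \<le> norm (column i (?K t)) * norm (k' j t)" by (rule Cauchy_Schwarz_ineq2)
        also have "norm (column i (?K t)) = 1" using oK[OF t] by (simp add: orthogonal_matrix_orthonormal_columns)
        finally show "\<bar>Y t $ i $ j\<bar> \<le> C * (real ?d * \<delta>)" using k'(3)[OF t, of j] by simp
      qed
      then show ?thesis by (simp add: C'_def mult_ac)
    qed
    have cY: "continuous_on {0..1} Y" unfolding Y_def continuous_on_def
      by (intro ballI tendsto_intros) (use cK cK' in \<open>auto simp: continuous_on_def\<close>)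
    show "\<exists>Y. (\<forall>t\<in>{0..1}. ((\<lambda>t. gs_frame (A + t *\<^sub>R B)) has_vector_derivative (gs_frame (A + t *\<^sub>R B) ** Y t)) (at t within {0..1}) \<and>
        transpose (Y t) = - Y t \<and> norm (Y t) \<le> C' * \<delta>) \<and> continuous_on {0..1} Y"
      unfolding m_def[symmetric]
    proof (intro exI[of _ Y] conjI ballI cY)
      fix t :: real assume t: "t \<in> {0..1}"
      show "(?K has_vector_derivative ?K t ** Y t) (at t within {0..1})" using dK[OF t] by (simp add: KY[OF t])
    qed (fact skew bd)+
  qed
qed

section \<open>Tangent vectors and invariant metrics\<close>

definition commutator :: "real^'n^'n \<Rightarrow> real^'n^'n \<Rightarrow> real^'n^'n::finite" where
  "commutator X D = X ** D - D ** X"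

lemma frame_path_flag_curve:
  fixes K :: "real \<Rightarrow> real^'n^'n::finite"
  assumes P: "P \<subseteq> {1..CARD('n)}" and Q: "orthogonal_matrix Q"
    and K: "\<And>t. t \<in> {0..1} \<Longrightarrow> orthogonal_matrix (K t)"
      "\<And>t. t \<in> {0..1} \<Longrightarrow> (K has_vector_derivative (K t ** Y t)) (at t within {0..1})"
      "\<And>t. t \<in> {0..1} \<Longrightarrow> transpose (Y t) = - Y t" "continuous_on {0..1} Y"
  shows "C1_flag_curve P (\<lambda>t. frame_flag P (Q ** K t))
     (\<lambda>t. (Q ** K t) ** commutator (Y t) (diag (level P)) ** transpose (Q ** K t))"
  unfolding C1_flag_curve_def
proof (intro conjI ballI)
  let ?D = "diag (level P) :: real^'n^'n"
  let ?c' = "\<lambda>t. (Q ** K t) ** commutator (Y t) ?D ** transpose (Q ** K t)"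
  have oQK: "orthogonal_matrix (Q ** K t)" if "t \<in> {0..1}" for t by (intro orthogonal_matrix_mul Q K that)
  fix t :: real assume t: "t \<in> {0..1}"
  show "frame_flag P (Q ** K t) \<in> flags P" by (rule frame_flag_in_flags[OF P orthogonal_det_nz[OF oQK[OF t]]])
  have dQK: "((\<lambda>s. Q ** K s) has_vector_derivative (Q ** (K t ** Y t))) (at t within {0..1})"
    using has_vector_derivative_matrix_mult[OF has_vector_derivative_const K(2)[OF t], of Q] by simp
  have dQD: "((\<lambda>s. (Q ** K s) ** ?D) has_vector_derivative (Q ** (K t ** Y t) ** ?D)) (at t within {0..1})"
    using has_vector_derivative_matrix_mult[OF dQK has_vector_derivative_const, of ?D] by simp
  have "((\<lambda>s. ((Q ** K s) ** ?D) ** transpose (Q ** K s)) has_vector_derivative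
      (((Q ** K t) ** ?D) ** transpose (Q ** (K t ** Y t)) + (Q ** (K t ** Y t) ** ?D) ** transpose (Q ** K t))) (at t within {0..1})"
    by (intro has_vector_derivative_matrix_mult dQD has_vector_derivative_transpose dQK)
  moreover have "((Q ** K t) ** ?D) ** transpose (Q ** (K t ** Y t)) + (Q ** (K t ** Y t) ** ?D) ** transpose (Q ** K t) = ?c' t"
  proof -
    have 1: "transpose (Q ** (K t ** Y t)) = - (Y t ** transpose (Q ** K t))"
    proof -
      have "transpose ((Q ** K t) ** Y t) = transpose (Y t) ** transpose (Q ** K t)" by (rule matrix_transpose_mul)
      also have "\<dots> = - (Y t ** transpose (Q ** K t))" unfolding K(3)[OF t] by (rule matrix_mult_minus_left)
      finally show ?thesis by (simp only: matrix_mul_assoc)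
    qed
    have "(A ** D) ** (- (y ** B)) + (A ** y ** D) ** B = A ** (y ** D - D ** y) ** B" for A D y B :: "real^'n^'n"
    proof -
      have "(A ** D) ** (- (y ** B)) = - (A ** (D ** y) ** B)"
        by (simp add: matrix_mul_assoc[symmetric]) (simp add: matrix_matrix_mult_def vec_eq_iff sum_negf)
      moreover have "A ** (y ** D - D ** y) ** B = A ** (y ** D) ** B - A ** (D ** y) ** B"
        by (simp add: matrix_mult_diff_right matrix_mult_diff_left)
      ultimately show ?thesis by (simp add: matrix_mul_assoc)
    qed
    from this[of "Q ** K t" ?D "Y t" "transpose (Q ** K t)"] show ?thesis
      unfolding 1 commutator_def by (simp only: matrix_mul_assoc)
  qed
  ultimately have "((\<lambda>s. ((Q ** K s) ** ?D) ** transpose (Q ** K s)) has_vector_derivative ?c' t) (at t within {0..1})" by simp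
  then show "((\<lambda>s. flag_embed P (frame_flag P (Q ** K s))) has_vector_derivative ?c' t) (at t within {0..1})"
    by (rule has_vector_derivative_transform[OF t, rotated]) (simp add: flag_embed_frame[OF oQK P])
next
  have "continuous_on {0..1} K"
    unfolding continuous_on_eq_continuous_within using K(2) has_vector_derivative_continuous by blast
  then show "continuous_on {0..1} (\<lambda>t. (Q ** K t) ** commutator (Y t) (diag (level P)) ** transpose (Q ** K t))"
    using K(4) unfolding continuous_on_def commutator_def by (intro ballI tendsto_intros tendsto_diff) auto
qed

definition strict_lower :: "real^'n^'n \<Rightarrow> real^'n^'n::finite" where
  "strict_lower X = (\<chi> i j. if pos j < pos i then X $ i $ j else 0)"

text \<open>Rotating the flag by a path in the orthogonal group with skew-symmetric velocity \<open>Y\<close> at the frame realises the commutator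
  as a velocity of the embedded flag.\<close>

lemma commutator_in_tangent:
  fixes X :: "real^'n^'n::finite"
  assumes P: "P \<subseteq> {1..CARD('n)}"
  defines "Z \<equiv> strict_lower X - transpose (strict_lower X)"
  shows "commutator Z (diag (level P)) \<in> flag_tangent P (frame_flag P (mat 1 :: real^'n^'n))"
proof -
  let ?B = "strict_lower X"
  define T where "T = 1 + norm X"
  have T: "1 \<le> T" by (simp add: T_def)
  have u: "unitri T (mat 1 + t *\<^sub>R ?B)" if t: "t \<in> {0..1}" for t
  proof -
    have "\<bar>(mat 1 + t *\<^sub>R ?B) $ i $ j\<bar> \<le> T" for i j
    proof -
      have "\<bar>t * X $ i $ j\<bar> \<le> 1 * norm X" unfolding abs_mult
        using t entry_le_norm[of X i j] by (intro mult_mono) auto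
      then show ?thesis by (auto simp: mat_def strict_lower_def T_def)
    qed
    then show ?thesis by (auto simp: unitri_def mat_def strict_lower_def)
  qed
  have bB: "\<forall>i j. \<bar>?B $ i $ j\<bar> \<le> norm X" using entry_le_norm[of X] by (simp add: strict_lower_def)
  let ?K = "\<lambda>t. gs_frame (mat 1 + t *\<^sub>R ?B)"
  obtain Y where Y: "\<And>t. t \<in> {0..1} \<Longrightarrow> (?K has_vector_derivative (?K t ** Y t)) (at t within {0..1})"
    "\<And>t. t \<in> {0..1} \<Longrightarrow> transpose (Y t) = - Y t" "continuous_on {0..1} Y"
    using gs_frame_path[OF T, where 'n='n] u bB by metis
  have oK: "orthogonal_matrix (?K t)" if "t \<in> {0..1}" for t by (rule orthogonal_gs_frame[OF u[OF that]])
  have curve: "C1_flag_curve P (\<lambda>t. frame_flag P (mat 1 ** ?K t))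
     (\<lambda>t. (mat 1 ** ?K t) ** commutator (Y t) (diag (level P)) ** transpose (mat 1 ** ?K t))"
    by (rule frame_path_flag_curve[OF P _ oK Y]) (auto simp: orthogonal_matrix_id)
  have 0: "(0::real) \<in> {0..1}" by simp
  have K0: "frame_flag P (?K 0) = frame_flag P (mat 1 :: real^'n^'n)"
    using frame_flag_gs_frame[OF P u[OF 0] orthogonal_matrix_id] by simp
  have k1: "?K 0 = mat 1"
  proof -
    have g: "gram_schmidt (cols (mat 1 :: real^'n^'n)) k = axis (ix k) 1" if "k \<in> {1..CARD('n)}" for k
      using that
    proof (induction k rule: less_induct)
      case (less k)
      have cm: "cols (mat 1 :: real^'n^'n) k = axis (ix k) 1" by (simp add: cols_def column_def mat_def axis_def vec_eq_iff)
      have "(\<Sum>j\<in>{1..<k}. (gram_schmidt (cols (mat 1)) j \<bullet> cols (mat 1 :: real^'n^'n) k) *\<^sub>R gram_schmidt (cols (mat 1)) j) = 0"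
      proof (rule sum.neutral, rule ballI)
        fix j assume j: "j \<in> {1..<k}"
        then have "ix j \<noteq> (ix k :: 'n)" using less.prems by (metis atLeastAtMost_iff atLeastLessThan_iff less_imp_le less_irrefl order_trans pos_ix)
        then show "(gram_schmidt (cols (mat 1)) j \<bullet> cols (mat 1 :: real^'n^'n) k) *\<^sub>R gram_schmidt (cols (mat 1)) j = 0"
          using less.IH[of j] j less.prems by (simp add: cm inner_axis_axis)
      qed
      then have "gs_residual (cols (mat 1 :: real^'n^'n)) k = axis (ix k) 1" by (simp add: gs_residual_def cm)
      then show ?case by (simp add: gram_schmidt_eq)
    qed
    have "gram_schmidt (cols (mat 1 :: real^'n^'n)) (pos j) = axis j 1" for j :: 'n using g[of "pos j"] by simp
    then have "gs_frame (mat 1 :: real^'n^'n) = (\<chi> i j. axis j 1 $ i)" unfolding gs_frame_def by simp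
    also have "\<dots> = mat 1" by (simp add: axis_def mat_def vec_eq_iff)
    finally show ?thesis by simp
  qed
  have "Y 0 = Z"
  proof -
    let ?r = "\<lambda>s. transpose (?K s) ** (mat 1 + s *\<^sub>R ?B)"
    have dr: "(?r has_vector_derivative (transpose (?K 0) ** ?B + transpose (?K 0 ** Y 0) ** (mat 1 + 0 *\<^sub>R ?B))) (at 0 within {0..1})"
      by (intro has_vector_derivative_matrix_mult has_vector_derivative_transpose Y(1)[OF 0])
         (auto intro!: derivative_eq_intros)
    then have dr: "(?r has_vector_derivative (?B - Y 0)) (at 0 within {0..1})"
      unfolding k1 using Y(2)[OF 0] by (simp add: matrix_transpose_mul)
    have low: "Y 0 $ i $ j = ?B $ i $ j" if ij: "pos j < pos i" for i j
    proof -
      have bl: "bounded_linear (\<lambda>A :: real^'n^'n. A $ i $ j)"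
        by (intro bounded_linear_intros bounded_linear_vec_nth bounded_linear_compose[OF bounded_linear_vec_nth])
      have "((\<lambda>s. ?r s $ i $ j) has_vector_derivative (?B - Y 0) $ i $ j) (at 0 within {0..1})"
        by (rule bounded_linear.has_vector_derivative[OF bl dr])
      then have "(?B - Y 0) $ i $ j = 0"
        by (rule unique_derivative_of_constant[OF 0, rotated]) (rule gs_frame_triangular[OF u ij])
      then show ?thesis by simp
    qed
    have sk: "Y 0 $ j $ i = - Y 0 $ i $ j" for i j using arg_cong[OF Y(2)[OF 0], of "\<lambda>A. A $ i $ j"] by (simp add: transpose_def)
    show ?thesis
    proof (subst vec_eq_iff, intro allI, subst vec_eq_iff, intro allI)
      fix i j :: 'n
      consider "pos j < pos i" | "pos i < pos j" | "i = j" by (metis linorder_neqE_nat pos_inj)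
      then show "Y 0 $ i $ j = Z $ i $ j"
      proof cases
        case 1 then show ?thesis using low[OF 1] by (simp add: Z_def transpose_def strict_lower_def)
      next
        case 2 then show ?thesis using low[OF 2] sk[of j i] by (simp add: Z_def transpose_def strict_lower_def)
      next
        case 3 then show ?thesis using sk[of j j] by (simp add: Z_def transpose_def strict_lower_def)
      qed
    qed
  qed
  then have "commutator Z (diag (level P)) = (mat 1 ** ?K 0) ** commutator (Y 0) (diag (level P)) ** transpose (mat 1 ** ?K 0)"
    using k1 by simp
  moreover have "frame_flag P (mat 1 ** ?K 0) = frame_flag P (mat 1 :: real^'n^'n)" using K0 by simp
  ultimately show ?thesis unfolding flag_tangent_def mem_Collect_eq
    by (intro exI[of _ "\<lambda>t. (mat 1 ** ?K t) ** commutator (Y t) (diag (level P)) ** transpose (mat 1 ** ?K t)"]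
        exI[of _ "\<lambda>t. frame_flag P (mat 1 ** ?K t)"] conjI curve)
qed

lemma norm_matrix_mono:
  fixes A B :: "real^'n^'m::finite"
  assumes "\<And>i j. \<bar>A $ i $ j\<bar> \<le> \<bar>B $ i $ j\<bar>"
  shows "norm A \<le> norm B"
proof (rule norm_le_componentwise_cart)
  fix i show "norm (A $ i) \<le> norm (B $ i)"
    by (rule norm_le_componentwise_cart) (simp only: real_norm_def assms)
qed

lemma commutator_add: "commutator (X + Y) D = commutator X D + commutator Y D"
proof -
  have "(X + Y) ** D = X ** D + Y ** D" by (simp add: matrix_matrix_mult_def vec_eq_iff sum.distrib distrib_right)
  moreover have "D ** (X + Y) = D ** X + D ** Y" by (rule matrix_add_ldistrib)
  ultimately show ?thesis by (simp add: commutator_def)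
qed

lemma commutator_scale: "commutator (c *\<^sub>R X) D = c *\<^sub>R commutator X D"
proof -
  have "(c *\<^sub>R X) ** D = c *\<^sub>R (X ** D)"
    by (simp add: matrix_matrix_mult_def vec_eq_iff sum_distrib_left mult.assoc)
  moreover have "D ** (c *\<^sub>R X) = c *\<^sub>R (D ** X)"
    by (simp add: matrix_matrix_mult_def vec_eq_iff sum_distrib_left mult.left_commute)
  ultimately show ?thesis by (simp add: commutator_def scaleR_diff_right)
qed

text \<open>Invariance reduces the estimate to the tangent space at the standard flag, where the metric is a bilinear form on a
  finite-dimensional space. The metric is only defined on tangent vectors, so it is pulled back along the linear map
  \<open>Z\<close>, which is defined on all matrices and takes values in tangent vectors.\<close>

lemma invariant_metric_bound:
  fixes g :: "'n::finite flag \<Rightarrow> real^'n^'n \<Rightarrow> real^'n^'n \<Rightarrow> real"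
  assumes P: "P \<subseteq> {1..CARD('n)}" and g: "SO_invariant_riemannian P g"
  obtains B where "0 \<le> B" "\<And>k Y. orthogonal_matrix k \<Longrightarrow> transpose Y = - Y \<Longrightarrow>
    g (frame_flag P k) (k ** commutator Y (diag (level P)) ** transpose k) (k ** commutator Y (diag (level P)) ** transpose k)
      \<le> B * (norm Y)\<^sup>2"
proof -
  let ?D = "diag (level P) :: real^'n^'n"
  define F0 where "F0 = frame_flag P (mat 1 :: real^'n^'n)"
  have F0: "F0 \<in> flags P" unfolding F0_def by (rule frame_flag_in_flags[OF P]) simp
  define Z where "Z X = commutator (strict_lower X - transpose (strict_lower X)) ?D" for X :: "real^'n^'n"
  have ZT: "Z X \<in> flag_tangent P F0" for X
    unfolding Z_def F0_def by (rule commutator_in_tangent[OF P])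
  have Zlin: "linear Z"
  proof (rule linearI)
    show "Z (X + Y) = Z X + Z Y" for X Y
    proof -
      have "strict_lower (X + Y) - transpose (strict_lower (X + Y))
        = (strict_lower X - transpose (strict_lower X)) + (strict_lower Y - transpose (strict_lower Y))"
        by (simp add: strict_lower_def transpose_def vec_eq_iff)
      then show ?thesis unfolding Z_def by (simp only: commutator_add)
    qed
    show "Z (c *\<^sub>R X) = c *\<^sub>R Z X" for c X
    proof -
      have "strict_lower (c *\<^sub>R X) - transpose (strict_lower (c *\<^sub>R X)) = c *\<^sub>R (strict_lower X - transpose (strict_lower X))"
        by (auto simp: strict_lower_def transpose_def vec_eq_iff right_diff_distrib)
      then show ?thesis unfolding Z_def by (simp only: commutator_scale)
    qed
  qed
  have inv: "\<forall>u\<in>flag_tangent P F0. \<forall>v\<in>flag_tangent P F0.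
        g F0 u v = g F0 v u \<and>
        (\<forall>w\<in>flag_tangent P F0. \<forall>a b. g F0 (a *\<^sub>R u + b *\<^sub>R v) w = a * g F0 u w + b * g F0 v w) \<and>
        (u \<noteq> 0 \<longrightarrow> 0 < g F0 u u) \<and>
        (\<forall>k. orthogonal_matrix k \<and> det k = 1 \<longrightarrow>
           g (flag_act P k F0) (k ** u ** transpose k) (k ** v ** transpose k) = g F0 u v)"
    by (rule bspec[OF iffD1[OF SO_invariant_riemannian_def g] F0])
  note inv' = bspec[OF bspec[OF inv ZT] ZT]
  have SO1: "g F0 (Z X) (Z X') = g F0 (Z X') (Z X)" for X X'
    by (rule conjunct1[OF inv'])
  have SO2: "g F0 (a *\<^sub>R Z X + b *\<^sub>R Z X') (Z W) = a * g F0 (Z X) (Z W) + b * g F0 (Z X') (Z W)" for X X' W a b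
    by (rule spec[OF spec[OF bspec[OF conjunct1[OF conjunct2[OF inv']] ZT]]])
  have SO3: "g (flag_act P k F0) (k ** Z X ** transpose k) (k ** Z X' ** transpose k) = g F0 (Z X) (Z X')"
    if "orthogonal_matrix k" "det k = 1" for k X X'
    by (rule mp[OF spec[OF conjunct2[OF conjunct2[OF conjunct2[OF inv']]]] conjI[OF that]])
  define H where "H X X' = g F0 (Z X) (Z X')" for X X'
  have Hsym: "H X X' = H X' X" for X X' unfolding H_def by (rule SO1)
  have Hlin: "linear (\<lambda>X. H X W)" for W
  proof (rule linearI)
    show "H (X + Y) W = H X W + H Y W" for X Y
      using SO2[of 1 X 1 Y W] by (simp add: H_def linear_add[OF Zlin])
    show "H (c *\<^sub>R X) W = c *\<^sub>R H X W" for c X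
      using SO2[of c X 0 X W] by (simp add: H_def linear_scale[OF Zlin])
  qed
  have bil: "bilinear H"
  proof -
    have e: "(\<lambda>X. H W X) = (\<lambda>X. H X W)" for W by (rule ext) (rule Hsym)
    have "linear (\<lambda>X. H W X)" for W by (rule ssubst[OF e, of linear]) (rule Hlin)
    then show ?thesis unfolding bilinear_def using Hlin by blast
  qed
  obtain B where B: "B > 0" "\<And>X X'. norm (H X X') \<le> B * norm X * norm X'"
    using bilinear_bounded_pos[OF bil] by metis
  show ?thesis
  proof (rule that[of B])
    show "0 \<le> B" using B by simp
    fix k Y :: "real^'n^'n"
    assume k: "orthogonal_matrix k" and Y: "transpose Y = - Y"
    \<comment> \<open>a sign change in one arbitrary coordinate: invariance is available for determinant 1 only\<close>
    define q where "q = diag (\<lambda>i::'n. if i = undefined then det k else 1)"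
    have dk: "det k * det k = 1" using det_orthogonal_matrix[OF k] by auto
    have qq: "q ** q = mat 1" unfolding q_def diag_mult_diag diag_1[symmetric]
      by (rule arg_cong[of _ _ diag], rule ext) (simp add: dk)
    have qt: "transpose q = q" by (simp add: q_def)
    have oq: "orthogonal_matrix q" by (simp add: orthogonal_matrix_def qt qq)
    have dq: "det q = det k" unfolding q_def det_diag by simp
    define k1 where "k1 = k ** q"
    have k1: "orthogonal_matrix k1" "det k1 = 1"
      unfolding k1_def by (rule orthogonal_matrix_mul[OF k oq]) (simp only: det_mul dq dk)
    define Y1 where "Y1 = q ** Y ** q"
    have qD: "q ** ?D = ?D ** q" 
      unfolding q_def diag_mult_diag by (rule arg_cong[of _ _ diag]) (rule ext, rule mult.commute)
    have c: "q ** commutator Y ?D ** q = commutator Y1 ?D"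
    proof -
      have "q ** commutator Y ?D ** q = q ** Y ** (?D ** q) - (q ** ?D) ** Y ** q"
        by (simp add: commutator_def matrix_mult_diff_right matrix_mult_diff_left matrix_mul_assoc)
      also have "\<dots> = q ** Y ** (q ** ?D) - (?D ** q) ** Y ** q" by (simp only: qD)
      finally show ?thesis by (simp add: commutator_def Y1_def matrix_mul_assoc)
    qed
    have k1q: "k = k1 ** q" by (simp add: k1_def qq flip: matrix_mul_assoc)
    have v: "k ** commutator Y ?D ** transpose k = k1 ** commutator Y1 ?D ** transpose k1"
      unfolding c[symmetric] by (subst (1 2) k1q) (simp add: matrix_transpose_mul qt matrix_mul_assoc)
    have Y1s: "transpose Y1 = - Y1"
      unfolding Y1_def by (simp add: matrix_transpose_mul qt Y matrix_mul_assoc)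
        (simp add: matrix_matrix_mult_def vec_eq_iff sum_negf)
    have ZY: "Z Y1 = commutator Y1 ?D"
    proof -
      have sk: "Y1 $ j $ i = - Y1 $ i $ j" for i j using arg_cong[OF Y1s, of "\<lambda>A. A $ i $ j"] by (simp add: transpose_def)
      have "strict_lower Y1 - transpose (strict_lower Y1) = Y1"
      proof (subst vec_eq_iff, intro allI, subst vec_eq_iff, intro allI)
        fix i j :: 'n
        consider "pos j < pos i" | "pos i < pos j" | "i = j" by (metis linorder_neqE_nat pos_inj)
        then show "(strict_lower Y1 - transpose (strict_lower Y1)) $ i $ j = Y1 $ i $ j"
        proof cases
          case 1 then show ?thesis by (simp add: transpose_def strict_lower_def)
        next
          case 2 then show ?thesis using sk[of j i] by (simp add: transpose_def strict_lower_def)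
        next
          case 3 then show ?thesis using sk[of j j] by (simp add: transpose_def strict_lower_def)
        qed
      qed
      then show ?thesis by (simp add: Z_def)
    qed
    have fk: "frame_flag P k = flag_act P k1 F0"
    proof -
      have "frame_flag P (k1 ** q) = frame_flag P k1"
        by (rule frame_flag_blocktri[OF P orthogonal_det_nz[OF k1(1)] orthogonal_det_nz[OF oq]])
           (auto simp: blocktri_def q_def diag_def)
      then show ?thesis by (simp add: k1q[symmetric] F0_def flag_act_frame)
    qed
    have nY: "norm Y1 \<le> norm Y"
      by (rule norm_matrix_mono)
        (use det_orthogonal_matrix[OF k] in \<open>auto simp: Y1_def q_def diag_mult_left diag_mult_right\<close>)
    have "g (frame_flag P k) (k ** commutator Y ?D ** transpose k) (k ** commutator Y ?D ** transpose k) = H Y1 Y1"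
      unfolding fk v H_def using SO3[OF k1, of Y1 Y1] by (simp only: ZY)
    also have "\<dots> \<le> B * norm Y1 * norm Y1" using B(2)[of Y1 Y1] by simp
    also have "\<dots> \<le> B * norm Y * norm Y" using B(1) nY by (intro mult_mono) auto
    finally show "g (frame_flag P k) (k ** commutator Y ?D ** transpose k) (k ** commutator Y ?D ** transpose k) \<le> B * (norm Y)\<^sup>2"
      by (simp add: power2_eq_square mult.assoc)
  qed
qed

lemma flag_curve_tangent:
  assumes c: "C1_flag_curve P c c'" and t: "t \<in> {0..<1}"
  shows "c' t \<in> flag_tangent P (c t)"
proof -
  define a where "a = 1 - t"
  have a: "a > 0" using t by (simp add: a_def)
  define \<phi> where "\<phi> s = t + a * s / (a + s)" for s
  define \<phi>' where "\<phi>' s = (a / (a + s))\<^sup>2" for s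
  have in01: "\<phi> s \<in> {0..1}" if "s \<in> {0..1}" for s
  proof -
    have "a * s / (a + s) \<le> a" using a that by (simp add: divide_le_eq)
    moreover have "0 \<le> a * s / (a + s)" using a that by simp
    ultimately show ?thesis using t by (simp add: \<phi>_def a_def)
  qed
  have d\<phi>: "(\<phi> has_vector_derivative \<phi>' s) (at s within {0..1})" if s: "s \<in> {0..1}" for s
  proof -
    have "a + s \<noteq> 0" using a s by auto
    then have "(\<phi> has_real_derivative \<phi>' s) (at s within {0..1})"
      unfolding \<phi>_def \<phi>'_def by (auto intro!: derivative_eq_intros simp: field_simps power2_eq_square)
    then show ?thesis by (simp add: has_real_derivative_iff_has_vector_derivative)
  qed
  have c\<phi>: "continuous_on {0..1} \<phi>"
    unfolding continuous_on_eq_continuous_within using d\<phi> has_vector_derivative_continuous by blast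
  have "C1_flag_curve P (\<lambda>s. c (\<phi> s)) (\<lambda>s. \<phi>' s *\<^sub>R c' (\<phi> s))"
    unfolding C1_flag_curve_def
  proof (intro conjI ballI)
    fix s :: real assume s: "s \<in> {0..1}"
    show "c (\<phi> s) \<in> flags P" using c in01[OF s] by (auto simp: C1_flag_curve_def)
    have "((\<lambda>s. flag_embed P (c s)) has_vector_derivative c' (\<phi> s)) (at (\<phi> s) within {0..1})"
      using c in01[OF s] by (auto simp: C1_flag_curve_def)
    then have "((\<lambda>s. flag_embed P (c s)) has_vector_derivative c' (\<phi> s)) (at (\<phi> s) within \<phi> ` {0..1})"
      by (rule has_vector_derivative_within_subset) (use in01 in blast)
    from vector_diff_chain_within[OF d\<phi>[OF s] this]
    show "((\<lambda>s. flag_embed P (c (\<phi> s))) has_vector_derivative \<phi>' s *\<^sub>R c' (\<phi> s)) (at s within {0..1})"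
      by (simp add: o_def)
  next
    have "continuous_on {0..1} c'" using c by (simp add: C1_flag_curve_def)
    then have "continuous_on {0..1} (\<lambda>s. c' (\<phi> s))"
      using in01 by (intro continuous_on_compose2[OF _ c\<phi>]) auto
    moreover have "continuous_on {0..1} \<phi>'" unfolding \<phi>'_def
      by (intro continuous_intros) (use a in auto)
    ultimately show "continuous_on {0..1} (\<lambda>s. \<phi>' s *\<^sub>R c' (\<phi> s))" by (intro continuous_intros)
  qed
  moreover have "\<phi> 0 = t" "\<phi>' 0 = 1" using a by (simp_all add: \<phi>_def \<phi>'_def)
  then have "c' t = \<phi>' 0 *\<^sub>R c' (\<phi> 0)" "c (\<phi> 0) = c t" by simp_all
  ultimately show ?thesis unfolding flag_tangent_def mem_Collect_eq
    by (intro exI[of _ "\<lambda>s. \<phi>' s *\<^sub>R c' (\<phi> s)"] exI[of _ "\<lambda>s. c (\<phi> s)"] conjI)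
qed

lemma curve_length_nonneg:
  fixes g :: "'n::finite flag \<Rightarrow> real^'n^'n \<Rightarrow> real^'n^'n \<Rightarrow> real"
  assumes g: "SO_invariant_riemannian P g" and c: "C1_flag_curve P c c'"
  shows "0 \<le> integral {0..1} (\<lambda>t. sqrt (g (c t) (c' t) (c' t)))"
proof -
  define f where "f t = (if t = 1 then 0 else sqrt (g (c t) (c' t) (c' t)))" for t :: real
  have "integral {0..1} (\<lambda>t. sqrt (g (c t) (c' t) (c' t))) = integral {0..1} f"
    by (rule integral_spike[of "{1}"]) (auto simp: f_def)
  moreover have "0 \<le> f t" if t: "t \<in> {0..1}" for t
  proof (cases "t = 1")
    case False
    then have t': "t \<in> {0..<1}" using t by auto
    have T: "c' t \<in> flag_tangent P (c t)" by (rule flag_curve_tangent[OF c t'])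
    have F: "c t \<in> flags P" using c t by (auto simp: C1_flag_curve_def)
    have pos: "c' t \<noteq> 0 \<Longrightarrow> 0 < g (c t) (c' t) (c' t)"
      and lin: "g (c t) (0 *\<^sub>R c' t + 0 *\<^sub>R c' t) (c' t) = 0 * g (c t) (c' t) (c' t) + 0 * g (c t) (c' t) (c' t)"
      using g F T unfolding SO_invariant_riemannian_def by blast+
    have "0 \<le> g (c t) (c' t) (c' t)" using pos lin by (cases "c' t = 0") auto
    then show ?thesis by (simp add: f_def)
  qed (simp add: f_def)
  then have "0 \<le> integral {0..1} f"
    by (cases "f integrable_on {0..1}") (auto intro: integral_nonneg simp: not_integrable_integral)
  ultimately show ?thesis by simp
qed

text \<open>The distance is an infimum of lengths, so one curve of bounded speed suffices.\<close>

lemma riemannian_dist_le: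
  fixes g :: "'n::finite flag \<Rightarrow> real^'n^'n \<Rightarrow> real^'n^'n \<Rightarrow> real"
  assumes g: "SO_invariant_riemannian P g" and c: "C1_flag_curve P c c'" "c 0 = E" "c 1 = F"
    and b: "0 \<le> b" "\<And>t. t \<in> {0..1} \<Longrightarrow> g (c t) (c' t) (c' t) \<le> b\<^sup>2"
  shows "riemannian_dist P g E F \<le> b"
proof -
  let ?L = "{integral {0..1} (\<lambda>t. sqrt (g (c t) (c' t) (c' t))) | c c'. C1_flag_curve P c c' \<and> c 0 = E \<and> c 1 = F}"
  let ?f = "\<lambda>t. sqrt (g (c t) (c' t) (c' t))"
  have "bdd_below ?L" by (rule bdd_belowI[of _ 0]) (use curve_length_nonneg[OF g] in auto)
  moreover have "integral {0..1} ?f \<in> ?L" using c by blast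
  ultimately have "riemannian_dist P g E F \<le> integral {0..1} ?f"
    unfolding riemannian_dist_def by (rule cInf_lower[rotated])
  also have "\<dots> \<le> b"
  proof (cases "?f integrable_on {0..1}")
    case True
    have "integral {0..1} ?f \<le> integral {0..1} (\<lambda>_::real. b)"
    proof (rule integral_le[OF True])
      show "(\<lambda>_::real. b) integrable_on {0..1}" by (rule integrable_const_ivl)
      show "?f t \<le> b" if "t \<in> {0..1}" for t
        using real_sqrt_le_mono[OF b(2)[OF that]] b(1) by simp
    qed
    then show ?thesis by simp
  qed (use b in \<open>simp add: not_integrable_integral\<close>)
  finally show ?thesis .
qed

text \<open>The affine path in the chart, orthonormalised, has speed at most a constant times the difference of the endpoints. The
  constant does not depend on the rotation \<open>Q\<close> because the metric is invariant.\<close>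

lemma riemannian_dist_unip:
  fixes g :: "'n::finite flag \<Rightarrow> real^'n^'n \<Rightarrow> real^'n^'n \<Rightarrow> real"
  assumes P: "P \<subseteq> {1..CARD('n)}" and g: "SO_invariant_riemannian P g" and T: "1 \<le> T"
  obtains C where "0 < C" "\<And>(Q :: real^'n^'n) m m' \<delta>. orthogonal_matrix Q \<Longrightarrow> unip P T m \<Longrightarrow> unip P T m' \<Longrightarrow>
    (\<And>i j. \<bar>m $ i $ j - m' $ i $ j\<bar> \<le> \<delta>) \<Longrightarrow> riemannian_dist P g (frame_flag P (Q ** m)) (frame_flag P (Q ** m')) \<le> C * \<delta>"
proof -
  obtain B where B: "0 \<le> B" "\<And>k Y. orthogonal_matrix k \<Longrightarrow> transpose Y = - Y \<Longrightarrow>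
    g (frame_flag P k) (k ** commutator Y (diag (level P)) ** transpose k) (k ** commutator Y (diag (level P)) ** transpose k)
      \<le> B * (norm Y)\<^sup>2" using invariant_metric_bound[OF P g] by blast
  obtain C where C: "0 \<le> C" "\<And>(M :: real^'n^'n) N \<delta>. (\<forall>t\<in>{0..1}. unitri T (M + t *\<^sub>R N)) \<Longrightarrow> (\<forall>i j. \<bar>N $ i $ j\<bar> \<le> \<delta>) \<Longrightarrow>
    (\<exists>Y. (\<forall>t\<in>{0..1}. ((\<lambda>t. gs_frame (M + t *\<^sub>R N)) has_vector_derivative (gs_frame (M + t *\<^sub>R N) ** Y t)) (at t within {0..1}) \<and>
        transpose (Y t) = - Y t \<and> norm (Y t) \<le> C * \<delta>) \<and> continuous_on {0..1} Y)"
    using gs_frame_path[OF T, where 'n='n] by blast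
  show ?thesis
  proof (rule that[of "sqrt B * C + 1"])
    show "0 < sqrt B * C + 1" using B C by (simp add: add_nonneg_pos)
    fix Q m m' :: "real^'n^'n" and \<delta>
    assume Q: "orthogonal_matrix Q" and m: "unip P T m" "unip P T m'" and \<delta>: "\<And>i j. \<bar>m $ i $ j - m' $ i $ j\<bar> \<le> \<delta>"
    have \<delta>0: "0 \<le> \<delta>" using \<delta> abs_ge_zero order_trans by blast
    define N where "N = m' - m"
    have um: "unitri T m" "unitri T m'" using unip_unitri m T by blast+
    have u: "unitri T (m + t *\<^sub>R N)" if t: "t \<in> {0..1}" for t
    proof -
      have e: "(m + t *\<^sub>R N) $ i $ j = (1 - t) * m $ i $ j + t * m' $ i $ j" for i j by (simp add: N_def algebra_simps)
      have "\<bar>(m + t *\<^sub>R N) $ i $ j\<bar> \<le> T" for i j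
      proof -
        have "\<bar>(m + t *\<^sub>R N) $ i $ j\<bar> \<le> (1 - t) * \<bar>m $ i $ j\<bar> + t * \<bar>m' $ i $ j\<bar>"
          unfolding e using t abs_triangle_ineq[of "(1 - t) * m $ i $ j" "t * m' $ i $ j"] by (simp add: abs_mult)
        also have "\<dots> \<le> (1 - t) * T + t * T" using t um by (intro add_mono mult_left_mono) (auto simp: unitri_def)
        finally show ?thesis by (simp add: algebra_simps)
      qed
      then show ?thesis using um unfolding unitri_def e by auto
    qed
    have "\<forall>t\<in>{0..1}. unitri T (m + t *\<^sub>R N)" "\<forall>i j. \<bar>N $ i $ j\<bar> \<le> \<delta>"
      using u \<delta> by (auto simp: N_def abs_minus_commute)
    from C(2)[OF this] obtain Y where Y:
      "\<And>t. t \<in> {0..1} \<Longrightarrow> ((\<lambda>t. gs_frame (m + t *\<^sub>R N)) has_vector_derivative (gs_frame (m + t *\<^sub>R N) ** Y t)) (at t within {0..1})"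
      "\<And>t. t \<in> {0..1} \<Longrightarrow> transpose (Y t) = - Y t" "\<And>t. t \<in> {0..1} \<Longrightarrow> norm (Y t) \<le> C * \<delta>" "continuous_on {0..1} Y" by blast
    let ?K = "\<lambda>t. gs_frame (m + t *\<^sub>R N)"
    have oK: "orthogonal_matrix (?K t)" if "t \<in> {0..1}" for t by (rule orthogonal_gs_frame[OF u[OF that]])
    have "riemannian_dist P g (frame_flag P (Q ** m)) (frame_flag P (Q ** m')) \<le> sqrt B * (C * \<delta>)"
    proof (rule riemannian_dist_le[OF g frame_path_flag_curve[OF P Q oK Y(1,2,4)]])
      show "frame_flag P (Q ** ?K 0) = frame_flag P (Q ** m)" using frame_flag_gs_frame[OF P um(1) Q] by simp
      show "frame_flag P (Q ** ?K 1) = frame_flag P (Q ** m')" using frame_flag_gs_frame[OF P um(2) Q] by (simp add: N_def)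
      show "0 \<le> sqrt B * (C * \<delta>)" using B C \<delta>0 by simp
      fix t :: real assume t: "t \<in> {0..1}"
      have "g (frame_flag P (Q ** ?K t)) ((Q ** ?K t) ** commutator (Y t) (diag (level P)) ** transpose (Q ** ?K t))
         ((Q ** ?K t) ** commutator (Y t) (diag (level P)) ** transpose (Q ** ?K t)) \<le> B * (norm (Y t))\<^sup>2"
        by (intro B(2) orthogonal_matrix_mul Q oK Y t)
      also have "\<dots> \<le> B * (C * \<delta>)\<^sup>2" using Y(3)[OF t] B(1) by (intro mult_left_mono power_mono) auto
      also have "\<dots> = (sqrt B * (C * \<delta>))\<^sup>2" using B(1) by (simp add: power_mult_distrib)
      finally show "g (frame_flag P (Q ** ?K t)) ((Q ** ?K t) ** commutator (Y t) (diag (level P)) ** transpose (Q ** ?K t))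
         ((Q ** ?K t) ** commutator (Y t) (diag (level P)) ** transpose (Q ** ?K t)) \<le> (sqrt B * (C * \<delta>))\<^sup>2" .
    qed
    also have "\<dots> \<le> (sqrt B * C + 1) * \<delta>" using \<delta>0 by (simp add: algebra_simps)
    finally show "riemannian_dist P g (frame_flag P (Q ** m)) (frame_flag P (Q ** m')) \<le> (sqrt B * C + 1) * \<delta>" .
  qed
qed

section \<open>Charts along geodesic words\<close>

context anosov_rep
begin

text \<open>The box in the flag manifold attached to \<open>x\<close>: the standard chart of size \<open>T\<close> at the right singular basis, moved by
  \<open>\<rho> x\<close>. In the left singular basis its side in the direction of a root \<open>\<alpha>\<close> is \<open>T exp (-\<alpha>)\<close>.\<close>

definition chart :: "real \<Rightarrow> 'g \<Rightarrow> 'n flag set" where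
  "chart T x = {frame_flag P (svK (\<rho> x) ** (diag (sv (\<rho> x)) ** m ** diag (\<lambda>i. 1 / sv (\<rho> x) i))) | m. unip P T m}"

lemma transverse_limit:
  assumes "H \<longlonglongrightarrow> H'" "\<forall>\<^sub>F n in sequentially. transverse T (H n)"
  shows "transverse T H'"
  unfolding transverse_def
proof (intro ballI)
  fix p and x :: "real^'n" assume p: "p \<in> P" "x \<in> std p"
  have pl: "(\<lambda>n. proj I (y n)) \<longlonglongrightarrow> proj I z" if "y \<longlonglongrightarrow> z" for I and y :: "nat \<Rightarrow> real^'n" and z
    unfolding proj_def
    by (intro vec_tendstoI) (use tendsto_vec_nth[OF that] in auto)
  have 1: "(\<lambda>n. H n *v x) \<longlonglongrightarrow> H' *v x" by (intro tendsto_intros assms)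
  have 2: "(\<lambda>n. T * norm (proj (head p) (H n *v x))) \<longlonglongrightarrow> T * norm (proj (head p) (H' *v x))"
    by (intro tendsto_intros pl 1)
  show "norm (H' *v x) \<le> T * norm (proj (head p) (H' *v x))"
    by (rule tendsto_le[OF _ 2 tendsto_norm[OF 1]])
       (simp, rule eventually_mono[OF assms(2)], simp add: transverse_def p)
qed

text \<open>A limit flag is approached by singular flags of long elements, represented by geodesic words. By pigeonhole, infinitely
  many of these words share their first \<open>n\<close> letters. Uniform transversality, applied to every prefix of this common word,
  passes to the limit and places the flag in the chart of each prefix.\<close>

theorem limit_flags_charts:
  obtains T J where "1 \<le> T" "\<And>\<xi> n. \<xi> \<in> limit_flags \<Longrightarrow>
    \<exists>ws. geodesic ws \<and> length ws = n \<and> (\<forall>l. J \<le> l \<longrightarrow> l \<le> n \<longrightarrow> \<xi> \<in> chart T (gprod (take l ws)))"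
proof -
  let ?H = "\<lambda>xs ys. svL (\<rho> (gprod xs)) ** \<rho> (inv\<^bsub>G\<^esub> (gprod xs)) ** svK (\<rho> (gprod (xs @ ys)))"
  obtain T0 J where T0: "T0 > 0" and J: "\<And>l. J \<le> l \<Longrightarrow>
     \<exists>m0. \<forall>xs ys. geodesic (xs @ ys) \<and> length xs = l \<and> m0 \<le> length ys \<longrightarrow> transverse T0 (?H xs ys)"
    using uniform_transversality by blast
  define T where "T = max 1 T0"
  show ?thesis
  proof (rule that[of T J])
    show "1 \<le> T" by (simp add: T_def)
    fix \<xi> n assume "\<xi> \<in> limit_flags"
    then obtain k where k: "k \<in> limit_frames" "\<xi> = frame_flag P k" by (auto simp: limit_flags_def)
    obtain \<gamma> :: "nat \<Rightarrow> 'g" where \<gamma>: "\<And>i. \<gamma> i \<in> carrier G" "\<And>i. i \<le> wl (\<gamma> i)" "(\<lambda>i. svK (\<rho> (\<gamma> i))) \<longlonglongrightarrow> k"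
      using limit_frames_sequence[OF k(1)] by blast
    have "\<forall>i. \<exists>w. geodesic w \<and> gprod w = \<gamma> i" using geodesic_exists[OF \<gamma>(1)] by blast
    then obtain w where w: "\<And>i. geodesic (w i)" "\<And>i. gprod (w i) = \<gamma> i" by metis
    have lw: "i \<le> length (w i)" for i using \<gamma>(2)[of i] w[of i] by (simp add: geodesic_def)
    have "(\<lambda>i. take n (w i)) ` {n..} \<subseteq> {ws. set ws \<subseteq> S \<and> length ws \<le> n}"
      using w(1) by (auto simp: geodesic_def dest: in_set_takeD)
    then have fin: "finite ((\<lambda>i. take n (w i)) ` {n..})"
      using finite_lists_length_le[OF S_facts(1)] finite_subset by blast
    \<comment> \<open>infinitely many of the words share their first \<open>n\<close> letters\<close>
    obtain i0 where i0: "i0 \<in> {n..}" "infinite {i \<in> {n..}. take n (w i) = take n (w i0)}"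
      using pigeonhole_infinite[OF infinite_Ici fin] by blast
    define ws where "ws = take n (w i0)"
    obtain r :: "nat \<Rightarrow> nat" where r: "strict_mono r" "\<And>i. r i \<in> {i \<in> {n..}. take n (w i) = ws}"
      using infinite_enumerate[OF i0(2)] unfolding ws_def by blast
    have rw: "w (r i) = ws @ drop n (w (r i))" for i using r(2)[of i] by (metis (mono_tags, lifting) append_take_drop_id mem_Collect_eq)
    have gws: "geodesic ws" unfolding ws_def using w(1)[of i0] geodesic_append[of "take n (w i0)" "drop n (w i0)"] by simp
    have lws: "length ws = n" unfolding ws_def using lw[of i0] i0(1) by simp
    have klim: "(\<lambda>i. svK (\<rho> (\<gamma> (r i)))) \<longlonglongrightarrow> k" using LIMSEQ_subseq_LIMSEQ[OF \<gamma>(3) r(1)] by (simp add: o_def)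
    have "\<xi> \<in> chart T (gprod (take l ws))" if l: "J \<le> l" "l \<le> n" for l
    proof -
      define xs where "xs = take l ws"
      define ys where "ys i = drop l ws @ drop n (w (r i))" for i
      have xy: "xs @ ys i = w (r i)" for i unfolding xs_def ys_def using rw[of i] by (simp flip: append.assoc)
      have lx: "length xs = l" unfolding xs_def using lws l by simp
      obtain m0 where m0: "\<And>xs ys. geodesic (xs @ ys) \<Longrightarrow> length xs = l \<Longrightarrow> m0 \<le> length ys \<Longrightarrow> transverse T0 (?H xs ys)"
        using J[OF l(1)] by blast
      have tr: "transverse T0 (?H xs (ys i))" if "m0 + l \<le> i" for i
      proof (rule m0)
        show "geodesic (xs @ ys i)" unfolding xy by (rule w(1))
        have "i \<le> r i" using seq_suble[OF r(1)] .
        then have "i \<le> length (xs @ ys i)" unfolding xy using lw[of "r i"] by simp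
        then show "m0 \<le> length (ys i)" using that lx by simp
      qed (rule lx)
      have gx: "gprod xs \<in> carrier G" using gws gprod_closed unfolding xs_def geodesic_def by (meson set_take_subset subset_trans)
      let ?A = "\<rho> (gprod xs)" and ?A' = "\<rho> (inv\<^bsub>G\<^esub> (gprod xs))"
      note dA = rho_det_nz[OF gx]
      define H where "H = svL ?A ** (?A' ** k)"
      have "(\<lambda>i. ?H xs (ys i)) \<longlonglongrightarrow> H"
        unfolding xy w(2) H_def matrix_mul_assoc by (intro tendsto_intros klim)
      then have trH: "transverse T0 H"
        by (rule transverse_limit) (use tr in \<open>auto simp: eventually_sequentially\<close>)
      have dk: "det (?A' ** k) \<noteq> 0"
        using rho_det_nz[OF inv_closed[OF gx]] orthogonal_det_nz[OF limit_frames_orthogonal[OF k(1)]] by (simp add: det_mul)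
      then have dH: "det H \<noteq> 0" unfolding H_def using orthogonal_det_nz[OF orthogonal_svL[OF dA]] by (simp add: det_mul)
      have "norm (H *v x) \<le> T * norm (proj (head p) (H *v x))" if "p \<in> P" "x \<in> std p" for p x
        using trH that mult_right_mono[of T0 T "norm (proj (head p) (H *v x))"] unfolding transverse_def T_def by fastforce
      then obtain m where m: "unip P T m" "frame_flag P m = frame_flag P H"
        using unip_frame_exists[OF P_range' dH] T0 by (metis T_def less_eq_real_def max.coboundedI2)
      have "?A ** (?A' ** k) = k" using rho_inv(2)[OF gx] by (simp add: matrix_mul_assoc)
      then have "\<xi> = frame_flag P (svK ?A ** (diag (sv ?A) ** m ** diag (\<lambda>i. 1 / sv ?A i)))"
        using frame_flag_svd_unip[OF dA dk m(1)] m(2) k(2) by (simp add: H_def)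
      then show ?thesis unfolding chart_def xs_def using m(1) by blast
    qed
    then show "\<exists>ws. geodesic ws \<and> length ws = n \<and> (\<forall>l. J \<le> l \<longrightarrow> l \<le> n \<longrightarrow> \<xi> \<in> chart T (gprod (take l ws)))"
      using gws lws by blast
  qed
qed

section \<open>Covering a chart by balls\<close>

definition rootval :: "'g \<Rightarrow> nat \<times> nat \<Rightarrow> real" where
  "rootval x = (\<lambda>(a, b). ln (singular_value (\<rho> x) a) - ln (singular_value (\<rho> x) b))"

lemma finite_roots: "finite (root_pairs CARD('n) P)"
  by (rule finite_subset[of _ "{1..CARD('n)} \<times> {1..CARD('n)}"]) (auto simp: root_pairs_def)

lemma root_below: "(a, b) \<in> (root_pairs CARD('n) P) \<Longrightarrow> a \<in> {1..CARD('n)} \<and> b \<in> {1..CARD('n)} \<and> below P (ix b :: 'n) (ix a)"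
  by (auto simp: root_pairs_def below_def)

lemma below_root: "below P (i :: 'n) j \<Longrightarrow> (pos j, pos i) \<in> root_pairs CARD('n) P"
  using below_less[of P i j] by (auto simp: root_pairs_def below_def)

lemma exp_rootval:
  assumes "x \<in> carrier G" "a \<in> {1..CARD('n)}" "b \<in> {1..CARD('n)}"
  shows "exp (- rootval x (a, b)) = sv (\<rho> x) (ix b) / sv (\<rho> x) (ix a)"
  using sv_pos[OF rho_det_nz[OF assms(1)], of "ix a"] sv_pos[OF rho_det_nz[OF assms(1)], of "ix b"] assms(2,3)
  by (simp add: rootval_def sv_def exp_diff)

lemma rootval_nonneg: "x \<in> carrier G \<Longrightarrow> q \<in> (root_pairs CARD('n) P) \<Longrightarrow> 0 \<le> rootval x q"
proof -
  assume x: "x \<in> carrier G" and q: "q \<in> root_pairs CARD('n) P"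
  obtain a b where ab: "q = (a, b)" by (cases q)
  note f = root_below[of a b] q[unfolded ab]
  have "sv (\<rho> x) (ix b) \<le> sv (\<rho> x) (ix a)"
    using f below_less[of P "ix b :: 'n" "ix a"] by (intro sv_antimono[OF rho_det_nz[OF x]]) auto
  then have "exp (- rootval x q) \<le> 1"
    unfolding ab using f sv_pos[OF rho_det_nz[OF x], of "ix a"] by (subst exp_rootval[OF x]) auto
  then show ?thesis by simp
qed

end

lemma interval_net:
  fixes b h :: real
  assumes "0 \<le> b" "0 < h"
  obtains N where "finite N" "N \<subseteq> {-b..b}" "real (card N) \<le> 1 + 2 * b / h" "\<And>x. \<bar>x\<bar> \<le> b \<Longrightarrow> \<exists>y\<in>N. \<bar>x - y\<bar> \<le> h"
proof -
  define M where "M = nat \<lfloor>2 * b / h\<rfloor>"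
  have M: "real M \<le> 2 * b / h" "2 * b / h < real M + 1" using assms unfolding M_def by (simp, linarith)
  define N where "N = (\<lambda>k. - b + real k * h) ` {0..M}"
  show ?thesis
  proof (rule that[of N])
    show "finite N" by (simp add: N_def)
    show "N \<subseteq> {-b..b}"
    proof
      fix y assume "y \<in> N"
      then obtain k where k: "k \<le> M" "y = - b + real k * h" by (auto simp: N_def)
      have "real k * h \<le> 2 * b / h * h" using k M assms by (intro mult_right_mono) auto
      then show "y \<in> {-b..b}" using k assms by simp
    qed
    have "card N \<le> M + 1" unfolding N_def using card_image_le[of "{0..M}"] by force
    then show "real (card N) \<le> 1 + 2 * b / h" using M by linarith
    fix x assume x: "\<bar>x\<bar> \<le> b"
    define k where "k = nat \<lfloor>(x + b) / h\<rfloor>"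
    have k: "real k \<le> (x + b) / h" "(x + b) / h < real k + 1" using x assms unfolding k_def by (simp, linarith)
    have "(x + b) / h \<le> 2 * b / h" using x assms by (intro divide_right_mono) auto
    then have "real k < real M + 1" using k M by linarith
    then have kM: "k \<le> M" by simp
    have "real k * h \<le> x + b" "x + b < (real k + 1) * h" using k assms by (simp_all add: field_simps)
    then have "\<bar>x - (- b + real k * h)\<bar> \<le> h" by (simp add: algebra_simps)
    then show "\<exists>y\<in>N. \<bar>x - y\<bar> \<le> h" using kM by (auto simp: N_def)
  qed
qed

context anosov_rep
begin

text \<open>A box is covered by a product of one-dimensional nets, one for each root.\<close>

lemma chart_net:
  assumes x: "x \<in> carrier G" and T: "1 \<le> T" and h: "0 < h"
  obtains N where "finite N" "N \<subseteq> {m. unip P T m}" "real (card N) \<le> (\<Prod>q\<in>root_pairs CARD('n) P. 1 + 2 * (T * exp (- rootval x q)) / h)"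
    "\<And>m. unip P T m \<Longrightarrow> \<exists>m'\<in>N. \<forall>i j. \<bar>(diag (sv (\<rho> x)) ** m ** diag (\<lambda>i. 1 / sv (\<rho> x) i)) $ i $ j - m' $ i $ j\<bar> \<le> h"
proof -
  define b where "b q = T * exp (- rootval x q)" for q
  have b0: "0 \<le> b q" for q using T by (simp add: b_def)
  have "\<forall>q. \<exists>N. finite N \<and> N \<subseteq> {-b q..b q} \<and> real (card N) \<le> 1 + 2 * b q / h \<and> (\<forall>x. \<bar>x\<bar> \<le> b q \<longrightarrow> (\<exists>y\<in>N. \<bar>x - y\<bar> \<le> h))"
    using interval_net[OF b0 h] by metis
  then obtain Nq where Nq: "\<And>q. finite (Nq q)" "\<And>q. Nq q \<subseteq> {-b q..b q}" "\<And>q. real (card (Nq q)) \<le> 1 + 2 * b q / h"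
    "\<And>q x. \<bar>x\<bar> \<le> b q \<Longrightarrow> \<exists>y\<in>Nq q. \<bar>x - y\<bar> \<le> h" by metis
  define mat_of :: "(nat \<times> nat \<Rightarrow> real) \<Rightarrow> real^'n^'n" where
    "mat_of f = (\<chi> i j. if i = j then 1 else if below P i j then f (pos j, pos i) else 0)" for f
  have bT: "b q \<le> T" if "q \<in> root_pairs CARD('n) P" for q
    using rootval_nonneg[OF x that] T mult_left_mono[of "exp (- rootval x q)" 1 T] by (simp add: b_def)
  show ?thesis
  proof (rule that[of "mat_of ` PiE (root_pairs CARD('n) P) Nq"])
    show "finite (mat_of ` PiE (root_pairs CARD('n) P) Nq)" by (intro finite_imageI finite_PiE finite_roots Nq)
    show "mat_of ` PiE (root_pairs CARD('n) P) Nq \<subseteq> {m. unip P T m}"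
    proof
      fix m assume "m \<in> mat_of ` PiE (root_pairs CARD('n) P) Nq"
      then obtain f where f: "f \<in> PiE (root_pairs CARD('n) P) Nq" "m = mat_of f" by blast
      have "\<bar>f (pos j, pos i)\<bar> \<le> T" if "below P i j" for i j :: 'n
      proof -
        have q: "(pos j, pos i) \<in> root_pairs CARD('n) P" by (rule below_root[OF that])
        then have "f (pos j, pos i) \<in> {-b (pos j, pos i)..b (pos j, pos i)}" using f(1) Nq(2) by (meson PiE_mem subsetD)
        then show ?thesis using bT[OF q] by auto
      qed
      then show "m \<in> {m. unip P T m}" unfolding f(2) mat_of_def unip_def by auto
    qed
    have "card (mat_of ` PiE (root_pairs CARD('n) P) Nq) \<le> card (PiE (root_pairs CARD('n) P) Nq)" by (intro card_image_le finite_PiE finite_roots Nq)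
    also have "\<dots> = (\<Prod>q\<in>root_pairs CARD('n) P. card (Nq q))" by (rule card_PiE[OF finite_roots])
    finally have "real (card (mat_of ` PiE (root_pairs CARD('n) P) Nq)) \<le> (\<Prod>q\<in>root_pairs CARD('n) P. real (card (Nq q)))"
      by (metis of_nat_le_iff of_nat_prod)
    also have "\<dots> \<le> (\<Prod>q\<in>root_pairs CARD('n) P. 1 + 2 * (T * exp (- rootval x q)) / h)"
      using Nq(3) by (intro prod_mono) (auto simp: b_def)
    finally show "real (card (mat_of ` PiE (root_pairs CARD('n) P) Nq)) \<le> (\<Prod>q\<in>root_pairs CARD('n) P. 1 + 2 * (T * exp (- rootval x q)) / h)" .
    fix m :: "real^'n^'n" assume m: "unip P T m"
    let ?m = "diag (sv (\<rho> x)) ** m ** diag (\<lambda>i. 1 / sv (\<rho> x) i)"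
    note sp = sv_pos[OF rho_det_nz[OF x]]
    have bd: "\<bar>?m $ ix (snd q) $ ix (fst q)\<bar> \<le> b q" if q: "q \<in> root_pairs CARD('n) P" for q
    proof -
      obtain a c where ac: "q = (a, c)" by (cases q)
      have f: "a \<in> {1..CARD('n)}" "c \<in> {1..CARD('n)}" "below P (ix c :: 'n) (ix a)" using root_below[of a c] q ac by auto
      have ne: "ix c \<noteq> (ix a :: 'n)" using below_less[OF f(3)] by auto
      have "\<bar>m $ ix c $ ix a\<bar> \<le> T" using m ne T unfolding unip_def by (smt (verit))
      then have "\<bar>m $ ix c $ ix a\<bar> * (sv (\<rho> x) (ix c) / sv (\<rho> x) (ix a)) \<le> T * (sv (\<rho> x) (ix c) / sv (\<rho> x) (ix a))"
        using sp[of "ix c"] sp[of "ix a"] by (intro mult_right_mono) auto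
      then show ?thesis using sp[of "ix c"] sp[of "ix a"]
        by (simp add: ac b_def exp_rootval[OF x f(1,2)] diag_conj_entry abs_mult mult.commute mult.left_commute)
    qed
    have "\<forall>q\<in>root_pairs CARD('n) P. \<exists>y\<in>Nq q. \<bar>?m $ ix (snd q) $ ix (fst q) - y\<bar> \<le> h" using Nq(4)[OF bd] by blast
    then obtain f0 where f0: "\<And>q. q \<in> (root_pairs CARD('n) P) \<Longrightarrow> f0 q \<in> Nq q \<and> \<bar>?m $ ix (snd q) $ ix (fst q) - f0 q\<bar> \<le> h" by metis
    define f where "f = restrict f0 (root_pairs CARD('n) P)"
    have fPi: "f \<in> PiE (root_pairs CARD('n) P) Nq" unfolding f_def using f0 by auto
    have "\<bar>?m $ i $ j - mat_of f $ i $ j\<bar> \<le> h" for i j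
    proof (cases "below P i j")
      case True
      then have "(pos j, pos i) \<in> root_pairs CARD('n) P" "i \<noteq> j" using below_root[OF True] below_less[OF True] by auto
      then show ?thesis using True f0[of "(pos j, pos i)"] by (simp add: mat_of_def f_def)
    next
      case False
      then have "m $ i $ j = (if i = j then 1 else 0)" using m unfolding unip_def by blast
      then have "?m $ i $ j = mat_of f $ i $ j" using False sp[of i] by (auto simp: diag_conj_entry mat_of_def)
      then show ?thesis using h by simp
    qed
    then show "\<exists>m'\<in>mat_of ` PiE (root_pairs CARD('n) P) Nq. \<forall>i j. \<bar>?m $ i $ j - m' $ i $ j\<bar> \<le> h" using fPi by blast
  qed
qed

lemma conj_unip:
  assumes x: "x \<in> carrier G" and T: "1 \<le> T" and m: "unip P T m"
  shows "unip P T (diag (sv (\<rho> x)) ** m ** diag (\<lambda>i. 1 / sv (\<rho> x) i))"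
  unfolding unip_def
proof (intro allI)
  fix i j :: 'n
  note sp = sv_pos[OF rho_det_nz[OF x]]
  let ?m = "diag (sv (\<rho> x)) ** m ** diag (\<lambda>i. 1 / sv (\<rho> x) i)"
  show "?m $ i $ j = (if i = j then 1 else 0) \<or> (below P i j \<and> \<bar>?m $ i $ j\<bar> \<le> T)"
  proof (cases "m $ i $ j = (if i = j then 1 else 0)")
    case True
    then show ?thesis using sp[of i] by (auto simp: diag_conj_entry)
  next
    case False
    then have mb: "below P i j" "\<bar>m $ i $ j\<bar> \<le> T" using m unfolding unip_def by blast+
    have "sv (\<rho> x) i / sv (\<rho> x) j \<le> 1"
      using sv_antimono[OF rho_det_nz[OF x], of j i] below_less[OF mb(1)] sp[of j] by simp
    then have "\<bar>m $ i $ j\<bar> * (sv (\<rho> x) i / sv (\<rho> x) j) \<le> T * 1"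
      using mb(2) T sp[of i] sp[of j] by (intro mult_mono) auto
    then have "\<bar>?m $ i $ j\<bar> \<le> T" using sp[of i] sp[of j] by (simp add: diag_conj_entry abs_mult mult.commute)
    then show ?thesis using mb by blast
  qed
qed

text \<open>The number of balls of radius \<open>\<epsilon>\<close> needed for a union of charts: each chart is, up to a
  uniformly Lipschitz map, a box with sides \<open>T exp (-\<alpha>)\<close>.\<close>

lemma covering_number_charts:
  fixes g :: "'n flag \<Rightarrow> real^'n^'n \<Rightarrow> real^'n^'n \<Rightarrow> real"
  assumes g: "SO_invariant_riemannian P g" and T: "1 \<le> T"
  obtains K where "0 \<le> K" "\<And>Cut L \<epsilon>. finite Cut \<Longrightarrow> Cut \<subseteq> carrier G \<Longrightarrow> L \<subseteq> (\<Union>x\<in>Cut. chart T x) \<Longrightarrow> 0 < \<epsilon> \<Longrightarrow>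
    real (covering_number (flags P) (riemannian_dist P g) L \<epsilon>) \<le> (\<Sum>x\<in>Cut. \<Prod>q\<in>root_pairs CARD('n) P. 1 + K * exp (- rootval x q) / \<epsilon>)"
proof -
  obtain C where C: "0 < C" "\<And>(Q :: real^'n^'n) m m' \<delta>. orthogonal_matrix Q \<Longrightarrow> unip P T m \<Longrightarrow> unip P T m' \<Longrightarrow>
    (\<And>i j. \<bar>m $ i $ j - m' $ i $ j\<bar> \<le> \<delta>) \<Longrightarrow> riemannian_dist P g (frame_flag P (Q ** m)) (frame_flag P (Q ** m')) \<le> C * \<delta>"
    using riemannian_dist_unip[OF P_range' g T] by blast
  show ?thesis
  proof (rule that[of "4 * C * T"])
    show "0 \<le> 4 * C * T" using C T by simp
    fix Cut L and \<epsilon> :: real assume Cut: "finite Cut" "Cut \<subseteq> carrier G" and L: "L \<subseteq> (\<Union>x\<in>Cut. chart T x)" and \<epsilon>: "0 < \<epsilon>"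
    \<comment> \<open>the factor 2 makes the distance strictly smaller than \<open>\<epsilon>\<close>\<close>
    define h where "h = \<epsilon> / (2 * C)"
    have h: "0 < h" using \<epsilon> C by (simp add: h_def)
    let ?c = "\<lambda>x m. diag (sv (\<rho> x)) ** m ** diag (\<lambda>i. 1 / sv (\<rho> x) i)"
    have "\<forall>x\<in>Cut. \<exists>N. finite N \<and> N \<subseteq> {m. unip P T m} \<and> real (card N) \<le> (\<Prod>q\<in>root_pairs CARD('n) P. 1 + 2 * (T * exp (- rootval x q)) / h) \<and>
      (\<forall>m. unip P T m \<longrightarrow> (\<exists>m'\<in>N. \<forall>i j. \<bar>?c x m $ i $ j - m' $ i $ j\<bar> \<le> h))"
    proof
      fix x assume "x \<in> Cut"
      then have "x \<in> carrier G" using Cut by blast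
      from chart_net[OF this T h] show "\<exists>N. finite N \<and> N \<subseteq> {m. unip P T m} \<and> real (card N) \<le> (\<Prod>q\<in>root_pairs CARD('n) P. 1 + 2 * (T * exp (- rootval x q)) / h) \<and>
      (\<forall>m. unip P T m \<longrightarrow> (\<exists>m'\<in>N. \<forall>i j. \<bar>?c x m $ i $ j - m' $ i $ j\<bar> \<le> h))" by metis
    qed
    then obtain N where N: "\<And>x. x \<in> Cut \<Longrightarrow> finite (N x)" "\<And>x. x \<in> Cut \<Longrightarrow> N x \<subseteq> {m. unip P T m}"
      "\<And>x. x \<in> Cut \<Longrightarrow> real (card (N x)) \<le> (\<Prod>q\<in>root_pairs CARD('n) P. 1 + 2 * (T * exp (- rootval x q)) / h)"
      "\<And>x m. x \<in> Cut \<Longrightarrow> unip P T m \<Longrightarrow> \<exists>m'\<in>N x. \<forall>i j. \<bar>?c x m $ i $ j - m' $ i $ j\<bar> \<le> h" by metis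
    define D where "D = (\<Union>x\<in>Cut. (\<lambda>m. frame_flag P (svK (\<rho> x) ** m)) ` N x)"
    have oK: "orthogonal_matrix (svK (\<rho> x))" if "x \<in> Cut" for x
      using orthogonal_svK[OF rho_det_nz] Cut that by blast
    have fl: "frame_flag P (svK (\<rho> x) ** m) \<in> flags P" if "x \<in> Cut" "unip P T m" for x m
      using orthogonal_det_nz[OF oK[OF that(1)]] unip_det_nz[OF that(2)] by (intro frame_flag_in_flags[OF P_range']) (simp add: det_mul)
    have fD: "finite D" unfolding D_def using Cut N by auto
    have Dsub: "D \<subseteq> flags P" unfolding D_def using fl N(2) by blast
    have cov: "L \<subseteq> (\<Union>c\<in>D. {y\<in>flags P. riemannian_dist P g c y < \<epsilon>})"
    proof
      fix y assume "y \<in> L"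
      then obtain x m where xm: "x \<in> Cut" "unip P T m" "y = frame_flag P (svK (\<rho> x) ** ?c x m)"
        using L by (auto simp: chart_def)
      have xG: "x \<in> carrier G" using Cut xm by blast
      obtain m' where m': "m' \<in> N x" "\<forall>i j. \<bar>?c x m $ i $ j - m' $ i $ j\<bar> \<le> h" using N(4)[OF xm(1,2)] by blast
      have um: "unip P T (?c x m)" "unip P T m'" using conj_unip[OF xG T xm(2)] N(2)[OF xm(1)] m'(1) by auto
      have "riemannian_dist P g (frame_flag P (svK (\<rho> x) ** m')) y \<le> C * h"
        unfolding xm(3) using m'(2) by (intro C(2) oK xm um) (simp add: abs_minus_commute)
      also have "\<dots> < \<epsilon>" using C \<epsilon> by (simp add: h_def)
      finally have "riemannian_dist P g (frame_flag P (svK (\<rho> x) ** m')) y < \<epsilon>" .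
      moreover have "frame_flag P (svK (\<rho> x) ** m') \<in> D" unfolding D_def using xm(1) m'(1) by blast
      moreover have "y \<in> flags P" unfolding xm(3) by (rule fl[OF xm(1) um(1)])
      ultimately show "y \<in> (\<Union>c\<in>D. {y\<in>flags P. riemannian_dist P g c y < \<epsilon>})" by blast
    qed
    have "covering_number (flags P) (riemannian_dist P g) L \<epsilon> \<le> card D"
      unfolding covering_number_def by (rule Least_le) (use fD Dsub cov in blast)
    also have "card D \<le> (\<Sum>x\<in>Cut. card ((\<lambda>m. frame_flag P (svK (\<rho> x) ** m)) ` N x))"
      unfolding D_def by (rule card_UN_le[OF Cut(1)])
    also have "\<dots> \<le> (\<Sum>x\<in>Cut. card (N x))" by (intro sum_mono card_image_le N)
    finally have "real (covering_number (flags P) (riemannian_dist P g) L \<epsilon>) \<le> (\<Sum>x\<in>Cut. real (card (N x)))"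
      by (metis of_nat_le_iff of_nat_sum)
    also have "\<dots> \<le> (\<Sum>x\<in>Cut. \<Prod>q\<in>root_pairs CARD('n) P. 1 + 2 * (T * exp (- rootval x q)) / h)" by (intro sum_mono N)
    also have "\<dots> = (\<Sum>x\<in>Cut. \<Prod>q\<in>root_pairs CARD('n) P. 1 + 4 * C * T * exp (- rootval x q) / \<epsilon>)"
      by (simp add: h_def mult.assoc mult.commute mult.left_commute)
    finally show "real (covering_number (flags P) (riemannian_dist P g) L \<epsilon>) \<le> (\<Sum>x\<in>Cut. \<Prod>q\<in>root_pairs CARD('n) P. 1 + 4 * C * T * exp (- rootval x q) / \<epsilon>)" .
  qed
qed

end

section \<open>The Falconer functional\<close>

text \<open>Any admissible choice of weights bounds the functional from above, hence its exponential from below.\<close>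

lemma falconer_upper:
  assumes "finite (root_pairs d P)" "\<And>q. q \<in> root_pairs d P \<Longrightarrow> 0 \<le> w q \<and> w q \<le> 1" "r \<le> (\<Sum>q\<in>root_pairs d P. w q)"
    and a: "\<And>i j. (i, j) \<in> root_pairs d P \<Longrightarrow> 0 \<le> a i - a j"
  shows "exp (- (\<Sum>q\<in>root_pairs d P. w q * (a (fst q) - a (snd q)))) \<le> exp_neg (falconer_functional d P r a)"
proof -
  let ?R = "root_pairs d P"
  let ?v = "\<lambda>w :: nat \<times> nat \<Rightarrow> real. (\<Sum>(i, j)\<in>?R. w (i, j) * (a i - a j))"
  let ?W = "{w :: nat \<times> nat \<Rightarrow> real. (\<forall>ij\<in>?R. 0 \<le> w ij \<and> w ij \<le> 1) \<and> r \<le> (\<Sum>ij\<in>?R. w ij)}"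
  let ?F = "falconer_functional d P r a"
  have F: "?F = (INF w\<in>?W. ereal (?v w))" by (simp add: falconer_functional_def)
  have w: "w \<in> ?W" using assms by auto
  have upper: "?F \<le> ereal (?v w)" unfolding F by (rule INF_lower[OF w])
  have lower: "0 \<le> ?F" unfolding F
  proof (rule INF_greatest)
    fix w' assume "w' \<in> ?W"
    then have "0 \<le> ?v w'" using a by (intro sum_nonneg) auto
    then show "0 \<le> ereal (?v w')" by simp
  qed
  obtain f where f: "?F = ereal f" "f \<le> ?v w" using upper lower by (cases ?F) auto
  have "?v w = (\<Sum>q\<in>?R. w q * (a (fst q) - a (snd q)))" by (simp add: case_prod_beta)
  then show ?thesis using f by (simp add: exp_neg_def)
qed

lemma exp_neg_nonneg: "0 \<le> exp_neg y"
  by (simp add: exp_neg_def)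

text \<open>Weights concentrated on the roots below the threshold \<open>\<tau>\<close> are optimal up to a bounded error:
  this is the duality between the linear program defining the functional and the number
  \<open>exp (\<Sum> max 0 (\<tau> - \<alpha>))\<close> of balls of radius \<open>exp (-\<tau>)\<close> covering a box with sides \<open>exp (-\<alpha>)\<close>.\<close>

lemma threshold_weights:
  fixes \<alpha> :: "'q \<Rightarrow> real"
  assumes fin: "finite R" and c: "0 \<le> c"
    and r: "real (card {q\<in>R. \<alpha> q < \<tau>}) \<le> r" "r \<le> real (card {q\<in>R. \<alpha> q \<le> \<tau> + c})"
  obtains w where "\<And>q. q \<in> R \<Longrightarrow> 0 \<le> w q \<and> w q \<le> (1::real)" "r \<le> (\<Sum>q\<in>R. w q)"
    "(\<Sum>q\<in>R. max 0 (\<tau> - \<alpha> q)) \<le> r * \<tau> - (\<Sum>q\<in>R. w q * \<alpha> q) + real (card R) * c"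
proof -
  define A where "A = {q\<in>R. \<alpha> q < \<tau>}"
  define M where "M = {q\<in>R. \<tau> \<le> \<alpha> q \<and> \<alpha> q \<le> \<tau> + c}"
  have fA: "finite A" "finite M" using fin by (auto simp: A_def M_def)
  have AM: "{q\<in>R. \<alpha> q \<le> \<tau> + c} = A \<union> M" "A \<inter> M = {}" using c by (auto simp: A_def M_def)
  have cAM: "card {q\<in>R. \<alpha> q \<le> \<tau> + c} = card A + card M" unfolding AM(1) by (rule card_Un_disjoint[OF fA AM(2)])
  define \<phi> where "\<phi> = (if card M = 0 then 0 else (r - real (card A)) / real (card M))"
  have rA: "real (card A) \<le> r" using r(1) by (simp add: A_def)
  have rAM: "r \<le> real (card A) + real (card M)" using r(2) cAM by simp
  have \<phi>: "0 \<le> \<phi>" "\<phi> \<le> 1" "\<phi> * real (card M) = r - real (card A)"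
    using rA rAM by (auto simp: \<phi>_def field_simps)
  define w where "w q = (if q \<in> A then 1 else if q \<in> M then \<phi> else 0)" for q
  have split: "(\<Sum>q\<in>R. w q * f q) = (\<Sum>q\<in>A. f q) + \<phi> * (\<Sum>q\<in>M. f q)" for f :: "'q \<Rightarrow> real"
  proof -
    have "(\<Sum>q\<in>R. w q * f q) = (\<Sum>q\<in>A \<union> M. w q * f q)"
      by (rule sum.mono_neutral_right) (use fin in \<open>auto simp: w_def A_def M_def\<close>)
    also have "\<dots> = (\<Sum>q\<in>A. w q * f q) + (\<Sum>q\<in>M. w q * f q)" by (rule sum.union_disjoint[OF fA AM(2)])
    also have "(\<Sum>q\<in>A. w q * f q) = (\<Sum>q\<in>A. f q)" by (intro sum.cong) (auto simp: w_def)
    also have "(\<Sum>q\<in>M. w q * f q) = \<phi> * (\<Sum>q\<in>M. f q)"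
      unfolding sum_distrib_left by (intro sum.cong) (use AM(2) in \<open>auto simp: w_def\<close>)
    finally show ?thesis .
  qed
  show ?thesis
  proof (rule that[of w])
    show "0 \<le> w q \<and> w q \<le> 1" for q using \<phi> by (simp add: w_def)
    have "(\<Sum>q\<in>R. w q) = real (card A) + \<phi> * real (card M)" using split[of "\<lambda>_. 1"] by simp
    then show "r \<le> (\<Sum>q\<in>R. w q)" using \<phi>(3) by simp
    have "(\<Sum>q\<in>M. \<alpha> q) \<le> (\<Sum>q\<in>M. \<tau> + c)" by (intro sum_mono) (auto simp: M_def)
    then have "\<phi> * (\<Sum>q\<in>M. \<alpha> q) \<le> \<phi> * (real (card M) * (\<tau> + c))" using \<phi>(1) by (intro mult_left_mono) auto
    also have "\<dots> = (r - real (card A)) * (\<tau> + c)" using \<phi>(3) by (simp add: mult.assoc[symmetric])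
    finally have 1: "(\<Sum>q\<in>R. w q * \<alpha> q) \<le> (\<Sum>q\<in>A. \<alpha> q) + (r - real (card A)) * (\<tau> + c)" unfolding split by simp
    have 2: "(\<Sum>q\<in>R. max 0 (\<tau> - \<alpha> q)) = real (card A) * \<tau> - (\<Sum>q\<in>A. \<alpha> q)"
    proof -
      have "(\<Sum>q\<in>R. max 0 (\<tau> - \<alpha> q)) = (\<Sum>q\<in>A. max 0 (\<tau> - \<alpha> q))"
        by (rule sum.mono_neutral_right) (use fin in \<open>auto simp: A_def\<close>)
      also have "\<dots> = (\<Sum>q\<in>A. \<tau> - \<alpha> q)" by (intro sum.cong) (auto simp: A_def)
      finally show ?thesis by (simp add: sum_subtractf)
    qed
    have "card M \<le> card R" using fin by (intro card_mono) (auto simp: M_def)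
    then have "(r - real (card A)) * c \<le> real (card R) * c" using rAM c by (intro mult_right_mono) auto
    then show "(\<Sum>q\<in>R. max 0 (\<tau> - \<alpha> q)) \<le> r * \<tau> - (\<Sum>q\<in>R. w q * \<alpha> q) + real (card R) * c"
      using 1 2 by (simp add: algebra_simps)
  qed
qed

text \<open>A multiplicative constant in front of the power of \<open>1 / \<epsilon>\<close> disappears after taking logarithms and dividing.\<close>

lemma minkowski_dim_le:
  assumes K: "0 < K" and \<epsilon>0: "0 < \<epsilon>0" "\<epsilon>0 < 1"
    and le: "\<And>\<epsilon>. 0 < \<epsilon> \<Longrightarrow> \<epsilon> \<le> \<epsilon>0 \<Longrightarrow> real (covering_number X d L \<epsilon>) \<le> K * (1 / \<epsilon>) powr r" and r: "0 \<le> r"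
  shows "minkowski_dim X d L \<le> ereal r"
proof -
  define K' where "K' = max 1 K"
  let ?N = "\<lambda>\<epsilon>. real (covering_number X d L \<epsilon>)"
  have "eventually (\<lambda>\<epsilon>. \<epsilon> \<in> {0<..<\<epsilon>0}) (at_right 0)" using \<epsilon>0 by (intro eventually_at_right_real)
  then have ev: "eventually (\<lambda>\<epsilon>. ereal (ln (?N \<epsilon>) / ln (1 / \<epsilon>)) \<le> ereal (r + ln K' / ln (1 / \<epsilon>))) (at_right 0)"
  proof eventually_elim
    case (elim \<epsilon>)
    then have e: "0 < \<epsilon>" "\<epsilon> < 1" "\<epsilon> \<le> \<epsilon>0" using \<epsilon>0 by auto
    have L: "0 < ln (1 / \<epsilon>)" using e by simp
    have big: "1 \<le> K' * (1 / \<epsilon>) powr r"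
    proof -
      have "1 \<le> (1 / \<epsilon>) powr r" using e r by (intro ge_one_powr_ge_zero) auto
      then show ?thesis using mult_mono[of 1 K' 1 "(1 / \<epsilon>) powr r"] by (simp add: K'_def)
    qed
    have "?N \<epsilon> \<le> K' * (1 / \<epsilon>) powr r"
      by (rule order_trans[OF le[OF e(1,3)]]) (intro mult_right_mono; simp add: K'_def)
    then have "ln (?N \<epsilon>) \<le> ln (K' * (1 / \<epsilon>) powr r)"
      using big by (cases "?N \<epsilon> = 0") (auto intro!: ln_mono)
    also have "\<dots> = ln K' + r * ln (1 / \<epsilon>)" using e by (simp add: K'_def ln_mult ln_powr)
    finally have "ln (?N \<epsilon>) / ln (1 / \<epsilon>) \<le> (ln K' + r * ln (1 / \<epsilon>)) / ln (1 / \<epsilon>)"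
      using L by (intro divide_right_mono) auto
    also have "\<dots> = r + ln K' / ln (1 / \<epsilon>)" using L by (simp add: add_divide_distrib)
    finally show ?case by simp
  qed
  have "((\<lambda>\<epsilon>. r + ln K' / ln (1 / \<epsilon>)) \<longlongrightarrow> r) (at_right 0)"
    by real_asymp
  then have lim: "((\<lambda>\<epsilon>. ereal (r + ln K' / ln (1 / \<epsilon>))) \<longlongrightarrow> ereal r) (at_right 0)" by (simp add: tendsto_ereal)
  have "minkowski_dim X d L \<le> Limsup (at_right 0) (\<lambda>\<epsilon>. ereal (r + ln K' / ln (1 / \<epsilon>)))"
    unfolding minkowski_dim_def by (rule Limsup_mono[OF ev])
  also have "\<dots> = ereal r" by (rule lim_imp_Limsup[OF _ lim]) simp
  finally show ?thesis .
qed

context anosov_rep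
begin

text \<open>Along a word the roots change by a bounded amount with each letter, so a threshold is crossed with bounded overshoot.\<close>

lemma rootval_step:
  obtains c where "0 \<le> c" "\<And>x s q. x \<in> carrier G \<Longrightarrow> s \<in> S \<Longrightarrow> q \<in> (root_pairs CARD('n) P) \<Longrightarrow> rootval (x \<otimes>\<^bsub>G\<^esub> s) q \<le> rootval x q + c"
    "\<And>x q. x \<in> carrier G \<Longrightarrow> q \<in> (root_pairs CARD('n) P) \<Longrightarrow> rootval x q \<le> c * real (wl x)"
proof -
  obtain C where C: "C \<ge> 1" "\<And>x. x \<in> carrier G \<Longrightarrow> mbound (C ^ wl x) (\<rho> x)" using uniform_bound by blast
  have ratio: "rootval (x \<otimes>\<^bsub>G\<^esub> y) q \<le> rootval x q + 2 * ln C * real (wl y)"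
    if xy: "x \<in> carrier G" "y \<in> carrier G" and q: "q \<in> root_pairs CARD('n) P" for x y q
  proof -
    obtain a b where ab: "q = (a, b)" by (cases q)
    have f: "a \<in> {1..CARD('n)}" "b \<in> {1..CARD('n)}" using root_below[of a b] q ab by auto
    let ?x = "\<rho> x" and ?z = "\<rho> (x \<otimes>\<^bsub>G\<^esub> y)"
    note dx = rho_det_nz[OF xy(1)] and dy = rho_det_nz[OF xy(2)] and dz = rho_det_nz[OF m_closed[OF xy]]
    have Cp: "C ^ wl y > 0" using C by simp
    have up: "sv ?z i \<le> C ^ wl y * sv ?x i" for i
      unfolding rho_mult[OF xy] by (rule sv_mult_right_le[OF dx dy C(2)[OF xy(2)] Cp])
    have iy: "inv\<^bsub>G\<^esub> y \<in> carrier G" using xy by simp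
    have "sv ?x i \<le> C ^ wl y * sv ?z i" for i
    proof -
      have "x = (x \<otimes>\<^bsub>G\<^esub> y) \<otimes>\<^bsub>G\<^esub> inv\<^bsub>G\<^esub> y" using xy by (simp add: m_assoc)
      then have "?x = ?z ** \<rho> (inv\<^bsub>G\<^esub> y)" using rho_mult[OF m_closed[OF xy] iy] by simp
      moreover have "mbound (C ^ wl y) (\<rho> (inv\<^bsub>G\<^esub> y))"
        by (rule mbound_mono[OF C(2)[OF iy]]) (intro power_increasing wl_inv_le xy C)
      ultimately show ?thesis using sv_mult_right_le[OF dz rho_det_nz[OF iy] _ Cp] by simp
    qed
    then have lo: "sv ?x (ix b) \<le> C ^ wl y * sv ?z (ix b)" .
    have p: "0 < sv ?x i" "0 < sv ?z i" for i using sv_pos[OF dx] sv_pos[OF dz] by auto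
    then have p0: "sv ?x i \<noteq> 0" "sv ?z i \<noteq> 0" for i by (metis less_irrefl)+
    have up': "ln (sv ?z (ix a)) \<le> real (wl y) * ln C + ln (sv ?x (ix a))"
    proof -
      have "ln (sv ?z (ix a)) \<le> ln (C ^ wl y * sv ?x (ix a))" by (intro ln_mono p up)
      then show ?thesis using C by (simp add: ln_mult ln_realpow p0)
    qed
    have lo': "ln (sv ?x (ix b)) \<le> real (wl y) * ln C + ln (sv ?z (ix b))"
    proof -
      have "ln (sv ?x (ix b)) \<le> ln (C ^ wl y * sv ?z (ix b))" by (intro ln_mono p lo)
      then show ?thesis using C by (simp add: ln_mult ln_realpow p0)
    qed
    have rv: "rootval u (a, b) = ln (sv (\<rho> u) (ix a)) - ln (sv (\<rho> u) (ix b))" for u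
      using f by (simp add: rootval_def sv_def)
    show ?thesis using up' lo' unfolding ab rv by (simp add: algebra_simps)
  qed
  have lnC: "0 \<le> ln C" using C by simp
  have one: "rootval \<one>\<^bsub>G\<^esub> q \<le> 0" if q: "q \<in> root_pairs CARD('n) P" for q
  proof -
    obtain a b where ab: "q = (a, b)" by (cases q)
    have f: "a \<in> {1..CARD('n)}" "b \<in> {1..CARD('n)}" using root_below[of a b] q ab by auto
    have "is_svd (mat 1 :: real^'n^'n) (mat 1) (\<lambda>_. 1) (mat 1)" by (simp add: is_svd_def orthogonal_matrix_id diag_1)
    from singular_value_svd[OF this] have "sv (\<rho> \<one>\<^bsub>G\<^esub>) i = 1" for i by (simp add: sv_def rho_one)
    then have "exp (- rootval \<one>\<^bsub>G\<^esub> (a, b)) = 1" by (simp add: exp_rootval[OF one_closed f])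
    then show ?thesis by (simp add: ab)
  qed
  show ?thesis
  proof (rule that[of "2 * ln C"])
    show "0 \<le> 2 * ln C" using lnC by simp
    fix x s q assume x: "x \<in> carrier G" and q: "q \<in> root_pairs CARD('n) P"
    { assume s: "s \<in> S"
      then have sG: "s \<in> carrier G" using S_facts(2) by blast
      have "wl s \<le> 1" using wl_le[of "[s]"] s sG by simp
      then have "2 * ln C * real (wl s) \<le> 2 * ln C * 1" using lnC by (intro mult_left_mono) auto
      then show "rootval (x \<otimes>\<^bsub>G\<^esub> s) q \<le> rootval x q + 2 * ln C" using ratio[OF x sG q] by simp }
    show "rootval x q \<le> 2 * ln C * real (wl x)" using ratio[OF one_closed x q] one[OF q] x by simp
  qed
qed

text \<open>The Anosov condition at a single \<open>p\<close> between the two indices of a root already forces that root to grow linearly.\<close>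

lemma rootval_growth:
  obtains c where "0 < c" "\<And>x q. x \<in> carrier G \<Longrightarrow> q \<in> (root_pairs CARD('n) P) \<Longrightarrow> ln c + c * real (wl x) \<le> rootval x q"
proof -
  obtain c where c: "c > 0" "\<And>x p. x \<in> carrier G \<Longrightarrow> p \<in> P \<Longrightarrow> gap p x \<le> exp (- c * real (wl x)) / c"
    using gap_decay by blast
  show ?thesis
  proof (rule that[OF c(1)])
    fix x q assume x: "x \<in> carrier G" and q: "q \<in> root_pairs CARD('n) P"
    obtain a b where ab: "q = (a, b)" by (cases q)
    have f: "a \<in> {1..CARD('n)}" "b \<in> {1..CARD('n)}" "below P (ix b :: 'n) (ix a)" using root_below[of a b] q ab by auto
    then obtain p where p: "p \<in> P" "pos (ix a :: 'n) \<le> p" "p < pos (ix b :: 'n)" by (auto simp: below_def)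
    have "exp (- rootval x q) \<le> gap p x"
      unfolding ab exp_rootval[OF x f(1,2)] by (rule sv_ratio_le_gap[OF x p])
    also have "\<dots> \<le> exp (- c * real (wl x)) / c" by (rule c(2)[OF x p(1)])
    also have "\<dots> = exp (- (ln c + c * real (wl x)))" using c(1) by (simp add: exp_diff exp_minus exp_add field_simps)
    finally show "ln c + c * real (wl x) \<le> rootval x q" by simp
  qed
qed

definition falconer_term :: "real \<Rightarrow> 'g \<Rightarrow> real" where
  "falconer_term r x = exp_neg (falconer_functional CARD('n) P r (\<lambda>i. ln (singular_value (\<rho> x) i)))"

text \<open>For an element at which exactly the right number of roots has crossed \<open>\<tau>\<close>, up to the bounded error \<open>c\<close>, the number of
  balls of radius \<open>exp (-\<tau>)\<close> needed for its box is comparable with \<open>exp (r \<tau>)\<close> times its term of the Falconer series.\<close>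

lemma box_count_le:
  assumes x: "x \<in> carrier G" and c: "0 \<le> c" and K: "0 \<le> K"
    and r: "real (card {q\<in>root_pairs CARD('n) P. rootval x q < \<tau>}) \<le> r" "r \<le> real (card {q\<in>root_pairs CARD('n) P. rootval x q \<le> \<tau> + c})"
  shows "(\<Prod>q\<in>root_pairs CARD('n) P. 1 + K * exp (- rootval x q) * exp \<tau>) \<le> (1 + K) ^ card (root_pairs CARD('n) P) * exp (real (card (root_pairs CARD('n) P)) * c) * exp (r * \<tau>) * falconer_term r x"
proof -
  obtain w where w: "\<And>q. q \<in> (root_pairs CARD('n) P) \<Longrightarrow> 0 \<le> w q \<and> w q \<le> 1" "r \<le> (\<Sum>q\<in>root_pairs CARD('n) P. w q)"
    "(\<Sum>q\<in>root_pairs CARD('n) P. max 0 (\<tau> - rootval x q)) \<le> r * \<tau> - (\<Sum>q\<in>root_pairs CARD('n) P. w q * rootval x q) + real (card (root_pairs CARD('n) P)) * c"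
    using threshold_weights[OF finite_roots c r] by blast
  have "exp (- (\<Sum>q\<in>root_pairs CARD('n) P. w q * rootval x q)) \<le> falconer_term r x"
    unfolding falconer_term_def
    using falconer_upper[OF finite_roots w(1,2), of "\<lambda>i. ln (singular_value (\<rho> x) i)"]
      rootval_nonneg[OF x, of "(i, j)" for i j]
    unfolding rootval_def case_prod_beta fst_conv snd_conv by blast
  then have f: "exp (r * \<tau> - (\<Sum>q\<in>root_pairs CARD('n) P. w q * rootval x q) + real (card (root_pairs CARD('n) P)) * c) \<le> exp (real (card (root_pairs CARD('n) P)) * c) * exp (r * \<tau>) * falconer_term r x"
    by (simp add: exp_add exp_diff exp_minus field_simps)
  have "(\<Prod>q\<in>root_pairs CARD('n) P. 1 + K * exp (- rootval x q) * exp \<tau>) \<le> (\<Prod>q\<in>root_pairs CARD('n) P. (1 + K) * exp (max 0 (\<tau> - rootval x q)))"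
  proof (rule prod_mono, rule conjI)
    fix q
    show "0 \<le> 1 + K * exp (- rootval x q) * exp \<tau>" using K by simp
    have "exp (- rootval x q) * exp \<tau> \<le> exp (max 0 (\<tau> - rootval x q))" by (simp add: exp_add[symmetric])
    then have "K * (exp (- rootval x q) * exp \<tau>) \<le> K * exp (max 0 (\<tau> - rootval x q))" using K by (rule mult_left_mono)
    moreover have "1 \<le> exp (max 0 (\<tau> - rootval x q))" by simp
    ultimately show "1 + K * exp (- rootval x q) * exp \<tau> \<le> (1 + K) * exp (max 0 (\<tau> - rootval x q))"
      by (simp only: distrib_right mult_1_left mult.assoc)
  qed
  also have "\<dots> = (1 + K) ^ card (root_pairs CARD('n) P) * exp (\<Sum>q\<in>root_pairs CARD('n) P. max 0 (\<tau> - rootval x q))"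
    by (simp add: prod.distrib exp_sum[OF finite_roots])
  also have "\<dots> \<le> (1 + K) ^ card (root_pairs CARD('n) P) * (exp (real (card (root_pairs CARD('n) P)) * c) * exp (r * \<tau>) * falconer_term r x)"
    using w(3) f K by (intro mult_left_mono) (auto intro: order_trans)
  finally show ?thesis by (simp add: mult_ac)
qed

lemma finite_ball: "finite {x \<in> carrier G. wl x \<le> n}"
proof (rule finite_subset)
  show "{x \<in> carrier G. wl x \<le> n} \<subseteq> gprod ` {ws. set ws \<subseteq> S \<and> length ws \<le> n}"
  proof
    fix x assume x: "x \<in> {x \<in> carrier G. wl x \<le> n}"
    then obtain ws where "geodesic ws" "gprod ws = x" using geodesic_exists by blast
    then show "x \<in> gprod ` {ws. set ws \<subseteq> S \<and> length ws \<le> n}" using x by (force simp: geodesic_def)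
  qed
  show "finite (gprod ` {ws. set ws \<subseteq> S \<and> length ws \<le> n})"
    by (intro finite_imageI finite_lists_length_le S_facts)
qed

text \<open>Along a geodesic word that leads to a limit flag, the first prefix of length at least \<open>J\<close> at which at most \<open>r\<close> roots are
  still below \<open>\<tau> = ln (1 / \<epsilon>)\<close> is selected. The boxes of the selected elements cover the limit set. They do not overshoot, since
  the preceding prefix had more than \<open>r\<close> roots below \<open>\<tau>\<close>. Summing \<open>box_count_le\<close> over the selected elements,
  a subset of the group, gives at most a constant times \<open>(1 / \<epsilon>) powr r\<close> balls. When \<open>r\<close> exceeds the number of roots the
  term of the series vanishes identically, and the boxes of finitely many short elements suffice instead.\<close>

theorem minkowski_dim_limit_flags_le:
  fixes g :: "'n flag \<Rightarrow> real^'n^'n \<Rightarrow> real^'n^'n \<Rightarrow> real"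
  assumes g: "SO_invariant_riemannian P g" and r: "0 \<le> r" and sum: "falconer_term r summable_on carrier G"
  shows "minkowski_dim (flags P) (riemannian_dist P g) limit_flags \<le> ereal r"
proof -
  let ?N = "\<lambda>\<epsilon>. real (covering_number (flags P) (riemannian_dist P g) limit_flags \<epsilon>)"
  obtain T J where T: "1 \<le> T" and charts: "\<And>\<xi> n. \<xi> \<in> limit_flags \<Longrightarrow>
    \<exists>ws. geodesic ws \<and> length ws = n \<and> (\<forall>l. J \<le> l \<longrightarrow> l \<le> n \<longrightarrow> \<xi> \<in> chart T (gprod (take l ws)))"
    using limit_flags_charts by blast
  obtain K where K: "0 \<le> K" "\<And>Cut L \<epsilon>. finite Cut \<Longrightarrow> Cut \<subseteq> carrier G \<Longrightarrow> L \<subseteq> (\<Union>x\<in>Cut. chart T x) \<Longrightarrow> 0 < \<epsilon> \<Longrightarrow>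
    real (covering_number (flags P) (riemannian_dist P g) L \<epsilon>) \<le> (\<Sum>x\<in>Cut. \<Prod>q\<in>root_pairs CARD('n) P. 1 + K * exp (- rootval x q) / \<epsilon>)"
    using covering_number_charts[OF g T] by blast
  show ?thesis
  proof (cases "r \<le> real (card (root_pairs CARD('n) P))")
    case False
    define Cut where "Cut = {x \<in> carrier G. wl x \<le> J}"
    have Cut: "finite Cut" "Cut \<subseteq> carrier G" using finite_ball by (auto simp: Cut_def)
    have cov: "limit_flags \<subseteq> (\<Union>x\<in>Cut. chart T x)"
    proof
      fix \<xi> assume "\<xi> \<in> limit_flags"
      from charts[OF this, of J] obtain ws where ws: "geodesic ws" "length ws = J" "\<xi> \<in> chart T (gprod (take J ws))" by blast
      then have "gprod ws \<in> Cut" using gprod_closed by (auto simp: Cut_def geodesic_def)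
      then show "\<xi> \<in> (\<Union>x\<in>Cut. chart T x)" using ws by auto
    qed
    show ?thesis
    proof (rule minkowski_dim_le[of "real (card Cut) * (1 + K) ^ card (root_pairs CARD('n) P) + 1" "1/2"])
      show "0 < real (card Cut) * (1 + K) ^ card (root_pairs CARD('n) P) + 1" using K by (simp add: add_nonneg_pos)
      fix \<epsilon> :: real assume \<epsilon>: "0 < \<epsilon>" "\<epsilon> \<le> 1/2"
      have "?N \<epsilon> \<le> (\<Sum>x\<in>Cut. \<Prod>q\<in>root_pairs CARD('n) P. 1 + K * exp (- rootval x q) / \<epsilon>)" by (rule K(2)[OF Cut cov \<epsilon>(1)])
      also have "\<dots> \<le> (\<Sum>x\<in>Cut. \<Prod>q\<in>root_pairs CARD('n) P. (1 + K) * (1 / \<epsilon>))"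
      proof (intro sum_mono prod_mono conjI)
        fix x q assume xq: "x \<in> Cut" "q \<in> root_pairs CARD('n) P"
        show "0 \<le> 1 + K * exp (- rootval x q) / \<epsilon>" using K \<epsilon> by simp
        have "exp (- rootval x q) \<le> 1" using rootval_nonneg[of x q] xq Cut(2) by auto
        then have "K * exp (- rootval x q) \<le> K" using K(1) mult_left_mono[of _ 1 K] by simp
        then have "K * exp (- rootval x q) / \<epsilon> \<le> K / \<epsilon>" using \<epsilon> by (intro divide_right_mono) auto
        moreover have "1 \<le> 1 / \<epsilon>" using \<epsilon> by simp
        ultimately show "1 + K * exp (- rootval x q) / \<epsilon> \<le> (1 + K) * (1 / \<epsilon>)" by (simp add: add_divide_distrib)
      qed
      also have "\<dots> = real (card Cut) * (1 + K) ^ card (root_pairs CARD('n) P) * (1 / \<epsilon>) ^ card (root_pairs CARD('n) P)" by (simp only: prod_constant sum_constant power_mult_distrib mult.assoc)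
      also have "(1 / \<epsilon>) ^ card (root_pairs CARD('n) P) = (1 / \<epsilon>) powr real (card (root_pairs CARD('n) P))" using \<epsilon> by (simp add: powr_realpow)
      also have "real (card Cut) * (1 + K) ^ card (root_pairs CARD('n) P) * (1 / \<epsilon>) powr real (card (root_pairs CARD('n) P))
         \<le> (real (card Cut) * (1 + K) ^ card (root_pairs CARD('n) P) + 1) * (1 / \<epsilon>) powr r"
        using \<epsilon> False K by (intro mult_mono powr_mono) auto
      finally show "?N \<epsilon> \<le> (real (card Cut) * (1 + K) ^ card (root_pairs CARD('n) P) + 1) * (1 / \<epsilon>) powr r" .
    qed (use r in auto)
  next
    case rM: True
    obtain c where c: "0 \<le> c" "\<And>x s q. x \<in> carrier G \<Longrightarrow> s \<in> S \<Longrightarrow> q \<in> (root_pairs CARD('n) P) \<Longrightarrow> rootval (x \<otimes>\<^bsub>G\<^esub> s) q \<le> rootval x q + c"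
      "\<And>x q. x \<in> carrier G \<Longrightarrow> q \<in> (root_pairs CARD('n) P) \<Longrightarrow> rootval x q \<le> c * real (wl x)" using rootval_step by blast
    obtain e where e: "0 < e" "\<And>x q. x \<in> carrier G \<Longrightarrow> q \<in> (root_pairs CARD('n) P) \<Longrightarrow> ln e + e * real (wl x) \<le> rootval x q" using rootval_growth by blast
    define \<tau>0 where "\<tau>0 = 1 + c * real J"
    have \<tau>0: "\<tau>0 > 0" unfolding \<tau>0_def using c(1) by (simp add: add_pos_nonneg)
    define B where "B = (1 + K) ^ card (root_pairs CARD('n) P) * exp (real (card (root_pairs CARD('n) P)) * c)"
    have B: "B > 0" unfolding B_def using K by simp
    define \<Sigma> where "\<Sigma> = infsum (falconer_term r) (carrier G)"
    have ft: "0 \<le> falconer_term r x" for x by (simp add: falconer_term_def exp_neg_nonneg)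
    have \<Sigma>0: "0 \<le> \<Sigma>" unfolding \<Sigma>_def by (rule infsum_nonneg) (rule ft)
    show ?thesis
    proof (rule minkowski_dim_le[of "B * (\<Sigma> + 1)" "exp (- \<tau>0)"])
      show "0 < B * (\<Sigma> + 1)" using B \<Sigma>0 by simp
      fix \<epsilon> :: real assume \<epsilon>: "0 < \<epsilon>" "\<epsilon> \<le> exp (- \<tau>0)"
      define \<tau> where "\<tau> = ln (1 / \<epsilon>)"
      have e\<tau>: "exp \<tau> = 1 / \<epsilon>" using \<epsilon> by (simp add: \<tau>_def)
      have "ln \<epsilon> \<le> - \<tau>0" using \<epsilon> ln_mono[of \<epsilon> "exp (- \<tau>0)"] by simp
      then have \<tau>: "\<tau>0 \<le> \<tau>" using \<epsilon> by (simp add: \<tau>_def ln_div)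
      define cnt where "cnt x = card {q\<in>root_pairs CARD('n) P. rootval x q < \<tau>}" for x
      obtain n where n: "J \<le> n" "\<tau> \<le> ln e + e * real n"
      proof -
        obtain n1 :: nat where "(\<tau> - ln e) / e \<le> real n1" using real_arch_simple by blast
        then have "\<tau> - ln e \<le> e * real n1" using e(1) by (simp add: field_simps)
        also have "\<dots> \<le> e * real (max J n1)" using e(1) by (intro mult_left_mono) auto
        finally show ?thesis by (intro that[of "max J n1"]) auto
      qed
      define Cut where "Cut = {x \<in> carrier G. wl x \<le> n \<and> real (cnt x) \<le> r \<and> r \<le> real (card {q\<in>root_pairs CARD('n) P. rootval x q \<le> \<tau> + c})}"
      have Cut: "finite Cut" "Cut \<subseteq> carrier G"
        by (rule finite_subset[OF _ finite_ball[of n]]) (auto simp: Cut_def)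
      have cov: "limit_flags \<subseteq> (\<Union>x\<in>Cut. chart T x)"
      proof
        fix \<xi> assume "\<xi> \<in> limit_flags"
        from charts[OF this, of n] obtain ws where ws: "geodesic ws" "length ws = n"
          "\<And>l. J \<le> l \<Longrightarrow> l \<le> n \<Longrightarrow> \<xi> \<in> chart T (gprod (take l ws))" by blast
        let ?x = "\<lambda>l. gprod (take l ws)"
        have sw: "set (take l ws) \<subseteq> S" for l using ws(1) by (auto simp: geodesic_def dest: in_set_takeD)
        have xG: "?x l \<in> carrier G" for l by (rule gprod_closed[OF sw])
        have wx: "wl (?x l) = l" if "l \<le> n" for l
          using geodesic_append(1)[of "take l ws" "drop l ws"] ws that by (simp add: geodesic_def)
        have "cnt (?x n) = 0"
        proof -
          have "\<tau> \<le> rootval (?x n) q" if "q \<in> root_pairs CARD('n) P" for q using e(2)[OF xG that, of n] wx[of n] n by simp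
          then have "{q\<in>root_pairs CARD('n) P. rootval (?x n) q < \<tau>} = {}" by force
          then show ?thesis by (simp only: cnt_def card.empty)
        qed
        then have ex: "J \<le> n \<and> real (cnt (?x n)) \<le> r" using n r by simp
        \<comment> \<open>the stopping rule\<close>
        define l where "l = (LEAST l. J \<le> l \<and> real (cnt (?x l)) \<le> r)"
        have l: "J \<le> l" "real (cnt (?x l)) \<le> r" using LeastI[of "\<lambda>l. J \<le> l \<and> real (cnt (?x l)) \<le> r", OF ex] by (auto simp: l_def)
        have ln: "l \<le> n" unfolding l_def by (rule Least_le) (rule ex)
        have "r \<le> real (card {q\<in>root_pairs CARD('n) P. rootval (?x l) q \<le> \<tau> + c})"
        \<comment> \<open>at the minimal length \<open>J\<close> all roots are below \<open>\<tau>\<close> because \<open>\<epsilon>\<close> is small; otherwise the preceding prefix violates the stopping rule\<close>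
        proof (cases "l = J")
          case True
          have "rootval (?x l) q \<le> \<tau> + c" if "q \<in> root_pairs CARD('n) P" for q
            using c(3)[OF xG that, of l] wx[OF ln] True \<tau> c(1) by (simp add: \<tau>0_def)
          then have "{q\<in>root_pairs CARD('n) P. rootval (?x l) q \<le> \<tau> + c} = (root_pairs CARD('n) P)" by blast
          then show ?thesis using rM by simp
        next
          case False
          then obtain k where k: "l = Suc k" "J \<le> k" using l(1) by (cases l) auto
          have "\<not> (J \<le> k \<and> real (cnt (?x k)) \<le> r)" using not_less_Least[of k "\<lambda>l. J \<le> l \<and> real (cnt (?x l)) \<le> r"] k by (simp add: l_def)
          then have rk: "r < real (cnt (?x k))" using k by simp
          have kl: "k < length ws" using k ln ws(2) by simp
          have sS: "ws ! k \<in> S" using ws(1) kl by (auto simp: geodesic_def)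
          have "?x l = ?x k \<otimes>\<^bsub>G\<^esub> gprod [ws ! k]"
            unfolding k(1) take_Suc_conv_app_nth[OF kl] by (rule gprod_append) (use sw sS in auto)
          then have step: "?x l = ?x k \<otimes>\<^bsub>G\<^esub> ws ! k" using sS S_facts(2) by auto
          have "{q\<in>root_pairs CARD('n) P. rootval (?x k) q < \<tau>} \<subseteq> {q\<in>root_pairs CARD('n) P. rootval (?x l) q \<le> \<tau> + c}"
          proof
            fix q assume q: "q \<in> {q\<in>root_pairs CARD('n) P. rootval (?x k) q < \<tau>}"
            then have "rootval (?x l) q \<le> rootval (?x k) q + c" unfolding step using c(2)[OF xG sS] by blast
            then show "q \<in> {q\<in>root_pairs CARD('n) P. rootval (?x l) q \<le> \<tau> + c}" using q by simp
          qed
          then have "cnt (?x k) \<le> card {q\<in>root_pairs CARD('n) P. rootval (?x l) q \<le> \<tau> + c}"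
            unfolding cnt_def using finite_roots by (intro card_mono) auto
          then show ?thesis using rk by linarith
        qed
        then have "?x l \<in> Cut" unfolding Cut_def using xG wx[OF ln] ln l(2) by simp
        then show "\<xi> \<in> (\<Union>x\<in>Cut. chart T x)" using ws(3)[OF l(1) ln] by blast
      qed
      have "?N \<epsilon> \<le> (\<Sum>x\<in>Cut. \<Prod>q\<in>root_pairs CARD('n) P. 1 + K * exp (- rootval x q) / \<epsilon>)" by (rule K(2)[OF Cut cov \<epsilon>(1)])
      also have "\<dots> = (\<Sum>x\<in>Cut. \<Prod>q\<in>root_pairs CARD('n) P. 1 + K * exp (- rootval x q) * exp \<tau>)" by (simp add: e\<tau>)
      also have "\<dots> \<le> (\<Sum>x\<in>Cut. B * exp (r * \<tau>) * falconer_term r x)"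
        unfolding B_def by (intro sum_mono box_count_le c K) (auto simp: Cut_def cnt_def)
      also have "\<dots> = B * exp (r * \<tau>) * (\<Sum>x\<in>Cut. falconer_term r x)" by (simp add: sum_distrib_left)
      also have "\<dots> \<le> B * exp (r * \<tau>) * (\<Sigma> + 1)"
      proof (rule mult_left_mono)
        have "(\<Sum>x\<in>Cut. falconer_term r x) \<le> \<Sigma>" unfolding \<Sigma>_def
          by (rule finite_sum_le_infsum[OF sum Cut]) (rule ft)
        then show "(\<Sum>x\<in>Cut. falconer_term r x) \<le> \<Sigma> + 1" by simp
      qed (use B in simp)
      also have "exp (r * \<tau>) = (1 / \<epsilon>) powr r" using \<epsilon> by (simp add: powr_def \<tau>_def)
      finally show "?N \<epsilon> \<le> B * (\<Sigma> + 1) * (1 / \<epsilon>) powr r" by (simp add: mult_ac)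
    qed (use \<tau>0 r in auto)
  qed
qed

end

theorem theorem1p8:
  fixes G :: "('g, 'm) monoid_scheme"
    and S :: "'g set"
    and P :: "nat set"
    and \<rho> :: "'g \<Rightarrow> real^'n^'n"
    and g :: "'n::finite flag \<Rightarrow> real^'n^'n \<Rightarrow> real^'n^'n \<Rightarrow> real"
  assumes "hyperbolic_group G S"
    and "\<not> elementary_group G"
    and "P \<subseteq> {1..CARD('n) - 1}" and "card P \<ge> 2"
    and "\<rho> \<in> hom G SL_group"
    and "inj_on \<rho> (carrier G)"
    and "anosov G S P \<rho>"
    and "zariski_dense_in_SL (\<rho> ` carrier G)"
    and "SO_invariant_riemannian P g"
  shows "minkowski_dim (flags P) (riemannian_dist P g) (limit_set G P \<rho>)
           \<le> ereal (falconer_dim G P \<rho>)"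
proof -
  have grp: "group G" and gens: "symmetric_generating_set G S"
    using assms(1) by (auto simp: hyperbolic_group_def)
  have inf: "infinite (carrier G)"
  proof
    assume fin: "finite (carrier G)"
    interpret group G by (rule grp)
    have "rcosets\<^bsub>G\<^esub> (generate G {\<one>\<^bsub>G\<^esub>}) \<subseteq> Pow (carrier G)"
      using subgroup.rcosets_carrier[OF generate_is_subgroup grp] by (auto simp: RCOSETS_def r_coset_def dest: generate_in_carrier[rotated])
    then have "finite (rcosets\<^bsub>G\<^esub> (generate G {\<one>\<^bsub>G\<^esub>}))" using fin finite_subset by blast
    then show False using assms(2) unfolding elementary_group_def by blast
  qed
  interpret anosov_rep G S P \<rho>
    by (rule anosov_rep.intro) (use grp gens inf assms in auto)
  let ?A = "{r. 0 \<le> r \<and> (\<lambda>\<gamma>. exp_neg (falconer_functional CARD('n) P r (\<lambda>i. ln (singular_value (\<rho> \<gamma>) i)))) summable_on carrier G}"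
  have le: "minkowski_dim (flags P) (riemannian_dist P g) limit_flags \<le> ereal r" if "r \<in> ?A" for r
  proof (rule minkowski_dim_limit_flags_le[OF assms(9)])
    show "falconer_term r summable_on carrier G" unfolding falconer_term_def using that by simp
  qed (use that in simp)
  have ne: "?A \<noteq> {}"
  proof -
    \<comment> \<open>above the number of roots the linear program is infeasible, so every term of the series is zero\<close>
    let ?r = "real (card (root_pairs CARD('n) P)) + 1"
    have "falconer_functional CARD('n) P ?r a = \<infinity>" for a
    proof -
      have "(\<Sum>q\<in>root_pairs CARD('n) P. w q) \<le> real (card (root_pairs CARD('n) P))" if "\<forall>q\<in>root_pairs CARD('n) P. 0 \<le> w q \<and> w q \<le> (1::real)" for w
        using sum_mono[of "root_pairs CARD('n) P" w "\<lambda>_. 1"] that by simp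
      then have "{w :: nat \<times> nat \<Rightarrow> real. (\<forall>ij\<in>root_pairs CARD('n) P. 0 \<le> w ij \<and> w ij \<le> 1) \<and> ?r \<le> (\<Sum>ij\<in>root_pairs CARD('n) P. w ij)} = {}" by fastforce
      then show ?thesis unfolding falconer_functional_def by (simp only: image_empty Inf_empty top_ereal_def)
    qed
    then have "?r \<in> ?A" by (simp add: exp_neg_def)
    then show ?thesis by blast
  qed
  have "minkowski_dim (flags P) (riemannian_dist P g) limit_flags \<le> ereal (Inf ?A)"
  proof (rule ereal_le_epsilon2)
    fix e :: real assume "0 < e"
    then obtain r where r: "r \<in> ?A" "r < Inf ?A + e"
      using cInf_lessD[OF ne, of "Inf ?A + e"] by auto
    have "minkowski_dim (flags P) (riemannian_dist P g) limit_flags \<le> ereal r" by (rule le[OF r(1)])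
    also have "\<dots> \<le> ereal (Inf ?A) + ereal e" using r(2) by simp
    finally show "minkowski_dim (flags P) (riemannian_dist P g) limit_flags \<le> ereal (Inf ?A) + ereal e" .
  qed
  then show ?thesis by (simp add: limit_set_eq[OF assms(8)] falconer_dim_def)
qed

end
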